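(* Let $d\ge1$ and $1\le p\le 1+\frac4d$. Let $T_0,\tau^*\in(0,\infty]$ be random variables and let $v$ be a solution, with $v(T_0)=v_0\in H^1(\mathbb R^d)$ and $v\in C([T_0,\tau^* );H^1)$, of the random equation $$i\partial_t v+(\Delta+b\cdot\nabla+c)v+|v|^{p-1}v=0\quad\text{on }[T_0,\tau^* ).$$ Then, $\mathbb P$-a.s., $X:=e^{W}v$ is a solution of $$dX=i\Delta X\,dt+i|X|^{p-1}X\,dt-\mu X\,dt+\sum_{k=1}^N X\,G_k\,dB_k$$ on $[T_0,\tau^* )$ in the sense of controlled rough paths described in the context.
   Context: Let $(\Omega,\mathscr F,\{\mathscr F_t\},\mathbb P)$ be a filtered probability space satisfying the usual conditions, carrying independent real standard Brownian motions $B_1,\dots,B_N$, enhanced to the It\^o rough path $(B,\mathbb B)$ with $\mathbb B_{jk,st}=\int_s^t(B_j(r)-B_j(s))\,dB_k(r)$. Let $\phi_1,\dots,\phi_N\in C_b^\infty(\mathbb R^d;\mathbb R)$ with $\lim_{|x|\to\infty}|x|^2|\partial^\upsilon\phi_l(x)|=0$ for all multi-indices $\upsilon\ne0$, and let $g_1,\dots,g_N$ be real continuous $\{\mathscr F_t\}$-adapted processes controlled by $B$: for some $\alpha\in(\frac13,\frac12)$ there are $\alpha$-H\"older $g'_{lj}$ with $|g_l(t)-g_l(s)-\sum_jg'_{lj}(s)(B_j(t)-B_j(s))|\le C|t-s|^{2\alpha}$ on compact intervals. $G_k=i\phi_kg_k$, $\mu=\frac12\sum_k\phi_k^2g_k^2$.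 $W(t,x)=\sum_{k=1}^N i\phi_k(x)\int_0^tg_k(s)\,dB_k(s)$, $b=2\nabla W$, $c=\sum_{j=1}^d(\partial_jW)^2+\Delta W$. Solution notion: $X$ is a solution on $[T_0,\tau^* )$ if a.s. for every $\varphi\in C_c^\infty$, $t\mapsto\langle X(t),\varphi\rangle$ ($\langle v,w\rangle=\int v\bar w$) is continuous and for $T_0\le s<t<\tau^*$, $\langle X(t)-X(s),\varphi\rangle-\int_s^t\big(\langle iX,\Delta\varphi\rangle+\langle i|X|^{p-1}X,\varphi\rangle-\langle\mu X,\varphi\rangle\big)dr=\sum_{k=1}^N\int_s^t\langle i\phi_kg_kX,\varphi\rangle\,dB_k(r)$, the right side being the rough integral against $(B,\mathbb B)$: $\langle i\phi_kg_kX,\varphi\rangle$ is $\alpha$-H\"older and controlled by $B$ with Gubinelli derivative $\langle-\phi_j\phi_kg_jg_kX+i\phi_kg'_{kj}X,\varphi\rangle$ ($\alpha$-H\"older, with $2\alpha$-H\"older remainder), and $\int_s^tY_kdB_k=\lim_{|\mathcal P|\to0}\sum_i\big(Y_k(t_i)\delta B_{k,t_it_{i+1}}+\sum_jY'_{kj}(t_i)\mathbb B_{jk,t_it_{i+1}}\big)$. *)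

theory Defs
  imports "HOL-Probability.Probability"
begin

fun dpart :: "'a::euclidean_space list \<Rightarrow> ('a \<Rightarrow> 'b::real_normed_vector) \<Rightarrow> 'a \<Rightarrow> 'b" where
  "dpart [] f = f"
| "dpart (j # js) f = (\<lambda>x. vector_derivative (\<lambda>t. dpart js f (x + t *\<^sub>R j)) (at 0))"

definition smooth_fn :: "('a::euclidean_space \<Rightarrow> 'b::real_normed_vector) \<Rightarrow> bool" where
  "smooth_fn f \<longleftrightarrow> (\<forall>js. set js \<subseteq> Basis \<longrightarrow>
      continuous_on UNIV (dpart js f) \<and>
      (\<forall>j\<in>Basis. \<forall>x. (\<lambda>t. dpart js f (x + t *\<^sub>R j)) differentiable (at (0::real))))"

definition test_fn :: "('a::euclidean_space \<Rightarrow> complex) \<Rightarrow> bool" where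
  "test_fn f \<longleftrightarrow> smooth_fn f \<and> compact (closure {x. f x \<noteq> 0})"

definition cb_inf_decay :: "('a::euclidean_space \<Rightarrow> real) \<Rightarrow> bool" where
  "cb_inf_decay f \<longleftrightarrow> smooth_fn f \<and>
     (\<forall>js. set js \<subseteq> Basis \<longrightarrow> bounded (range (dpart js f))) \<and>
     (\<forall>js. set js \<subseteq> Basis \<and> js \<noteq> [] \<longrightarrow>
        ((\<lambda>x. (norm x)\<^sup>2 * \<bar>dpart js f x\<bar>) \<longlongrightarrow> 0) at_infinity)"

definition lap :: "('a::euclidean_space \<Rightarrow> 'b::real_normed_vector) \<Rightarrow> 'a \<Rightarrow> 'b" where
  "lap f = (\<lambda>x. \<Sum>j\<in>Basis. dpart [j, j] f x)"

definition sq_int :: "('a::euclidean_space \<Rightarrow> complex) \<Rightarrow> bool" where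
  "sq_int v \<longleftrightarrow> v \<in> borel_measurable lborel \<and> integrable lborel (\<lambda>x. (cmod (v x))\<^sup>2)"

definition pair :: "('a::euclidean_space \<Rightarrow> complex) \<Rightarrow> ('a \<Rightarrow> complex) \<Rightarrow> complex" where
  "pair v w = integral\<^sup>L lborel (\<lambda>x. v x * cnj (w x))"

definition weak_pd :: "'a::euclidean_space \<Rightarrow> ('a \<Rightarrow> complex) \<Rightarrow> ('a \<Rightarrow> complex) \<Rightarrow> bool" where
  "weak_pd j v g \<longleftrightarrow> g \<in> borel_measurable lborel \<and>
     (\<forall>\<phi>. test_fn \<phi> \<longrightarrow>
        integral\<^sup>L lborel (\<lambda>x. v x * dpart [j] \<phi> x) = - integral\<^sup>L lborel (\<lambda>x. g x * \<phi> x))"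

definition H1 :: "('a::euclidean_space \<Rightarrow> complex) \<Rightarrow> bool" where
  "H1 v \<longleftrightarrow> sq_int v \<and> (\<forall>j\<in>Basis. \<exists>g. sq_int g \<and> weak_pd j v g)"

definition wgrad :: "'a::euclidean_space \<Rightarrow> ('a \<Rightarrow> complex) \<Rightarrow> 'a \<Rightarrow> complex" where
  "wgrad j v = (SOME g. sq_int g \<and> weak_pd j v g)"

definition h1_dist :: "('a::euclidean_space \<Rightarrow> complex) \<Rightarrow> ('a \<Rightarrow> complex) \<Rightarrow> real" where
  "h1_dist v w = sqrt (integral\<^sup>L lborel (\<lambda>x. (cmod (v x - w x))\<^sup>2)
      + (\<Sum>j\<in>Basis. integral\<^sup>L lborel (\<lambda>x. (cmod (wgrad j v x - wgrad j w x))\<^sup>2)))"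

definition cont_H1 :: "real set \<Rightarrow> (real \<Rightarrow> 'a::euclidean_space \<Rightarrow> complex) \<Rightarrow> bool" where
  "cont_H1 I v \<longleftrightarrow> (\<forall>t\<in>I. H1 (v t)) \<and>
     (\<forall>t\<in>I. \<forall>\<epsilon>>0. \<exists>\<delta>>0. \<forall>s\<in>I. \<bar>s - t\<bar> < \<delta> \<longrightarrow> h1_dist (v s) (v t) < \<epsilon>)"

definition partition_of :: "real set \<Rightarrow> real \<Rightarrow> real \<Rightarrow> bool" where
  "partition_of P a b \<longleftrightarrow> finite P \<and> a \<in> P \<and> b \<in> P \<and> P \<subseteq> {a..b}"

definition mesh :: "real set \<Rightarrow> real" where
  "mesh P = (let xs = sorted_list_of_set P in
      Max (insert 0 {xs ! (i+1) - xs ! i | i. i + 1 < length xs}))"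

definition psum :: "real set \<Rightarrow> (real \<Rightarrow> real \<Rightarrow> 'b::comm_monoid_add) \<Rightarrow> 'b" where
  "psum P f = (let xs = sorted_list_of_set P in (\<Sum>i<length xs - 1. f (xs ! i) (xs ! (i+1))))"

definition mesh_lim :: "real \<Rightarrow> real \<Rightarrow> (real \<Rightarrow> real \<Rightarrow> 'b::real_normed_vector) \<Rightarrow> 'b \<Rightarrow> bool" where
  "mesh_lim a b S L \<longleftrightarrow> (\<forall>\<epsilon>>0. \<exists>\<delta>>0. \<forall>P. partition_of P a b \<and> mesh P < \<delta> \<longrightarrow>
      norm (psum P S - L) < \<epsilon>)"

definition holder_on :: "real set \<Rightarrow> real \<Rightarrow> (real \<Rightarrow> 'b::real_normed_vector) \<Rightarrow> bool" where
  "holder_on S \<alpha> f \<longleftrightarrow> (\<exists>C. \<forall>s\<in>S. \<forall>t\<in>S. norm (f t - f s) \<le> C * \<bar>t - s\<bar> powr \<alpha>)"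

definition controlled_on :: "real set \<Rightarrow> real \<Rightarrow> nat \<Rightarrow> (nat \<Rightarrow> real \<Rightarrow> real)
    \<Rightarrow> (real \<Rightarrow> 'b::real_normed_vector) \<Rightarrow> (nat \<Rightarrow> real \<Rightarrow> 'b) \<Rightarrow> bool" where
  "controlled_on S \<alpha> N Bp Y Y' \<longleftrightarrow> holder_on S \<alpha> Y \<and> (\<forall>j<N. holder_on S \<alpha> (Y' j)) \<and>
     (\<exists>C. \<forall>u\<in>S. \<forall>v\<in>S.
        norm (Y v - Y u - (\<Sum>j<N. (Bp j v - Bp j u) *\<^sub>R Y' j u)) \<le> C * \<bar>v - u\<bar> powr (2 * \<alpha>))"

definition filtration_usual :: "'w measure \<Rightarrow> (real \<Rightarrow> 'w set set) \<Rightarrow> bool" where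
  "filtration_usual M F \<longleftrightarrow>
     (\<forall>t\<ge>0. sigma_algebra (space M) (F t) \<and> F t \<subseteq> sets M) \<and>
     (\<forall>s t. 0 \<le> s \<and> s \<le> t \<longrightarrow> F s \<subseteq> F t) \<and>
     (\<forall>t\<ge>0. F t = (\<Inter>u\<in>{t<..}. F u)) \<and>
     (\<forall>A. A \<subseteq> space M \<and> (\<exists>Z\<in>null_sets M. A \<subseteq> Z) \<longrightarrow> A \<in> F 0)"

definition adapted :: "'w measure \<Rightarrow> (real \<Rightarrow> 'w set set) \<Rightarrow> (real \<Rightarrow> 'w \<Rightarrow> real) \<Rightarrow> bool" where
  "adapted M F X \<longleftrightarrow> (\<forall>t\<ge>0. X t \<in> measurable (sigma (space M) (F t)) borel)"

definition std_BM_family :: "'w measure \<Rightarrow> (real \<Rightarrow> 'w set set) \<Rightarrow> nat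
    \<Rightarrow> (nat \<Rightarrow> real \<Rightarrow> 'w \<Rightarrow> real) \<Rightarrow> bool" where
  "std_BM_family M F N B \<longleftrightarrow>
     (\<forall>k<N. adapted M F (B k)) \<and>
     (AE \<omega> in M. \<forall>k<N. B k 0 \<omega> = 0 \<and> continuous_on {0..} (\<lambda>t. B k t \<omega>)) \<and>
     (\<forall>s t. 0 \<le> s \<and> s < t \<longrightarrow>
        (\<forall>A\<in>F s. \<forall>C::nat \<Rightarrow> real set. (\<forall>k<N. C k \<in> sets borel) \<longrightarrow>
           measure M (A \<inter> {\<omega>\<in>space M. \<forall>k<N. B k t \<omega> - B k s \<omega> \<in> C k})
           = measure M A * (\<Prod>k<N. integral\<^sup>L lborel
                 (\<lambda>x. indicator (C k) x * normal_density 0 (sqrt (t - s)) x))))"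

definition ito_proc :: "'w measure \<Rightarrow> (real \<Rightarrow> 'w \<Rightarrow> real) \<Rightarrow> (real \<Rightarrow> 'w \<Rightarrow> real)
    \<Rightarrow> (real \<Rightarrow> 'w \<Rightarrow> real) \<Rightarrow> bool" where
  "ito_proc M h B J \<longleftrightarrow>
     (\<forall>t\<ge>0. J t \<in> borel_measurable M) \<and>
     (AE \<omega> in M. J 0 \<omega> = 0 \<and> continuous_on {0..} (\<lambda>t. J t \<omega>)) \<and>
     (\<forall>t>0. \<forall>\<epsilon>>0. \<forall>\<eta>>0. \<exists>\<delta>>0. \<forall>P. partition_of P 0 t \<and> mesh P < \<delta> \<longrightarrow>
        measure M {\<omega>\<in>space M. \<epsilon> < \<bar>psum P (\<lambda>u v. h u \<omega> * (B v \<omega> - B u \<omega>)) - J t \<omega>\<bar>} < \<eta>)"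

definition Iv :: "('w \<Rightarrow> ereal) \<Rightarrow> ('w \<Rightarrow> ereal) \<Rightarrow> 'w \<Rightarrow> real set" where
  "Iv T0 \<tau> \<omega> = {t. T0 \<omega> \<le> ereal t \<and> ereal t < \<tau> \<omega>}"

text \<open>W(t,x) = sum_k i phi_k(x) int_0^t g_k dB_k, with Ip k t = int_0^t g_k dB_k.\<close>
definition Wfun :: "nat \<Rightarrow> (nat \<Rightarrow> 'a::euclidean_space \<Rightarrow> real) \<Rightarrow> (nat \<Rightarrow> real \<Rightarrow> real)
    \<Rightarrow> real \<Rightarrow> 'a \<Rightarrow> complex" where
  "Wfun N \<phi> Ip t x = (\<Sum>k<N. \<i> * complex_of_real (\<phi> k x * Ip k t))"

definition bcoef :: "nat \<Rightarrow> (nat \<Rightarrow> 'a::euclidean_space \<Rightarrow> real) \<Rightarrow> (nat \<Rightarrow> real \<Rightarrow> real)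
    \<Rightarrow> 'a \<Rightarrow> real \<Rightarrow> 'a \<Rightarrow> complex" where
  "bcoef N \<phi> Ip j t x = 2 * dpart [j] (Wfun N \<phi> Ip t) x"

definition ccoef :: "nat \<Rightarrow> (nat \<Rightarrow> 'a::euclidean_space \<Rightarrow> real) \<Rightarrow> (nat \<Rightarrow> real \<Rightarrow> real)
    \<Rightarrow> real \<Rightarrow> 'a \<Rightarrow> complex" where
  "ccoef N \<phi> Ip t x = (\<Sum>j\<in>Basis. (dpart [j] (Wfun N \<phi> Ip t) x)\<^sup>2) + lap (Wfun N \<phi> Ip t) x"

text \<open>v in C(I;H^1) solves  i v_t + (Delta + b.grad + c) v + |v|^(p-1) v = 0  on I
  in the weak (distributional, time-integrated) sense.\<close>
definition random_nls_sol :: "nat \<Rightarrow> real \<Rightarrow> (nat \<Rightarrow> 'a::euclidean_space \<Rightarrow> real)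
    \<Rightarrow> (nat \<Rightarrow> real \<Rightarrow> real) \<Rightarrow> real set \<Rightarrow> (real \<Rightarrow> 'a \<Rightarrow> complex) \<Rightarrow> bool" where
  "random_nls_sol N p \<phi> Ip I v \<longleftrightarrow> cont_H1 I v \<and>
     (\<forall>\<psi>. test_fn \<psi> \<longrightarrow> (\<forall>s\<in>I. \<forall>t\<in>I. s < t \<longrightarrow>
        (let D = (\<lambda>r. pair (\<lambda>x. \<i> * v r x) (lap \<psi>)
                    + pair (\<lambda>x. \<i> * (\<Sum>j\<in>Basis. bcoef N \<phi> Ip j r x * wgrad j (v r) x)) \<psi>
                    + pair (\<lambda>x. \<i> * ccoef N \<phi> Ip r x * v r x) \<psi>
                    + pair (\<lambda>x. \<i> * complex_of_real ((cmod (v r x)) powr (p - 1)) * v r x) \<psi>)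
         in set_integrable lborel {s..t} D \<and>
            pair (v t) \<psi> - pair (v s) \<psi> = set_lebesgue_integral lborel {s..t} D)))"

text \<open>Second-level Ito rough path: BB j k u v = int_u^v (B_j(r) - B_j(u)) dB_k(r),
  where Jp j k t = int_0^t B_j dB_k (Ito).\<close>
definition BBp :: "(nat \<Rightarrow> real \<Rightarrow> real) \<Rightarrow> (nat \<Rightarrow> nat \<Rightarrow> real \<Rightarrow> real)
    \<Rightarrow> nat \<Rightarrow> nat \<Rightarrow> real \<Rightarrow> real \<Rightarrow> real" where
  "BBp Bp Jp j k u v = Jp j k v - Jp j k u - Bp j u * (Bp k v - Bp k u)"

text \<open>X is a solution on I of dX = i Delta X dt + i|X|^(p-1)X dt - mu X dt + sum_k X G_k dB_k,
  G_k = i phi_k g_k, mu = 1/2 sum_k phi_k^2 g_k^2, in the controlled rough path sense.\<close>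
definition rough_sol :: "nat \<Rightarrow> real \<Rightarrow> real \<Rightarrow> (nat \<Rightarrow> 'a::euclidean_space \<Rightarrow> real)
    \<Rightarrow> (nat \<Rightarrow> real \<Rightarrow> real) \<Rightarrow> (nat \<Rightarrow> nat \<Rightarrow> real \<Rightarrow> real)
    \<Rightarrow> (nat \<Rightarrow> real \<Rightarrow> real) \<Rightarrow> (nat \<Rightarrow> nat \<Rightarrow> real \<Rightarrow> real)
    \<Rightarrow> real set \<Rightarrow> (real \<Rightarrow> 'a \<Rightarrow> complex) \<Rightarrow> bool" where
  "rough_sol N \<alpha> p \<phi> gg gp Bp Jp I X \<longleftrightarrow>
    (\<forall>\<psi>. test_fn \<psi> \<longrightarrow>
      continuous_on I (\<lambda>t. pair (X t) \<psi>) \<and>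
      (\<forall>s\<in>I. \<forall>t\<in>I. s < t \<longrightarrow>
        (let Y = (\<lambda>k r. pair (\<lambda>x. \<i> * complex_of_real (\<phi> k x * gg k r) * X r x) \<psi>);
             Y' = (\<lambda>k j r. pair (\<lambda>x. complex_of_real (- (\<phi> j x * \<phi> k x * gg j r * gg k r)) * X r x
                                  + \<i> * complex_of_real (\<phi> k x * gp k j r) * X r x) \<psi>);
             \<mu> = (\<lambda>r x. complex_of_real (1/2 * (\<Sum>k<N. (\<phi> k x)\<^sup>2 * (gg k r)\<^sup>2)));
             D = (\<lambda>r. pair (\<lambda>x. \<i> * X r x) (lap \<psi>)
                     + pair (\<lambda>x. \<i> * complex_of_real ((cmod (X r x)) powr (p - 1)) * X r x) \<psi>
                     - pair (\<lambda>x. \<mu> r x * X r x) \<psi>)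
         in (\<forall>k<N. controlled_on {s..t} \<alpha> N Bp (Y k) (Y' k)) \<and>
            set_integrable lborel {s..t} D \<and>
            (\<exists>L. (\<forall>k<N. mesh_lim s t
                     (\<lambda>u w. (Bp k w - Bp k u) *\<^sub>R Y k u
                            + (\<Sum>j<N. BBp Bp Jp j k u w *\<^sub>R Y' k j u)) (L k)) \<and>
                 pair (X t) \<psi> - pair (X s) \<psi> - set_lebesgue_integral lborel {s..t} D
                   = (\<Sum>k<N. L k)))))"

end

theory Submission
 imports Defs
begin

text \<open>
Write F(r) = <X(r), \<psi>> for a test function \<psi>. Testing the random equation with exp(-W(w)) \<psi> turns it into
i \<Delta>X + i |X|^(p-1) X, and expanding exp(W(w) - W(u)) to second order expresses F(w) - F(u) through the increments of
I_k = int g_k dB_k up to O((w-u)^(3\<alpha>)). The analytic input is a local L^p bound for H^1 functions, 1 <= p <= 1 + 4/d,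
obtained from the decay of the measure of level sets. Almost surely I_k agrees with the sewn rough integral of g_k, and
BB_jk + BB_kj = dB_j dB_k - \<delta>_jk (w-u), so the quadratic terms split into the second-level germ and the drift \<mu>.
As 3\<alpha> > 1, a path whose increments agree up to O((w-u)^(3\<alpha>)) with those of the drift and the rough integrals
equals their sum.
\<close>

text \<open>The gauge exp(-W(t)) is only Hoelder continuous in time, so no product rule links v and
  X. Freezing it at the right end w keeps the test function admissible and makes <v(w), exp(-W(w))
  \<psi>> equal to F(w) exactly; the error in the drift is O((w-u)^(1+\<alpha>)), hence
  O((w-u)^(3\<alpha>)) on a compact window because \<alpha> < 1/2. As W is purely imaginary, |X| =
  |v|, and Taylor bounds for exp(W) carry no exponential factor. The nonlinearity must be bounded
  uniformly in time, whence an L^p bound that sees v only through its H^1 size. On the stochastic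
  side the Ito integrals are given as limits in probability only: the area is bounded by Gaussian
  exponential moments of truncated adapted sums and chaining, while the derivative of g, which comes
  without any measurability in \<omega>, is treated path by path. All probabilistic facts become
  estimates on the intervals [0,T] with T a natural number, outside one null set chosen before
  \<psi>, s and t; the remaining argument is deterministic and lives on one window [s,t].\<close>

abbreviation "cplx \<equiv> complex_of_real"

abbreviation sint :: "real => real => (real => 'b::{banach, second_countable_topology}) => 'b" where
 "sint u w \<equiv> set_lebesgue_integral lborel {u..w}"

section \<open>Smooth functions and test functions\<close>

text \<open>A relational derivative asserts existence together with the value, so product and chain
  rules compose without separate differentiability conditions. \<open>pdir_dpart\<close> leads back
  to \<open>dpart\<close>.\<close>

definition pdir :: "'a::euclidean_space => ('a => 'b::real_normed_vector) => ('a => 'b) => bool" where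
 "pdir j f f' \<longleftrightarrow> (\<forall>x. ((\<lambda>t. f (x + t *\<^sub>R j)) has_vector_derivative f' x) (at 0))"

lemma pdir_dpart: "pdir j (dpart js f) f' ==> dpart (j # js) f = f'"
 by (auto simp: pdir_def fun_eq_iff intro: vector_derivative_at)

lemma pdir_dpart1: "pdir j f f' ==> dpart [j] f = f'"
 using pdir_dpart[of j "[]"] by simp

lemma smooth_pdir:
 assumes "smooth_fn f" "set js \<subseteq> Basis" "j \<in> Basis"
 shows "pdir j (dpart js f) (dpart (j # js) f)"
 using assms by (auto simp: pdir_def smooth_fn_def vector_derivative_works[symmetric])

lemma smooth_pdir1: "smooth_fn f ==> j \<in> Basis ==> pdir j f (dpart [j] f)"
 using smooth_pdir[of f "[]" j] by simp

lemma smooth_continuous: "smooth_fn f ==> continuous_on UNIV f"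
 unfolding smooth_fn_def by (metis dpart.simps(1) empty_subsetI list.set(1))

lemma dpart_append: "dpart (js @ ks) f = dpart js (dpart ks f)"
 by (induction js) auto

lemma smooth_dpart: "smooth_fn f ==> set ks \<subseteq> Basis ==> smooth_fn (dpart ks f)"
 unfolding smooth_fn_def by (metis dpart_append le_sup_iff set_append)

text \<open>Every iterated derivative stays in P, by induction on the list of directions. Closure
  under a single differentiation therefore suffices, and closure proofs never have to handle lists
  of directions.\<close>

lemma smooth_coinduct:
 assumes "P f"
  and step: "!!f. P f ==> continuous_on UNIV f \<and> (\<forall>j\<in>Basis. \<exists>f'. P f' \<and> pdir j f f')"
 shows "smooth_fn f"
proof -
 have *: "P (dpart js f)" if "set js \<subseteq> Basis" for js
  using that
 proof (induction js)
  case (Cons j js)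
  then obtain f' where "P f'" "pdir j (dpart js f) f'" using step by (metis insert_subset list.set(2))
  then show ?case by (metis pdir_dpart)
 qed (use assms in simp)
 show ?thesis unfolding smooth_fn_def
 proof (intro allI impI conjI ballI)
  fix js :: "'a list" assume js: "set js \<subseteq> Basis"
  show "continuous_on UNIV (dpart js f)" using *[OF js] step by blast
  fix j :: 'a and x assume "j \<in> Basis"
  then obtain f' where "pdir j (dpart js f) f'" using step *[OF js] by blast
  then show "(\<lambda>t. dpart js f (x + t *\<^sub>R j)) differentiable at 0"
   unfolding pdir_def by (metis differentiableI_vector)
 qed
qed

lemma pdir_line:
 assumes "pdir j f f'"
 shows "((\<lambda>s. f (x + s *\<^sub>R j)) has_vector_derivative f' (x + t *\<^sub>R j)) (at t)"
proof -
 have "((\<lambda>s. f ((x + t *\<^sub>R j) + s *\<^sub>R j)) has_vector_derivative f' (x + t *\<^sub>R j)) (at (t - t))"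
  using assms by (simp add: pdir_def)
 moreover have "((\<lambda>s. s - t) has_vector_derivative 1) (at t)"
  by (auto intro!: derivative_eq_intros)
 ultimately have "(((\<lambda>s. f ((x + t *\<^sub>R j) + s *\<^sub>R j)) \<circ> (\<lambda>s. s - t)) has_vector_derivative 1 *\<^sub>R f' (x + t *\<^sub>R j)) (at t)"
  by (intro vector_diff_chain_at)
 moreover have "(\<lambda>s. f ((x + t *\<^sub>R j) + s *\<^sub>R j)) \<circ> (\<lambda>s. s - t) = (\<lambda>s. f (x + s *\<^sub>R j))"
  by (auto simp: fun_eq_iff algebra_simps)
 ultimately show ?thesis by simp
qed

section \<open>Flat functions and a class closed under differentiation\<close>

definition flat :: "real poly => real => real" where
 "flat P s = (if s <= 0 then 0 else poly P (1 / s) * exp (- 1 / s))"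

lemma poly_exp_limit: "((\<lambda>y. poly P y * exp (- y)) \<longlongrightarrow> (0::real)) at_top"
proof -
 have "((\<lambda>y. \<Sum>i\<le>degree P. coeff P i * (y ^ i / exp y)) \<longlongrightarrow> (\<Sum>i\<le>degree P. coeff P i * 0)) at_top"
  by (intro tendsto_sum tendsto_mult tendsto_const tendsto_power_div_exp_0)
 then show ?thesis
  by (simp add: poly_altdef exp_minus divide_inverse sum_distrib_right mult.assoc)
qed

text \<open>\<open>flat 1\<close> is the classical exp(-1/s) extended by 0; polynomial prefactors in
  y = 1/s close the family under differentiation. Indeed the derivative of P(y) exp(-y) is y^2 (P(y)
  - P'(y)) exp(-y), and \<open>[:0, 0, 1:]\<close> is the polynomial y^2. At 0 the quotient from the
  right is y P(y) exp(-y) with y = 1/h, which tends to 0.\<close>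

lemma has_derivative_flat:
 "(flat P has_field_derivative flat ([:0, 0, 1:] * (P - pderiv P)) s) (at s)"
proof -
 consider "s > 0" | "s < 0" | "s = 0" by linarith
 then show ?thesis
 proof cases
  case 1
  have "((\<lambda>s. poly P (1 / s) * exp (- 1 / s)) has_field_derivative
    flat ([:0, 0, 1:] * (P - pderiv P)) s) (at s)"
   using 1 by (auto intro!: derivative_eq_intros DERIV_chain2[OF poly_DERIV]
     simp: flat_def field_simps power2_eq_square)
  then show ?thesis
   by (rule has_field_derivative_transform_within_open[of _ _ _ "{0<..}"])
    (use 1 in \<open>auto simp: flat_def\<close>)
 next
  case 2
  have "((\<lambda>s. 0) has_field_derivative flat ([:0, 0, 1:] * (P - pderiv P)) s) (at s)"
   using 2 by (auto simp: flat_def)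
  then show ?thesis
   by (rule has_field_derivative_transform_within_open[of _ _ _ "{..<0}"])
    (use 2 in \<open>auto simp: flat_def\<close>)
 next
  case 3
  have r: "((\<lambda>h. flat P h / h) \<longlongrightarrow> 0) (at_right 0)"
  proof -
   have "((\<lambda>h. poly (pCons 0 P) (inverse h) * exp (- inverse h)) \<longlongrightarrow> 0) (at_right 0)"
    by (rule filterlim_compose[OF poly_exp_limit filterlim_inverse_at_top_right])
   moreover have "eventually (\<lambda>h. poly (pCons 0 P) (inverse h) * exp (- inverse h) = flat P h / h) (at_right (0::real))"
    by (rule eventually_at_right_less[THEN eventually_mono]) (auto simp: flat_def field_simps)
   ultimately show ?thesis by (rule Lim_transform_eventually)
  qed
  have l: "((\<lambda>h. flat P h / h) \<longlongrightarrow> 0) (at_left 0)"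
  proof (rule Lim_transform_eventually[OF tendsto_const])
   show "eventually (\<lambda>h. 0 = flat P h / h) (at_left (0::real))"
    by (auto simp: flat_def eventually_at_filter)
  qed
  have "((\<lambda>h. (flat P (0 + h) - flat P 0) / h) \<longlongrightarrow> 0) (at 0)"
   using l r by (intro filterlim_split_at) (auto simp: flat_def)
  then show ?thesis using 3 by (simp add: DERIV_def flat_def)
 qed
qed

text \<open>A syntactic class containing the gauges, weights and cutoffs that occur, and with each
  function its partial derivatives. Smoothness of a composite thus reduces to introduction rules.
  \<open>flat\<close> is composed with affine functions of one inner product only, the form found in
  the box cutoffs.\<close>

inductive smcl :: "('a::euclidean_space => complex) => bool" where
 smooth: "smooth_fn f ==> smcl f"
| of_real: "smooth_fn h ==> smcl (\<lambda>x. cplx (h x))"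
| const: "smcl (\<lambda>x. c)"
| add: "smcl f ==> smcl g ==> smcl (\<lambda>x. f x + g x)"
| mult: "smcl f ==> smcl g ==> smcl (\<lambda>x. f x * g x)"
| exp: "smcl f ==> smcl (\<lambda>x. exp (f x))"
| cnj: "smcl f ==> smcl (\<lambda>x. cnj (f x))"
| flat: "smcl (\<lambda>x. cplx (flat P (c + e * (x \<bullet> i))))"

lemma pdir_of_real: "pdir j h h' ==> pdir j (\<lambda>x. cplx (h x)) (\<lambda>x. cplx (h' x))"
 unfolding pdir_def by (auto intro: has_vector_derivative_of_real simp: has_real_derivative_iff_has_vector_derivative)

lemma pdir_const: "pdir j (\<lambda>x. c) (\<lambda>x. 0)"
 by (auto simp: pdir_def)

lemma pdir_add: "pdir j f f' ==> pdir j g g' ==> pdir j (\<lambda>x. f x + g x) (\<lambda>x. f' x + g' x)"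
 by (auto simp: pdir_def intro: has_vector_derivative_add)

lemma pdir_mult:
 fixes f g :: "'a::euclidean_space => 'b::real_normed_algebra"
 shows "pdir j f f' ==> pdir j g g' ==> pdir j (\<lambda>x. f x * g x) (\<lambda>x. f x * g' x + f' x * g x)"
 unfolding pdir_def
proof (intro allI)
 fix x
 assume "\<forall>x. ((\<lambda>t. f (x + t *\<^sub>R j)) has_vector_derivative f' x) (at 0)"
  "\<forall>x. ((\<lambda>t. g (x + t *\<^sub>R j)) has_vector_derivative g' x) (at 0)"
 then have "((\<lambda>t. f (x + t *\<^sub>R j)) has_vector_derivative f' x) (at 0)"
  "((\<lambda>t. g (x + t *\<^sub>R j)) has_vector_derivative g' x) (at 0)" by blast+
 from has_vector_derivative_mult[OF this]
 show "((\<lambda>t. f (x + t *\<^sub>R j) * g (x + t *\<^sub>R j)) has_vector_derivative f x * g' x + f' x * g x) (at 0)"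
  by simp
qed

lemma pdir_exp:
 fixes f :: "'a::euclidean_space => complex"
 shows "pdir j f f' ==> pdir j (\<lambda>x. exp (f x)) (\<lambda>x. f' x * exp (f x))"
 unfolding pdir_def
proof
 fix x assume "\<forall>x. ((\<lambda>t. f (x + t *\<^sub>R j)) has_vector_derivative f' x) (at 0)"
 then have "((\<lambda>t. f (x + t *\<^sub>R j)) has_vector_derivative f' x) (at 0)" by blast
 from field_vector_diff_chain_at[OF this, of exp "exp (f x)"]
 show "((\<lambda>t. exp (f (x + t *\<^sub>R j))) has_vector_derivative f' x * exp (f x)) (at 0)"
  by (simp add: o_def)
qed

lemma pdir_cnj: "pdir j f f' ==> pdir j (\<lambda>x. cnj (f x)) (\<lambda>x. cnj (f' x))"
 unfolding pdir_def by (auto intro: has_vector_derivative_cnj)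

lemma pdir_flat:
 "pdir j (\<lambda>x. flat P (c + e * (x \<bullet> i))) (\<lambda>x. flat ([:0, 0, 1:] * (P - pderiv P)) (c + e * (x \<bullet> i)) * (e * (j \<bullet> i)))"
 unfolding pdir_def
proof
 fix x
 have "((\<lambda>t. c + e * ((x + t *\<^sub>R j) \<bullet> i)) has_field_derivative e * (j \<bullet> i)) (at 0)"
  by (auto simp: inner_add_left intro!: derivative_eq_intros)
 from DERIV_chain2[OF has_derivative_flat this, of P]
 show "((\<lambda>t. flat P (c + e * ((x + t *\<^sub>R j) \<bullet> i))) has_vector_derivative
   flat ([:0, 0, 1:] * (P - pderiv P)) (c + e * (x \<bullet> i)) * (e * (j \<bullet> i))) (at 0)"
  by (simp add: has_real_derivative_iff_has_vector_derivative)
qed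

lemma continuous_flat: "continuous_on A (flat P)"
 by (rule DERIV_continuous_on) (rule has_field_derivative_at_within[OF has_derivative_flat])

lemma smcl_smooth: "smcl f ==> smooth_fn f"
proof (erule smooth_coinduct)
 fix f :: "'a => complex" assume "smcl f"
 then show "continuous_on UNIV f \<and> (\<forall>j\<in>Basis. \<exists>f'. smcl f' \<and> pdir j f f')"
 proof induction
  case (smooth f)
  then show ?case by (metis smooth_continuous smooth_pdir1 smooth_dpart smcl.smooth empty_subsetI insert_subset list.set)
 next
  case (of_real h)
  have "\<exists>f'. smcl f' \<and> pdir j (\<lambda>x. cplx (h x)) f'" if j: "j \<in> Basis" for j
  proof (intro exI conjI)
   show "smcl (\<lambda>x. cplx (dpart [j] h x))"
    by (rule smcl.of_real[OF smooth_dpart[OF of_real]]) (use j in simp)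
   show "pdir j (\<lambda>x. cplx (h x)) (\<lambda>x. cplx (dpart [j] h x))"
    by (rule pdir_of_real[OF smooth_pdir1[OF of_real j]])
  qed
  then show ?case using smooth_continuous[OF of_real] by (auto intro: continuous_intros)
 next
  case (const c)
  then show ?case using pdir_const smcl.const by (auto intro!: continuous_intros)
 next
  case (add f g)
  show ?case
  proof (intro conjI ballI)
   fix j :: 'a assume "j \<in> Basis"
   then obtain f' g' where "smcl f'" "pdir j f f'" "smcl g'" "pdir j g g'" using add.IH by blast
   then show "\<exists>h. smcl h \<and> pdir j (\<lambda>x. f x + g x) h" using pdir_add smcl.add by blast
  qed (use add.IH in \<open>auto intro: continuous_intros\<close>)
 next
  case (mult f g)
  show ?case
  proof (intro conjI ballI)
   fix j :: 'a assume "j \<in> Basis"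
   then obtain f' g' where fg: "smcl f'" "pdir j f f'" "smcl g'" "pdir j g g'" using mult.IH by blast
   have "smcl (\<lambda>x. f x * g' x + f' x * g x)" using fg mult.hyps by (intro smcl.add smcl.mult)
   then show "\<exists>h. smcl h \<and> pdir j (\<lambda>x. f x * g x) h" using pdir_mult fg by blast
  qed (use mult.IH in \<open>auto intro: continuous_intros\<close>)
 next
  case (exp f)
  show ?case
  proof (intro conjI ballI)
   fix j :: 'a assume "j \<in> Basis"
   then obtain f' where f: "smcl f'" "pdir j f f'" using exp.IH by blast
   have "smcl (\<lambda>x. f' x * exp (f x))" using f exp.hyps by (intro smcl.exp smcl.mult)
   then show "\<exists>h. smcl h \<and> pdir j (\<lambda>x. exp (f x)) h" using pdir_exp f by blast
  qed (use exp.IH in \<open>auto intro: continuous_intros\<close>)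
 next
  case (cnj f)
  show ?case
  proof (intro conjI ballI)
   fix j :: 'a assume "j \<in> Basis"
   then obtain f' where "smcl f'" "pdir j f f'" using cnj.IH by blast
   then show "\<exists>h. smcl h \<and> pdir j (\<lambda>x. cnj (f x)) h" using pdir_cnj smcl.cnj by blast
  qed (use cnj.IH in \<open>auto intro: continuous_intros\<close>)
 next
  case (flat P c e i)
  have "smcl (\<lambda>x. cplx (flat Q (c + e * (x \<bullet> i)) * b))" for Q b
   using smcl.mult[OF smcl.flat[of Q c e i] smcl.const[of "cplx b"]] by simp
  then have "\<forall>j\<in>Basis. \<exists>f'. smcl f' \<and> pdir j (\<lambda>x. cplx (flat P (c + e * (x \<bullet> i)))) f'"
   using pdir_of_real[OF pdir_flat[of _ P c e i]] by blast
  moreover have "continuous_on UNIV (\<lambda>x. cplx (flat P (c + e * (x \<bullet> i))))"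
   by (intro continuous_on_of_real continuous_on_compose2[OF continuous_flat[of UNIV]] continuous_intros) auto
  ultimately show ?case by blast
 qed
qed

lemma smcl_sum: "(!!i. i \<in> A ==> smcl (f i)) ==> smcl (\<lambda>x. \<Sum>i\<in>A. f i x)"
proof (induction A rule: infinite_finite_induct)
 case (insert a A)
 then have "smcl (\<lambda>x. f a x + (\<Sum>i\<in>A. f i x))" by (intro smcl.add) auto
 then show ?case using insert by simp
qed (auto intro: smcl.const)

lemma smcl_prod: "(!!i. i \<in> A ==> smcl (f i)) ==> smcl (\<lambda>x. \<Prod>i\<in>A. f i x)"
proof (induction A rule: infinite_finite_induct)
 case (insert a A)
 then have "smcl (\<lambda>x. f a x * (\<Prod>i\<in>A. f i x))" by (intro smcl.mult) auto
 then show ?case using insert by simp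
qed (auto intro: smcl.const)

lemma smcl_diff: "smcl f ==> smcl g ==> smcl (\<lambda>x. f x - g x)"
 using smcl.add[of f "\<lambda>x. (- 1) * g x"] smcl.mult[OF smcl.const[of "-1"], of g] by simp

lemma smcl_power: "smcl f ==> smcl (\<lambda>x. f x ^ n)"
 by (induction n) (auto intro: smcl.const smcl.mult)

section \<open>Test functions and their stability\<close>

lemma test_fn_smooth: "test_fn f ==> smooth_fn f"
 by (simp add: test_fn_def)

lemma test_fn_smcl: "test_fn f ==> smcl f"
 by (simp add: test_fn_def smcl.smooth)

lemma test_fnI:
 assumes "smcl f" "bounded S" "!!x. x \<notin> S ==> f x = 0"
 shows "test_fn f"
proof -
 have "bounded {x. f x \<noteq> 0}" using assms by (intro bounded_subset[OF assms(2)]) auto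
 then show ?thesis using assms smcl_smooth by (auto simp: test_fn_def compact_closure)
qed

lemma test_fn_bounded_support: "test_fn f ==> bounded {x. f x \<noteq> 0}"
 by (auto simp: test_fn_def compact_closure)

lemma test_fn_mult: "test_fn f ==> smcl g ==> test_fn (\<lambda>x. g x * f x)"
 by (rule test_fnI[OF _ test_fn_bounded_support]) (auto intro: smcl.mult test_fn_smcl)

text \<open>On the open complement of the support the function vanishes along short segments, hence
  so do all derivatives: the support does not grow.\<close>

lemma test_fn_dpart:
 assumes "test_fn f" "set js \<subseteq> Basis"
 shows "test_fn (dpart js f)"
proof (rule test_fnI)
 let ?K = "closure {x. f x \<noteq> 0}"
 show "smcl (dpart js f)" using assms by (auto simp: test_fn_def intro: smcl.smooth smooth_dpart)
 show "bounded ?K" using assms by (auto simp: test_fn_def compact_imp_bounded)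
 fix x assume "x \<notin> ?K"
 moreover have "\<forall>x. x \<notin> ?K --> dpart js f x = 0" using assms(2)
 proof (induction js)
  case Nil
  then show ?case using closure_subset[of "{x. f x \<noteq> 0}"] by auto
 next
  case (Cons j js)
  show ?case
  proof (intro allI impI)
   fix x assume x: "x \<notin> ?K"
   have "open ((\<lambda>t. x + t *\<^sub>R j) -` (- ?K))"
    by (intro open_vimage) (auto intro!: continuous_intros)
   moreover have "0 \<in> (\<lambda>t. x + t *\<^sub>R j) -` (- ?K)" using x by auto
   ultimately have "((\<lambda>t. dpart js f (x + t *\<^sub>R j)) has_vector_derivative 0) (at 0)"
    using Cons by (intro has_vector_derivative_transform_within_open[OF has_vector_derivative_const]) auto
   then show "dpart (j # js) f x = 0" by (simp add: vector_derivative_at)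
  qed
 qed
 ultimately show "dpart js f x = 0" by blast
qed

lemma test_fn_continuous: "test_fn f ==> continuous_on UNIV f"
 by (auto simp: test_fn_def intro: smooth_continuous)

lemma test_fn_borel [measurable]: "test_fn f ==> f \<in> borel_measurable borel"
 by (rule borel_measurable_continuous_onI[OF test_fn_continuous])

lemma test_fn_bounded: "test_fn f ==> \<exists>C. \<forall>x. cmod (f x) <= C"
proof -
 assume f: "test_fn f"
 then have "bounded (f ` closure {x. f x \<noteq> 0})"
  by (auto simp: test_fn_def intro!: compact_imp_bounded compact_continuous_image
    continuous_on_subset[OF test_fn_continuous])
 then obtain C where C: "\<forall>x\<in>closure {x. f x \<noteq> 0}. cmod (f x) <= C" by (auto simp: bounded_iff)
 then have "cmod (f x) <= max C 0" for x
  using closure_subset[of "{x. f x \<noteq> 0}"] by (cases "f x = 0") (auto simp: le_max_iff_disj)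
 then show ?thesis by blast
qed

lemma dpart_shift: "dpart js (\<lambda>x. f (x + y)) = (\<lambda>x. dpart js f (x + y))"
 by (induction js) (auto simp: fun_eq_iff add_ac)

lemma test_fn_shift:
 assumes "test_fn f" shows "test_fn (\<lambda>x. f (x + y))"
proof (rule test_fnI)
 have "continuous_on UNIV (\<lambda>x. g (x + y))" if "continuous_on UNIV g" for g :: "'a => complex"
  by (rule continuous_on_compose2[OF that]) (auto intro: continuous_intros)
 moreover have "(\<lambda>t. dpart js f (x + t *\<^sub>R j + y)) = (\<lambda>t. dpart js f ((x + y) + t *\<^sub>R j))" for x j js
  by (simp add: add_ac)
 ultimately have "smooth_fn (\<lambda>x. f (x + y))"
  using test_fn_smooth[OF assms] unfolding smooth_fn_def dpart_shift by simp
 then show "smcl (\<lambda>x. f (x + y))" by (rule smcl.smooth)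
 show "bounded ((\<lambda>x. x - y) ` {x. f x \<noteq> 0})"
  by (intro bounded_translation_minus test_fn_bounded_support assms)
 show "f (x + y) = 0" if "x \<notin> (\<lambda>x. x - y) ` {x. f x \<noteq> 0}" for x
 proof (rule ccontr)
  assume "f (x + y) \<noteq> 0"
  then have "x \<in> (\<lambda>x. x - y) ` {x. f x \<noteq> 0}" by (intro image_eqI[of _ _ "x + y"]) auto
  then show False using that by simp
 qed
qed

section \<open>Smooth approximation of indicators\<close>

definition box_bump :: "'a::euclidean_space => 'a => 'a => real" where
 "box_bump a b x = (\<Prod>i\<in>Basis. flat 1 (- (a \<bullet> i) + 1 * (x \<bullet> i)) * flat 1 (b \<bullet> i + (- 1) * (x \<bullet> i)))"

lemma flat_1: "0 <= flat 1 s" "flat 1 s < 1" "0 < flat 1 s \<longleftrightarrow> s > 0"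
 by (auto simp: flat_def)

text \<open>Values strictly below 1 and positivity exactly on the box are what makes the powers in
  \<open>test_fn_approx_open\<close> converge. The factors \<open>1 *\<close> and
  \<open>(- 1) *\<close> in the definition keep the arguments in the affine form of
  \<open>smcl.flat\<close>.\<close>

lemma box_bump:
 "0 <= box_bump a b x" "box_bump a b x < 1" "0 < box_bump a b x \<longleftrightarrow> x \<in> box a b"
proof -
 show nn: "0 <= box_bump a b x" by (auto simp: box_bump_def flat_1 intro!: prod_nonneg mult_nonneg_nonneg)
 have lt: "flat 1 s * flat 1 t < 1" for s t
  using flat_1[of s] flat_1[of t] by (meson less_imp_le mult_left_le order_le_less_trans)
 obtain k :: 'a where k: "k \<in> Basis" using nonempty_Basis by blast
 let ?f = "\<lambda>i. flat 1 (- (a \<bullet> i) + 1 * (x \<bullet> i)) * flat 1 (b \<bullet> i + (- 1) * (x \<bullet> i))"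
 have "box_bump a b x = ?f k * (\<Prod>i\<in>Basis - {k}. ?f i)"
  unfolding box_bump_def using k by (subst prod.remove[of _ k]) auto
 also have "... <= ?f k * 1"
  by (intro mult_left_mono prod_le_1) (auto simp: flat_1 intro: less_imp_le[OF lt])
 finally have "box_bump a b x <= ?f k" by simp
 then show "box_bump a b x < 1" by (rule order_le_less_trans) (rule lt)
 have "0 < box_bump a b x \<longleftrightarrow> box_bump a b x \<noteq> 0" using nn by linarith
 also have "... \<longleftrightarrow> (\<forall>i\<in>Basis. ?f i \<noteq> 0)" by (auto simp: box_bump_def)
 also have "... \<longleftrightarrow> x \<in> box a b"
  unfolding mem_box using flat_1(1,3) by (auto simp: less_le)
 finally show "0 < box_bump a b x \<longleftrightarrow> x \<in> box a b" .
qed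

lemma smcl_box_bump: "smcl (\<lambda>x. cplx (box_bump a b x))"
 unfolding box_bump_def of_real_prod of_real_mult
 by (intro smcl_prod smcl.mult smcl.flat)

text \<open>U is a countable union of boxes with bumps q_i, and the approximants are 1 - prod_{i<n}
  (1 - q_i)^n. At a point of U some 1 - q_k is below 1 and its n-th power drives the product to 0;
  off U every bump vanishes.\<close>

lemma test_fn_approx_open:
 fixes U :: "'a::euclidean_space set"
 assumes U: "open U" "bounded U"
 obtains \<psi> :: "nat => 'a => real" where
  "!!n. test_fn (\<lambda>x. cplx (\<psi> n x))" "!!n x. 0 <= \<psi> n x" "!!n x. \<psi> n x <= 1"
  "!!n x. x \<notin> U ==> \<psi> n x = 0" "!!x. (\<lambda>n. \<psi> n x) \<longlonglongrightarrow> indicator U x"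
proof -
 obtain D :: "'a set set" where D: "countable D" "D \<subseteq> Pow U" "!!X. X \<in> D ==> \<exists>a b. X = box a b" "\<Union>D = U"
  using open_countable_Union_open_box[OF U(1)] by metis
 \<comment> \<open>Adding the empty box leaves the union unchanged and makes the enumeration
   \<open>from_nat_into\<close> available even for empty U.\<close>
 define E where "E = insert {} D"
 have E: "countable E" "E \<noteq> {}" "!!X. X \<in> E ==> X \<subseteq> U \<and> (\<exists>a b. X = box a b)" "\<Union>E = U"
 proof -
  have "{} = box (0::'a) 0" by (simp add: box_eq_empty ex_in_conv)
  then show "!!X. X \<in> E ==> X \<subseteq> U \<and> (\<exists>a b. X = box a b)" using D unfolding E_def by blast
 qed (use D in \<open>auto simp: E_def\<close>)
 obtain a b where ab: "!!i. from_nat_into E i = box (a i) (b i)"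
 proof -
  have "\<forall>i. \<exists>ab. from_nat_into E i = box (fst ab) (snd ab)"
   using E(3) from_nat_into[OF E(2)] by fastforce
  then obtain ab where "\<forall>i. from_nat_into E i = box (fst (ab i)) (snd (ab i))" by (rule choice[THEN exE])
  then show thesis by (intro that) blast
 qed
 have sub: "box (a i) (b i) \<subseteq> U" for i using E(3)[OF from_nat_into[OF E(2)]] ab[of i] by auto
 have cov: "\<exists>i. x \<in> box (a i) (b i)" if "x \<in> U" for x
  using that E(4) ab from_nat_into_surj[OF E(1)] by (metis UnionE)
 define \<psi> where "\<psi> n x = 1 - (\<Prod>i<n. (1 - box_bump (a i) (b i) x) ^ n)" for n x
 have r: "0 <= (1 - box_bump (a i) (b i) x) ^ n" "(1 - box_bump (a i) (b i) x) ^ n <= 1" for i x n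
  using box_bump[of "a i" "b i" x] by (auto intro!: power_le_one)
 have z: "box_bump (a i) (b i) x = 0" if "x \<notin> box (a i) (b i)" for i x
  using that box_bump[of "a i" "b i" x] by linarith
 show thesis
 proof (rule that[of \<psi>])
  show out: "\<psi> n x = 0" if "x \<notin> U" for n x
  proof -
   have "x \<notin> box (a i) (b i)" for i using sub that by blast
   then show ?thesis unfolding \<psi>_def using z by simp
  qed
  show "test_fn (\<lambda>x. cplx (\<psi> n x))" for n
  proof (rule test_fnI[OF _ U(2)])
   show "smcl (\<lambda>x. cplx (\<psi> n x))"
    unfolding \<psi>_def of_real_diff of_real_prod of_real_power
    by (intro smcl_diff smcl_prod smcl_power smcl_box_bump smcl.const)
  qed (use out in auto)
  show "0 <= \<psi> n x" "\<psi> n x <= 1" for n x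
   unfolding \<psi>_def using r by (auto intro!: prod_le_1 prod_nonneg)
  show "(\<lambda>n. \<psi> n x) \<longlonglongrightarrow> indicator U x" for x
  proof (cases "x \<in> U")
   case False
   then show ?thesis by (simp add: out)
  next
   case True
   then obtain k where k: "x \<in> box (a k) (b k)" using cov by blast
   let ?q = "1 - box_bump (a k) (b k) x"
   have q: "0 <= ?q" "?q < 1" using box_bump[of "a k" "b k" x] k by auto
   have "(\<lambda>n. \<Prod>i<n. (1 - box_bump (a i) (b i) x) ^ n) \<longlonglongrightarrow> 0"
   proof (rule tendsto_sandwich[OF _ _ tendsto_const LIMSEQ_power_zero[of ?q]])
    show "\<forall>\<^sub>F n in sequentially. (\<Prod>i<n. (1 - box_bump (a i) (b i) x) ^ n) <= ?q ^ n"
     using eventually_gt_at_top[of k]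
    proof eventually_elim
     case (elim n)
     then have "(\<Prod>i<n. (1 - box_bump (a i) (b i) x) ^ n) = ?q ^ n * (\<Prod>i\<in>{..<n} - {k}. (1 - box_bump (a i) (b i) x) ^ n)"
      by (subst prod.remove[of _ k]) auto
     also have "... <= ?q ^ n * 1" using r q by (intro mult_left_mono prod_le_1) auto
     finally show ?case by simp
    qed
   qed (use q r in \<open>auto intro!: prod_nonneg always_eventually simp del: zero_le_power_eq\<close>)
   from tendsto_diff[OF tendsto_const this, of 1] show ?thesis using True by (simp add: \<psi>_def)
  qed
 qed
qed

text \<open>Outer regularity encloses E in an open set of nearly the same measure, and the smooth
  approximants of that set converge in L^1 by dominated convergence.\<close>

lemma test_fn_approx_indicator:
 fixes E :: "'a::euclidean_space set"
 assumes E: "E \<in> sets borel" "bounded E" and "\<eta> > 0"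
 obtains \<psi> :: "'a => real" where
  "test_fn (\<lambda>x. cplx (\<psi> x))" "!!x. 0 <= \<psi> x" "!!x. \<psi> x <= 1"
  "(LBINT x. \<bar>\<psi> x - indicator E x\<bar>) < \<eta>"
  "integrable lborel (\<lambda>x. \<bar>\<psi> x - indicator E x\<bar>)"
proof -
 obtain V where V: "open V" "E \<subseteq> V" "emeasure lborel (V - E) < ennreal (\<eta> / 2)"
  using outer_regular_lborel[OF E(1), of "\<eta> / 2"] \<open>\<eta> > 0\<close> by auto
 obtain R where R: "E \<subseteq> ball 0 R" using E(2) bounded_subset_ballD by blast
 \<comment> \<open>Cutting with a ball makes the open set bounded, so that its indicator is an
   integrable majorant.\<close>
 define U where "U = V \<inter> ball 0 R"
 have U: "open U" "bounded U" "E \<subseteq> U" using V R by (auto simp: U_def bounded_Int)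
 have UE: "emeasure lborel (U - E) < ennreal (\<eta> / 2)"
  by (rule le_less_trans[OF emeasure_mono V(3)]) (use V E in \<open>auto simp: U_def\<close>)
 obtain \<psi> :: "nat => 'a => real" where p:
  "!!n. test_fn (\<lambda>x. cplx (\<psi> n x))" "!!n x. 0 <= \<psi> n x" "!!n x. \<psi> n x <= 1"
  "!!n x. x \<notin> U ==> \<psi> n x = 0" "!!x. (\<lambda>n. \<psi> n x) \<longlonglongrightarrow> indicator U x"
  using test_fn_approx_open[OF U(1,2)] by metis
 have meas: "\<psi> n \<in> borel_measurable borel" for n
 proof -
  have "(\<lambda>x. Re (cplx (\<psi> n x))) \<in> borel_measurable borel"
   by (rule measurable_compose[OF test_fn_borel[OF p(1)]]) measurable
  then show ?thesis by simp
 qed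
 have Ufin: "emeasure lborel U < \<infinity>" using emeasure_bounded_finite[OF U(2)] by simp
 have Ub: "U \<in> sets borel" using U by auto
 have iU: "integrable lborel (indicator U :: 'a => real)" using Ub Ufin by simp
 have EU: "indicator E x <= (indicator U x :: real)" for x using U by (auto simp: indicator_def)
 have intE: "integrable lborel (indicator E :: 'a => real)"
  by (rule Bochner_Integration.integrable_bound[OF iU]) (use E EU in auto)
 have int: "integrable lborel (\<lambda>x. \<bar>\<psi> n x - indicator E x\<bar>)" for n
 proof (rule Bochner_Integration.integrable_bound[OF iU])
  show "(\<lambda>x. \<bar>\<psi> n x - indicator E x\<bar>) \<in> borel_measurable lborel" using meas E by measurable
  have "\<bar>\<psi> n x - indicator E x\<bar> <= indicator U x" for x
   using p(2,3)[of n x] p(4)[of x n] U(3) by (auto simp: indicator_def)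
  then show "AE x in lborel. norm \<bar>\<psi> n x - indicator E x\<bar> <= norm (indicator U x :: real)" by auto
 qed
 have "(\<lambda>n. (LBINT x. \<bar>\<psi> n x - indicator E x\<bar>)) \<longlonglongrightarrow>
   (LBINT x. \<bar>indicator U x - indicator E x\<bar> :: real)"
 proof (rule integral_dominated_convergence[where w = "indicator U"])
  show "AE x in lborel. norm \<bar>\<psi> n x - indicator E x\<bar> <= indicator U x" for n
  proof (rule AE_I2)
   fix x
   show "norm \<bar>\<psi> n x - indicator E x\<bar> <= indicator U x"
    using p(2,3)[of n x] p(4)[of x n] U(3) by (auto simp: indicator_def)
  qed
 qed (use meas E Ub iU p(5) in \<open>auto intro!: tendsto_intros\<close>)
 moreover have "(LBINT x. \<bar>indicator U x - indicator E x\<bar> :: real) < \<eta>"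
 proof -
  have "(\<lambda>x. \<bar>indicator U x - indicator E x\<bar> :: real) = indicator (U - E)"
   using U(3) by (auto simp: indicator_def fun_eq_iff)
  moreover have "measure lborel (U - E) < \<eta>"
  proof -
   have "measure lborel (U - E) <= \<eta> / 2"
    using UE \<open>\<eta> > 0\<close> unfolding measure_def by (intro enn2real_leI) auto
   then show ?thesis using \<open>\<eta> > 0\<close> by simp
  qed
  ultimately show ?thesis using E Ub by simp
 qed
 ultimately have "\<forall>\<^sub>F n in sequentially. (LBINT x. \<bar>\<psi> n x - indicator E x\<bar>) < \<eta>"
  by (rule order_tendstoD(2))
 then obtain n where "(LBINT x. \<bar>\<psi> n x - indicator E x\<bar>) < \<eta>"
  by (auto simp: eventually_sequentially)
 with p int show thesis by (intro that[of "\<psi> n"]) auto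
qed

section \<open>Partitions and sewing\<close>

text \<open>Consecutive pairs of a finite set, free of lists: splitting and concatenating partitions
  become set identities. \<open>psum_gaps\<close> and \<open>mesh_less_iff\<close> translate the
  list-based definitions.\<close>

definition gaps :: "real set => (real \<times> real) set" where
 "gaps P = {(x, y). x \<in> P \<and> y \<in> P \<and> x < y \<and> P \<inter> {x<..<y} = {}}"

lemma finite_gaps: "finite P ==> finite (gaps P)"
 by (rule finite_subset[of _ "P \<times> P"]) (auto simp: gaps_def)

lemma bij_betw_gaps:
 fixes xs :: "real list"
 assumes "sorted_wrt (<) xs"
 shows "bij_betw (\<lambda>i. (xs ! i, xs ! (i + 1))) {..<length xs - 1} (gaps (set xs))"
proof -
 have d: "distinct xs" and lt: "!!i j. i < j ==> j < length xs ==> xs ! i < xs ! j"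
  using assms by (auto simp: strict_sorted_iff intro: sorted_wrt_nth_less)
 have inj: "inj_on (\<lambda>i. (xs ! i, xs ! (i + 1))) {..<length xs - 1}"
  using d by (auto simp: inj_on_def nth_eq_iff_index_eq)
 have no: "\<not> (xs ! i < xs ! k \<and> xs ! k < xs ! (i + 1))" if "i + 1 < length xs" "k < length xs" for i k
 proof
  assume h: "xs ! i < xs ! k \<and> xs ! k < xs ! (i + 1)"
  have "i < k" by (rule ccontr) (use h lt[of k i] that in \<open>cases "k = i"; auto\<close>)
  moreover have "k < i + 1" by (rule ccontr) (use h lt[of "i+1" k] that in \<open>cases "k = i + 1"; auto\<close>)
  ultimately show False by simp
 qed
 have "(\<lambda>i. (xs ! i, xs ! (i + 1))) ` {..<length xs - 1} = gaps (set xs)"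
 proof (intro equalityI subsetI)
  fix z assume "z \<in> (\<lambda>i. (xs ! i, xs ! (i + 1))) ` {..<length xs - 1}"
  then obtain i where "i < length xs - 1" and iz: "z = (xs ! i, xs ! (i + 1))" by auto
  then have i: "i + 1 < length xs" "z = (xs ! i, xs ! (i + 1))" by simp_all
  have "set xs \<inter> {xs ! i<..<xs ! (i + 1)} = {}"
   using no[OF i(1)] by (auto simp: in_set_conv_nth)
  then show "z \<in> gaps (set xs)" using i lt[of i "i+1"] by (auto simp: gaps_def)
 next
  fix z assume "z \<in> gaps (set xs)"
  then obtain i j where ij: "i < length xs" "j < length xs" "z = (xs ! i, xs ! j)" "xs ! i < xs ! j"
   "set xs \<inter> {xs ! i<..<xs ! j} = {}"
   by (auto simp: gaps_def in_set_conv_nth)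
  have "i < j" by (rule ccontr) (use ij lt[of j i] in \<open>cases "i = j"; auto\<close>)
  have "j = i + 1"
  proof (rule ccontr)
   assume "j \<noteq> i + 1"
   then have "i + 1 < j" using \<open>i < j\<close> by simp
   then have "xs ! (i + 1) \<in> set xs \<inter> {xs ! i<..<xs ! j}"
    using lt[of i "i+1"] lt[of "i+1" j] ij(1,2) by (auto simp del: nth_mem intro!: nth_mem)
   then show False using ij(5) by blast
  qed
  then show "z \<in> (\<lambda>i. (xs ! i, xs ! (i + 1))) ` {..<length xs - 1}"
   using ij by auto
 qed
 with inj show ?thesis by (simp add: bij_betw_def)
qed

lemma psum_gaps:
 assumes "finite P"
 shows "psum P f = (\<Sum>(x, y)\<in>gaps P. f x y)"
proof -
 let ?xs = "sorted_list_of_set P"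
 have "(\<Sum>z\<in>gaps (set ?xs). (\<lambda>(x, y). f x y) z) = (\<Sum>i<length ?xs - 1. f (?xs ! i) (?xs ! (i + 1)))"
  by (subst sum.reindex_bij_betw[OF bij_betw_gaps, symmetric]) auto
 then show ?thesis using assms by (simp add: psum_def Let_def)
qed

lemma mesh_less_iff:
 assumes "finite P" "\<delta> > 0"
 shows "mesh P < \<delta> \<longleftrightarrow> (\<forall>(x, y)\<in>gaps P. y - x < \<delta>)"
proof -
 let ?xs = "sorted_list_of_set P"
 have im: "{?xs ! (i+1) - ?xs ! i | i. i + 1 < length ?xs} = (\<lambda>(x, y). y - x) ` gaps P"
 proof -
  have "gaps P = (\<lambda>i. (?xs ! i, ?xs ! (i + 1))) ` {..<length ?xs - 1}"
   using bij_betw_gaps[of ?xs] assms by (simp add: bij_betw_def)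
  then show ?thesis by (auto simp: image_image less_diff_conv)
 qed
 show ?thesis unfolding mesh_def Let_def im
  using assms by (subst Max_less_iff) (auto simp: finite_gaps)
qed

text \<open>No gap straddles a point of P, so each gap lies on one side of m.\<close>

lemma gaps_split:
 assumes "m \<in> P"
 shows "gaps P = gaps (P \<inter> {..m}) \<union> gaps (P \<inter> {m..})" "gaps (P \<inter> {..m}) \<inter> gaps (P \<inter> {m..}) = {}"
proof -
 show "gaps P = gaps (P \<inter> {..m}) \<union> gaps (P \<inter> {m..})"
 proof (intro equalityI subsetI)
  fix z assume "z \<in> gaps P"
  then obtain x y where z: "z = (x, y)" "x \<in> P" "y \<in> P" "x < y" "P \<inter> {x<..<y} = {}"
   by (auto simp: gaps_def)
  have "m \<notin> {x<..<y}" using z(5) assms by blast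
  then have "y <= m \<or> m <= x" by auto
  then show "z \<in> gaps (P \<inter> {..m}) \<union> gaps (P \<inter> {m..})" using z by (auto simp: gaps_def)
 next
  fix z assume "z \<in> gaps (P \<inter> {..m}) \<union> gaps (P \<inter> {m..})"
  then consider "z \<in> gaps (P \<inter> {..m})" | "z \<in> gaps (P \<inter> {m..})" by blast
  then show "z \<in> gaps P"
  proof cases
   case 1
   then have z: "fst z \<in> P" "snd z \<in> P" "fst z < snd z" "snd z <= m" "P \<inter> {..m} \<inter> {fst z<..<snd z} = {}"
    by (auto simp: gaps_def)
   have "P \<inter> {fst z<..<snd z} = P \<inter> {..m} \<inter> {fst z<..<snd z}" using z(4) by auto
   then show ?thesis using z by (simp add: gaps_def case_prod_unfold)
  next
   case 2
   then have z: "fst z \<in> P" "snd z \<in> P" "fst z < snd z" "m <= fst z" "P \<inter> {m..} \<inter> {fst z<..<snd z} = {}"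
    by (auto simp: gaps_def)
   have "P \<inter> {fst z<..<snd z} = P \<inter> {m..} \<inter> {fst z<..<snd z}" using z(4) by auto
   then show ?thesis using z by (simp add: gaps_def case_prod_unfold)
  qed
 qed
 show "gaps (P \<inter> {..m}) \<inter> gaps (P \<inter> {m..}) = {}" by (auto simp: gaps_def)
qed

lemma psum_split:
 assumes "finite P" "m \<in> P"
 shows "psum P f = psum (P \<inter> {..m}) f + psum (P \<inter> {m..}) f"
 using assms by (simp add: psum_gaps gaps_split(1)[OF assms(2)] sum.union_disjoint finite_gaps gaps_split(2))

lemma psum_pair: "x < y ==> psum {x, y} f = f x y"
proof -
 assume "x < y"
 then have "gaps {x, y} = {(x, y)}" by (auto simp: gaps_def)
 then show ?thesis by (simp add: psum_gaps)
qed

lemma psum_single [simp]: "psum {x} f = 0"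
 by (simp add: psum_def)

lemma psum_cong:
 assumes "finite P" "!!x y. (x, y) \<in> gaps P ==> f x y = g x y"
 shows "psum P f = psum P g"
 using assms by (auto simp: psum_gaps intro!: sum.cong)

lemma psum_mono:
 fixes f g :: "real => real => real"
 assumes "finite P" "!!x y. (x, y) \<in> gaps P ==> f x y <= g x y"
 shows "psum P f <= psum P g"
 using assms by (auto simp: psum_gaps intro!: sum_mono)

lemma norm_psum:
 "finite P ==> norm (psum P f) <= psum P (\<lambda>x y. norm (f x y))"
 unfolding psum_gaps by (rule order_trans[OF norm_sum]) (simp add: case_prod_unfold)

lemma psum_add: "psum P (\<lambda>x y. f x y + g x y) = psum P f + psum P g"
 by (simp add: psum_def Let_def sum.distrib)

lemma psum_diff:
 fixes f g :: "real => real => 'b::ab_group_add"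
 shows "psum P (\<lambda>x y. f x y - g x y) = psum P f - psum P g"
 by (simp add: psum_def Let_def sum_subtractf)

lemma psum_sum: "psum P (\<lambda>x y. \<Sum>i\<in>I. f i x y) = (\<Sum>i\<in>I. psum P (f i))"
 unfolding psum_def Let_def by (rule sum.swap)

lemma psum_mult:
 fixes c :: real
 shows "psum P (\<lambda>x y. c * f x y) = c * psum P f"
 by (simp add: psum_def Let_def sum_distrib_left)

lemma partition_gapsD:
 assumes "partition_of P a b" "(x, y) \<in> gaps P"
 shows "a <= x" "x < y" "y <= b" "x \<in> P" "y \<in> P"
 using assms by (auto simp: partition_of_def gaps_def)

lemma partition_split:
 assumes "partition_of P a b" "m \<in> P"
 shows "partition_of (P \<inter> {..m}) a m" "partition_of (P \<inter> {m..}) m b"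
 using assms by (auto simp: partition_of_def)

text \<open>The partition is cut at the gap (m, m') around the midpoint, so both remaining pieces
  have at most half the length. Two uses of the defect bound cost 2 C (w-u)^\<theta>, the pieces
  contribute 2 K ((w-u)/2)^\<theta> = K 2^(1-\<theta>) (w-u)^\<theta>, and the induction on the
  cardinality closes for the K with K 2^(1-\<theta>) + 2 C = K.\<close>

lemma sewing_bound:
 fixes \<Xi> :: "real => real => 'b::real_normed_vector"
 assumes C: "C >= 0" and th: "\<theta> > 1"
  and d: "!!u m w. a <= u ==> u <= m ==> m <= w ==> w <= b ==>
       norm (\<Xi> u w - \<Xi> u m - \<Xi> m w) <= C * (w - u) powr \<theta>"
  and P: "partition_of P u w" "a <= u" "w <= b"
 shows "norm (psum P \<Xi> - \<Xi> u w) <= 2 * C / (1 - 2 powr (1 - \<theta>)) * (w - u) powr \<theta>"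
 using P
proof (induction "card P" arbitrary: P u w rule: less_induct)
 case less
 let ?K = "2 * C / (1 - 2 powr (1 - \<theta>))"
 have q: "2 powr (1 - \<theta>) < 1" using th powr_less_mono[of "1 - \<theta>" 0 2] by simp
 have K: "?K >= 0" using C q by simp
 have KC: "?K * 2 powr (1 - \<theta>) + 2 * C = ?K"
 proof -
  have "2 * C / (1 - x) * x + 2 * C = 2 * C / (1 - x)" if "x < 1" for x :: real
   using that by (simp add: field_simps)
  then show ?thesis using q by blast
 qed
 have fin: "finite P" and uw: "u \<in> P" "w \<in> P" "P \<subseteq> {u..w}" using less.prems by (auto simp: partition_of_def)
 \<comment> \<open>With u = m = w the right side of the defect bound is 0 powr \<theta> = 0, which
   forces the germ to vanish on the diagonal.\<close>
 have diag: "\<Xi> x x = 0" if "a <= x" "x <= b" for x using d[of x x x] that by simp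
 show ?case
 proof (cases "u = w")
  case True
  then have "P = {u}" using uw by auto
  then show ?thesis using True diag less.prems by simp
 next
  case False
  then have lt: "u < w" using uw by force
  define c where "c = (u + w) / 2"
  have c: "u < c" "c < w" using lt by (auto simp: c_def)
  define m where "m = Max {x \<in> P. x <= c}"
  define m' where "m' = Min {x \<in> P. x > c}"
  have "{x \<in> P. x <= c} \<noteq> {}" "{x \<in> P. x > c} \<noteq> {}" using uw c by (blast intro: less_imp_le)+
  then have "m \<in> {x \<in> P. x <= c}" "m' \<in> {x \<in> P. x > c}" unfolding m_def m'_def
   using fin by (intro Max_in Min_in; simp)+
  then have m: "m \<in> P" "m <= c" and m': "m' \<in> P" "m' > c" by auto
  have mx: "x <= m" if "x \<in> P" "x <= c" for x using that fin unfolding m_def by auto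
  have mn: "m' <= x" if "x \<in> P" "x > c" for x using that fin unfolding m'_def by auto
  have mm: "m < m'" using m m' by simp
  have um: "u <= m" "m' <= w" using uw m m' by auto
  let ?P1 = "P \<inter> {..m}" let ?P2 = "P \<inter> {m'..}"
  have p1: "partition_of ?P1 u m" and p2: "partition_of ?P2 m' w"
   using partition_split[OF less.prems(1)] m m' by auto
  have "m' \<notin> ?P1" "m \<notin> ?P2" using mm by auto
  then have "?P1 \<subset> P" "?P2 \<subset> P" using m m' by blast+
  then have c1: "card ?P1 < card P" and c2: "card ?P2 < card P"
   by (auto intro!: psubset_card_mono[OF fin])
  have i1: "norm (psum ?P1 \<Xi> - \<Xi> u m) <= ?K * (m - u) powr \<theta>"
   by (rule less.hyps[OF c1 p1]) (use less.prems um mm in auto)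
  have i2: "norm (psum ?P2 \<Xi> - \<Xi> m' w) <= ?K * (w - m') powr \<theta>"
   by (rule less.hyps[OF c2 p2]) (use less.prems um mm in auto)
  have "psum P \<Xi> = psum ?P1 \<Xi> + psum (P \<inter> {m..}) \<Xi>" by (rule psum_split[OF fin m(1)])
  also have "psum (P \<inter> {m..}) \<Xi> = psum (P \<inter> {m..} \<inter> {..m'}) \<Xi> + psum (P \<inter> {m..} \<inter> {m'..}) \<Xi>"
   by (rule psum_split) (use fin m' mm in auto)
  also have "P \<inter> {m..} \<inter> {..m'} = {m, m'}"
  proof -
   have "x = m \<or> x = m'" if "x \<in> P" "m <= x" "x <= m'" for x
    using mx[of x] mn[of x] that by (cases "x <= c") auto
   then show ?thesis using m m' mm by auto
  qed
  also have "P \<inter> {m..} \<inter> {m'..} = ?P2" using mm by auto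
  finally have S: "psum P \<Xi> = psum ?P1 \<Xi> + \<Xi> m m' + psum ?P2 \<Xi>" by (simp add: psum_pair[OF mm])
  have d1: "norm (\<Xi> u w - \<Xi> u m - \<Xi> m w) <= C * (w - u) powr \<theta>"
   by (rule d) (use less.prems um mm in auto)
  have d2: "norm (\<Xi> m w - \<Xi> m m' - \<Xi> m' w) <= C * (w - u) powr \<theta>"
  proof (rule order_trans[OF d])
   show "C * (w - m) powr \<theta> <= C * (w - u) powr \<theta>"
    by (intro mult_left_mono powr_mono2) (use um mm C th in auto)
  qed (use less.prems um mm in auto)
  have "psum P \<Xi> - \<Xi> u w = (psum ?P1 \<Xi> - \<Xi> u m) + (psum ?P2 \<Xi> - \<Xi> m' w)
    - (\<Xi> u w - \<Xi> u m - \<Xi> m w) - (\<Xi> m w - \<Xi> m m' - \<Xi> m' w)" unfolding S by simp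
  then have "norm (psum P \<Xi> - \<Xi> u w) <= norm (psum ?P1 \<Xi> - \<Xi> u m) + norm (psum ?P2 \<Xi> - \<Xi> m' w)
    + norm (\<Xi> u w - \<Xi> u m - \<Xi> m w) + norm (\<Xi> m w - \<Xi> m m' - \<Xi> m' w)"
   by (smt (verit) norm_triangle_ineq norm_triangle_ineq4)
  also have "... <= ?K * (m - u) powr \<theta> + ?K * (w - m') powr \<theta> + 2 * C * (w - u) powr \<theta>"
   using i1 i2 d1 d2 by simp
  also have "... <= ?K * ((w - u) / 2) powr \<theta> + ?K * ((w - u) / 2) powr \<theta> + 2 * C * (w - u) powr \<theta>"
   by (intro add_mono mult_left_mono powr_mono2 order_refl K)
    (use um m m' mm th in \<open>auto simp: c_def field_simps\<close>)
  also have "... = (?K * 2 powr (1 - \<theta>) + 2 * C) * (w - u) powr \<theta>"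
   using lt by (simp add: powr_divide powr_diff field_simps)
  finally show ?thesis unfolding KC .
 qed
qed

text \<open>The germ of increments has no defect, so the sewing bound holds with C = 0; any exponent
  above 1 would serve in place of 2.\<close>

lemma psum_additive:
 fixes f :: "real => 'b::real_normed_vector"
 assumes "partition_of P u w"
 shows "psum P (\<lambda>x y. f y - f x) = f w - f u"
 using sewing_bound[of 0 2 u w "\<lambda>x y. f y - f x" P u w] assms by auto

lemma psum_powr_le:
 assumes P: "partition_of P u w" "mesh P < \<delta>" and "\<delta> > 0" "\<theta> > 1"
 shows "psum P (\<lambda>x y. (y - x) powr \<theta>) <= \<delta> powr (\<theta> - 1) * (w - u)"
proof -
 have fin: "finite P" using P by (auto simp: partition_of_def)
 have "psum P (\<lambda>x y. (y - x) powr \<theta>) <= psum P (\<lambda>x y. \<delta> powr (\<theta> - 1) * (y - x))"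
 proof (rule psum_mono[OF fin])
  fix x y assume g: "(x, y) \<in> gaps P"
  then have "x < y" "y - x < \<delta>" using P mesh_less_iff[OF fin \<open>\<delta> > 0\<close>] by (auto simp: gaps_def)
  then have "(y - x) powr \<theta> = (y - x) powr (\<theta> - 1) * (y - x)" by (simp add: powr_diff)
  also have "... <= \<delta> powr (\<theta> - 1) * (y - x)"
   by (intro mult_right_mono powr_mono2) (use \<open>x < y\<close> \<open>y - x < \<delta>\<close> assms in auto)
  finally show "(y - x) powr \<theta> <= \<delta> powr (\<theta> - 1) * (y - x)" .
 qed
 also have "... = \<delta> powr (\<theta> - 1) * (w - u)"
  using psum_additive[OF P(1), of "\<lambda>x. x"] by (simp add: psum_mult)
 finally show ?thesis .
qed

lemma psum_powr_small:
 assumes "\<theta> > 1" "\<epsilon> > 0"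
 obtains \<delta> where "\<delta> > 0" "!!P. partition_of P u w ==> mesh P < \<delta> ==> K * psum P (\<lambda>x y. (y - x) powr \<theta>) < \<epsilon>"
proof -
 \<comment> \<open>The summands 1 keep the denominator positive when K or w - u vanishes, and give
   the strict inequality at the end.\<close>
 define c where "c = \<epsilon> / ((\<bar>K\<bar> + 1) * (\<bar>w - u\<bar> + 1))"
 have c: "c > 0" using assms by (simp add: c_def)
 define \<delta> where "\<delta> = c powr (1 / (\<theta> - 1))"
 have d: "\<delta> > 0" "\<delta> powr (\<theta> - 1) = c" using c assms by (auto simp: \<delta>_def powr_powr)
 show thesis
 proof (rule that[OF d(1)])
  fix P assume P: "partition_of P u w" "mesh P < \<delta>"
  have nn: "psum P (\<lambda>x y. (y - x) powr \<theta>) >= 0"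
   using P by (auto simp: psum_gaps partition_of_def intro!: sum_nonneg)
  have "K * psum P (\<lambda>x y. (y - x) powr \<theta>) <= \<bar>K\<bar> * psum P (\<lambda>x y. (y - x) powr \<theta>)"
   using nn by (intro mult_right_mono) auto
  also have "... <= \<bar>K\<bar> * (c * \<bar>w - u\<bar>)"
   using psum_powr_le[OF P d(1) assms(1)] c unfolding d(2)
   by (intro mult_left_mono) (auto intro: order_trans[OF _ mult_left_mono])
  also have "... < c * ((\<bar>K\<bar> + 1) * (\<bar>w - u\<bar> + 1))"
   using c by (simp add: field_simps add_pos_nonneg)
  also have "... = \<epsilon>" by (simp add: c_def)
  finally show "K * psum P (\<lambda>x y. (y - x) powr \<theta>) < \<epsilon>" .
 qed
qed

text \<open>The errors add up to at most K times the sum of (y-x)^\<theta>, which vanishes with the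
  mesh as \<theta> > 1. Applied to the zero germ, together with \<open>mesh_lim_unique\<close>, it
  yields constancy of paths whose increments have order above 1.\<close>

lemma mesh_lim_of_germ:
 fixes I :: "real => 'b::real_normed_vector"
 assumes th: "\<theta> > 1"
  and I: "!!x y. u <= x ==> x <= y ==> y <= w ==> norm (I y - I x - \<Xi> x y) <= K * (y - x) powr \<theta>"
 shows "mesh_lim u w \<Xi> (I w - I u)"
 unfolding mesh_lim_def
proof (intro allI impI)
 fix \<epsilon> :: real assume "\<epsilon> > 0"
 then obtain \<delta> where d: "\<delta> > 0"
  "!!P. partition_of P u w ==> mesh P < \<delta> ==> K * psum P (\<lambda>x y. (y - x) powr \<theta>) < \<epsilon>"
  using psum_powr_small[OF th] by blast
 show "\<exists>\<delta>>0. \<forall>P. partition_of P u w \<and> mesh P < \<delta> --> norm (psum P \<Xi> - (I w - I u)) < \<epsilon>"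
 proof (intro exI conjI allI impI)
  fix P assume P: "partition_of P u w \<and> mesh P < \<delta>"
  then have fin: "finite P" by (auto simp: partition_of_def)
  have "norm (psum P \<Xi> - (I w - I u)) = norm (psum P (\<lambda>x y. \<Xi> x y - (I y - I x)))"
   using psum_additive[of P u w I] P by (simp add: psum_diff)
  also have "... <= psum P (\<lambda>x y. norm (\<Xi> x y - (I y - I x)))" by (rule norm_psum[OF fin])
  also have "... <= psum P (\<lambda>x y. K * (y - x) powr \<theta>)"
  proof (rule psum_mono[OF fin])
   fix x y assume "(x, y) \<in> gaps P"
   then show "norm (\<Xi> x y - (I y - I x)) <= K * (y - x) powr \<theta>"
    using partition_gapsD[of P u w x y] P I[of x y] by (simp add: norm_minus_commute)
  qed
  also have "... < \<epsilon>" using d(2) P by (simp add: psum_mult)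
  finally show "norm (psum P \<Xi> - (I w - I u)) < \<epsilon>" .
 qed (use d in auto)
qed

lemma psum_refine:
 assumes "partition_of P u w" "partition_of Q u w" "P \<subseteq> Q"
 shows "psum Q f = psum P (\<lambda>x y. psum (Q \<inter> {x..y}) f)"
 using assms
proof (induction "card P" arbitrary: P Q u w rule: less_induct)
 case less
 have fin: "finite P" "finite Q" and uw: "u \<in> P" "w \<in> P" "P \<subseteq> {u..w}" "Q \<subseteq> {u..w}"
  using less.prems by (auto simp: partition_of_def)
 show ?case
 proof (cases "\<exists>m\<in>P. u < m \<and> m < w")
  case False
  then have P: "P = {u, w}" using uw by force
  show ?thesis
  proof (cases "u = w")
   case True
   then have "Q = {u}" using uw less.prems P by auto
   then show ?thesis using P True by simp
  next
   case False
   then have "u < w" using uw by force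
   moreover have "Q \<inter> {u..w} = Q" using uw by auto
   ultimately show ?thesis by (simp add: P psum_pair)
  qed
 next
  case True
  then obtain m where m: "m \<in> P" "u < m" "m < w" by auto
  have "w \<notin> P \<inter> {..m}" "u \<notin> P \<inter> {m..}" using m by auto
  then have "P \<inter> {..m} \<subset> P" "P \<inter> {m..} \<subset> P" using uw by blast+
  then have c1: "card (P \<inter> {..m}) < card P" and c2: "card (P \<inter> {m..}) < card P"
   by (auto intro!: psubset_card_mono[OF fin(1)])
  have mQ: "m \<in> Q" using m less.prems by auto
  have "psum Q f = psum (Q \<inter> {..m}) f + psum (Q \<inter> {m..}) f" by (rule psum_split[OF fin(2) mQ])
  also have "psum (Q \<inter> {..m}) f = psum (P \<inter> {..m}) (\<lambda>x y. psum (Q \<inter> {..m} \<inter> {x..y}) f)"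
   by (rule less.hyps[OF c1, of u m]) (use less.prems partition_split m mQ in auto)
  also have "... = psum (P \<inter> {..m}) (\<lambda>x y. psum (Q \<inter> {x..y}) f)"
  proof (rule psum_cong)
   fix x y assume "(x, y) \<in> gaps (P \<inter> {..m})"
   then have "Q \<inter> {..m} \<inter> {x..y} = Q \<inter> {x..y}" by (auto simp: gaps_def)
   then show "psum (Q \<inter> {..m} \<inter> {x..y}) f = psum (Q \<inter> {x..y}) f" by simp
  qed (use fin in auto)
  also have "psum (Q \<inter> {m..}) f = psum (P \<inter> {m..}) (\<lambda>x y. psum (Q \<inter> {m..} \<inter> {x..y}) f)"
   by (rule less.hyps[OF c2, of m w]) (use less.prems partition_split m mQ in auto)
  also have "... = psum (P \<inter> {m..}) (\<lambda>x y. psum (Q \<inter> {x..y}) f)"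
  proof (rule psum_cong)
   fix x y assume "(x, y) \<in> gaps (P \<inter> {m..})"
   then have "Q \<inter> {m..} \<inter> {x..y} = Q \<inter> {x..y}" by (auto simp: gaps_def)
   then show "psum (Q \<inter> {m..} \<inter> {x..y}) f = psum (Q \<inter> {x..y}) f" by simp
  qed (use fin in auto)
  finally show ?thesis using psum_split[OF fin(1) m(1)] by metis
 qed
qed

text \<open>Arbitrarily fine partitions are what keeps \<open>mesh_lim\<close> from holding
  vacuously; uniqueness and additivity of limits rest on them.\<close>

lemma partition_exists:
 assumes "u <= w" "\<delta> > 0"
 obtains P where "partition_of P u w" "mesh P < \<delta>"
proof -
 obtain n :: nat where n: "(w - u) / \<delta> < real n" using reals_Archimedean2 by blast
 have n0: "n > 0" using n assms by (cases n) (auto simp: field_simps)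
 let ?h = "(w - u) / real n"
 have h: "?h < \<delta>" using n n0 assms by (simp add: field_simps)
 define P where "P = (\<lambda>i. u + ?h * real i) ` {0..n}"
 have "w = u + ?h * real n" using n0 by simp
 then have wP: "w \<in> P" unfolding P_def by (metis atLeastAtMost_iff imageI le0 order_refl)
 have uP: "u \<in> P" unfolding P_def by (rule image_eqI[of _ _ 0]) auto
 have sub: "P \<subseteq> {u..w}"
 proof
  fix x assume "x \<in> P"
  then obtain i where i: "i <= n" "x = u + ?h * real i" by (auto simp: P_def)
  have "?h * real i <= ?h * real n" using i assms by (intro mult_left_mono) auto
  then show "x \<in> {u..w}" using i n0 assms by auto
 qed
 have P: "partition_of P u w" using wP uP sub by (simp add: partition_of_def P_def)
 have "y - x < \<delta>" if g: "(x, y) \<in> gaps P" for x y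
 proof (rule ccontr)
  assume "\<not> y - x < \<delta>"
  then have yx: "x + ?h < y" using h by simp
  obtain i where i: "i <= n" "x = u + ?h * real i" using g by (auto simp: P_def gaps_def)
  have "i \<noteq> n" using g i n0 sub by (auto simp: gaps_def)
  then have "Suc i <= n" using i by simp
  then have "u + ?h * real (Suc i) \<in> P" unfolding P_def by (intro image_eqI[of _ _ "Suc i"]) auto
  moreover have xh: "u + ?h * real (Suc i) = x + ?h" unfolding i(2) of_nat_Suc by (simp only: distrib_left mult_1_right add_ac)
  ultimately have "x + ?h \<in> P" by metis
  moreover have "x \<in> {u..w}" "y \<in> {u..w}" "x < y" using g sub by (auto simp: gaps_def)
  then have "w > u" by simp
  then have "?h > 0" using n0 by simp
  ultimately have "x + ?h \<in> P \<inter> {x<..<y}" using yx by simp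
  moreover have "P \<inter> {x<..<y} = {}" using g by (auto simp: gaps_def)
  ultimately show False by blast
 qed
 then have "mesh P < \<delta>" using mesh_less_iff[of P \<delta>] P assms by (auto simp: partition_of_def)
 with P show thesis by (rule that)
qed

lemma mesh_lim_unique:
 assumes "mesh_lim u w \<Xi> L" "mesh_lim u w \<Xi> L'" "u <= w"
 shows "L = L'"
proof (rule ccontr)
 assume "L \<noteq> L'"
 then have e: "norm (L - L') / 2 > 0" by simp
 obtain d where "d > 0"
  "!!P. partition_of P u w ==> mesh P < d ==> norm (psum P \<Xi> - L) < norm (L - L') / 2"
  using assms(1) e unfolding mesh_lim_def by meson
 moreover obtain d' where "d' > 0"
  "!!P. partition_of P u w ==> mesh P < d' ==> norm (psum P \<Xi> - L') < norm (L - L') / 2"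
  using assms(2) e unfolding mesh_lim_def by meson
 ultimately have d: "d > 0" "d' > 0"
  "!!P. partition_of P u w ==> mesh P < d ==> norm (psum P \<Xi> - L) < norm (L - L') / 2"
  "!!P. partition_of P u w ==> mesh P < d' ==> norm (psum P \<Xi> - L') < norm (L - L') / 2"
  by auto
 obtain P where P: "partition_of P u w" "mesh P < min d d'"
  using partition_exists[of u w "min d d'"] assms d by auto
 have "norm (psum P \<Xi> - L) < norm (L - L') / 2" "norm (psum P \<Xi> - L') < norm (L - L') / 2"
  using d P by auto
 then show False using norm_triangle_ineq4[of "psum P \<Xi> - L'" "psum P \<Xi> - L"] by simp
qed

lemma partition_union:
 assumes "partition_of P u m" "partition_of Q m w"
 shows "partition_of (P \<union> Q) u w" "(P \<union> Q) \<inter> {..m} = P" "(P \<union> Q) \<inter> {m..} = Q"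
 using assms by (force simp: partition_of_def)+

lemma mesh_union:
 assumes "partition_of P u m" "partition_of Q m w" "mesh P < \<delta>" "mesh Q < \<delta>" "\<delta> > 0"
 shows "mesh (P \<union> Q) < \<delta>"
proof -
 have "gaps (P \<union> Q) = gaps P \<union> gaps Q"
  using gaps_split(1)[of m "P \<union> Q"] partition_union[OF assms(1,2)] assms by (auto simp: partition_of_def)
 then show ?thesis using assms mesh_less_iff[of _ \<delta>] by (auto simp: partition_of_def)
qed

lemma psum_union:
 assumes "partition_of P u m" "partition_of Q m w"
 shows "psum (P \<union> Q) f = psum P f + psum Q f"
 using psum_split[of "P \<union> Q" m f] partition_union[OF assms] assms by (auto simp: partition_of_def)

lemma mesh_lim_concat:
 assumes 1: "mesh_lim u m \<Xi> L1" and 2: "mesh_lim m w \<Xi> L2" and 3: "mesh_lim u w \<Xi> L"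
  and o: "u <= m" "m <= w"
 shows "L = L1 + L2"
proof (rule ccontr)
 assume "L \<noteq> L1 + L2"
 then have e: "norm (L - (L1 + L2)) / 3 > 0" (is "?e > 0") by simp
 obtain d1 where d1: "d1 > 0" "!!P. partition_of P u m ==> mesh P < d1 ==> norm (psum P \<Xi> - L1) < ?e"
  using 1 e unfolding mesh_lim_def by meson
 obtain d2 where d2: "d2 > 0" "!!P. partition_of P m w ==> mesh P < d2 ==> norm (psum P \<Xi> - L2) < ?e"
  using 2 e unfolding mesh_lim_def by meson
 obtain d3 where d3: "d3 > 0" "!!P. partition_of P u w ==> mesh P < d3 ==> norm (psum P \<Xi> - L) < ?e"
  using 3 e unfolding mesh_lim_def by meson
 define d where "d = min d1 (min d2 d3)"
 have d: "d > 0" using d1 d2 d3 by (simp add: d_def)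
 obtain P where P: "partition_of P u m" "mesh P < d" using partition_exists[OF o(1) d] .
 obtain Q where Q: "partition_of Q m w" "mesh Q < d" using partition_exists[OF o(2) d] .
 have "norm (psum P \<Xi> - L1) < ?e" "norm (psum Q \<Xi> - L2) < ?e" "norm (psum P \<Xi> + psum Q \<Xi> - L) < ?e"
  using d1(2)[OF P(1)] d2(2)[OF Q(1)] d3(2)[OF partition_union(1)[OF P(1) Q(1)]]
   mesh_union[OF P(1) Q(1) P(2) Q(2) d] P Q psum_union[OF P(1) Q(1), of \<Xi>] by (auto simp: d_def)
 moreover have eq: "L - (L1 + L2) = (psum P \<Xi> - L1) + (psum Q \<Xi> - L2) - (psum P \<Xi> + psum Q \<Xi> - L)" by simp
 have "norm (L - (L1 + L2)) <= norm (psum P \<Xi> - L1) + norm (psum Q \<Xi> - L2) + norm (psum P \<Xi> + psum Q \<Xi> - L)"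
  unfolding eq using norm_triangle_ineq[of "psum P \<Xi> - L1" "psum Q \<Xi> - L2"]
   norm_triangle_ineq4[of "(psum P \<Xi> - L1) + (psum Q \<Xi> - L2)" "psum P \<Xi> + psum Q \<Xi> - L"] by linarith
 ultimately show False by simp
qed

text \<open>Two fine partitions are compared through their union: refining P changes the sum by at
  most K times the sum of (y-x)^\<theta> over P, by \<open>sewing_bound\<close> on each gap. The
  Cauchy property gives a limit on every subinterval, and concatenation makes these limits additive,
  so they are the increments of one path.\<close>

theorem sewing:
 fixes \<Xi> :: "real => real => 'b::banach"
 assumes C: "C >= 0" and th: "\<theta> > 1"
  and d: "!!u m w. a <= u ==> u <= m ==> m <= w ==> w <= b ==>
       norm (\<Xi> u w - \<Xi> u m - \<Xi> m w) <= C * (w - u) powr \<theta>"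
 obtains I K where "!!u w. a <= u ==> u <= w ==> w <= b ==> norm (I w - I u - \<Xi> u w) <= K * (w - u) powr \<theta>"
proof -
 let ?K = "2 * C / (1 - 2 powr (1 - \<theta>))"
 have bd: "norm (psum P \<Xi> - \<Xi> u w) <= ?K * (w - u) powr \<theta>"
  if "partition_of P u w" "a <= u" "w <= b" for P u w
  using sewing_bound[of C \<theta> a b \<Xi> P u w] C th d that by blast
 have ref: "norm (psum Q \<Xi> - psum P \<Xi>) <= ?K * psum P (\<lambda>x y. (y - x) powr \<theta>)"
  if PQ: "partition_of P u w" "partition_of Q u w" "P \<subseteq> Q" and uw: "a <= u" "w <= b" for P Q u w
 proof -
  have fin: "finite P" using PQ by (auto simp: partition_of_def)
  have "norm (psum Q \<Xi> - psum P \<Xi>) = norm (psum P (\<lambda>x y. psum (Q \<inter> {x..y}) \<Xi> - \<Xi> x y))"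
   by (simp add: psum_diff psum_refine[OF PQ, symmetric])
  also have "... <= psum P (\<lambda>x y. norm (psum (Q \<inter> {x..y}) \<Xi> - \<Xi> x y))" by (rule norm_psum[OF fin])
  also have "... <= psum P (\<lambda>x y. ?K * (y - x) powr \<theta>)"
  proof (rule psum_mono[OF fin])
   fix x y assume "(x, y) \<in> gaps P"
   note g = partition_gapsD[OF PQ(1) this]
   have "partition_of (Q \<inter> {x..y}) x y" using g PQ by (auto simp: partition_of_def)
   then show "norm (psum (Q \<inter> {x..y}) \<Xi> - \<Xi> x y) <= ?K * (y - x) powr \<theta>"
    by (rule bd) (use g uw in auto)
  qed
  finally show ?thesis unfolding psum_mult .
 qed
 have ex: "\<exists>L. mesh_lim u w \<Xi> L" if uw: "a <= u" "u <= w" "w <= b" for u w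
 proof -
  have cau: "\<exists>\<delta>>0. \<forall>P Q. partition_of P u w \<and> mesh P < \<delta> \<and> partition_of Q u w \<and> mesh Q < \<delta> -->
    norm (psum P \<Xi> - psum Q \<Xi>) < \<epsilon>" if "\<epsilon> > 0" for \<epsilon>
  proof -
   have "\<epsilon> / 2 > 0" using that by simp
   then obtain \<delta> where dl: "\<delta> > 0"
    "!!P. partition_of P u w ==> mesh P < \<delta> ==> ?K * psum P (\<lambda>x y. (y - x) powr \<theta>) < \<epsilon> / 2"
    using psum_powr_small[OF th] by blast
   show ?thesis
   proof (intro exI conjI allI impI)
    fix P Q assume PQ: "partition_of P u w \<and> mesh P < \<delta> \<and> partition_of Q u w \<and> mesh Q < \<delta>"
    then have R: "partition_of (P \<union> Q) u w" by (auto simp: partition_of_def)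
    have "norm (psum (P \<union> Q) \<Xi> - psum P \<Xi>) < \<epsilon> / 2" "norm (psum (P \<union> Q) \<Xi> - psum Q \<Xi>) < \<epsilon> / 2"
     using ref[OF _ R] PQ uw dl(2) by (meson Un_upper1 Un_upper2 order_le_less_trans)+
    then show "norm (psum P \<Xi> - psum Q \<Xi>) < \<epsilon>"
     using norm_triangle_ineq4[of "psum (P \<union> Q) \<Xi> - psum Q \<Xi>" "psum (P \<union> Q) \<Xi> - psum P \<Xi>"] by simp
   qed (use dl in auto)
  qed
  define Pn where "Pn n = (SOME P. partition_of P u w \<and> mesh P < 1 / real (Suc n))" for n
  have Pn: "partition_of (Pn n) u w" "mesh (Pn n) < 1 / real (Suc n)" for n
  proof -
   have "\<exists>P. partition_of P u w \<and> mesh P < 1 / real (Suc n)"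
    using partition_exists[OF uw(2), of "1 / real (Suc n)"] by (metis of_nat_0_less_iff zero_less_Suc zero_less_divide_1_iff)
   from someI_ex[OF this] show "partition_of (Pn n) u w" "mesh (Pn n) < 1 / real (Suc n)"
    unfolding Pn_def by auto
  qed
  have ev: "\<exists>n0. \<forall>n\<ge>n0. mesh (Pn n) < \<delta>" if dp: "\<delta> > 0" for \<delta>
  proof -
   obtain n0 where n0: "1 / real (Suc n0) < \<delta>" using nat_approx_posE[OF dp] by blast
   have "mesh (Pn n) < \<delta>" if "n >= n0" for n
    using Pn(2)[of n] n0 that by (smt (verit) frac_le of_nat_0_less_iff of_nat_mono Suc_le_mono zero_less_Suc)
   then show ?thesis by blast
  qed
  have "Cauchy (\<lambda>n. psum (Pn n) \<Xi>)"
   unfolding Cauchy_iff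
  proof (intro allI impI)
   fix e :: real assume "e > 0"
   from cau[OF this] obtain \<delta> where dl: "\<delta> > 0" "\<forall>P Q. partition_of P u w \<and> mesh P < \<delta> \<and> partition_of Q u w \<and> mesh Q < \<delta> -->
    norm (psum P \<Xi> - psum Q \<Xi>) < e" by blast
   then show "\<exists>M. \<forall>m\<ge>M. \<forall>n\<ge>M. norm (psum (Pn m) \<Xi> - psum (Pn n) \<Xi>) < e"
    using ev[OF dl(1)] Pn by meson
  qed
  then obtain L where L: "(\<lambda>n. psum (Pn n) \<Xi>) \<longlonglongrightarrow> L" using Cauchy_convergent convergent_def by blast
  have "mesh_lim u w \<Xi> L" unfolding mesh_lim_def
  proof (intro allI impI)
   fix e :: real assume e: "e > 0"
   then have "e / 2 > 0" by simp
   from cau[OF this] obtain \<delta> where dl: "\<delta> > 0" "\<forall>P Q. partition_of P u w \<and> mesh P < \<delta> \<and> partition_of Q u w \<and> mesh Q < \<delta> -->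
    norm (psum P \<Xi> - psum Q \<Xi>) < e / 2" by blast
   have "norm (psum P \<Xi> - L) < e" if P: "partition_of P u w" "mesh P < \<delta>" for P
   proof -
    obtain n0 where n0: "\<forall>n\<ge>n0. mesh (Pn n) < \<delta>" using ev[OF dl(1)] by blast
    have "norm (psum P \<Xi> - L) <= e / 2"
    proof (rule Lim_bounded[of "\<lambda>n. norm (psum P \<Xi> - psum (Pn n) \<Xi>)" _ n0])
     show "(\<lambda>n. norm (psum P \<Xi> - psum (Pn n) \<Xi>)) \<longlonglongrightarrow> norm (psum P \<Xi> - L)"
      by (intro tendsto_intros L)
     show "\<forall>n\<ge>n0. norm (psum P \<Xi> - psum (Pn n) \<Xi>) <= e / 2"
      using dl(2) P n0 Pn by (meson less_imp_le)
    qed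
    then show ?thesis using e by simp
   qed
   then show "\<exists>\<delta>>0. \<forall>P. partition_of P u w \<and> mesh P < \<delta> --> norm (psum P \<Xi> - L) < e"
    using dl(1) by blast
  qed
  then show ?thesis by blast
 qed
 define I where "I t = (SOME L. mesh_lim a t \<Xi> L)" for t
 have I: "mesh_lim a t \<Xi> (I t)" if "a <= t" "t <= b" for t
  unfolding I_def by (rule someI_ex[OF ex]) (use that in auto)
 have "norm (I w - I u - \<Xi> u w) <= ?K * (w - u) powr \<theta>" if uw: "a <= u" "u <= w" "w <= b" for u w
 proof -
  obtain L where L: "mesh_lim u w \<Xi> L" using ex uw by blast
  have Lw: "I w = I u + L" by (rule mesh_lim_concat[OF I L I]) (use uw in auto)
  have "norm (L - \<Xi> u w) <= ?K * (w - u) powr \<theta> + e" if ep: "e > 0" for e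
  proof -
   obtain \<delta> where dl: "\<delta> > 0" "!!P. partition_of P u w ==> mesh P < \<delta> ==> norm (psum P \<Xi> - L) < e"
    using L ep unfolding mesh_lim_def by meson
   obtain P where P: "partition_of P u w" "mesh P < \<delta>" using partition_exists[OF uw(2) dl(1)] .
   have "norm (L - \<Xi> u w) <= norm (psum P \<Xi> - \<Xi> u w) + norm (psum P \<Xi> - L)"
    using norm_triangle_ineq4[of "psum P \<Xi> - \<Xi> u w" "psum P \<Xi> - L"] by simp
   then show ?thesis using bd[OF P(1) uw(1,3)] dl(2)[OF P] by linarith
  qed
  then have "norm (L - \<Xi> u w) <= ?K * (w - u) powr \<theta>" by (rule field_le_epsilon)
  then show ?thesis using Lw by simp
 qed
 then show thesis by (rule that)
qed

section \<open>A local bound for weakly differentiable functions\<close>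

text \<open>Young's inequality optimised over its weight. The shift by e > 0 keeps the optimal c =
  sqrt(b+e)/sqrt(a+e) meaningful when a or b is 0; then e tends to 0.\<close>

lemma le_sqrt_mult:
 fixes x a b :: real
 assumes "0 <= a" "0 <= b" "!!c. c > 0 ==> x <= (c * a + b / c) / 2"
 shows "x <= sqrt a * sqrt b"
proof -
 have "x <= sqrt (a + e) * sqrt (b + e)" if e: "e > 0" for e
 proof -
  define c where "c = sqrt (b + e) / sqrt (a + e)"
  have c: "c > 0" using assms e by (simp add: c_def)
  have "c * a <= c * (a + e)" "b / c <= (b + e) / c" using c e by (auto simp: divide_right_mono)
  moreover have "c * (a + e) = sqrt (a + e) * sqrt (b + e)" "(b + e) / c = sqrt (a + e) * sqrt (b + e)"
  proof -
   have "B / A * (A * A) = A * B" "B * B / (B / A) = A * B" if "A > 0" "B > 0" for A B :: real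
    using that by simp_all
   from this[of "sqrt (a + e)" "sqrt (b + e)"]
   show "c * (a + e) = sqrt (a + e) * sqrt (b + e)" "(b + e) / c = sqrt (a + e) * sqrt (b + e)"
    using assms e by (simp_all add: c_def)
  qed
  ultimately have "c * a <= sqrt (a + e) * sqrt (b + e)" "b / c <= sqrt (a + e) * sqrt (b + e)" by metis+
  then have "(c * a + b / c) / 2 <= (sqrt (a + e) * sqrt (b + e) + sqrt (a + e) * sqrt (b + e)) / 2" by (intro divide_right_mono add_mono) auto
  then show ?thesis using assms(3)[OF c] by simp
 qed
 then have ev: "eventually (\<lambda>e. x <= sqrt (a + e) * sqrt (b + e)) (at_right 0)"
  by (auto simp: eventually_at_filter)
 have "((\<lambda>e. sqrt (a + e) * sqrt (b + e)) \<longlongrightarrow> sqrt (a + 0) * sqrt (b + 0)) (at_right 0)"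
  by (intro tendsto_intros)
 from tendsto_lowerbound[OF this ev] show ?thesis by simp
qed

lemma sq_int_meas [measurable_dest]: "sq_int f ==> f \<in> borel_measurable borel"
 by (simp add: sq_int_def)

lemma sq_int_mult:
 assumes "sq_int f" "sq_int g"
 shows "integrable lborel (\<lambda>x. f x * g x)"
proof (rule Bochner_Integration.integrable_bound)
 show "integrable lborel (\<lambda>x. ((cmod (f x))\<^sup>2 + (cmod (g x))\<^sup>2))"
  using assms by (auto simp: sq_int_def)
 have "cmod (f x) * cmod (g x) <= (cmod (f x))\<^sup>2 + (cmod (g x))\<^sup>2" for x
  using sum_squares_bound[of "cmod (f x)" "cmod (g x)"]
   mult_nonneg_nonneg[OF norm_ge_zero[of "f x"] norm_ge_zero[of "g x"]] by linarith
 then show "AE x in lborel. norm (f x * g x) <= norm ((cmod (f x))\<^sup>2 + (cmod (g x))\<^sup>2)"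
  by (simp add: norm_mult)
qed (use assms in \<open>auto simp: sq_int_def\<close>)

definition l2n :: "('a::euclidean_space => complex) => real" where
 "l2n f = sqrt (LBINT x. (cmod (f x))\<^sup>2)"

lemma l2n_nonneg [simp]: "0 <= l2n f" by (simp add: l2n_def)

lemma abs_integral_mult_le:
 assumes "sq_int f" "sq_int g"
 shows "(LBINT x. cmod (f x) * cmod (g x)) <= l2n f * l2n g"
 unfolding l2n_def
proof (rule le_sqrt_mult)
 fix c :: real assume c: "c > 0"
 have i: "integrable lborel (\<lambda>x. cmod (f x) * cmod (g x))"
  using integrable_norm[OF sq_int_mult[OF assms]] by (simp add: norm_mult)
 have "(LBINT x. cmod (f x) * cmod (g x)) \<le>
   (LBINT x. (c * (cmod (f x))\<^sup>2 + (cmod (g x))\<^sup>2 / c) / 2)"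
 proof (rule integral_mono[OF i])
  show "integrable lborel (\<lambda>x. (c * (cmod (f x))\<^sup>2 + (cmod (g x))\<^sup>2 / c) / 2)"
   using assms by (auto simp: sq_int_def)
  fix x
  have "0 <= (c * cmod (f x) - cmod (g x))\<^sup>2 / c" using c by simp
  also have "... = c * (cmod (f x))\<^sup>2 + (cmod (g x))\<^sup>2 / c - 2 * (cmod (f x) * cmod (g x))"
   using c by (simp add: power2_eq_square field_simps)
  finally show "cmod (f x) * cmod (g x) <= (c * (cmod (f x))\<^sup>2 + (cmod (g x))\<^sup>2 / c) / 2" by simp
 qed
 also have "... = (c * (LBINT x. (cmod (f x))\<^sup>2) + (LBINT x. (cmod (g x))\<^sup>2) / c) / 2"
  using assms by (subst integral_divide_zero, subst Bochner_Integration.integral_add) (auto simp: sq_int_def)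
 finally show "(LBINT x. cmod (f x) * cmod (g x)) <= ..." .
qed auto

lemma norm_integral_mult_le:
 assumes "sq_int f" "sq_int g"
 shows "cmod (LBINT x. f x * g x) <= l2n f * l2n g"
proof -
 have "cmod (LBINT x. f x * g x) <= (LBINT x. cmod (f x) * cmod (g x))"
  using integral_norm_bound[of lborel "\<lambda>x. f x * g x"] by (simp add: norm_mult)
 then show ?thesis using abs_integral_mult_le[OF assms] by linarith
qed

lemma bounded_supp_integrable:
 fixes f :: "'a::euclidean_space => 'b::{banach, second_countable_topology}"
 assumes "f \<in> borel_measurable borel" "bounded S" "!!x. x \<notin> S ==> f x = 0" "!!x. norm (f x) <= C"
 shows "integrable lborel f"
proof -
 obtain R where R: "S \<subseteq> ball 0 R" using assms(2) bounded_subset_ballD by blast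
 have "emeasure lborel (ball (0::'a) R) < \<infinity>" by (rule emeasure_bounded_finite) simp
 then have "integrable lborel (\<lambda>x. \<bar>C\<bar> * indicator (ball (0::'a) R) x :: real)"
  by (intro integrable_mult_right integrable_real_indicator) auto
 then show ?thesis
 proof (rule Bochner_Integration.integrable_bound)
  have "norm (f x) <= \<bar>C\<bar> * indicator (ball 0 R) x" for x
   using assms(3)[of x] assms(4)[of x] R by (cases "x \<in> S") (auto simp: indicator_def)
  then show "AE x in lborel. norm (f x) <= norm (\<bar>C\<bar> * indicator (ball 0 R) x :: real)" by auto
 qed (use assms in auto)
qed

lemma bounded_supp_sq_int:
 assumes "f \<in> borel_measurable borel" "bounded S" "!!x. x \<notin> S ==> f x = 0" "!!x. cmod (f x) <= C"
 shows "sq_int f"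
proof -
 have "integrable lborel (\<lambda>x. (cmod (f x))\<^sup>2)"
  by (rule bounded_supp_integrable[of _ S "C\<^sup>2"]) (use assms in \<open>auto intro: power_mono\<close>)
 then show ?thesis using assms by (simp add: sq_int_def)
qed

lemma test_fn_sq_int: "test_fn f ==> sq_int f"
proof -
 assume f: "test_fn f"
 obtain C where "!!x. cmod (f x) <= C" using test_fn_bounded[OF f] by blast
 then show ?thesis
  by (intro bounded_supp_sq_int[OF test_fn_borel[OF f] test_fn_bounded_support[OF f]]) auto
qed

lemma integral_shift:
 fixes f :: "'a::euclidean_space => 'b::{banach, second_countable_topology}"
 assumes "f \<in> borel_measurable borel"
 shows "(LBINT x. f (x + y)) = integral\<^sup>L lborel f"
proof -
 have "integral\<^sup>L lborel f = integral\<^sup>L (distr lborel borel ((+) y)) f" by (simp add: lborel_distr_plus)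
 also have "... = (LBINT x. f (y + x))" using assms by (intro integral_distr) auto
 finally show ?thesis by (simp add: add.commute)
qed

lemma nn_integral_shift:
 fixes f :: "'a::euclidean_space => ennreal"
 assumes "f \<in> borel_measurable borel"
 shows "integral\<^sup>N lborel (\<lambda>x. f (x + y)) = integral\<^sup>N lborel f"
proof -
 have "integral\<^sup>N lborel f = integral\<^sup>N (distr lborel borel ((+) y)) f" by (simp add: lborel_distr_plus)
 also have "... = integral\<^sup>N lborel (\<lambda>x. f (y + x))" using assms by (intro nn_integral_distr) auto
 finally show ?thesis by (simp add: add.commute)
qed

lemma nn_integral_reflect:
 fixes f :: "'a::euclidean_space => ennreal"
 assumes f: "f \<in> borel_measurable borel"
 shows "integral\<^sup>N lborel (\<lambda>x. f (z - x)) = integral\<^sup>N lborel f"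
proof -
 have "integral\<^sup>N lborel f = integral\<^sup>N (density (distr lborel borel (\<lambda>x. z + (-1) *\<^sub>R x)) (\<lambda>_. ennreal (\<bar>-1\<bar>^DIM('a)))) f"
  by (subst lborel_affine[of "-1" z]) auto
 also have "... = integral\<^sup>N lborel (\<lambda>x. f (z - x))"
  using f by (simp add: nn_integral_density nn_integral_distr)
 finally show ?thesis by simp
qed

lemma l2n_shift: "sq_int f ==> l2n (\<lambda>x. f (x + y)) = l2n f"
 unfolding l2n_def by (subst integral_shift[of "\<lambda>x. (cmod (f x))\<^sup>2"]) (auto simp: sq_int_def)

section \<open>Translation estimates from weak derivatives\<close>

lemma vector_mean_bound:
 fixes f :: "real => 'b::real_normed_vector"
 assumes "!!t. (f has_vector_derivative f' t) (at t)" "!!t. t \<in> closed_segment a b ==> norm (f' t) <= B"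
 shows "norm (f b - f a) <= B * \<bar>b - a\<bar>"
proof -
 have "norm (f b - f a) <= B * norm (b - a)"
 proof (rule differentiable_bound[of "closed_segment a b" f "\<lambda>t h. h *\<^sub>R f' t"])
  fix t assume t: "t \<in> closed_segment a b"
  show "(f has_derivative (\<lambda>h. h *\<^sub>R f' t)) (at t within closed_segment a b)"
   using assms(1)[of t] by (simp add: has_vector_derivative_def has_derivative_at_withinI)
  show "onorm (\<lambda>h. h *\<^sub>R f' t) <= B"
   by (rule onorm_le) (use assms(2)[OF t] in \<open>auto simp: mult.commute[of B] intro: mult_left_mono\<close>)
 qed auto
 then show ?thesis by simp
qed

lemma test_fn_taylor:
 assumes f: "test_fn f" and j: "j \<in> Basis"
 obtains M where "!!x s. cmod (f (x + s *\<^sub>R j) - f x - s *\<^sub>R dpart [j] f x) <= M * s\<^sup>2" "M >= 0"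
proof -
 have "test_fn (dpart [j, j] f)" by (rule test_fn_dpart[OF f]) (use j in simp)
 then obtain M where M: "!!x. cmod (dpart [j, j] f x) <= M" using test_fn_bounded by blast
 have M0: "M >= 0" using M[of 0] norm_ge_zero order_trans by blast
 have d1: "((\<lambda>s. f (x + s *\<^sub>R j)) has_vector_derivative dpart [j] f (x + t *\<^sub>R j)) (at t)" for x t
  by (rule pdir_line[OF smooth_pdir1[OF test_fn_smooth[OF f] j]])
 have d2: "((\<lambda>s. dpart [j] f (x + s *\<^sub>R j)) has_vector_derivative dpart [j, j] f (x + t *\<^sub>R j)) (at t)" for x t
  by (rule pdir_line[OF smooth_pdir[OF test_fn_smooth[OF f]]]) (use j in auto)
 have b1: "cmod (dpart [j] f (x + t *\<^sub>R j) - dpart [j] f x) <= M * \<bar>t\<bar>" for x t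
  using vector_mean_bound[of "\<lambda>s. dpart [j] f (x + s *\<^sub>R j)" _ 0 t M, OF d2 M] by simp
 have d3: "((\<lambda>s. f (x + s *\<^sub>R j) - s *\<^sub>R dpart [j] f x) has_vector_derivative
   dpart [j] f (x + t *\<^sub>R j) - dpart [j] f x) (at t)" for x t
  by (auto intro!: derivative_eq_intros d1)
 have "cmod (f (x + s *\<^sub>R j) - f x - s *\<^sub>R dpart [j] f x) <= M * s\<^sup>2" for x s
 proof -
  have "cmod ((f (x + s *\<^sub>R j) - s *\<^sub>R dpart [j] f x) - (f (x + 0 *\<^sub>R j) - 0 *\<^sub>R dpart [j] f x)) <= (M * \<bar>s\<bar>) * \<bar>s - 0\<bar>"
  proof (rule vector_mean_bound[OF d3])
   fix t assume "t \<in> closed_segment 0 s"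
   then have "\<bar>t\<bar> <= \<bar>s\<bar>" by (auto simp: closed_segment_eq_real_ivl split: if_splits)
   then show "cmod (dpart [j] f (x + t *\<^sub>R j) - dpart [j] f x) <= M * \<bar>s\<bar>"
    using b1[of x t] M0 by (meson mult_left_mono order_trans)
  qed
  then show ?thesis by (simp add: power2_eq_square algebra_simps)
 qed
 then show thesis using M0 that by blast
qed

text \<open>The Taylor remainder of f is at most M (s-t)^2 uniformly in space, and for |s-t| < 1 all
  translates live in one ball, on which v is integrable. The difference quotient therefore has an
  explicit error linear in |s-t|.\<close>

lemma shift_deriv:
 assumes v: "sq_int v" and f: "test_fn f" and j: "j \<in> Basis"
 shows "((\<lambda>t. (LBINT x. v x * f (x + t *\<^sub>R j))) has_vector_derivative
   (LBINT x. v x * dpart [j] f (x + t *\<^sub>R j))) (at t)"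
proof -
 have f1: "test_fn (dpart [j] f)" by (rule test_fn_dpart[OF f]) (use j in simp)
 obtain M where M: "!!x s. cmod (f (x + s *\<^sub>R j) - f x - s *\<^sub>R dpart [j] f x) <= M * s\<^sup>2" "M >= 0"
  using test_fn_taylor[OF f j] by metis
 obtain R where R: "{x. f x \<noteq> 0} \<subseteq> ball 0 R" "{x. dpart [j] f x \<noteq> 0} \<subseteq> ball 0 R"
 proof -
  have "bounded ({x. f x \<noteq> 0} \<union> {x. dpart [j] f x \<noteq> 0})"
   using test_fn_bounded_support[OF f] test_fn_bounded_support[OF f1] by simp
  then show thesis using bounded_subset_ballD that by (metis le_sup_iff)
 qed
 \<comment> \<open>|t| accounts for the base translation and 1 for every further one with |s-t| <
   1.\<close>
 define A where "A = ball (0::'a) (R + \<bar>t\<bar> + 1)"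
 have iv: "sq_int (indicator A :: 'a => complex)"
  by (rule bounded_supp_sq_int[of _ A 1]) (auto simp: A_def intro!: borel_measurable_indicator split: split_indicator)
 define C where "C = (LBINT x. cmod (v x) * cmod (indicator A x))"
 have iC: "integrable lborel (\<lambda>x. cmod (v x) * cmod (indicator A x))"
  using integrable_norm[OF sq_int_mult[OF v iv]] by (simp add: norm_mult)
 let ?m = "\<lambda>t. (LBINT x. v x * f (x + t *\<^sub>R j))"
 let ?m' = "(LBINT x. v x * dpart [j] f (x + t *\<^sub>R j))"
 have if0: "integrable lborel (\<lambda>x. v x * f (x + s *\<^sub>R j))" for s
  by (rule sq_int_mult[OF v test_fn_sq_int[OF test_fn_shift[OF f]]])
 have if1: "integrable lborel (\<lambda>x. v x * dpart [j] f (x + s *\<^sub>R j))" for s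
  by (rule sq_int_mult[OF v test_fn_sq_int[OF test_fn_shift[OF f1]]])
 have key: "cmod (?m s - ?m t - (s - t) *\<^sub>R ?m') <= M * C * (s - t)\<^sup>2" if s: "\<bar>s - t\<bar> < 1" for s
 proof -
  have eq: "(\<lambda>x. v x * (f (x + s *\<^sub>R j) - f (x + t *\<^sub>R j) - (s - t) *\<^sub>R dpart [j] f (x + t *\<^sub>R j))) =
    (\<lambda>x. v x * f (x + s *\<^sub>R j) - v x * f (x + t *\<^sub>R j) - (s - t) *\<^sub>R (v x * dpart [j] f (x + t *\<^sub>R j)))"
   by (simp only: right_diff_distrib mult_scaleR_right)
  have eqi: "integrable lborel (\<lambda>x. v x * (f (x + s *\<^sub>R j) - f (x + t *\<^sub>R j) - (s - t) *\<^sub>R dpart [j] f (x + t *\<^sub>R j)))"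
   unfolding eq by (intro Bochner_Integration.integrable_diff integrable_scaleR_right if0 if1)
  have pt: "cmod (v x * (f (x + s *\<^sub>R j) - f (x + t *\<^sub>R j) - (s - t) *\<^sub>R dpart [j] f (x + t *\<^sub>R j)))
    <= (M * (s - t)\<^sup>2) * (cmod (v x) * cmod (indicator A x))" for x
   proof (cases "x \<in> A")
    case True
    have "f (x + s *\<^sub>R j) = f ((x + t *\<^sub>R j) + (s - t) *\<^sub>R j)" by (simp add: algebra_simps)
    then have "cmod (f (x + s *\<^sub>R j) - f (x + t *\<^sub>R j) - (s - t) *\<^sub>R dpart [j] f (x + t *\<^sub>R j)) <= M * (s - t)\<^sup>2"
     using M(1)[of "x + t *\<^sub>R j" "s - t"] by simp
    then show ?thesis using True by (simp add: norm_mult mult_left_mono mult.commute)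
   next
    case False
    have j1: "norm j = 1" using j by simp
    have "norm x - \<bar>t\<bar> <= norm (x + t *\<^sub>R j)" "norm x - \<bar>s\<bar> <= norm (x + s *\<^sub>R j)"
     using norm_triangle_ineq4[of "x + t *\<^sub>R j" "t *\<^sub>R j"] norm_triangle_ineq4[of "x + s *\<^sub>R j" "s *\<^sub>R j"] j1 by auto
    moreover have "norm x >= R + \<bar>t\<bar> + 1" using False by (simp add: A_def)
    ultimately have "x + t *\<^sub>R j \<notin> ball 0 R" "x + s *\<^sub>R j \<notin> ball 0 R" using s by auto
    then have "f (x + t *\<^sub>R j) = 0" "f (x + s *\<^sub>R j) = 0" "dpart [j] f (x + t *\<^sub>R j) = 0" using R by blast+
    then show ?thesis using False by simp
   qed
  have e1: "?m s - ?m t - (s - t) *\<^sub>R ?m' =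
   (LBINT x. v x * (f (x + s *\<^sub>R j) - f (x + t *\<^sub>R j) - (s - t) *\<^sub>R dpart [j] f (x + t *\<^sub>R j)))"
   unfolding eq Bochner_Integration.integral_diff[OF Bochner_Integration.integrable_diff[OF if0 if0] integrable_scaleR_right[OF if1]]
    Bochner_Integration.integral_diff[OF if0 if0] integral_scaleR_right ..
  have "cmod (?m s - ?m t - (s - t) *\<^sub>R ?m') <= (LBINT x. cmod (v x * (f (x + s *\<^sub>R j) - f (x + t *\<^sub>R j) - (s - t) *\<^sub>R dpart [j] f (x + t *\<^sub>R j))))"
   unfolding e1 by (rule integral_norm_bound)
  also have "... <= (LBINT x. (M * (s - t)\<^sup>2) * (cmod (v x) * cmod (indicator A x)))"
   by (rule Bochner_Integration.integral_mono[OF integrable_norm[OF eqi] integrable_mult_right[OF iC] pt])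
  also have "... = M * C * (s - t)\<^sup>2" by (simp add: C_def)
  finally show ?thesis .
 qed
 show ?thesis unfolding has_vector_derivative_def
 proof (rule has_derivativeI_sandwich[of 1])
  show "((\<lambda>s. M * C * \<bar>s - t\<bar>) \<longlongrightarrow> 0) (at t)"
   by (auto intro!: tendsto_eq_intros)
  fix s
  show "s \<noteq> t ==> dist s t < 1 ==> norm (?m s - ?m t - (s - t) *\<^sub>R ?m') / norm (s - t) <= M * C * \<bar>s - t\<bar>"
  proof -
   have "(s - t)\<^sup>2 = \<bar>s - t\<bar> * \<bar>s - t\<bar>" by (simp add: power2_eq_square)
   moreover assume "s \<noteq> t" "dist s t < 1"
   ultimately have "cmod (?m s - ?m t - (s - t) *\<^sub>R ?m') <= (M * C * \<bar>s - t\<bar>) * norm (s - t)"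
    using key[of s] by (simp add: dist_real_def mult.assoc)
   then show ?thesis using \<open>s \<noteq> t\<close> by (subst pos_divide_le_eq) auto
  qed
 qed (auto intro: bounded_linear_scaleR_left)
qed

text \<open>Dual form of the L^2 translation bound |h| ||g||: differentiate in the shift, pass the
  derivative from f to g, and use Cauchy-Schwarz with the translation invariance of the L^2
  norm.\<close>

lemma weak_pd_shift_le:
 assumes v: "sq_int v" and g: "weak_pd j v g" "sq_int g" and f: "test_fn f" and j: "j \<in> Basis"
 shows "cmod ((LBINT x. v x * f (x + h *\<^sub>R j)) - (LBINT x. v x * f x)) <= l2n g * l2n f * \<bar>h\<bar>"
proof -
 let ?m = "\<lambda>t. (LBINT x. v x * f (x + t *\<^sub>R j))"
 have "cmod (?m h - ?m 0) <= l2n g * l2n f * \<bar>h - 0\<bar>"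
 proof (rule vector_mean_bound[OF shift_deriv[OF v f j]])
  fix t
  have sf: "test_fn (\<lambda>x. f (x + t *\<^sub>R j))" by (rule test_fn_shift[OF f])
  have "(LBINT x. v x * dpart [j] f (x + t *\<^sub>R j)) = - (LBINT x. g x * f (x + t *\<^sub>R j))"
  proof -
   have "(LBINT x. v x * dpart [j] (\<lambda>x. f (x + t *\<^sub>R j)) x) = - (LBINT x. g x * f (x + t *\<^sub>R j))"
    using g(1) sf unfolding weak_pd_def by blast
   then show ?thesis unfolding dpart_shift .
  qed
  then show "cmod (LBINT x. v x * dpart [j] f (x + t *\<^sub>R j)) <= l2n g * l2n f"
   using norm_integral_mult_le[OF g(2) test_fn_sq_int[OF sf]] l2n_shift[OF test_fn_sq_int[OF f]] by simp
 qed
 then show ?thesis by simp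
qed

text \<open>The shift is performed one coordinate direction at a time. Translating f leaves its L^2
  norm unchanged, so the costs add up.\<close>

lemma weak_grad_shift_le:
 assumes v: "sq_int v" and g: "!!j. j \<in> Basis ==> weak_pd j v (g j) \<and> sq_int (g j) \<and> l2n (g j) <= G"
  and f: "test_fn f" and A: "A \<subseteq> Basis"
 shows "cmod ((LBINT x. v x * f (x + (\<Sum>j\<in>A. c j *\<^sub>R j))) - (LBINT x. v x * f x))
  <= G * l2n f * (\<Sum>j\<in>A. \<bar>c j\<bar>)"
proof -
 have "finite A" using A finite_Basis finite_subset by blast
 then show ?thesis using A
 proof (induction A)
  case (insert k A)
  let ?y = "\<Sum>j\<in>A. c j *\<^sub>R j"
  let ?f = "\<lambda>x. f (x + ?y)"
  have sf: "test_fn ?f" by (rule test_fn_shift[OF f])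
  have "cmod ((LBINT x. v x * ?f (x + c k *\<^sub>R k)) - (LBINT x. v x * ?f x)) <= l2n (g k) * l2n ?f * \<bar>c k\<bar>"
   by (rule weak_pd_shift_le[OF v _ _ sf]) (use insert g in auto)
  also have "... <= G * l2n f * \<bar>c k\<bar>"
   using g[of k] insert by (simp add: l2n_shift[OF test_fn_sq_int[OF f]] mult_right_mono)
  finally have 1: "cmod ((LBINT x. v x * ?f (x + c k *\<^sub>R k)) - (LBINT x. v x * ?f x)) <= G * l2n f * \<bar>c k\<bar>" .
  have 2: "cmod ((LBINT x. v x * ?f x) - (LBINT x. v x * f x)) <= G * l2n f * (\<Sum>j\<in>A. \<bar>c j\<bar>)"
   using insert by simp
  have "(\<lambda>x. v x * ?f (x + c k *\<^sub>R k)) = (\<lambda>x. v x * f (x + (\<Sum>j\<in>insert k A. c j *\<^sub>R j)))"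
   using insert by (simp add: add_ac)
  then show ?case using 1 2 insert
   norm_triangle_ineq[of "(LBINT x. v x * ?f (x + c k *\<^sub>R k)) - (LBINT x. v x * ?f x)"
     "(LBINT x. v x * ?f x) - (LBINT x. v x * f x)"]
   by (simp add: distrib_left)
 qed simp
qed

text \<open>Averaging over translations in a cube of side \<epsilon>: a single translation costs at
  most d \<epsilon> G ||f||, with d the dimension, and the mean of |v| over a cube is at most V
  \<epsilon>^(-d/2) by Cauchy-Schwarz, which pairs with the L^1 norm of f. Nonnegative integrals
  allow the order of integration to be exchanged on measurability alone.\<close>

lemma integral_pairing_le:
 fixes v :: "'a::euclidean_space => complex" and \<epsilon> G V :: real
 assumes v: "sq_int v" and g: "!!j. j \<in> Basis ==> weak_pd j v (g j) \<and> sq_int (g j) \<and> l2n (g j) <= G"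
  and f: "test_fn f" and e: "\<epsilon> > 0" and V: "l2n v <= V" "V > 0"
 shows "cmod (LBINT x. v x * f x) \<le>
   DIM('a) * \<epsilon> * G * l2n f + V * \<epsilon> powr (- (DIM('a) / 2)) * (LBINT x. cmod (f x))"
proof -
 define d where "d = DIM('a)"
 define Q where "Q = cbox (0::'a) (\<epsilon> *\<^sub>R One)"
 have mQ: "emeasure lborel Q = ennreal (\<epsilon> ^ d)"
  unfolding Q_def using e by (subst emeasure_lborel_cbox) (auto simp: d_def prod_constant inner_sum_left_Basis)
 have Qb: "Q \<in> sets borel" by (simp add: Q_def)
 define A where "A = cmod (LBINT x. v x * f x)"
 define D where "D = d * \<epsilon> * G * l2n f"
 obtain k :: 'a where "k \<in> Basis" using nonempty_Basis by blast
 then have G: "G >= 0" using g l2n_nonneg order_trans by blast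
 have D: "D >= 0" using e G by (simp add: D_def)
 have vm [measurable]: "v \<in> borel_measurable borel" and fm [measurable]: "f \<in> borel_measurable borel"
  using v test_fn_borel[OF f] by (auto simp: sq_int_def)
 define W where "W y = integral\<^sup>N lborel (\<lambda>x. ennreal (cmod (v (x - y)) * cmod (f x)))" for y
 have AW: "ennreal A <= ennreal D + W y" if y: "y \<in> Q" for y
 proof -
  have yb: "0 <= y \<bullet> j" "y \<bullet> j <= \<epsilon>" if "j \<in> Basis" for j
   using y that by (auto simp: Q_def mem_box)
  have "cmod ((LBINT x. v x * f (x + (\<Sum>j\<in>Basis. (y \<bullet> j) *\<^sub>R j))) - (LBINT x. v x * f x))
   <= G * l2n f * (\<Sum>j\<in>Basis. \<bar>y \<bullet> j\<bar>)" by (rule weak_grad_shift_le[OF v g f]) auto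
  also have "... <= G * l2n f * (\<Sum>j\<in>(Basis::'a set). \<epsilon>)"
   using yb G by (intro mult_left_mono sum_mono) auto
  also have "... = D" by (simp add: D_def d_def)
  finally have "A <= D + cmod (LBINT x. v x * f (x + y))"
   unfolding A_def euclidean_representation
   using norm_triangle_sub[of "(LBINT x. v x * f x)" "(LBINT x. v x * f (x + y))"]
   by (simp add: norm_minus_commute)
  then have "ennreal A <= ennreal D + ennreal (cmod (LBINT x. v x * f (x + y)))"
   using D by (simp flip: ennreal_plus)
  also have "ennreal (cmod (LBINT x. v x * f (x + y))) <= integral\<^sup>N lborel (\<lambda>x. ennreal (cmod (v x * f (x + y))))"
   by (rule integral_norm_bound_ennreal[OF sq_int_mult[OF v test_fn_sq_int[OF test_fn_shift[OF f]]]])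
  also have "... = W y"
   unfolding W_def using nn_integral_shift[of "\<lambda>x. ennreal (cmod (v (x - y)) * cmod (f x))" y]
   by (simp add: norm_mult)
  finally show ?thesis by (simp add: add_left_mono)
 qed
 have Vsq: "integral\<^sup>N lborel (\<lambda>x. ennreal ((cmod (v x))\<^sup>2)) <= ennreal (V\<^sup>2)"
 proof -
  have "integral\<^sup>N lborel (\<lambda>x. ennreal ((cmod (v x))\<^sup>2)) = ennreal (LBINT x. (cmod (v x))\<^sup>2)"
   using v by (intro nn_integral_eq_integral) (auto simp: sq_int_def)
  also have "(LBINT x. (cmod (v x))\<^sup>2) <= V\<^sup>2"
   using power_mono[OF V(1) l2n_nonneg, of 2] by (simp add: l2n_def)
  finally show ?thesis by (simp add: ennreal_leI)
 qed
 \<comment> \<open>The Young weight that balances the two terms over the cube: V^2 / c and c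
   \<epsilon>^d both equal V \<epsilon>^(d/2).\<close>
 define c where "c = V * \<epsilon> powr (- (d / 2))"
 have c: "c > 0" using V e by (simp add: c_def)
 have ed: "\<epsilon> ^ d = \<epsilon> powr (d / 2) * \<epsilon> powr (d / 2)"
  using e by (simp add: powr_realpow flip: powr_add)
 have cc: "V\<^sup>2 / c + c * \<epsilon> ^ d = 2 * (\<epsilon> ^ d * c)"
 proof -
  have "V\<^sup>2 / c = V * \<epsilon> powr (d / 2)" using V e by (simp add: c_def powr_minus field_simps power2_eq_square)
  moreover have "c * \<epsilon> ^ d = V * \<epsilon> powr (d / 2)" unfolding ed c_def using e by (simp add: powr_minus)
  ultimately show ?thesis by (simp add: mult.commute)
 qed
 have inner: "(\<integral>\<^sup>+y. indicator Q y * ennreal (cmod (v (x - y))) \<partial>lborel) <= ennreal (\<epsilon> ^ d * c)" for x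
 proof -
  have "(\<integral>\<^sup>+y. indicator Q y * ennreal (cmod (v (x - y))) \<partial>lborel) \<le>
    (\<integral>\<^sup>+y. ennreal (1 / (2 * c)) * ennreal ((cmod (v (x - y)))\<^sup>2) + ennreal (c / 2) * indicator Q y \<partial>lborel)"
  proof (rule nn_integral_mono)
   fix y
   have "cmod (v (x - y)) <= 1 / (2 * c) * (cmod (v (x - y)))\<^sup>2 + c / 2"
   proof -
    have "0 <= (cmod (v (x - y)) - c)\<^sup>2 / (2 * c)" using c by simp
    also have "... = 1 / (2 * c) * (cmod (v (x - y)))\<^sup>2 + c / 2 - cmod (v (x - y))"
     using c by (simp add: power2_eq_square field_simps)
    finally show ?thesis by simp
   qed
   then have "ennreal (cmod (v (x - y))) <= ennreal (1 / (2 * c)) * ennreal ((cmod (v (x - y)))\<^sup>2) + ennreal (c / 2)"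
    using c by (simp add: ennreal_leI flip: ennreal_mult ennreal_plus)
   then show "indicator Q y * ennreal (cmod (v (x - y))) \<le>
     ennreal (1 / (2 * c)) * ennreal ((cmod (v (x - y)))\<^sup>2) + ennreal (c / 2) * indicator Q y"
    by (auto simp: indicator_def)
  qed
  also have "... = ennreal (1 / (2 * c)) * (\<integral>\<^sup>+y. ennreal ((cmod (v (x - y)))\<^sup>2) \<partial>lborel) + ennreal (c / 2) * emeasure lborel Q"
   using Qb by (subst nn_integral_add) (auto simp: nn_integral_cmult nn_integral_cmult_indicator)
  also have "(\<integral>\<^sup>+y. ennreal ((cmod (v (x - y)))\<^sup>2) \<partial>lborel) = integral\<^sup>N lborel (\<lambda>x. ennreal ((cmod (v x))\<^sup>2))"
   by (rule nn_integral_reflect) simp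
  also have "ennreal (1 / (2 * c)) * ... <= ennreal (1 / (2 * c)) * ennreal (V\<^sup>2)"
   using Vsq by (rule mult_left_mono) simp
  also have "ennreal (1 / (2 * c)) * ennreal (V\<^sup>2) + ennreal (c / 2) * emeasure lborel Q = ennreal ((V\<^sup>2 / c + c * \<epsilon> ^ d) / 2)"
   unfolding mQ using c e by (simp flip: ennreal_mult ennreal_plus add: field_simps)
  also have "(V\<^sup>2 / c + c * \<epsilon> ^ d) / 2 = \<epsilon> ^ d * c" using cc by simp
  finally show ?thesis by (simp add: add_right_mono)
 qed
 define F where "F = (LBINT x. cmod (f x))"
 have F: "F >= 0" by (simp add: F_def)
 have Fn: "integral\<^sup>N lborel (\<lambda>x. ennreal (cmod (f x))) = ennreal F"
 proof -
  obtain C where "!!x. cmod (f x) <= C" using test_fn_bounded[OF f] by blast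
  then have "integrable lborel f"
   by (intro bounded_supp_integrable[OF fm test_fn_bounded_support[OF f]]) auto
  then show ?thesis unfolding F_def by (intro nn_integral_eq_integral) auto
 qed
 have "ennreal (A * \<epsilon> ^ d) = (\<integral>\<^sup>+y. indicator Q y * ennreal A \<partial>lborel)"
  unfolding mult.commute[of "indicator Q _"] using Qb mQ e
  by (subst nn_integral_cmult_indicator) (auto simp: ennreal_mult A_def)
 also have "... <= (\<integral>\<^sup>+y. indicator Q y * ennreal D + indicator Q y * W y \<partial>lborel)"
  using AW by (intro nn_integral_mono) (auto simp: indicator_def)
 also have "... = ennreal (D * \<epsilon> ^ d) + (\<integral>\<^sup>+y. indicator Q y * W y \<partial>lborel)"
 proof -
  have "(\<integral>\<^sup>+y. indicator Q y * ennreal D \<partial>lborel) = ennreal (D * \<epsilon> ^ d)"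
   unfolding mult.commute[of "indicator Q _"] using Qb mQ e D
   by (subst nn_integral_cmult_indicator) (auto simp: ennreal_mult)
  then show ?thesis unfolding W_def using Qb by (subst nn_integral_add) auto
 qed
 also have "(\<integral>\<^sup>+y. indicator Q y * W y \<partial>lborel) =
   (\<integral>\<^sup>+y. (\<integral>\<^sup>+x. indicator Q y * ennreal (cmod (v (x - y)) * cmod (f x)) \<partial>lborel) \<partial>lborel)"
  unfolding W_def using Qb by (intro nn_integral_cong nn_integral_cmult[symmetric]) auto
 also have "... = (\<integral>\<^sup>+x. (\<integral>\<^sup>+y. indicator Q y * ennreal (cmod (v (x - y)) * cmod (f x)) \<partial>lborel) \<partial>lborel)"
 proof (rule lborel_pair.Fubini')
  note [measurable] = Qb
  have eq: "borel_measurable (lborel \<Otimes>\<^sub>M lborel) = (borel_measurable (borel \<Otimes>\<^sub>M borel) :: ('a \<times> 'a => ennreal) set)"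
   by (intro measurable_cong_sets sets_pair_measure_cong) auto
  show "(\<lambda>(x, y). indicator Q y * ennreal (cmod (v (x - y)) * cmod (f x))) \<in> borel_measurable (lborel \<Otimes>\<^sub>M lborel)"
   unfolding eq by measurable
 qed
 also have "... = (\<integral>\<^sup>+x. (\<integral>\<^sup>+y. indicator Q y * ennreal (cmod (v (x - y))) \<partial>lborel) * ennreal (cmod (f x)) \<partial>lborel)"
  using Qb by (intro nn_integral_cong) (subst nn_integral_multc[symmetric]; auto simp: ennreal_mult mult.assoc)
 also have "... <= (\<integral>\<^sup>+x. ennreal (\<epsilon> ^ d * c) * ennreal (cmod (f x)) \<partial>lborel)"
  by (intro nn_integral_mono mult_right_mono inner) auto
 also have "... = ennreal (\<epsilon> ^ d * c * F)"
  using e c F by (simp add: nn_integral_cmult Fn ennreal_mult)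
 finally have "ennreal (A * \<epsilon> ^ d) <= ennreal (D * \<epsilon> ^ d) + ennreal (\<epsilon> ^ d * c * F)" by (simp add: add_left_mono)
 also have "... = ennreal ((D + c * F) * \<epsilon> ^ d)"
  using e D c F by (simp flip: ennreal_plus add: algebra_simps)
 finally have "A * \<epsilon> ^ d <= (D + c * F) * \<epsilon> ^ d"
  using e D c F by (subst (asm) ennreal_le_iff) auto
 then have "A <= D + c * F" using e by simp
 then show ?thesis by (simp add: A_def D_def c_def F_def d_def)
qed

section \<open>Level sets and local integrability\<close>

lemma indicator_sq_int:
 assumes "E \<in> sets borel" "bounded E"
 shows "sq_int (indicator E :: 'a::euclidean_space => complex)"
 by (rule bounded_supp_sq_int[of _ E 1]) (use assms in \<open>auto intro!: borel_measurable_indicator split: split_indicator\<close>)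

lemma integrable_indicator_bounded:
 assumes "E \<in> sets borel" "bounded E"
 shows "integrable lborel (indicator E :: 'a::euclidean_space => real)"
 using emeasure_bounded_finite[OF assms(2)] assms(1) by (intro integrable_real_indicator) auto

text \<open>Pairing v with smooth approximations of the indicator of E gives \<kappa> m \<le> d
  \<epsilon> G sqrt m + V \<epsilon>^(-d/2) m in the limit. The choice of \<epsilon> turns the last
  term into \<kappa> m / 2, which is absorbed; squaring leaves m of order \<kappa>^(-2-4/d). The
  unit factor \<sigma> serves to select a sign of the real or imaginary part.\<close>

lemma level_set_measure_le:
 fixes v :: "'a::euclidean_space => complex" and G V :: real
 assumes v: "sq_int v" and g: "!!j. j \<in> Basis ==> weak_pd j v (g j) \<and> sq_int (g j) \<and> l2n (g j) <= G"
  and V: "l2n v <= V" "V > 0"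
  and E: "E \<in> sets borel" "bounded E" and l: "\<kappa> > 0" and s: "cmod \<sigma> = 1"
  and Ev: "!!x. x \<in> E ==> Re (\<sigma> * v x) >= \<kappa>"
 shows "measure lborel E <= (2 * real DIM('a) * G / \<kappa>)\<^sup>2 * (2 * V / \<kappa>) powr (4 / real DIM('a))"
proof -
 define d where "d = real DIM('a)"
 have d: "d > 0" by (simp add: d_def)
 define m where "m = measure lborel E"
 have m0: "m >= 0" by (simp add: m_def)
 obtain k :: 'a where "k \<in> Basis" using nonempty_Basis by blast
 then have G: "G >= 0" using g l2n_nonneg order_trans by blast
 \<comment> \<open>The solution of V \<epsilon>^(-d/2) = \<kappa> / 2.\<close>
 define \<epsilon> where "\<epsilon> = (2 * V / \<kappa>) powr (2 / d)"
 have e: "\<epsilon> > 0" using V l by (simp add: \<epsilon>_def)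
 note iE = integrable_indicator_bounded[OF E] and sE = indicator_sq_int[OF E]
 have lower: "\<kappa> * m <= cmod (LBINT x. v x * indicator E x)"
 proof -
  have iv: "integrable lborel (\<lambda>x. v x * indicator E x)" by (rule sq_int_mult[OF v sE])
  have "\<kappa> * m = (LBINT x. \<kappa> * indicator E x)" using E by (simp add: m_def)
  also have "... <= (LBINT x. Re (\<sigma> * (v x * indicator E x)))"
  proof (rule Bochner_Integration.integral_mono)
   show "integrable lborel (\<lambda>x. Re (\<sigma> * (v x * indicator E x)))"
    by (intro integrable_Re integrable_mult_right iv)
   show "\<kappa> * indicator E x <= Re (\<sigma> * (v x * indicator E x))" for x
    using Ev[of x] by (cases "x \<in> E") auto
  qed (use iE in simp)
  also have "... = Re (\<sigma> * (LBINT x. v x * indicator E x))"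
   by (simp only: integral_Re[OF integrable_mult_right[OF iv]] integral_mult_right_zero)
  also have "... <= cmod (\<sigma> * (LBINT x. v x * indicator E x))" by (rule complex_Re_le_cmod)
  finally show ?thesis using s by (simp add: norm_mult)
 qed
 \<comment> \<open>\<eta> bounds the smoothing error in L^1. All functions involved lie between 0
   and 1, so it also bounds the squared L^2 error, whence the square roots.\<close>
 have step: "\<kappa> * m <= d * \<epsilon> * G * sqrt (m + \<eta>) + V * \<epsilon> powr (- (d / 2)) * (m + \<eta>) + V * sqrt \<eta>"
  if eta: "\<eta> > 0" for \<eta>
 proof -
  obtain \<psi> :: "'a => real" where p: "test_fn (\<lambda>x. cplx (\<psi> x))" "!!x. 0 <= \<psi> x" "!!x. \<psi> x <= 1"
   "(LBINT x. \<bar>\<psi> x - indicator E x\<bar>) < \<eta>" "integrable lborel (\<lambda>x. \<bar>\<psi> x - indicator E x\<bar>)"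
   by (rule test_fn_approx_indicator[OF E eta]) (rule that)
  let ?f = "\<lambda>x. cplx (\<psi> x)"
  have sf: "sq_int ?f" by (rule test_fn_sq_int[OF p(1)])
  have ifn: "integrable lborel \<psi>"
  proof -
   have "cmod (?f x) <= 1" for x using p(2,3)[of x] by simp
   then have "integrable lborel ?f"
    by (intro bounded_supp_integrable[OF test_fn_borel[OF p(1)] test_fn_bounded_support[OF p(1)], of 1]) auto
   from integrable_Re[OF this] show ?thesis by simp
  qed
  have I1: "integral\<^sup>L lborel \<psi> <= m + \<eta>"
  proof -
   have "integral\<^sup>L lborel \<psi> <= (LBINT x. indicator E x + \<bar>\<psi> x - indicator E x\<bar>)"
    by (rule Bochner_Integration.integral_mono[OF ifn]) (use iE p(5) in auto)
   also have "... = m + (LBINT x. \<bar>\<psi> x - indicator E x\<bar>)"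
    using iE p(5) E by (subst Bochner_Integration.integral_add) (auto simp: m_def)
   finally show ?thesis using p(4) by simp
  qed
  have F1: "(LBINT x. cmod (?f x)) <= m + \<eta>" using I1 p(2) by simp
  have F2: "l2n ?f <= sqrt (m + \<eta>)"
  proof -
   have "(LBINT x. (cmod (?f x))\<^sup>2) <= integral\<^sup>L lborel \<psi>"
   proof (rule Bochner_Integration.integral_mono[OF _ ifn])
    show "(cmod (?f x))\<^sup>2 <= \<psi> x" for x
     using p(2,3)[of x] by (simp add: power2_eq_square mult_left_le)
   qed (use sf in \<open>simp add: sq_int_def\<close>)
   then show ?thesis using I1 by (simp add: l2n_def)
  qed
  have ci: "cmod (indicator E x - ?f x) = \<bar>\<psi> x - indicator E x\<bar>" for x
  proof -
   have "indicator E x - ?f x = cplx (indicator E x - \<psi> x)" by (cases "x \<in> E") auto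
   then show ?thesis by (simp only: norm_of_real abs_minus_commute)
  qed
  have p1: "\<bar>\<psi> x - indicator E x\<bar> <= 1" for x
   using p(2,3)[of x] by (cases "x \<in> E") auto
  have sd: "sq_int (\<lambda>x. indicator E x - ?f x)"
  proof (rule bounded_supp_sq_int[of _ "E \<union> {x. ?f x \<noteq> 0}" 1])
   show "(\<lambda>x. indicator E x - ?f x) \<in> borel_measurable borel" using E test_fn_borel[OF p(1)] by measurable
   show "cmod (indicator E x - ?f x) <= 1" for x using ci p1 by simp
  qed (use E test_fn_bounded_support[OF p(1)] in auto)
  have F3: "l2n (\<lambda>x. indicator E x - ?f x) <= sqrt \<eta>"
  proof -
   have "(LBINT x. (cmod (indicator E x - ?f x))\<^sup>2) <= (LBINT x. \<bar>\<psi> x - indicator E x\<bar>)"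
   proof (rule Bochner_Integration.integral_mono[OF _ p(5)])
    fix x
    show "(cmod (indicator E x - ?f x))\<^sup>2 <= \<bar>\<psi> x - indicator E x\<bar>"
     unfolding ci power2_eq_square by (rule mult_left_le[OF p1]) simp
   qed (use sd in \<open>simp add: sq_int_def\<close>)
   then show ?thesis using p(4) by (simp add: l2n_def)
  qed
  have "(LBINT x. v x * indicator E x) =
    (LBINT x. v x * ?f x) + (LBINT x. v x * (indicator E x - ?f x))"
   by (subst Bochner_Integration.integral_add[symmetric])
    (auto simp: algebra_simps intro!: sq_int_mult[OF v sf] sq_int_mult[OF v sd, simplified right_diff_distrib])
  then have "\<kappa> * m <= cmod (LBINT x. v x * ?f x) + cmod (LBINT x. v x * (indicator E x - ?f x))"
   using lower norm_triangle_ineq order_trans by metis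
  also have "... <= (d * \<epsilon> * G * l2n ?f + V * \<epsilon> powr (- (d / 2)) * (LBINT x. cmod (?f x)))
    + l2n v * l2n (\<lambda>x. indicator E x - ?f x)"
   using integral_pairing_le[OF v g p(1) e V] norm_integral_mult_le[OF v sd] unfolding d_def by (intro add_mono) auto
  also have "... <= (d * \<epsilon> * G * sqrt (m + \<eta>) + V * \<epsilon> powr (- (d / 2)) * (m + \<eta>)) + V * sqrt \<eta>"
   using F1 F2 F3 V e d G by (intro add_mono mult_left_mono mult_mono) auto
  finally show ?thesis .
 qed
 have "\<kappa> * m <= d * \<epsilon> * G * sqrt (m + 0) + V * \<epsilon> powr (- (d / 2)) * (m + 0) + V * sqrt 0"
 proof (rule tendsto_lowerbound)
  show "((\<lambda>\<eta>. d * \<epsilon> * G * sqrt (m + \<eta>) + V * \<epsilon> powr (- (d / 2)) * (m + \<eta>) + V * sqrt \<eta>) \<longlongrightarrow>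
   d * \<epsilon> * G * sqrt (m + 0) + V * \<epsilon> powr (- (d / 2)) * (m + 0) + V * sqrt 0) (at_right 0)"
   by (intro tendsto_intros)
  show "eventually (\<lambda>\<eta>. \<kappa> * m <= d * \<epsilon> * G * sqrt (m + \<eta>) + V * \<epsilon> powr (- (d / 2)) * (m + \<eta>) + V * sqrt \<eta>) (at_right 0)"
   using step by (auto simp: eventually_at_filter)
 qed simp
 moreover have "V * \<epsilon> powr (- (d / 2)) = \<kappa> / 2"
  using d V l by (simp add: \<epsilon>_def powr_powr powr_minus)
 ultimately have b: "\<kappa> / 2 * m <= d * \<epsilon> * G * sqrt m" by simp
 have "sqrt m <= 2 * d * G / \<kappa> * \<epsilon>"
 proof (cases "m = 0")
  case True
  then show ?thesis using d G e l by simp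
 next
  case False
  then have "sqrt m > 0" using m0 by simp
  moreover have "(\<kappa> / 2 * sqrt m) * sqrt m <= (d * \<epsilon> * G) * sqrt m" using b m0 by (simp add: mult.assoc)
  ultimately have "\<kappa> / 2 * sqrt m <= d * \<epsilon> * G" by (simp add: mult_le_cancel_right)
  then show ?thesis using l by (simp add: field_simps)
 qed
 then have "(sqrt m)\<^sup>2 <= (2 * d * G / \<kappa> * \<epsilon>)\<^sup>2" using m0 by (intro power_mono) auto
 then have "m <= (2 * d * G / \<kappa>)\<^sup>2 * \<epsilon>\<^sup>2" by (simp only: power_mult_distrib real_sqrt_pow2[OF m0])
 moreover have "\<epsilon>\<^sup>2 = (2 * V / \<kappa>) powr (4 / d)"
  using V l by (simp add: \<epsilon>_def power2_eq_square flip: powr_add)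
 ultimately show ?thesis by (simp add: m_def d_def)
qed

text \<open>On the layer 2^n < |v| \<le> 2^(n+1) the integrand is at most 2^((n+1)p), while the
  layer has measure of order 2^(-n(2+4/d)); for p \<le> 1 + 4/d the product decays at least like
  2^(-n). The constant sees v only through V and G, so it is uniform along a compact piece of a path
  continuous in H^1.\<close>

theorem local_Lp_bound:
 fixes K :: "'a::euclidean_space set" and G V p :: real
 assumes K: "K \<in> sets borel" "bounded K" and V: "V > 0" and p: "1 <= p" "p <= 1 + 4 / real DIM('a)"
 shows "\<exists>C\<ge>0. \<forall>(v :: 'a => complex) g. sq_int v \<and> l2n v <= V \<and>
   (\<forall>j\<in>Basis. weak_pd j v (g j) \<and> sq_int (g j) \<and> l2n (g j) <= G) -->
   integral\<^sup>N lborel (\<lambda>x. ennreal (cmod (v x) powr p * indicator K x)) <= ennreal C"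
proof -
 define d where "d = real DIM('a)"
 have d: "d > 0" by (simp add: d_def)
 \<comment> \<open>The outer 4 counts the directions 1, -1, \<i>, -\<i>: where |v| > 2^n, one of
   them has Re (\<sigma> v) \<ge> 2^n / 2. Inserting the level 2^n / 2 into
   \<open>level_set_measure_le\<close> produces 4 d G and 4 V.\<close>
 define C1 where "C1 = 4 * ((4 * d * G)\<^sup>2 * (4 * V) powr (4 / d))"
 have C1: "C1 >= 0" by (simp add: C1_def)
 define mK where "mK = measure lborel K"
 have emK: "emeasure lborel K = ennreal mK"
  unfolding mK_def using emeasure_bounded_finite[OF K(2)] by (intro emeasure_eq_ennreal_measure) auto
 show ?thesis
 \<comment> \<open>\<open>mK\<close> bounds the part with |v| \<le> 1; the final factor 2 is the
   value of the geometric series.\<close>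
 proof (intro exI[of _ "mK + 2 powr p * C1 * 2"] conjI allI impI)
  show "mK + 2 powr p * C1 * 2 >= 0" using C1 by (simp add: mK_def)
  fix v :: "'a => complex" and g
  assume vg: "sq_int v \<and> l2n v <= V \<and> (\<forall>j\<in>Basis. weak_pd j v (g j) \<and> sq_int (g j) \<and> l2n (g j) <= G)"
  then have v: "sq_int v" "l2n v <= V"
   and g: "!!j. j \<in> Basis ==> weak_pd j v (g j) \<and> sq_int (g j) \<and> l2n (g j) <= G" by auto
  have vm [measurable]: "v \<in> borel_measurable borel" using v by (simp add: sq_int_def)
  note [measurable] = K(1)
  define F where "F n = {x \<in> K. cmod (v x) > 2 ^ n}" for n :: nat
  have Fb: "F n \<in> sets borel" for n unfolding F_def by measurable
  have Fm: "emeasure lborel (F n) <= ennreal (C1 * 2 powr (- (real n * (2 + 4 / d))))" for n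
  proof -
   define E where "E \<sigma> = {x \<in> K. Re (\<sigma> * v x) >= 2 ^ n / 2}" for \<sigma>
   have Eb: "E \<sigma> \<in> sets borel" "bounded (E \<sigma>)" for \<sigma>
   proof -
    show "E \<sigma> \<in> sets borel" unfolding E_def by measurable
    show "bounded (E \<sigma>)" by (rule bounded_subset[OF K(2)]) (auto simp: E_def)
   qed
   have sub: "F n \<subseteq> E 1 \<union> E (-1) \<union> E \<i> \<union> E (-\<i>)"
   proof
    fix x assume x: "x \<in> F n"
    have "cmod (v x) <= \<bar>Re (v x)\<bar> + \<bar>Im (v x)\<bar>" by (rule cmod_le)
    moreover have "cmod (v x) > 2 ^ n" using x by (simp add: F_def)
    ultimately have "\<bar>Re (v x)\<bar> >= 2 ^ n / 2 \<or> \<bar>Im (v x)\<bar> >= 2 ^ n / 2" by linarith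
    then have "Re (v x) >= 2 ^ n / 2 \<or> - Re (v x) >= 2 ^ n / 2 \<or> Im (v x) >= 2 ^ n / 2 \<or> - Im (v x) >= 2 ^ n / 2" by linarith
    then show "x \<in> E 1 \<union> E (-1) \<union> E \<i> \<union> E (-\<i>)" using x by (auto simp: F_def E_def)
   qed
   let ?c = "(4 * d * G)\<^sup>2 * (4 * V) powr (4 / d) * 2 powr (- (real n * (2 + 4 / d)))"
   have Em: "emeasure lborel (E \<sigma>) <= ennreal ?c" if "cmod \<sigma> = 1" for \<sigma>
   proof -
    have "measure lborel (E \<sigma>) <= (2 * d * G / (2 ^ n / 2))\<^sup>2 * (2 * V / (2 ^ n / 2)) powr (4 / d)"
     unfolding d_def
    proof (rule level_set_measure_le[of v g G V "E \<sigma>" "2 ^ n / 2" \<sigma>])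
     show "!!x. x \<in> E \<sigma> ==> 2 ^ n / 2 <= Re (\<sigma> * v x)" by (simp add: E_def)
    qed (use v g V Eb that in auto)
    also have "... = ?c"
    proof -
     have "(2 * d * G / (2 ^ n / 2))\<^sup>2 = (4 * d * G)\<^sup>2 * (2 powr (- real n * 2))"
      by (simp add: power_divide powr_minus powr_realpow power_mult power2_eq_square power_mult_distrib
        flip: powr_powr) (simp add: powr_powr powr_add powr_realpow field_simps power2_eq_square flip: power_add mult_2_right)
     moreover have "(2 * V / (2 ^ n / 2)) powr (4 / d) = (4 * V) powr (4 / d) * 2 powr (- real n * (4 / d))"
     proof -
      have "2 * V / (2 ^ n / 2) = 4 * V * 2 powr (- real n)" by (simp add: powr_minus powr_realpow field_simps)
      then show ?thesis using V by (simp add: powr_mult powr_powr)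
     qed
     ultimately show ?thesis by (simp add: powr_add[symmetric] algebra_simps)
    qed
    finally show ?thesis
     using emeasure_bounded_finite[OF Eb(2)[of \<sigma>]]
     by (subst emeasure_eq_ennreal_measure) (auto intro: ennreal_leI)
   qed
   have "emeasure lborel (F n) <= emeasure lborel (E 1 \<union> E (-1) \<union> E \<i> \<union> E (-\<i>))"
    by (rule emeasure_mono[OF sub]) (use Eb in auto)
   also have "... <= emeasure lborel (E 1) + emeasure lborel (E (-1)) + emeasure lborel (E \<i>) + emeasure lborel (E (-\<i>))"
    using Eb by (intro order_trans[OF emeasure_subadditive] add_mono order_refl) auto
   also have "... <= ennreal ?c + ennreal ?c + ennreal ?c + ennreal ?c"
    by (intro add_mono Em) auto
   also have "... = ennreal (C1 * 2 powr (- (real n * (2 + 4 / d))))"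
    by (simp add: C1_def flip: ennreal_plus)
   finally show ?thesis .
  qed
  have pw: "ennreal (cmod (v x) powr p * indicator K x) \<le>
    indicator K x + (\<Sum>n. ennreal (2 powr ((real n + 1) * p)) * indicator (F n) x)" for x
  proof (cases "x \<in> K \<and> cmod (v x) > 1")
   case False
   then have "cmod (v x) powr p * indicator K x <= indicator K x"
    using p by (auto simp: indicator_def intro!: powr_le1)
   then have "ennreal (cmod (v x) powr p * indicator K x) <= indicator K x"
    by (auto simp: indicator_def split: if_splits)
   then show ?thesis by (simp add: add_increasing2)
  next
   case True
   have "\<exists>n. cmod (v x) <= 2 ^ n" using real_arch_pow[of 2 "cmod (v x)"] by (auto intro: less_imp_le)
   define N where "N = (LEAST n. cmod (v x) <= 2 ^ n)"
   have N1: "cmod (v x) <= 2 ^ N" unfolding N_def by (rule LeastI_ex) fact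
   have "N \<noteq> 0" using N1 True by (cases N) auto
   then obtain n where n: "N = Suc n" by (cases N) auto
   have N2: "cmod (v x) > 2 ^ n"
    using not_less_Least[of n "\<lambda>n. cmod (v x) <= 2 ^ n"] n unfolding N_def[symmetric] by simp
   have "ennreal (cmod (v x) powr p * indicator K x) <= ennreal (2 powr ((real n + 1) * p)) * indicator (F n) x"
   proof -
    have "cmod (v x) powr p <= (2 powr (real n + 1)) powr p"
     using N1 p by (intro powr_mono2) (auto simp: n powr_add powr_realpow mult.commute)
    then show ?thesis using True N2 by (simp add: F_def powr_powr ennreal_leI)
   qed
   also have "... <= (\<Sum>n. ennreal (2 powr ((real n + 1) * p)) * indicator (F n) x)"
   proof -
    have "f n <= suminf f" for f :: "nat => ennreal" using sum_le_suminf[of f "{n}"] by simp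
    then show ?thesis .
   qed
   finally show ?thesis by (simp add: add_increasing)
  qed
  have "integral\<^sup>N lborel (\<lambda>x. ennreal (cmod (v x) powr p * indicator K x)) \<le>
    integral\<^sup>N lborel (\<lambda>x. indicator K x + (\<Sum>n. ennreal (2 powr ((real n + 1) * p)) * indicator (F n) x))"
   by (rule nn_integral_mono[OF pw])
  also have "... = emeasure lborel K + (\<Sum>n. ennreal (2 powr ((real n + 1) * p)) * emeasure lborel (F n))"
   using Fb K by (subst nn_integral_add) (auto simp: nn_integral_suminf nn_integral_cmult_indicator)
  also have "(\<Sum>n. ennreal (2 powr ((real n + 1) * p)) * emeasure lborel (F n)) <= (\<Sum>n. ennreal (2 powr p * C1 * (1 / 2) ^ n))"
  proof (rule suminf_le)
   fix n
   have "ennreal (2 powr ((real n + 1) * p)) * emeasure lborel (F n) \<le>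
     ennreal (2 powr ((real n + 1) * p)) * ennreal (C1 * 2 powr (- (real n * (2 + 4 / d))))"
    by (rule mult_left_mono[OF Fm]) simp
   also have "... = ennreal (2 powr ((real n + 1) * p) * (C1 * 2 powr (- (real n * (2 + 4 / d)))))"
    using C1 by (simp add: ennreal_mult)
   also have "2 powr ((real n + 1) * p) * (C1 * 2 powr (- (real n * (2 + 4 / d)))) =
    2 powr p * C1 * 2 powr (real n * (p - (2 + 4 / d)))"
    by (simp add: algebra_simps flip: powr_add)
   also have "... <= 2 powr p * C1 * 2 powr (- real n)"
   proof (intro mult_left_mono powr_mono)
    have "real n * (p - (2 + 4 / d)) <= real n * (-1)" using p by (intro mult_left_mono) (auto simp: d_def)
    then show "real n * (p - (2 + 4 / d)) <= - real n" by simp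
   qed (use C1 in auto)
   also have "2 powr (- real n) = (1 / 2 :: real) ^ n" by (simp add: powr_minus powr_realpow power_one_over inverse_eq_divide)
   finally show "ennreal (2 powr ((real n + 1) * p)) * emeasure lborel (F n) <= ennreal (2 powr p * C1 * (1 / 2) ^ n)"
    by (simp add: ennreal_leI)
  qed auto
  also have "... = ennreal (2 powr p * C1 * 2)"
  proof (rule suminf_ennreal_eq)
   have "(\<lambda>n. (1/2::real) ^ n) sums (1 / (1 - 1/2))" by (rule geometric_sums) simp
   from sums_mult[OF this, of "2 powr p * C1"] show "(\<lambda>n. 2 powr p * C1 * (1 / 2) ^ n) sums (2 powr p * C1 * 2)" by simp
  qed (use C1 in auto)
  finally show "integral\<^sup>N lborel (\<lambda>x. ennreal (cmod (v x) powr p * indicator K x)) <= ennreal (mK + 2 powr p * C1 * 2)"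
   using C1 by (simp add: emK mK_def add_left_mono)
 qed
qed

section \<open>The gauge transformation\<close>

lemma dpart_outside_support:
 assumes "x \<notin> closure {x. f x \<noteq> 0}"
 shows "dpart js f x = 0"
 using assms
proof (induction js arbitrary: x)
 case Nil
 then show ?case using closure_subset[of "{x. f x \<noteq> 0}"] by auto
next
 case (Cons j js)
 let ?K = "closure {x. f x \<noteq> 0}"
 have "open ((\<lambda>t. x + t *\<^sub>R j) -` (- ?K))"
  by (intro open_vimage) (auto intro!: continuous_intros)
 moreover have "0 \<in> (\<lambda>t. x + t *\<^sub>R j) -` (- ?K)" using Cons.prems by auto
 ultimately have "((\<lambda>t. dpart js f (x + t *\<^sub>R j)) has_vector_derivative 0) (at 0)"
  using Cons.IH by (intro has_vector_derivative_transform_within_open[OF has_vector_derivative_const]) auto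
 then show ?case by (simp add: vector_derivative_at)
qed

text \<open>Only the integral over K of the majorant u enters, because f is bounded and lives on K.
  The majorants to come are |X| and |X|^p.\<close>

lemma pair_bound:
 assumes A: "integral\<^sup>N lborel (\<lambda>x. ennreal (u x * indicator K x)) <= ennreal A" "A >= 0"
  and uK: "u \<in> borel_measurable borel" "K \<in> sets borel"
  and h: "h \<in> borel_measurable borel" "!!x. cmod (h x) <= u x"
  and f: "f \<in> borel_measurable borel" "!!x. cmod (f x) <= \<epsilon>" "!!x. x \<notin> K ==> f x = 0"
  and e: "\<epsilon> >= 0"
 shows "integrable lborel (\<lambda>x. h x * f x)" "cmod (LBINT x. h x * f x) <= \<epsilon> * A"
proof -
 have m: "(\<lambda>x. h x * f x) \<in> borel_measurable lborel" using h f by simp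
 have pt: "ennreal (cmod (h x * f x)) <= ennreal \<epsilon> * ennreal (u x * indicator K x)" for x
 proof -
  have u: "0 <= u x" using h(2)[of x] norm_ge_zero order_trans by blast
  have "cmod (h x * f x) <= \<epsilon> * (u x * indicator K x)"
  proof (cases "x \<in> K")
   case True
   have "cmod (f x) * cmod (h x) <= \<epsilon> * u x" using f(2)[of x] h(2)[of x] e by (intro mult_mono) auto
   then show ?thesis using True by (simp add: norm_mult mult.commute)
  qed (simp add: f(3))
  then show ?thesis using e u by (simp add: ennreal_leI flip: ennreal_mult)
 qed
 have le: "integral\<^sup>N lborel (\<lambda>x. ennreal (cmod (h x * f x))) <= ennreal (\<epsilon> * A)"
 proof -
  have "integral\<^sup>N lborel (\<lambda>x. ennreal (cmod (h x * f x))) <= integral\<^sup>N lborel (\<lambda>x. ennreal \<epsilon> * ennreal (u x * indicator K x))"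
   by (rule nn_integral_mono[OF pt])
  also have "... = ennreal \<epsilon> * integral\<^sup>N lborel (\<lambda>x. ennreal (u x * indicator K x))"
  proof (rule nn_integral_cmult)
   note [measurable] = uK
   have "(\<lambda>x. ennreal (u x * indicator K x)) \<in> borel_measurable borel" by measurable
   then show "(\<lambda>x. ennreal (u x * indicator K x)) \<in> borel_measurable lborel" by simp
  qed
  also have "... <= ennreal \<epsilon> * ennreal A" using A by (intro mult_left_mono) auto
  finally show ?thesis using e A by (simp add: ennreal_mult)
 qed
 then show i: "integrable lborel (\<lambda>x. h x * f x)"
  using m by (intro integrableI_bounded) (auto intro: le_less_trans)
 have "ennreal (cmod (LBINT x. h x * f x)) <= ennreal (\<epsilon> * A)"
  using integral_norm_bound_ennreal[OF i] le by (rule order_trans)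
 then show "cmod (LBINT x. h x * f x) <= \<epsilon> * A"
  using e A by (subst (asm) ennreal_le_iff) auto
qed

lemma finite_uniform_bound:
 fixes f :: "'i => 'x => real"
 assumes "finite A" "!!a. a \<in> A ==> \<exists>B. \<forall>x. f a x <= B"
 shows "\<exists>B\<ge>0. \<forall>a\<in>A. \<forall>x. f a x <= B"
 using assms
proof (induction A)
 case (insert a A)
 then obtain B where "B >= 0" "\<forall>a\<in>A. \<forall>x. f a x <= B" by auto
 moreover obtain B' where "\<forall>x. f a x <= B'" using insert by blast
 ultimately have "\<forall>b\<in>insert a A. \<forall>x. f b x <= max B B'" by (auto simp: le_max_iff_disj)
 moreover have "max B B' >= 0" using \<open>B >= 0\<close> by simp
 ultimately show ?case by blast
qed auto

lemma H1_wgrad: "H1 v ==> j \<in> Basis ==> sq_int (wgrad j v) \<and> weak_pd j v (wgrad j v)"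
 unfolding H1_def wgrad_def using someI_ex[of "\<lambda>g. sq_int g \<and> weak_pd j v g"] by blast

lemma l2_diff_bound:
 assumes "sq_int f" "sq_int g" "(LBINT x. (cmod (f x - g x))\<^sup>2) <= D"
 shows "(LBINT x. (cmod (f x))\<^sup>2) <= 2 * (LBINT x. (cmod (g x))\<^sup>2) + 2 * D"
proof -
 have pt: "(cmod (a + b))\<^sup>2 <= 2 * (cmod a)\<^sup>2 + 2 * (cmod b)\<^sup>2" for a b
 proof -
  have "(cmod (a + b))\<^sup>2 <= (cmod a + cmod b)\<^sup>2" by (intro power_mono norm_triangle_ineq) auto
  then show ?thesis using sum_squares_bound[of "cmod a" "cmod b"] by (simp add: power2_sum)
 qed
 have i: "integrable lborel (\<lambda>x. (cmod (f x - g x))\<^sup>2)"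
 proof (rule Bochner_Integration.integrable_bound)
  show "integrable lborel (\<lambda>x. 2 * (cmod (f x))\<^sup>2 + 2 * (cmod (g x))\<^sup>2)" using assms by (auto simp: sq_int_def)
  show "AE x in lborel. norm ((cmod (f x - g x))\<^sup>2) <= norm (2 * (cmod (f x))\<^sup>2 + 2 * (cmod (g x))\<^sup>2)"
  proof (rule AE_I2)
   fix x show "norm ((cmod (f x - g x))\<^sup>2) <= norm (2 * (cmod (f x))\<^sup>2 + 2 * (cmod (g x))\<^sup>2)"
    using pt[of "f x" "- g x"] by simp
  qed
 qed (use assms in \<open>auto simp: sq_int_def\<close>)
 have "(LBINT x. (cmod (f x))\<^sup>2) <= (LBINT x. 2 * (cmod (g x))\<^sup>2 + 2 * (cmod (f x - g x))\<^sup>2)"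
 proof (rule Bochner_Integration.integral_mono)
  show "(cmod (f x))\<^sup>2 <= 2 * (cmod (g x))\<^sup>2 + 2 * (cmod (f x - g x))\<^sup>2" for x
   using pt[of "g x" "f x - g x"] by simp
 qed (use assms i in \<open>auto simp: sq_int_def\<close>)
 also have "... = 2 * (LBINT x. (cmod (g x))\<^sup>2) + 2 * (LBINT x. (cmod (f x - g x))\<^sup>2)"
  using assms i by (subst Bochner_Integration.integral_add) (auto simp: sq_int_def)
 finally show ?thesis using assms(3) by simp
qed

text \<open>Bisection replaces the extraction of a finite subcover.\<close>

lemma locally_bounded_imp_bounded:
 fixes f :: "real => real"
 assumes "s <= t" "!!x. x \<in> {s..t} ==> \<exists>d>0. \<exists>B. \<forall>y\<in>{s..t}. \<bar>y - x\<bar> < d --> f y <= B"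
 shows "\<exists>B. \<forall>y\<in>{s..t}. f y <= B"
proof -
 define P where "P a b \<longleftrightarrow> (\<exists>B. \<forall>y\<in>{a..b} \<inter> {s..t}. f y <= B)" for a b
 have "P s t"
 proof (rule Bolzano[OF assms(1)])
  fix a b c assume "P a b" "P b c" "a <= b" "b <= c"
  then obtain B B' where "\<forall>y\<in>{a..b} \<inter> {s..t}. f y <= B" "\<forall>y\<in>{b..c} \<inter> {s..t}. f y <= B'" by (auto simp: P_def)
  then have "f y <= max B B'" if "y \<in> {a..c} \<inter> {s..t}" for y
   using that by (cases "y <= b") (auto simp: le_max_iff_disj)
  then show "P a c" unfolding P_def by blast
 next
  fix x assume "s <= x" "x <= t"
  then obtain d B where d: "d > 0" "\<forall>y\<in>{s..t}. \<bar>y - x\<bar> < d --> f y <= B"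
   using assms(2)[of x] by (meson atLeastAtMost_iff)
  have "P a b" if "a <= x \<and> x <= b \<and> b - a < d" for a b
   unfolding P_def using d(2) that by (intro exI[of _ B]) (auto simp: abs_le_iff)
  then show "\<exists>d>0. \<forall>a b. a <= x \<and> x <= b \<and> b - a < d --> P a b" using d(1) by blast
 qed
 then show ?thesis by (simp add: P_def)
qed

text \<open>Near each time the squared norm is at most twice its value there plus a constant, and
  compactness of the window makes the bound global. The chosen gradients \<open>wgrad\<close> are
  the very functions compared in \<open>h1_dist\<close>.\<close>

lemma cont_H1_bounds:
 fixes v :: "real => 'a::euclidean_space => complex"
 assumes c: "cont_H1 I v" and st: "s <= t" "{s..t} \<subseteq> I"
 obtains V where "V > 0" "!!r. r \<in> {s..t} ==> sq_int (v r) \<and> l2n (v r) <= V \<and>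
   (\<forall>j\<in>Basis. weak_pd j (v r) (wgrad j (v r)) \<and> sq_int (wgrad j (v r)) \<and> l2n (wgrad j (v r)) <= V)"
proof -
 define f where "f r = (LBINT x. (cmod (v r x))\<^sup>2)
  + (\<Sum>j\<in>Basis. (LBINT x. (cmod (wgrad j (v r) x))\<^sup>2))" for r
 have h: "H1 (v r)" if "r \<in> {s..t}" for r using c st that by (auto simp: cont_H1_def)
 have sq: "sq_int (v r)" "!!j. j \<in> Basis ==> sq_int (wgrad j (v r)) \<and> weak_pd j (v r) (wgrad j (v r))" if "r \<in> {s..t}" for r
  using h[OF that] H1_wgrad[OF h[OF that]] by (auto simp: H1_def)
 have "\<exists>B. \<forall>r\<in>{s..t}. f r <= B"
 proof (rule locally_bounded_imp_bounded[OF st(1)])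
  fix x assume x: "x \<in> {s..t}"
  then obtain d where d: "d > 0" "\<forall>r\<in>I. \<bar>r - x\<bar> < d --> h1_dist (v r) (v x) < 1"
   using c st unfolding cont_H1_def by (metis subsetD zero_less_one)
  have "f r <= 2 * f x + 2 * (1 + DIM('a))" if r: "r \<in> {s..t}" "\<bar>r - x\<bar> < d" for r
  proof -
   let ?a = "(LBINT y. (cmod (v r y - v x y))\<^sup>2)"
   let ?b = "\<lambda>j. (LBINT y. (cmod (wgrad j (v r) y - wgrad j (v x) y))\<^sup>2)"
   have "sqrt (?a + (\<Sum>j\<in>Basis. ?b j)) < 1" using d(2) r st by (auto simp: h1_dist_def)
   then have lt: "?a + (\<Sum>j\<in>Basis. ?b j) < 1" by simp
   have nn: "?a >= 0" "!!j. ?b j >= 0" by auto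
   then have a1: "?a <= 1" using lt sum_nonneg[of "Basis" ?b] by simp
   have b1: "?b j <= 1" if "j \<in> Basis" for j
    using member_le_sum[of j Basis ?b] that nn(2) add_increasing[OF nn(1), of "?b j" "\<Sum>j\<in>Basis. ?b j"] lt by fastforce
   have "f r <= (2 * (LBINT y. (cmod (v x y))\<^sup>2) + 2 * 1) +
     (\<Sum>j\<in>Basis. 2 * (LBINT y. (cmod (wgrad j (v x) y))\<^sup>2) + 2 * 1)"
    unfolding f_def using sq r x a1 b1 by (intro add_mono sum_mono l2_diff_bound) auto
   also have "... = 2 * f x + 2 * (1 + DIM('a))"
    by (simp add: f_def sum.distrib sum_distrib_left algebra_simps)
   finally show ?thesis .
  qed
  then show "\<exists>d>0. \<exists>B. \<forall>y\<in>{s..t}. \<bar>y - x\<bar> < d --> f y <= B" using d(1) by blast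
 qed
 then obtain B where B: "!!r. r \<in> {s..t} ==> f r <= B" by blast
 show thesis
 \<comment> \<open>The added 1 provides the strict positivity that \<open>local_Lp_bound\<close>
   asks of V.\<close>
 proof (rule that[of "sqrt \<bar>B\<bar> + 1"])
  fix r assume r: "r \<in> {s..t}"
  have nn: "(LBINT x. (cmod (v r x))\<^sup>2) >= 0" "!!j. (LBINT x. (cmod (wgrad j (v r) x))\<^sup>2) >= 0" by auto
  have "(LBINT x. (cmod (v r x))\<^sup>2) <= \<bar>B\<bar>"
   using B[OF r] nn sum_nonneg[of Basis "\<lambda>j. (LBINT x. (cmod (wgrad j (v r) x))\<^sup>2)"]
   unfolding f_def by fastforce
  then have "l2n (v r) <= sqrt \<bar>B\<bar> + 1" unfolding l2n_def by (simp add: add_increasing2)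
  moreover have "l2n (wgrad j (v r)) <= sqrt \<bar>B\<bar> + 1" if "j \<in> Basis" for j
  proof -
   have "(LBINT x. (cmod (wgrad j (v r) x))\<^sup>2) <= (\<Sum>j\<in>Basis. (LBINT x. (cmod (wgrad j (v r) x))\<^sup>2))"
    using member_le_sum[of j Basis "\<lambda>j. (LBINT x. (cmod (wgrad j (v r) x))\<^sup>2)"] that nn by simp
   then have "(LBINT x. (cmod (wgrad j (v r) x))\<^sup>2) <= \<bar>B\<bar>" using B[OF r] nn(1) unfolding f_def by linarith
   then show ?thesis unfolding l2n_def by (simp add: add_increasing2)
  qed
  ultimately show "sq_int (v r) \<and> l2n (v r) <= sqrt \<bar>B\<bar> + 1 \<and>
   (\<forall>j\<in>Basis. weak_pd j (v r) (wgrad j (v r)) \<and> sq_int (wgrad j (v r)) \<and> l2n (wgrad j (v r)) <= sqrt \<bar>B\<bar> + 1)"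
   using sq[OF r] by blast
 qed (simp add: add_nonneg_pos)
qed

text \<open>The third formula is what appears when the first order term of the equation is
  integrated by parts onto the gauged test function.\<close>

lemma lap_exp_mult:
 fixes w h :: "'a::euclidean_space => complex"
 assumes w: "smooth_fn w" and h: "smooth_fn h" and j: "j \<in> Basis"
 shows "dpart [j] (\<lambda>x. exp (w x) * h x) = (\<lambda>x. exp (w x) * (dpart [j] w x * h x + dpart [j] h x))"
  and "dpart [j, j] (\<lambda>x. exp (w x) * h x) = (\<lambda>x. exp (w x) *
   ((dpart [j] w x)\<^sup>2 * h x + dpart [j, j] w x * h x + 2 * dpart [j] w x * dpart [j] h x + dpart [j, j] h x))"
  and "dpart [j] (\<lambda>x. dpart [j] w x * (exp (w x) * h x)) =
   (\<lambda>x. exp (w x) * (dpart [j, j] w x * h x + (dpart [j] w x)\<^sup>2 * h x + dpart [j] w x * dpart [j] h x))"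
proof -
 have w1: "pdir j w (dpart [j] w)" and h1: "pdir j h (dpart [j] h)"
  using smooth_pdir1[OF w j] smooth_pdir1[OF h j] .
 have w2: "pdir j (dpart [j] w) (dpart [j, j] w)" and h2: "pdir j (dpart [j] h) (dpart [j, j] h)"
  using smooth_pdir[OF w _ j, of "[j]"] smooth_pdir[OF h _ j, of "[j]"] j by auto
 have e1: "pdir j (\<lambda>x. exp (w x) * h x) (\<lambda>x. exp (w x) * dpart [j] h x + (dpart [j] w x * exp (w x)) * h x)"
  by (rule pdir_mult[OF pdir_exp[OF w1] h1])
 have eq1: "(\<lambda>x. exp (w x) * dpart [j] h x + (dpart [j] w x * exp (w x)) * h x) =
   (\<lambda>x. exp (w x) * (dpart [j] w x * h x + dpart [j] h x))"
  by (simp only: fun_eq_iff) (simp only: algebra_simps simp_thms)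
 show d1: "dpart [j] (\<lambda>x. exp (w x) * h x) = (\<lambda>x. exp (w x) * (dpart [j] w x * h x + dpart [j] h x))"
  using pdir_dpart1[OF e1] eq1 by (rule trans)
 have e2: "pdir j (\<lambda>x. exp (w x) * (dpart [j] w x * h x + dpart [j] h x))
   (\<lambda>x. exp (w x) * ((dpart [j] w x * dpart [j] h x + dpart [j, j] w x * h x) + dpart [j, j] h x) +
    (dpart [j] w x * exp (w x)) * (dpart [j] w x * h x + dpart [j] h x))"
  by (intro pdir_mult pdir_exp pdir_add w1 w2 h1 h2)
 have "dpart [j, j] (\<lambda>x. exp (w x) * h x) = dpart [j] (\<lambda>x. exp (w x) * (dpart [j] w x * h x + dpart [j] h x))"
  unfolding d1[symmetric] using dpart_append[of "[j]" "[j]"] by simp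
 also have "... = (\<lambda>x. exp (w x) * ((dpart [j] w x * dpart [j] h x + dpart [j, j] w x * h x) + dpart [j, j] h x) +
    (dpart [j] w x * exp (w x)) * (dpart [j] w x * h x + dpart [j] h x))"
  by (rule pdir_dpart1[OF e2])
 finally show "dpart [j, j] (\<lambda>x. exp (w x) * h x) = (\<lambda>x. exp (w x) *
   ((dpart [j] w x)\<^sup>2 * h x + dpart [j, j] w x * h x + 2 * dpart [j] w x * dpart [j] h x + dpart [j, j] h x))"
  by (simp only: fun_eq_iff) (simp add: algebra_simps power2_eq_square del: dpart.simps)
 have e3: "pdir j (\<lambda>x. dpart [j] w x * (exp (w x) * h x))
   (\<lambda>x. dpart [j] w x * (exp (w x) * dpart [j] h x + (dpart [j] w x * exp (w x)) * h x) + dpart [j, j] w x * (exp (w x) * h x))"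
  by (intro pdir_mult pdir_exp w1 w2 h1)
 show "dpart [j] (\<lambda>x. dpart [j] w x * (exp (w x) * h x)) =
   (\<lambda>x. exp (w x) * (dpart [j, j] w x * h x + (dpart [j] w x)\<^sup>2 * h x + dpart [j] w x * dpart [j] h x))"
  unfolding pdir_dpart1[OF e3] by (simp only: fun_eq_iff) (simp add: algebra_simps power2_eq_square del: dpart.simps)
qed

text \<open>The identity \<Delta>(e^w v) = e^w (\<Delta> v + 2 \<nabla>w . \<nabla>v +
  (|\<nabla>w|^2 + \<Delta>w) v), tested against h. Only first weak derivatives of v are at hand, so
  the gradient term is integrated by parts onto \<open>\<theta>\<close>; what is left is a pointwise
  identity between test functions.\<close>

lemma gauge_identity:
 fixes v w h :: "'a::euclidean_space => complex"
 assumes v: "sq_int v" and g: "!!j. j \<in> Basis ==> weak_pd j v (g j) \<and> sq_int (g j)"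
  and w: "smooth_fn w" and h: "test_fn h"
 defines "\<theta> \<equiv> (\<lambda>x. exp (w x) * h x)"
 shows "(LBINT x. v x * lap \<theta> x) + (LBINT x. (\<Sum>j\<in>Basis. 2 * dpart [j] w x * g j x) * \<theta> x)
   + (LBINT x. ((\<Sum>j\<in>Basis. (dpart [j] w x)\<^sup>2) + lap w x) * v x * \<theta> x)
   = (LBINT x. exp (w x) * v x * lap h x)"
proof -
 have hs: "smooth_fn h" by (rule test_fn_smooth[OF h])
 have ew: "smcl (\<lambda>x. exp (w x))" by (intro smcl.exp smcl.smooth w)
 have th: "test_fn \<theta>" unfolding \<theta>_def by (rule test_fn_mult[OF h ew])
 have dw: "smcl (dpart [j] w)" "smcl (dpart [j, j] w)" if "j \<in> Basis" for j
  using that by (auto intro!: smcl.smooth smooth_dpart[OF w] simp del: dpart.simps)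
 have t1: "test_fn (dpart [j, j] \<theta>)" if "j \<in> Basis" for j
  by (rule test_fn_dpart[OF th]) (use that in simp)
 have t2: "test_fn (\<lambda>x. dpart [j] w x * \<theta> x)" if "j \<in> Basis" for j
  by (rule test_fn_mult[OF th dw(1)[OF that]])
 have t2': "test_fn (dpart [j] (\<lambda>x. dpart [j] w x * \<theta> x))" if "j \<in> Basis" for j
  by (rule test_fn_dpart[OF t2[OF that]]) (use that in simp)
 have t3: "test_fn (\<lambda>x. ((dpart [j] w x)\<^sup>2 + dpart [j, j] w x) * \<theta> x)" if "j \<in> Basis" for j
  by (rule test_fn_mult[OF th]) (intro smcl.add smcl_power dw that)
 have t4: "test_fn (\<lambda>x. exp (w x) * dpart [j, j] h x)" if "j \<in> Basis" for j
  by (rule test_fn_mult[OF test_fn_dpart[OF h] ew]) (use that in simp)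
 have iv: "integrable lborel (\<lambda>x. v x * f x)" if "test_fn f" for f
  by (rule sq_int_mult[OF v test_fn_sq_int[OF that]])
 have ig: "integrable lborel (\<lambda>x. g j x * f x)" if "test_fn f" "j \<in> Basis" for f j
  using g[OF that(2)] by (intro sq_int_mult[OF _ test_fn_sq_int[OF that(1)]]) auto
 let ?A = "\<lambda>j. (LBINT x. v x * dpart [j, j] \<theta> x)"
 let ?B = "\<lambda>j. (LBINT x. g j x * (dpart [j] w x * \<theta> x))"
 let ?C = "\<lambda>j. (LBINT x. v x * (((dpart [j] w x)\<^sup>2 + dpart [j, j] w x) * \<theta> x))"
 let ?D = "\<lambda>j. (LBINT x. v x * (exp (w x) * dpart [j, j] h x))"
 have A: "(LBINT x. v x * lap \<theta> x) = (\<Sum>j\<in>Basis. ?A j)"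
  unfolding lap_def sum_distrib_left by (rule Bochner_Integration.integral_sum) (intro iv t1)
 have B: "(LBINT x. (\<Sum>j\<in>Basis. 2 * dpart [j] w x * g j x) * \<theta> x) = (\<Sum>j\<in>Basis. 2 * ?B j)"
 proof -
  have "(\<lambda>x. (\<Sum>j\<in>Basis. 2 * dpart [j] w x * g j x) * \<theta> x) = (\<lambda>x. \<Sum>j\<in>Basis. 2 * (g j x * (dpart [j] w x * \<theta> x)))"
   by (simp only: sum_distrib_right) (simp only: mult_ac)
  then have "(LBINT x. (\<Sum>j\<in>Basis. 2 * dpart [j] w x * g j x) * \<theta> x)
   = (\<Sum>j\<in>Basis. (LBINT x. 2 * (g j x * (dpart [j] w x * \<theta> x))))"
   by (simp only:) (intro Bochner_Integration.integral_sum integrable_mult_right ig t2)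
  then show ?thesis by (simp only: integral_mult_right_zero)
 qed
 have C: "(LBINT x. ((\<Sum>j\<in>Basis. (dpart [j] w x)\<^sup>2) + lap w x) * v x * \<theta> x) = (\<Sum>j\<in>Basis. ?C j)"
 proof -
  have "(\<lambda>x. ((\<Sum>j\<in>Basis. (dpart [j] w x)\<^sup>2) + lap w x) * v x * \<theta> x) =
    (\<lambda>x. \<Sum>j\<in>Basis. v x * (((dpart [j] w x)\<^sup>2 + dpart [j, j] w x) * \<theta> x))"
   by (simp only: lap_def sum.distrib[symmetric] sum_distrib_right) (simp only: mult_ac)
  then show ?thesis by (simp only:) (intro Bochner_Integration.integral_sum iv t3)
 qed
 have D: "(LBINT x. exp (w x) * v x * lap h x) = (\<Sum>j\<in>Basis. ?D j)"
 proof -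
  have "(\<lambda>x. exp (w x) * v x * lap h x) = (\<lambda>x. \<Sum>j\<in>Basis. v x * (exp (w x) * dpart [j, j] h x))"
   by (simp only: lap_def sum_distrib_left) (simp only: mult_ac)
  then show ?thesis by (simp only:) (intro Bochner_Integration.integral_sum iv t4)
 qed
 \<comment> \<open>With primes for the derivative along j and \<open>\<theta>\<close> = e^w h, the
   function \<theta>'' - 2 (w' \<theta>)' + (w'^2 + w'') \<theta> equals e^w h''.\<close>
 have main: "?A j + 2 * ?B j + ?C j = ?D j" if j: "j \<in> Basis" for j
 proof -
  have "?B j = - (LBINT x. v x * dpart [j] (\<lambda>x. dpart [j] w x * \<theta> x) x)"
  proof -
   have "(LBINT x. v x * dpart [j] (\<lambda>x. dpart [j] w x * \<theta> x) x) = - ?B j"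
    using g[OF j] t2[OF j] unfolding weak_pd_def by blast
   then show ?thesis by (simp only: minus_minus)
  qed
  then have "?A j + 2 * ?B j + ?C j = ?A j + (- 2) * (LBINT x. v x * dpart [j] (\<lambda>x. dpart [j] w x * \<theta> x) x) + ?C j"
   by simp
  also have "... = (LBINT x. v x * dpart [j, j] \<theta> x + (- 2) * (v x * dpart [j] (\<lambda>x. dpart [j] w x * \<theta> x) x)
    + v x * (((dpart [j] w x)\<^sup>2 + dpart [j, j] w x) * \<theta> x))"
   using iv[OF t1[OF j]] iv[OF t2'[OF j]] iv[OF t3[OF j]]
   by (simp only: Bochner_Integration.integral_add Bochner_Integration.integrable_add integrable_mult_right integral_mult_right_zero)
  also have "... = ?D j"
   unfolding \<theta>_def lap_exp_mult[OF w hs j]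
   by (rule Bochner_Integration.integral_cong[OF refl]) (simp add: algebra_simps power2_eq_square del: dpart.simps)
  finally show ?thesis .
 qed
 show ?thesis unfolding A B C D sum.distrib[symmetric] by (intro sum.cong refl main)
qed

text \<open>The coefficients form a plain vector, so that W(t), the increments W(w) - W(u) and -W
  are all of this shape. Each is purely imaginary and its exponential has modulus 1.\<close>

definition phase :: "nat => (nat => 'a::euclidean_space => real) => (nat => real) => 'a => complex" where
 "phase N \<phi> a x = (\<Sum>k<N. \<i> * cplx (\<phi> k x * a k))"

lemma Wfun_phase: "Wfun N \<phi> Ip t = phase N \<phi> (\<lambda>k. Ip k t)"
 by (simp add: fun_eq_iff Wfun_def phase_def)

lemma phase_alt: "phase N \<phi> a x = \<i> * cplx (\<Sum>k<N. \<phi> k x * a k)"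
 by (simp add: phase_def sum_distrib_left)

lemma Re_phase [simp]: "Re (phase N \<phi> a x) = 0"
 unfolding phase_alt by simp

lemma cnj_phase: "cnj (phase N \<phi> a x) = - phase N \<phi> a x"
 unfolding phase_alt by simp

lemma phase_minus: "phase N \<phi> (\<lambda>k. - a k) x = - phase N \<phi> a x"
 by (simp add: phase_alt sum_negf)

lemma phase_diff: "phase N \<phi> (\<lambda>k. a k - b k) x = phase N \<phi> a x - phase N \<phi> b x"
 by (simp add: phase_alt right_diff_distrib sum_subtractf)

lemma lap_cnj:
 assumes "smooth_fn f"
 shows "lap (\<lambda>x. cnj (f x)) = (\<lambda>x. cnj (lap f x))"
proof -
 have d: "dpart [j, j] (\<lambda>x. cnj (f x)) = (\<lambda>x. cnj (dpart [j, j] f x))" if j: "j \<in> Basis" for j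
 proof -
  have 1: "dpart [j] (\<lambda>x. cnj (f x)) = (\<lambda>x. cnj (dpart [j] f x))"
   by (rule pdir_dpart1[OF pdir_cnj[OF smooth_pdir1[OF assms j]]])
  have "dpart [j, j] (\<lambda>x. cnj (f x)) = dpart [j] (dpart [j] (\<lambda>x. cnj (f x)))"
   using dpart_append[of "[j]" "[j]"] by simp
  also have "... = (\<lambda>x. cnj (dpart [j, j] f x))"
   unfolding 1 by (rule pdir_dpart1[OF pdir_cnj[OF smooth_pdir[OF assms _ j]]]) (use j in simp)
  finally show ?thesis .
 qed
 show ?thesis unfolding lap_def by (simp only: fun_eq_iff cnj_sum) (simp add: d del: dpart.simps)
qed

lemma test_fn_cnj: "test_fn f ==> test_fn (\<lambda>x. cnj (f x))"
 by (rule test_fnI[OF _ test_fn_bounded_support]) (auto intro: smcl.cnj test_fn_smcl)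

lemma test_fn_lap: "test_fn f ==> test_fn (lap f)"
proof (rule test_fnI)
 assume f: "test_fn f"
 show "smcl (lap f)" unfolding lap_def
  by (intro smcl_sum smcl.smooth smooth_dpart test_fn_smooth[OF f]) simp
 show "bounded (closure {x. f x \<noteq> 0})" using f by (auto simp: test_fn_def compact_imp_bounded)
 show "lap f x = 0" if "x \<notin> closure {x. f x \<noteq> 0}" for x
  using dpart_outside_support[OF that] by (simp add: lap_def del: dpart.simps)
qed

text \<open>One realisation on one compact window. \<open>Ip k\<close> stands for the integral of
  g_k against B_k, of which only Hoelder continuity enters here. The sign of H is left open, whence
  |H| in the estimates.\<close>

locale nls_window =
 fixes N :: nat and p \<alpha> H s t :: real and \<phi> :: "nat => 'a::euclidean_space => real"
  and Ip :: "nat => real => real" and I :: "real set" and v :: "real => 'a => complex"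
 assumes phi: "!!k. k < N ==> cb_inf_decay (\<phi> k)"
  and p: "1 <= p" "p <= 1 + 4 / real DIM('a)"
  and sol: "random_nls_sol N p \<phi> Ip I v" and st: "s <= t" "{s..t} \<subseteq> I"
  and al: "0 < \<alpha>" "\<alpha> < 1 / 2"
  and hol: "!!k u w. k < N ==> u \<in> {s..t} ==> w \<in> {s..t} ==> \<bar>Ip k w - Ip k u\<bar> <= H * \<bar>w - u\<bar> powr \<alpha>"
begin

definition X :: "real => 'a => complex" where
 "X r x = exp (phase N \<phi> (\<lambda>k. Ip k r) x) * v r x"

definition FF :: "('a => complex) => real => complex" where
 "FF \<psi> r = pair (X r) \<psi>"

text \<open>The drift of the tested equation before the correction \<mu>, which emerges only when
  the quadratic terms are read through the second level of the rough path.\<close>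

definition NL :: "('a => complex) => real => complex" where
 "NL \<psi> r = pair (\<lambda>x. \<i> * X r x) (lap \<psi>)
   + pair (\<lambda>x. \<i> * cplx (cmod (X r x) powr (p - 1)) * X r x) \<psi>"

lemma phi_smooth: "k < N ==> smooth_fn (\<phi> k)"
 using phi by (auto simp: cb_inf_decay_def)

lemma smcl_phase: "smcl (phase N \<phi> a)"
proof -
 have "smcl (\<lambda>x. \<Sum>k<N. (\<i> * cplx (a k)) * cplx (\<phi> k x))"
  by (intro smcl_sum smcl.mult smcl.const smcl.of_real phi_smooth) simp
 moreover have "phase N \<phi> a = (\<lambda>x. \<Sum>k<N. (\<i> * cplx (a k)) * cplx (\<phi> k x))"
  by (simp add: fun_eq_iff phase_def mult_ac)
 ultimately show ?thesis by simp
qed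

lemma smcl_exp_phase: "smcl (\<lambda>x. exp (phase N \<phi> a x))"
 by (rule smcl.exp[OF smcl_phase])

lemma dpart_phase:
 assumes "set js \<subseteq> Basis"
 shows "dpart js (phase N \<phi> a) = phase N (\<lambda>k. dpart js (\<phi> k)) a"
 using assms
proof (induction js)
 case (Cons j js)
 have "pdir j (phase N (\<lambda>k. dpart js (\<phi> k)) a) (phase N (\<lambda>k. dpart (j # js) (\<phi> k)) a)"
 proof -
  have 1: "pdir j (\<lambda>x. \<i> * cplx (a k) * cplx (dpart js (\<phi> k) x))
   (\<lambda>x. \<i> * cplx (a k) * cplx (dpart (j # js) (\<phi> k) x) + 0 * cplx (dpart js (\<phi> k) x))" if "k < N" for k
   by (intro pdir_mult pdir_const pdir_of_real smooth_pdir phi_smooth that) (use Cons in auto)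
  have 2: "pdir j (\<lambda>x. \<Sum>k\<in>A. f k x) (\<lambda>x. \<Sum>k\<in>A. f' k x)" if "finite A" "!!k. k \<in> A ==> pdir j (f k) (f' k)"
   for A and f f' :: "nat => 'a => complex"
   using that by (induction A) (auto intro: pdir_add pdir_const)
  have "pdir j (\<lambda>x. \<Sum>k<N. \<i> * cplx (a k) * cplx (dpart js (\<phi> k) x))
    (\<lambda>x. \<Sum>k<N. \<i> * cplx (a k) * cplx (dpart (j # js) (\<phi> k) x) + 0 * cplx (dpart js (\<phi> k) x))"
   using 1 by (intro 2) auto
  moreover have "(\<lambda>x. \<Sum>k<N. \<i> * cplx (a k) * cplx (dpart js (\<phi> k) x)) = phase N (\<lambda>k. dpart js (\<phi> k)) a"
   "(\<lambda>x. \<Sum>k<N. \<i> * cplx (a k) * cplx (dpart (j # js) (\<phi> k) x) + 0 * cplx (dpart js (\<phi> k) x)) = phase N (\<lambda>k. dpart (j # js) (\<phi> k)) a"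
   by (simp_all add: fun_eq_iff phase_def mult_ac del: dpart.simps)
  ultimately show ?thesis by simp
 qed
 then show ?case using Cons pdir_dpart[of j js "phase N \<phi> a"] by (simp del: dpart.simps)
qed simp

lemma phi_bound:
 obtains B where "B >= 0" "!!k js j x. k < N ==> j \<in> Basis ==> js \<in> {[], [j], [j, j]} ==> \<bar>dpart js (\<phi> k) x\<bar> <= B"
proof -
 define L where "L = insert [] ((\<lambda>j. [j]) ` (Basis :: 'a set) \<union> (\<lambda>j. [j, j]) ` Basis)"
 have fin: "finite ({..<N} \<times> L)" by (simp add: L_def)
 have "\<exists>B\<ge>0. \<forall>a\<in>{..<N} \<times> L. \<forall>x. \<bar>dpart (snd a) (\<phi> (fst a)) x\<bar> <= B"
 proof (rule finite_uniform_bound[OF fin])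
  fix a assume "a \<in> {..<N} \<times> L"
  then have "fst a < N" "set (snd a) \<subseteq> Basis" by (auto simp: L_def)
  then have "bounded (range (dpart (snd a) (\<phi> (fst a))))" using phi unfolding cb_inf_decay_def by blast
  then show "\<exists>B. \<forall>x. \<bar>dpart (snd a) (\<phi> (fst a)) x\<bar> <= B" by (auto simp: bounded_iff simp del: dpart.simps)
 qed
 then obtain B where B: "B >= 0" "!!k js x. k < N ==> js \<in> L ==> \<bar>dpart js (\<phi> k) x\<bar> <= B" by (metis SigmaI fst_conv lessThan_iff snd_conv)
 show thesis
 proof (rule that[OF B(1)])
  fix k js x and j :: 'a assume "k < N" "j \<in> Basis" "js \<in> {[], [j], [j, j]}"
  then show "\<bar>dpart js (\<phi> k) x\<bar> <= B" by (intro B(2)) (auto simp: L_def simp del: dpart.simps)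
 qed
qed

lemma phase_bound:
 assumes "!!k. k < N ==> \<bar>\<eta> k x\<bar> <= B"
 shows "cmod (phase N \<eta> a x) <= B * (\<Sum>k<N. \<bar>a k\<bar>)"
proof -
 have "cmod (phase N \<eta> a x) <= (\<Sum>k<N. cmod (\<i> * cplx (\<eta> k x * a k)))"
  unfolding phase_def by (rule norm_sum)
 also have "... <= (\<Sum>k<N. B * \<bar>a k\<bar>)"
  by (rule sum_mono) (use assms in \<open>auto simp: norm_mult abs_mult intro!: mult_right_mono\<close>)
 finally show ?thesis by (simp add: sum_distrib_left)
qed

text \<open>The exponent is \<i> times a real number, so the Taylor remainders are bounded by pure
  powers of it, however large it is.\<close>

lemma exp_phase_bound:
 "cmod (exp (phase N \<eta> a x) - 1) <= cmod (phase N \<eta> a x)"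
 "cmod (exp (phase N \<eta> a x) - 1 - phase N \<eta> a x - (phase N \<eta> a x)\<^sup>2 / 2) <= cmod (phase N \<eta> a x) ^ 3"
proof -
 let ?T = "\<Sum>k<N. \<eta> k x * a k"
 show "cmod (exp (phase N \<eta> a x) - 1) <= cmod (phase N \<eta> a x)"
  using iexp_approx1[of ?T 0] by (simp add: phase_alt norm_mult del: of_real_sum)
 have "cmod (exp (phase N \<eta> a x) - 1 - phase N \<eta> a x - (phase N \<eta> a x)\<^sup>2 / 2) <= \<bar>?T\<bar> ^ 3 / 6"
  using iexp_approx1[of ?T 2] by (simp add: phase_alt eval_nat_numeral fact_Suc diff_diff_eq add_ac del: of_real_sum)
 also have "... <= \<bar>?T\<bar> ^ 3" by simp
 finally show "cmod (exp (phase N \<eta> a x) - 1 - phase N \<eta> a x - (phase N \<eta> a x)\<^sup>2 / 2) <= cmod (phase N \<eta> a x) ^ 3"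
  by (simp add: phase_alt norm_mult del: of_real_sum)
qed

text \<open>The gauge moves \<psi> and its Laplacian by an amount linear in the coefficients,
  uniformly in x. The bound R is what makes the squared gradient of the phase linear in them as
  well.\<close>

lemma gauge_test_bound:
 assumes \<psi>: "test_fn \<psi>"
 shows "\<exists>C\<ge>0. \<forall>a x. (\<Sum>k<N. \<bar>a k\<bar>) <= R -->
   cmod (exp (phase N \<phi> a x) * \<psi> x - \<psi> x) <= C * (\<Sum>k<N. \<bar>a k\<bar>) \<and>
   cmod (lap (\<lambda>x. exp (phase N \<phi> a x) * \<psi> x) x - lap \<psi> x) <= C * (\<Sum>k<N. \<bar>a k\<bar>)"
proof -
 obtain B where B: "B >= 0" "!!k js j x. k < N ==> j \<in> Basis ==> js \<in> {[], [j], [j, j]} ==> \<bar>dpart js (\<phi> k) x\<bar> <= B"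
  using phi_bound by metis
 obtain k0 :: 'a where k0: "k0 \<in> Basis" using nonempty_Basis by blast
 have "\<exists>M\<ge>0. \<forall>js\<in>insert [] ((\<lambda>j. [j]) ` Basis \<union> (\<lambda>j. [j, j]) ` Basis). \<forall>x. cmod (dpart js \<psi> x) <= M"
  by (rule finite_uniform_bound) (auto intro!: test_fn_bounded test_fn_dpart[OF \<psi>] simp del: dpart.simps(2))
 then obtain M where M: "M >= 0" "!!js x. js \<in> insert [] ((\<lambda>j. [j]) ` Basis \<union> (\<lambda>j. [j, j]) ` Basis) ==> cmod (dpart js \<psi> x) <= M"
  by metis
 have ph: "cmod (phase N \<phi> a x) <= B * (\<Sum>k<N. \<bar>a k\<bar>)" for a x
  by (rule phase_bound) (use B(2)[OF _ k0, of _ "[]"] in auto)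
 have dph: "cmod (dpart js (phase N \<phi> a) x) <= B * (\<Sum>k<N. \<bar>a k\<bar>)" if "j \<in> Basis" "js = [j] \<or> js = [j, j]" for a x j js
  using that unfolding dpart_phase[of js, OF iffD2[OF subset_code(1)], of a]
  by (subst dpart_phase) (auto intro!: phase_bound B(2)[OF _ that(1)] simp del: dpart.simps)
 define C where "C = M * B + DIM('a) * (B * B * \<bar>R\<bar> * M + B * M + 2 * B * M + B * M)"
 have MB: "M * B >= 0" "B * B * \<bar>R\<bar> * M + B * M + 2 * B * M + B * M >= 0" using M B by auto
 show ?thesis
 proof (intro exI[of _ C] conjI[of "C >= 0"] allI impI)
  show "C >= 0" using MB by (simp add: C_def)
  fix a :: "nat => real" and x assume R: "(\<Sum>k<N. \<bar>a k\<bar>) <= R"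
  define S where "S = (\<Sum>k<N. \<bar>a k\<bar>)"
  have S: "S >= 0" "S <= \<bar>R\<bar>" using R by (auto simp: S_def sum_nonneg)
  let ?e = "exp (phase N \<phi> a x)"
  have e1: "cmod (?e - 1) <= B * S" using exp_phase_bound(1) ph order_trans unfolding S_def by blast
  have p1: "cmod (\<psi> x) <= M" using M(2)[of "[]"] by simp
  have "?e * \<psi> x - \<psi> x = (?e - 1) * \<psi> x" by (simp add: algebra_simps)
  then have "cmod (?e * \<psi> x - \<psi> x) <= (B * S) * M"
   using e1 p1 B S by (simp add: norm_mult mult_mono)
  also have "... = (M * B) * S" by simp
  also have "... <= C * S" unfolding C_def using S MB by (intro mult_right_mono) auto
  finally have f1: "cmod (?e * \<psi> x - \<psi> x) <= C * (\<Sum>k<N. \<bar>a k\<bar>)" by (simp add: S_def)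
  let ?w = "phase N \<phi> a"
  have sw: "smooth_fn ?w" by (rule smcl_smooth[OF smcl_phase])
  have l1: "lap (\<lambda>x. exp (phase N \<phi> a x) * \<psi> x) x - lap \<psi> x = (\<Sum>j\<in>Basis.
    ?e * ((dpart [j] ?w x)\<^sup>2 * \<psi> x + dpart [j, j] ?w x * \<psi> x + 2 * dpart [j] ?w x * dpart [j] \<psi> x + dpart [j, j] \<psi> x) - dpart [j, j] \<psi> x)"
   unfolding lap_def sum_subtractf[symmetric]
   by (intro sum.cong refl) (simp only: lap_exp_mult(2)[OF sw test_fn_smooth[OF \<psi>]])
  have l2: "?e * (q + h) - h = ?e * q + (?e - 1) * h" for q h by (simp add: algebra_simps)
  have "cmod (lap (\<lambda>x. exp (phase N \<phi> a x) * \<psi> x) x - lap \<psi> x) <= (\<Sum>j\<in>(Basis::'a set). (B * B * \<bar>R\<bar> * M + B * M + 2 * B * M + B * M) * S)"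
   unfolding l1 l2
  proof (rule sum_norm_le)
   fix j :: 'a assume j: "j \<in> Basis"
   have d1: "cmod (dpart [j] ?w x) <= B * S" and d2: "cmod (dpart [j, j] ?w x) <= B * S"
    using dph[OF j] by (auto simp: S_def simp del: dpart.simps)
   have m1: "cmod (dpart [j] \<psi> x) <= M" and m2: "cmod (dpart [j, j] \<psi> x) <= M"
    using M(2) j by (auto simp del: dpart.simps)
   have a1: "cmod ((dpart [j] ?w x)\<^sup>2 * \<psi> x) <= (B * B * \<bar>R\<bar> * M) * S"
   proof -
    have "cmod ((dpart [j] ?w x)\<^sup>2 * \<psi> x) <= (B * S) * (B * \<bar>R\<bar>) * M"
     unfolding norm_mult power2_eq_square
     using d1 p1 S B M order_trans[OF d1 mult_left_mono[OF S(2) B(1)]]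
     by (intro mult_mono) auto
    then show ?thesis by (simp only: mult_ac)
   qed
   have a2: "cmod (dpart [j, j] ?w x * \<psi> x) <= (B * M) * S"
    using mult_mono[OF d2 p1] S B by (simp add: norm_mult mult_ac del: dpart.simps)
   have a3: "cmod (2 * dpart [j] ?w x * dpart [j] \<psi> x) <= (2 * B * M) * S"
    using mult_mono[OF d1 m1] S B by (simp add: norm_mult mult_ac del: dpart.simps)
   have a4: "cmod ((?e - 1) * dpart [j, j] \<psi> x) <= (B * M) * S"
    using mult_mono[OF e1 m2] S B by (simp add: norm_mult mult_ac del: dpart.simps)
   have "cmod (?e * ((dpart [j] ?w x)\<^sup>2 * \<psi> x + dpart [j, j] ?w x * \<psi> x + 2 * dpart [j] ?w x * dpart [j] \<psi> x) + (?e - 1) * dpart [j, j] \<psi> x)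
    <= cmod ((dpart [j] ?w x)\<^sup>2 * \<psi> x + dpart [j, j] ?w x * \<psi> x + 2 * dpart [j] ?w x * dpart [j] \<psi> x) + cmod ((?e - 1) * dpart [j, j] \<psi> x)"
    by (rule norm_triangle_le) (simp add: norm_mult del: dpart.simps)
   also have "... <= cmod ((dpart [j] ?w x)\<^sup>2 * \<psi> x) + cmod (dpart [j, j] ?w x * \<psi> x) + cmod (2 * dpart [j] ?w x * dpart [j] \<psi> x) + cmod ((?e - 1) * dpart [j, j] \<psi> x)"
    by (intro add_mono order_refl norm_triangle_le)
   also have "... <= (B * B * \<bar>R\<bar> * M + B * M + 2 * B * M + B * M) * S"
    unfolding distrib_right by (intro add_mono a1 a2 a3 a4)
   finally show "cmod (?e * ((dpart [j] ?w x)\<^sup>2 * \<psi> x + dpart [j, j] ?w x * \<psi> x + 2 * dpart [j] ?w x * dpart [j] \<psi> x) + (?e - 1) * dpart [j, j] \<psi> x)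
    <= (B * B * \<bar>R\<bar> * M + B * M + 2 * B * M + B * M) * S" .
  qed
  also have "... = (DIM('a) * (B * B * \<bar>R\<bar> * M + B * M + 2 * B * M + B * M)) * S" by simp
  also have "... <= C * S" unfolding C_def using S MB by (intro mult_right_mono) auto
  finally have "cmod (lap (\<lambda>x. exp (phase N \<phi> a x) * \<psi> x) x - lap \<psi> x) <= C * (\<Sum>k<N. \<bar>a k\<bar>)" by (simp add: S_def)
  with f1 show "cmod (?e * \<psi> x - \<psi> x) <= C * (\<Sum>k<N. \<bar>a k\<bar>) \<and>
    cmod (lap (\<lambda>x. exp (phase N \<phi> a x) * \<psi> x) x - lap \<psi> x) <= C * (\<Sum>k<N. \<bar>a k\<bar>)" ..
 qed
qed

text \<open>exp(W(r) - W(q)) \<psi>: the function against which X(r) is tested when v is tested with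
  the gauge frozen at q. It reduces to \<psi> for r = q.\<close>

definition gt :: "('a => complex) => real => real => 'a => complex" where
 "gt \<psi> q r x = exp (phase N \<phi> (\<lambda>k. Ip k r - Ip k q) x) * \<psi> x"

lemma test_fn_gt: "test_fn \<psi> ==> test_fn (gt \<psi> q r)"
 unfolding gt_def by (rule test_fn_mult[OF _ smcl_exp_phase])

lemma v_props:
 obtains V where "V > 0" "!!r. r \<in> {s..t} ==> sq_int (v r) \<and> l2n (v r) <= V \<and>
   (\<forall>j\<in>Basis. weak_pd j (v r) (wgrad j (v r)) \<and> sq_int (wgrad j (v r)) \<and> l2n (wgrad j (v r)) <= V)"
 by (rule cont_H1_bounds[OF _ st]) (use sol in \<open>auto simp: random_nls_sol_def\<close>)

lemma v_sq: "r \<in> {s..t} ==> sq_int (v r)"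
 using v_props by metis

lemma cmod_X: "cmod (X r x) = cmod (v r x)"
 by (simp add: X_def norm_mult)

lemma X_meas: "r \<in> {s..t} ==> X r \<in> borel_measurable borel"
proof -
 assume "r \<in> {s..t}"
 then have [measurable]: "v r \<in> borel_measurable borel" using v_sq by (simp add: sq_int_def)
 have [measurable]: "(\<lambda>x. exp (phase N \<phi> (\<lambda>k. Ip k r) x)) \<in> borel_measurable borel"
  by (rule borel_measurable_continuous_onI[OF smooth_continuous[OF smcl_smooth[OF smcl_exp_phase]]])
 show ?thesis unfolding X_def by measurable
qed

text \<open>The pairing conjugates its second argument and W is imaginary, so testing with
  exp(-W(r)) \<eta> multiplies v by exp(W(r)). \<open>gauge_identity\<close> absorbs the terms with
  b and c, and the nonlinearity is transported because |X| = |v|.\<close>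

lemma NL_gauge:
 assumes eta: "test_fn \<eta>" and r: "r \<in> {s..t}"
 defines "\<Psi> \<equiv> (\<lambda>x. exp (- phase N \<phi> (\<lambda>k. Ip k r) x) * \<eta> x)"
 shows "pair (\<lambda>x. \<i> * v r x) (lap \<Psi>)
    + pair (\<lambda>x. \<i> * (\<Sum>j\<in>Basis. bcoef N \<phi> Ip j r x * wgrad j (v r) x)) \<Psi>
    + pair (\<lambda>x. \<i> * ccoef N \<phi> Ip r x * v r x) \<Psi>
    + pair (\<lambda>x. \<i> * cplx ((cmod (v r x)) powr (p - 1)) * v r x) \<Psi> = NL \<eta> r"
proof -
 let ?w = "phase N \<phi> (\<lambda>k. Ip k r)"
 let ?h = "\<lambda>x. cnj (\<eta> x)"
 let ?th = "\<lambda>x. exp (?w x) * ?h x"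
 have cP: "cnj (\<Psi> x) = ?th x" for x
  by (simp add: \<Psi>_def cnj_phase exp_cnj)
 have sP: "smooth_fn \<Psi>"
 proof -
  have "smcl (\<lambda>x. exp (phase N \<phi> (\<lambda>k. - Ip k r) x))" by (rule smcl_exp_phase)
  then show ?thesis unfolding \<Psi>_def phase_minus
   by (intro smcl_smooth smcl.mult test_fn_smcl[OF eta])
 qed
 have lP: "cnj (lap \<Psi> x) = lap ?th x" for x
  using lap_cnj[OF sP] by (simp add: cP fun_eq_iff del: complex_cnj_mult)
 have lh: "lap ?h x = cnj (lap \<eta> x)" for x
  using lap_cnj[OF test_fn_smooth[OF eta]] by (simp add: fun_eq_iff)
 obtain V where V: "!!j. j \<in> Basis ==> weak_pd j (v r) (wgrad j (v r)) \<and> sq_int (wgrad j (v r))"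
  using v_props r by metis
 have gi: "(LBINT x. v r x * lap ?th x) + (LBINT x. (\<Sum>j\<in>Basis. 2 * dpart [j] ?w x * wgrad j (v r) x) * ?th x)
   + (LBINT x. ((\<Sum>j\<in>Basis. (dpart [j] ?w x)\<^sup>2) + lap ?w x) * v r x * ?th x)
   = (LBINT x. exp (?w x) * v r x * lap ?h x)"
  by (rule gauge_identity[OF v_sq[OF r] V smcl_smooth[OF smcl_phase] test_fn_cnj[OF eta]])
 have 1: "pair (\<lambda>x. \<i> * v r x) (lap \<Psi>) = \<i> * (LBINT x. v r x * lap ?th x)"
  unfolding pair_def lP by (simp only: mult.assoc integral_mult_right_zero)
 have 2: "pair (\<lambda>x. \<i> * (\<Sum>j\<in>Basis. bcoef N \<phi> Ip j r x * wgrad j (v r) x)) \<Psi> =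
   \<i> * (LBINT x. (\<Sum>j\<in>Basis. 2 * dpart [j] ?w x * wgrad j (v r) x) * ?th x)"
  unfolding pair_def cP bcoef_def Wfun_phase by (simp only: mult.assoc integral_mult_right_zero)
 have 3: "pair (\<lambda>x. \<i> * ccoef N \<phi> Ip r x * v r x) \<Psi> =
   \<i> * (LBINT x. ((\<Sum>j\<in>Basis. (dpart [j] ?w x)\<^sup>2) + lap ?w x) * v r x * ?th x)"
  unfolding pair_def cP ccoef_def Wfun_phase by (simp only: mult.assoc integral_mult_right_zero)
 have 4: "pair (\<lambda>x. \<i> * X r x) (lap \<eta>) = \<i> * (LBINT x. exp (?w x) * v r x * lap ?h x)"
  unfolding pair_def lh X_def by (simp only: mult.assoc integral_mult_right_zero)
 have 5: "pair (\<lambda>x. \<i> * cplx ((cmod (v r x)) powr (p - 1)) * v r x) \<Psi> =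
   pair (\<lambda>x. \<i> * cplx (cmod (X r x) powr (p - 1)) * X r x) \<eta>"
  unfolding pair_def cP cmod_X
  by (rule Bochner_Integration.integral_cong[OF refl]) (simp only: X_def mult_ac)
 show ?thesis unfolding NL_def 1 2 3 4 5 gi[symmetric] by (simp only: distrib_left)
qed

text \<open>As |X| = |v|, the local bound applies to X; exponent p serves the nonlinearity and
  exponent 1 the linear pairing.\<close>

lemma X_local_bound:
 assumes K: "K \<in> sets borel" "bounded K"
 shows "\<exists>A\<ge>0. \<forall>r\<in>{s..t}. integral\<^sup>N lborel (\<lambda>x. ennreal (cmod (X r x) powr p * indicator K x)) <= ennreal A
  \<and> integral\<^sup>N lborel (\<lambda>x. ennreal (cmod (X r x) * indicator K x)) <= ennreal A"
proof -
 obtain V where V: "V > 0" "!!r. r \<in> {s..t} ==> sq_int (v r) \<and> l2n (v r) <= V \<and>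
   (\<forall>j\<in>Basis. weak_pd j (v r) (wgrad j (v r)) \<and> sq_int (wgrad j (v r)) \<and> l2n (wgrad j (v r)) <= V)"
  using v_props by metis
 obtain A where A: "A >= 0" "\<forall>(v :: 'a => complex) g. sq_int v \<and> l2n v <= V \<and>
   (\<forall>j\<in>Basis. weak_pd j v (g j) \<and> sq_int (g j) \<and> l2n (g j) <= V) -->
   integral\<^sup>N lborel (\<lambda>x. ennreal (cmod (v x) powr p * indicator K x)) <= ennreal A"
  using local_Lp_bound[OF K V(1) p, of V] by (elim exE conjE) (rule that)
 obtain A' where A': "A' >= 0" "\<forall>(v :: 'a => complex) g. sq_int v \<and> l2n v <= V \<and>
   (\<forall>j\<in>Basis. weak_pd j v (g j) \<and> sq_int (g j) \<and> l2n (g j) <= V) -->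
   integral\<^sup>N lborel (\<lambda>x. ennreal (cmod (v x) powr 1 * indicator K x)) <= ennreal A'"
 proof -
  have "(1::real) <= 1 + 4 / real DIM('a)" by simp
  from local_Lp_bound[OF K V(1) order_refl this, of V] show thesis by (elim exE conjE) (rule that)
 qed
 show ?thesis
 proof (intro exI[of _ "A + A'"] conjI ballI)
  fix r assume r: "r \<in> {s..t}"
  have "integral\<^sup>N lborel (\<lambda>x. ennreal (cmod (v r x) powr p * indicator K x)) <= ennreal A"
   using A(2)[rule_format, of "v r" "\<lambda>j. wgrad j (v r)"] V(2)[OF r] by blast
  also have "... <= ennreal (A + A')" using A A' by (intro ennreal_leI) simp
  finally show "integral\<^sup>N lborel (\<lambda>x. ennreal (cmod (X r x) powr p * indicator K x)) <= ennreal (A + A')" by (simp add: cmod_X)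
  have "integral\<^sup>N lborel (\<lambda>x. ennreal (cmod (v r x) powr 1 * indicator K x)) <= ennreal A'"
   using A'(2)[rule_format, of "v r" "\<lambda>j. wgrad j (v r)"] V(2)[OF r] by blast
  also have "... <= ennreal (A + A')" using A A' by (intro ennreal_leI) simp
  finally show "integral\<^sup>N lborel (\<lambda>x. ennreal (cmod (X r x) * indicator K x)) <= ennreal (A + A')" by (simp add: cmod_X)
 qed (use A A' in simp)
qed

abbreviation "nlin r x \<equiv> \<i> * cplx (cmod (X r x) powr (p - 1)) * X r x"

text \<open>A common interface for the linear and the nonlinear pairing, with \<epsilon> the sup
  bound of the weight. Weights are merely Borel, so it covers test functions, their differences and
  Taylor remainders alike.\<close>

definition pairing_bound :: "'a set => real => bool" where
 "pairing_bound K A \<longleftrightarrow> (\<forall>r f \<epsilon>. r \<in> {s..t} \<and> f \<in> borel_measurable borel \<and> (\<forall>x. cmod (f x) <= \<epsilon>) \<and> (\<forall>x. x \<notin> K --> f x = 0) -->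
    (integrable lborel (\<lambda>x. X r x * f x) \<and> cmod (LBINT x. X r x * f x) <= \<epsilon> * A) \<and>
    (integrable lborel (\<lambda>x. nlin r x * f x) \<and>
    cmod (LBINT x. nlin r x * f x) <= \<epsilon> * A))"

lemma pairing_boundD:
 assumes "pairing_bound K A" "r \<in> {s..t}" "f \<in> borel_measurable borel" "!!x. cmod (f x) <= \<epsilon>" "!!x. x \<notin> K ==> f x = 0"
 shows "integrable lborel (\<lambda>x. X r x * f x) \<and> cmod (LBINT x. X r x * f x) <= \<epsilon> * A"
  and "integrable lborel (\<lambda>x. nlin r x * f x) \<and>
    cmod (LBINT x. nlin r x * f x) <= \<epsilon> * A"
 using assms unfolding pairing_bound_def by blast+

lemma pairing_bounds:
 assumes K: "bounded K" "closed K"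
 shows "\<exists>A\<ge>0. pairing_bound K A"
proof -
 have Kb: "K \<in> sets borel" using K by (simp add: borel_closed)
 obtain A where A: "A >= 0"
  "!!r. r \<in> {s..t} ==> integral\<^sup>N lborel (\<lambda>x. ennreal (cmod (X r x) powr p * indicator K x)) <= ennreal A"
  "!!r. r \<in> {s..t} ==> integral\<^sup>N lborel (\<lambda>x. ennreal (cmod (X r x) * indicator K x)) <= ennreal A"
  using X_local_bound[OF Kb K(1)] by blast
 show ?thesis unfolding pairing_bound_def
 proof (intro exI[of _ A] conjI[OF A(1)] allI impI)
  fix r f \<epsilon> assume h: "r \<in> {s..t} \<and> f \<in> borel_measurable borel \<and> (\<forall>x. cmod (f x) <= \<epsilon>) \<and> (\<forall>x. x \<notin> K --> f x = 0)"
  then have r: "r \<in> {s..t}" and f: "f \<in> borel_measurable borel" "!!x. cmod (f x) <= \<epsilon>" "!!x. x \<notin> K ==> f x = 0" by auto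
  have e: "\<epsilon> >= 0" using f(2)[of 0] norm_ge_zero order_trans by blast
  note [measurable] = X_meas[OF r]
  have c1: "integrable lborel (\<lambda>x. X r x * f x) \<and> cmod (LBINT x. X r x * f x) <= \<epsilon> * A"
   using pair_bound[OF A(3)[OF r] A(1) _ Kb _ _ f e, of "X r"] X_meas[OF r] by simp
  have le: "cmod (nlin r x) <= cmod (X r x) powr p" for x
  proof (cases "X r x = 0")
   case False
   have "cmod (nlin r x) = cmod (X r x) powr (p - 1) * cmod (X r x)"
    by (simp add: norm_mult)
   then show ?thesis using False by (simp add: powr_diff)
  qed simp
  have m1: "(\<lambda>x. cmod (X r x) powr p) \<in> borel_measurable borel" by measurable
  have m2: "(\<lambda>x. nlin r x) \<in> borel_measurable borel" by measurable
  have c2: "integrable lborel (\<lambda>x. nlin r x * f x) \<and>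
    cmod (LBINT x. nlin r x * f x) <= \<epsilon> * A"
   using pair_bound[OF A(2)[OF r] A(1) m1 Kb m2 le f e] by blast
  show "(integrable lborel (\<lambda>x. X r x * f x) \<and> cmod (LBINT x. X r x * f x) <= \<epsilon> * A) \<and>
    (integrable lborel (\<lambda>x. nlin r x * f x) \<and>
    cmod (LBINT x. nlin r x * f x) <= \<epsilon> * A)"
   using c1 c2 by (rule conjI)
 qed
qed

lemma FF_bound:
 assumes "test_fn \<psi>"
 obtains M where "!!r. r \<in> {s..t} ==> cmod (FF \<psi> r) <= M"
proof -
 let ?K = "closure {x. \<psi> x \<noteq> 0}"
 have K: "bounded ?K" "closed ?K" using assms by (auto simp: test_fn_def compact_imp_bounded)
 obtain A where A0: "A >= 0" and PA: "pairing_bound ?K A"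
  using pairing_bounds[OF K] by blast
 note A2 = pairing_boundD(1)[OF PA]
 obtain M where M: "!!x. cmod (\<psi> x) <= M" using test_fn_bounded[OF assms] by blast
 have "cmod (FF \<psi> r) <= M * A" if "r \<in> {s..t}" for r
 proof -
  have "integrable lborel (\<lambda>x. X r x * cnj (\<psi> x)) \<and> cmod (LBINT x. X r x * cnj (\<psi> x)) <= M * A"
  proof (rule A2[OF that test_fn_borel[OF test_fn_cnj[OF assms]]])
   show "cnj (\<psi> x) = 0" if "x \<notin> ?K" for x using dpart_outside_support[OF that, of "[]"] by simp
  qed (use M in simp)
  then show ?thesis by (simp add: FF_def pair_def)
 qed
 then show thesis by (rule that)
qed

lemma FF_integrable:
 assumes "test_fn \<psi>" "r \<in> {s..t}"
 shows "integrable lborel (\<lambda>x. X r x * cnj (\<psi> x))"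
proof -
 have "sq_int (X r)" using v_sq[OF assms(2)] X_meas[OF assms(2)] by (simp add: sq_int_def cmod_X)
 then show ?thesis by (rule sq_int_mult[OF _ test_fn_sq_int[OF test_fn_cnj[OF assms(1)]]])
qed

text \<open>Freezing the gauge at q instead of r alters the test function and its Laplacian by
  O(|r-q|^\<alpha>) in the sup norm, and \<open>pairing_bounds\<close> carries this over to the
  drift uniformly in r.\<close>

lemma NL_lipschitz:
 assumes \<psi>: "test_fn \<psi>"
 obtains C where "C >= 0"
  "!!r q. r \<in> {s..t} ==> q \<in> {s..t} ==> cmod (NL (gt \<psi> q r) r - NL \<psi> r) <= C * \<bar>r - q\<bar> powr \<alpha>"
  "!!r. r \<in> {s..t} ==> cmod (NL \<psi> r) <= C"
proof -
 let ?K = "closure {x. \<psi> x \<noteq> 0}"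
 have K: "bounded ?K" "closed ?K" using \<psi> by (auto simp: test_fn_def compact_imp_bounded)
 obtain A where A0: "A >= 0" and PA: "pairing_bound ?K A"
  using pairing_bounds[OF K] by blast
 note A2 = pairing_boundD(1)[OF PA]
 note A3 = pairing_boundD(2)[OF PA]
 \<comment> \<open>Dominates the sum of |Ip k r - Ip k q| over k for all r and q in the
   window.\<close>
 define R where "R = real N * (\<bar>H\<bar> * (t - s) powr \<alpha>)"
 obtain C where C: "C >= 0" and CC: "\<forall>a x. (\<Sum>k<N. \<bar>a k\<bar>) <= R -->
   cmod (exp (phase N \<phi> a x) * \<psi> x - \<psi> x) <= C * (\<Sum>k<N. \<bar>a k\<bar>) \<and>
   cmod (lap (\<lambda>x. exp (phase N \<phi> a x) * \<psi> x) x - lap \<psi> x) <= C * (\<Sum>k<N. \<bar>a k\<bar>)"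
  using gauge_test_bound[OF \<psi>, of R] by (elim exE conjE) (rule that)
 obtain M1 where M1: "!!x. cmod (\<psi> x) <= M1" using test_fn_bounded[OF \<psi>] by blast
 obtain M2 where M2: "!!x. cmod (lap \<psi> x) <= M2" using test_fn_bounded[OF test_fn_lap[OF \<psi>]] by blast
 have supp: "\<psi> x = 0" "lap \<psi> x = 0" "gt \<psi> q r x = 0" "lap (gt \<psi> q r) x = 0" if "x \<notin> ?K" for x q r
 proof -
  have eq: "{x. gt \<psi> q r x \<noteq> 0} = {x. \<psi> x \<noteq> 0}" by (simp add: gt_def)
  show "\<psi> x = 0" using dpart_outside_support[OF that, of "[]"] by simp
  then show "gt \<psi> q r x = 0" by (simp add: gt_def)
  show "lap \<psi> x = 0" using dpart_outside_support[OF that] by (simp add: lap_def del: dpart.simps)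
  show "lap (gt \<psi> q r) x = 0" using dpart_outside_support[of x "gt \<psi> q r"] that unfolding eq by (simp add: lap_def del: dpart.simps)
 qed
 have csupp: "cnj (\<psi> x) = 0" "cnj (lap \<psi> x) = 0" "cnj (gt \<psi> q r x) - cnj (\<psi> x) = 0"
  "cnj (lap (gt \<psi> q r) x) - cnj (lap \<psi> x) = 0" if "x \<notin> ?K" for x q r
  unfolding supp[OF that] by simp_all
 have tm: "(\<lambda>x. cnj (f x)) \<in> borel_measurable borel" if "test_fn f" for f :: "'a => complex"
  by (rule test_fn_borel[OF test_fn_cnj[OF that]])
 have pX: "pair (\<lambda>x. \<i> * X r x) f = \<i> * (LBINT x. X r x * cnj (f x))" for r f
  unfolding pair_def by (simp only: mult.assoc integral_mult_right_zero)
 have b1: "cmod (NL \<psi> r) <= M2 * A + M1 * A" if r: "r \<in> {s..t}" for r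
 proof -
  have "cmod (LBINT x. X r x * cnj (lap \<psi> x)) <= M2 * A"
   by (rule conjunct2[OF A2[OF r tm[OF test_fn_lap[OF \<psi>]] _ csupp(2)]]) (simp only: complex_mod_cnj M2)
  moreover have "cmod (LBINT x. nlin r x * cnj (\<psi> x)) <= M1 * A"
   by (rule conjunct2[OF A3[OF r tm[OF \<psi>] _ csupp(1)]]) (simp only: complex_mod_cnj M1)
  ultimately show ?thesis unfolding NL_def pX
   unfolding pair_def by (intro norm_triangle_le) (simp add: norm_mult)
 qed
 have b2: "cmod (NL (gt \<psi> q r) r - NL \<psi> r) <= (2 * C * real N * \<bar>H\<bar> * A) * \<bar>r - q\<bar> powr \<alpha>"
  if r: "r \<in> {s..t}" and q: "q \<in> {s..t}" for r q
 proof -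
  let ?a = "\<lambda>k. Ip k r - Ip k q"
  have Sle: "(\<Sum>k<N. \<bar>?a k\<bar>) <= real N * (\<bar>H\<bar> * \<bar>r - q\<bar> powr \<alpha>)"
  proof -
   have "(\<Sum>k<N. \<bar>?a k\<bar>) <= (\<Sum>k<N. \<bar>H\<bar> * \<bar>r - q\<bar> powr \<alpha>)"
   proof (rule sum_mono)
    fix k assume "k \<in> {..<N}"
    then have "\<bar>?a k\<bar> <= H * \<bar>r - q\<bar> powr \<alpha>" using hol[of k q r] r q by auto
    also have "... <= \<bar>H\<bar> * \<bar>r - q\<bar> powr \<alpha>" by (intro mult_right_mono) auto
    finally show "\<bar>?a k\<bar> <= \<bar>H\<bar> * \<bar>r - q\<bar> powr \<alpha>" .
   qed
   then show ?thesis by simp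
  qed
  have "\<bar>r - q\<bar> powr \<alpha> <= (t - s) powr \<alpha>" using r q al by (intro powr_mono2) auto
  then have SR: "(\<Sum>k<N. \<bar>?a k\<bar>) <= R" using Sle unfolding R_def
   by (meson abs_ge_zero mult_left_mono of_nat_0_le_iff order_trans)
  define e where "e = C * (\<Sum>k<N. \<bar>?a k\<bar>)"
  have g1: "cmod (cnj (gt \<psi> q r x) - cnj (\<psi> x)) <= e" for x
   using CC[rule_format, OF SR, of x, THEN conjunct1] unfolding gt_def e_def by (metis complex_cnj_diff complex_mod_cnj)
  have g2: "cmod (cnj (lap (gt \<psi> q r) x) - cnj (lap \<psi> x)) <= e" for x
   using CC[rule_format, OF SR, of x, THEN conjunct2] unfolding gt_def[abs_def] e_def by (metis complex_cnj_diff complex_mod_cnj)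
  have tg: "test_fn (gt \<psi> q r)" by (rule test_fn_gt[OF \<psi>])
  have i1: "cmod (LBINT x. X r x * (cnj (lap (gt \<psi> q r) x) - cnj (lap \<psi> x))) <= e * A"
   by (rule conjunct2[OF A2[OF r borel_measurable_diff[OF tm[OF test_fn_lap[OF tg]] tm[OF test_fn_lap[OF \<psi>]]] g2 csupp(4)]])
  have i2: "cmod (LBINT x. nlin r x * (cnj (gt \<psi> q r x) - cnj (\<psi> x))) <= e * A"
   by (rule conjunct2[OF A3[OF r borel_measurable_diff[OF tm[OF tg] tm[OF \<psi>]] g1 csupp(3)]])
  have in1: "integrable lborel (\<lambda>x. nlin r x * cnj (f x))"
   if tf: "test_fn f" "!!x. x \<notin> ?K ==> f x = 0" for f
  proof -
   obtain M where "!!x. cmod (f x) <= M" using test_fn_bounded[OF tf(1)] by blast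
   then have M: "cmod (cnj (f x)) <= M" for x by simp
   have z: "cnj (f x) = 0" if "x \<notin> ?K" for x unfolding tf(2)[OF that] by simp
   show ?thesis by (rule conjunct1[OF A3[OF r tm[OF tf(1)] M z]])
  qed
  let ?G = "nlin r"
  have p2: "pair ?G f = (LBINT x. ?G x * cnj (f x))" for f by (simp only: pair_def)
  have d1: "(LBINT x. X r x * (cnj (lap (gt \<psi> q r) x) - cnj (lap \<psi> x))) =
    (LBINT x. X r x * cnj (lap (gt \<psi> q r) x)) - (LBINT x. X r x * cnj (lap \<psi> x))"
   unfolding right_diff_distrib
   by (rule Bochner_Integration.integral_diff[OF FF_integrable[OF test_fn_lap[OF tg] r] FF_integrable[OF test_fn_lap[OF \<psi>] r]])
  have d2: "(LBINT x. ?G x * (cnj (gt \<psi> q r x) - cnj (\<psi> x))) =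
    (LBINT x. ?G x * cnj (gt \<psi> q r x)) - (LBINT x. ?G x * cnj (\<psi> x))"
   unfolding right_diff_distrib[of "?G _"]
   by (rule Bochner_Integration.integral_diff[OF in1[OF tg supp(3)] in1[OF \<psi> supp(1)]])
  have "NL (gt \<psi> q r) r - NL \<psi> r = \<i> * (LBINT x. X r x * (cnj (lap (gt \<psi> q r) x) - cnj (lap \<psi> x)))
   + (LBINT x. ?G x * (cnj (gt \<psi> q r x) - cnj (\<psi> x)))"
   unfolding NL_def pX p2 d1 d2 by (simp only: right_diff_distrib) simp
  then have "cmod (NL (gt \<psi> q r) r - NL \<psi> r) <= cmod (\<i> * (LBINT x. X r x * (cnj (lap (gt \<psi> q r) x) - cnj (lap \<psi> x))))
   + cmod (LBINT x. ?G x * (cnj (gt \<psi> q r x) - cnj (\<psi> x)))"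
   by (simp only: norm_triangle_ineq)
  also have "... <= e * A + e * A"
   using i2 by (intro add_mono) (simp_all only: norm_mult norm_ii mult_1_left i1)
  also have "... = 2 * A * C * (\<Sum>k<N. \<bar>?a k\<bar>)" by (simp add: e_def)
  also have "... <= 2 * A * C * (real N * (\<bar>H\<bar> * \<bar>r - q\<bar> powr \<alpha>))"
   by (rule mult_left_mono[OF Sle]) (use A0 C in simp)
  finally show ?thesis by (simp add: mult_ac)
 qed
 define C' where "C' = \<bar>M2 * A + M1 * A\<bar> + 2 * C * real N * \<bar>H\<bar> * A"
 have nn: "2 * C * real N * \<bar>H\<bar> * A >= 0" using A0 C by simp
 show thesis
 proof (rule that[of C'])
  show "C' >= 0" using nn by (simp add: C'_def)
  show "cmod (NL \<psi> r) <= C'" if "r \<in> {s..t}" for r using b1[OF that] nn unfolding C'_def by linarith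
  show "cmod (NL (gt \<psi> q r) r - NL \<psi> r) <= C' * \<bar>r - q\<bar> powr \<alpha>" if "r \<in> {s..t}" "q \<in> {s..t}" for r q
   by (rule order_trans[OF b2[OF that]], rule mult_right_mono) (auto simp: C'_def)
 qed
qed

end

lemma set_integral_norm_le_const:
 fixes f :: "real => 'b::{banach, second_countable_topology}"
 assumes i: "set_integrable lborel {u..w} f" and b: "!!r. r \<in> {u..w} ==> norm (f r) <= c" and uw: "u <= w"
 shows "norm (sint u w f) <= c * (w - u)"
proof -
 have "norm (sint u w f) <= (LBINT x. norm (indicator {u..w} x *\<^sub>R f x))"
  unfolding set_lebesgue_integral_def by (rule integral_norm_bound)
 also have "... <= (LBINT x. c * indicator {u..w} x)"
 proof (rule Bochner_Integration.integral_mono)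
  show "integrable lborel (\<lambda>x. norm (indicator {u..w} x *\<^sub>R f x))"
   using i unfolding set_integrable_def by (rule integrable_norm)
  show "norm (indicator {u..w} x *\<^sub>R f x) <= c * indicator {u..w} x" for x
   using b by (auto simp: indicator_def)
 qed (simp add: uw)
 also have "... = c * (w - u)" using uw by simp
 finally show ?thesis .
qed

section \<open>Evolution and expansion of the tested solution\<close>

context nls_window
begin

abbreviation "dI k u w \<equiv> cplx (Ip k w - Ip k u)"
abbreviation "F1 \<psi> k \<equiv> FF (\<lambda>x. cplx (\<phi> k x) * \<psi> x)"
abbreviation "F2 \<psi> j k \<equiv> FF (\<lambda>x. cplx (\<phi> j x * \<phi> k x) * \<psi> x)"
text \<open>The quadratic term carries a plus sign because the second Taylor term of exp(W(w) -
  W(u)) contributes minus half the double sum, by \<i>^2 = -1, and is moved to the left.\<close>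

abbreviation "remainder \<psi> u w \<equiv> FF \<psi> w - FF \<psi> u - sint u w (NL \<psi>)
 - \<i> * (\<Sum>k<N. dI k u w * F1 \<psi> k u)
 + (\<Sum>j<N. \<Sum>k<N. cplx ((Ip j w - Ip j u) * (Ip k w - Ip k u)) * F2 \<psi> j k u) / 2"

text \<open>The gauge frozen at q gives a test function independent of time, admissible in the
  random equation. At a running time r it equals exp(-W(r)) times \<open>gt \<psi> q r\<close>, so
  \<open>NL_gauge\<close> identifies the integrand.\<close>

lemma weak_evolution:
 assumes \<psi>: "test_fn \<psi>" and q: "q \<in> {s..t}" and uw: "u \<in> {s..t}" "w \<in> {s..t}" "u < w"
 defines "\<Psi> \<equiv> (\<lambda>x. exp (- phase N \<phi> (\<lambda>k. Ip k q) x) * \<psi> x)"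
 shows "set_integrable lborel {u..w} (\<lambda>r. NL (gt \<psi> q r) r)"
  and "pair (v w) \<Psi> - pair (v u) \<Psi> = sint u w (\<lambda>r. NL (gt \<psi> q r) r)"
proof -
 have tP: "test_fn \<Psi>"
 proof -
  have "smcl (\<lambda>x. exp (phase N \<phi> (\<lambda>k. - Ip k q) x))" by (rule smcl_exp_phase)
  then show ?thesis unfolding \<Psi>_def phase_minus by (rule test_fn_mult[OF \<psi>])
 qed
 define D where "D r = pair (\<lambda>x. \<i> * v r x) (lap \<Psi>)
    + pair (\<lambda>x. \<i> * (\<Sum>j\<in>Basis. bcoef N \<phi> Ip j r x * wgrad j (v r) x)) \<Psi>
    + pair (\<lambda>x. \<i> * ccoef N \<phi> Ip r x * v r x) \<Psi>
    + pair (\<lambda>x. \<i> * cplx ((cmod (v r x)) powr (p - 1)) * v r x) \<Psi>" for r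
 have DN: "D r = NL (gt \<psi> q r) r" if "r \<in> {s..t}" for r
 proof -
  have "\<Psi> = (\<lambda>x. exp (- phase N \<phi> (\<lambda>k. Ip k r) x) * gt \<psi> q r x)"
   by (simp add: \<Psi>_def gt_def phase_diff fun_eq_iff flip: mult.assoc exp_add)
  then show ?thesis unfolding D_def using NL_gauge[OF test_fn_gt[OF \<psi>] that, of q r] by (simp only:)
 qed
 have h: "set_integrable lborel {u..w} D \<and> pair (v w) \<Psi> - pair (v u) \<Psi> = sint u w D"
  using sol[unfolded random_nls_sol_def, THEN conjunct2, rule_format, OF tP, of u w] uw st
  unfolding Let_def D_def[abs_def, symmetric] by blast
 have eq: "D r = NL (gt \<psi> q r) r" if "r \<in> {u..w}" for r using DN[of r] that uw by auto
 show "set_integrable lborel {u..w} (\<lambda>r. NL (gt \<psi> q r) r)"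
  using h set_integrable_cong[of lborel lborel "{u..w}" "{u..w}" D "\<lambda>r. NL (gt \<psi> q r) r"] eq by simp
 show "pair (v w) \<Psi> - pair (v u) \<Psi> = sint u w (\<lambda>r. NL (gt \<psi> q r) r)"
  using h set_lebesgue_integral_cong[of "{u..w}" lborel D "\<lambda>r. NL (gt \<psi> q r) r"] eq by auto
qed

lemma pair_gauge:
 "pair (v r) (\<lambda>x. exp (- phase N \<phi> (\<lambda>k. Ip k q) x) * \<psi> x) = (LBINT x. exp (phase N \<phi> (\<lambda>k. Ip k q - Ip k r) x) * X r x * cnj (\<psi> x))"
 unfolding pair_def
proof (rule Bochner_Integration.integral_cong[OF refl])
 fix x
 have "exp (phase N \<phi> (\<lambda>k. Ip k q - Ip k r) x) * exp (phase N \<phi> (\<lambda>k. Ip k r) x) = exp (phase N \<phi> (\<lambda>k. Ip k q) x)"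
  by (simp add: phase_diff flip: exp_add)
 then have "exp (phase N \<phi> (\<lambda>k. Ip k q - Ip k r) x) * X r x = exp (phase N \<phi> (\<lambda>k. Ip k q) x) * v r x"
  unfolding X_def by (metis mult.assoc)
 then show "v r x * cnj (exp (- phase N \<phi> (\<lambda>k. Ip k q) x) * \<psi> x) =
   exp (phase N \<phi> (\<lambda>k. Ip k q - Ip k r) x) * X r x * cnj (\<psi> x)"
  by (simp add: exp_cnj cnj_phase)
qed

lemma FF_gauge: "FF \<psi> r = pair (v r) (\<lambda>x. exp (- phase N \<phi> (\<lambda>k. Ip k r) x) * \<psi> x)"
 unfolding pair_gauge unfolding FF_def pair_def by (simp add: phase_def)

text \<open>The random equation gives integrability for fixed test functions, whereas here the gauge
  moves with r. With the gauge frozen at q the drift is integrable; letting q run through grid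
  points next to r produces measurable functions converging pointwise, and a uniform bound does the
  rest.\<close>

lemma NL_integrable:
 assumes \<psi>: "test_fn \<psi>"
 shows "set_integrable lborel {s..t} (NL \<psi>)"
proof (cases "s = t")
 case True
 have "integrable lborel (\<lambda>r. indicator {t} r *\<^sub>R NL \<psi> t)" by simp
 moreover have "(\<lambda>r. indicator {t} r *\<^sub>R NL \<psi> t) = (\<lambda>r. indicator {s..t} r *\<^sub>R NL \<psi> r)"
  using True by (auto simp: indicator_def)
 ultimately show ?thesis by (simp add: set_integrable_def)
next
 case False
 then have lt: "s < t" using st by simp
 obtain C where C: "C >= 0"
  "!!r q. r \<in> {s..t} ==> q \<in> {s..t} ==> cmod (NL (gt \<psi> q r) r - NL \<psi> r) <= C * \<bar>r - q\<bar> powr \<alpha>"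
  "!!r. r \<in> {s..t} ==> cmod (NL \<psi> r) <= C"
  by (rule NL_lipschitz[OF \<psi>]) blast
 \<comment> \<open>Grid points are clamped to the window so that \<open>weak_evolution\<close>
   applies. Countably many indices i keep the composition with the floor function
   measurable.\<close>
 define q where "q n i = min t (max s (real_of_int i / real (Suc n)))" for n :: nat and i :: int
 have q: "q n i \<in> {s..t}" for n i using lt by (auto simp: q_def)
 define f where "f n i r = indicator {s..t} r *\<^sub>R NL (gt \<psi> (q n i) r) r" for n i r
 have fm: "f n i \<in> borel_measurable lborel" for n i
  using weak_evolution(1)[OF \<psi> q[of n i], of s t] lt unfolding set_integrable_def f_def by auto
 define h where "h n r = f n \<lfloor>real (Suc n) * r\<rfloor> r" for n r
 have hm: "h n \<in> borel_measurable lborel" for n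
  unfolding h_def by (rule measurable_compose_countable[OF fm]) measurable
 have lim: "(\<lambda>n. h n r) \<longlonglongrightarrow> indicator {s..t} r *\<^sub>R NL \<psi> r" for r
 proof (cases "r \<in> {s..t}")
  case True
  have "(\<lambda>n. h n r - NL \<psi> r) \<longlonglongrightarrow> 0"
  proof (rule Lim_null_comparison)
   show "\<forall>\<^sub>F n in sequentially. norm (h n r - NL \<psi> r) <= C * (1 / real (Suc n)) powr \<alpha>"
   proof (rule always_eventually, rule allI)
    fix n
    let ?m = "real (Suc n)"
    let ?q = "q n \<lfloor>?m * r\<rfloor>"
    have "\<bar>r - ?q\<bar> <= 1 / ?m"
    proof -
     define y where "y = real_of_int \<lfloor>?m * r\<rfloor> / ?m"
     have y: "y <= r" "r - y <= 1 / ?m"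
     proof -
      have "real_of_int \<lfloor>?m * r\<rfloor> <= ?m * r" "?m * r < real_of_int \<lfloor>?m * r\<rfloor> + 1" by linarith+
      moreover have "a / m <= r \<and> r - a / m <= 1 / m" if "a <= m * r" "m * r < a + 1" "m > 0" for a m :: real
      proof -
       have "a / m <= r" using that by (simp add: pos_divide_le_eq mult.commute)
       moreover have "r <= (a + 1) / m" using that by (simp add: pos_le_divide_eq mult.commute)
       ultimately show ?thesis by (simp add: add_divide_distrib)
      qed
      ultimately show "y <= r" "r - y <= 1 / ?m" unfolding y_def by (metis of_nat_0_less_iff zero_less_Suc)+
     qed
     have "?q = max s y" unfolding q_def y_def[symmetric] using y True by auto
     then show ?thesis using y True by auto
    qed
    then have "\<bar>r - ?q\<bar> powr \<alpha> <= (1 / ?m) powr \<alpha>" using al by (intro powr_mono2) auto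
    then have "C * \<bar>r - ?q\<bar> powr \<alpha> <= C * (1 / ?m) powr \<alpha>" using C(1) by (rule mult_left_mono)
    moreover have "norm (h n r - NL \<psi> r) <= C * \<bar>r - ?q\<bar> powr \<alpha>"
     using C(2)[OF True q[of n "\<lfloor>?m * r\<rfloor>"]] True by (simp add: h_def f_def)
    ultimately show "norm (h n r - NL \<psi> r) <= C * (1 / ?m) powr \<alpha>" by linarith
   qed
   have "(\<lambda>n. (1 / real (Suc n)) powr \<alpha>) \<longlonglongrightarrow> 0 powr \<alpha>"
    by (rule tendsto_powr'[OF LIMSEQ_Suc[OF lim_1_over_n, unfolded o_def] tendsto_const]) (use al in auto)
   from tendsto_mult[OF tendsto_const this, of C] al
   show "(\<lambda>n. C * (1 / real (Suc n)) powr \<alpha>) \<longlonglongrightarrow> 0" by simp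
  qed
  then have "(\<lambda>n. h n r) \<longlonglongrightarrow> NL \<psi> r" by (simp add: LIM_zero_iff)
  then show ?thesis using True by simp
 qed (simp add: h_def f_def)
 have m: "(\<lambda>r. indicator {s..t} r *\<^sub>R NL \<psi> r) \<in> borel_measurable lborel"
  by (rule borel_measurable_LIMSEQ_metric[OF hm lim])
 have "integrable lborel (\<lambda>r. C * indicator {s..t} r :: real)"
  by (intro integrable_mult_right integrable_real_indicator) (use st in auto)
 then show ?thesis unfolding set_integrable_def
 proof (rule Bochner_Integration.integrable_bound[OF _ m])
  have "norm (indicator {s..t} r *\<^sub>R NL \<psi> r) <= C * indicator {s..t} r" for r
   using C(3)[of r] by (auto simp: indicator_def)
  then show "AE r in lborel. norm (indicator {s..t} r *\<^sub>R NL \<psi> r) <= norm (C * indicator {s..t} r :: real)"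
   using C(1) by (intro AE_I2) (auto simp: abs_mult)
 qed
qed

lemma Ip_increment:
 assumes "u \<in> {s..t}" "w \<in> {s..t}"
 shows "(\<Sum>k<N. \<bar>Ip k w - Ip k u\<bar>) <= real N * \<bar>H\<bar> * \<bar>w - u\<bar> powr \<alpha>"
proof -
 have "(\<Sum>k<N. \<bar>Ip k w - Ip k u\<bar>) <= (\<Sum>k<N. \<bar>H\<bar> * \<bar>w - u\<bar> powr \<alpha>)"
 proof (rule sum_mono)
  fix k assume "k \<in> {..<N}"
  then have "\<bar>Ip k w - Ip k u\<bar> <= H * \<bar>w - u\<bar> powr \<alpha>" using hol[of k u w] assms by auto
  also have "... <= \<bar>H\<bar> * \<bar>w - u\<bar> powr \<alpha>" by (intro mult_right_mono) auto
  finally show "\<bar>Ip k w - Ip k u\<bar> <= \<bar>H\<bar> * \<bar>w - u\<bar> powr \<alpha>" .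
 qed
 then show ?thesis by simp
qed

text \<open>F(w) - F(u) splits into the evolution of v under the gauge frozen at w and the change of
  gauge at fixed v(u). The former is the drift up to O((w-u)^(1+\<alpha>)); the latter is the
  integral of (exp(W(w) - W(u)) - 1) X(u) against the conjugate of \<psi>, expanded with a cubic
  remainder.\<close>

lemma FF_expansion:
 assumes \<psi>: "test_fn \<psi>"
 shows "\<exists>C\<ge>0. \<forall>u w. s <= u \<and> u <= w \<and> w <= t -->
   cmod (remainder \<psi> u w)
   <= C * (w - u) powr (3 * \<alpha>)"
proof -
 obtain C where C: "C >= 0"
  "!!r q. r \<in> {s..t} ==> q \<in> {s..t} ==> cmod (NL (gt \<psi> q r) r - NL \<psi> r) <= C * \<bar>r - q\<bar> powr \<alpha>"
  by (rule NL_lipschitz[OF \<psi>]) blast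
 obtain B where B: "B >= 0" "!!k js j x. k < N ==> j \<in> Basis ==> js \<in> {[], [j], [j, j]} ==> \<bar>dpart js (\<phi> k) x\<bar> <= B"
  using phi_bound by metis
 obtain k0 :: 'a where k0: "k0 \<in> Basis" using nonempty_Basis by blast
 have ph: "cmod (phase N \<phi> a x) <= B * (\<Sum>k<N. \<bar>a k\<bar>)" for a x
  by (rule phase_bound) (use B(2)[OF _ k0, of _ "[]"] in auto)
 let ?K = "closure {x. \<psi> x \<noteq> 0}"
 have K: "bounded ?K" "closed ?K" using \<psi> by (auto simp: test_fn_def compact_imp_bounded)
 obtain A where A0: "A >= 0" and PA: "pairing_bound ?K A"
  using pairing_bounds[OF K] by blast
 obtain M where M: "!!x. cmod (\<psi> x) <= M" using test_fn_bounded[OF \<psi>] by blast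
 have M0: "M >= 0" using M[of 0] norm_ge_zero order_trans by blast
 define Q where "Q = real N * \<bar>H\<bar>"
 have Q: "Q >= 0" by (simp add: Q_def)
 have tphi: "test_fn (\<lambda>x. cplx (\<phi> k x) * \<psi> x)" if "k < N" for k
  by (rule test_fn_mult[OF \<psi> smcl.of_real[OF phi_smooth[OF that]]])
 have tphi2: "test_fn (\<lambda>x. cplx (\<phi> j x * \<phi> k x) * \<psi> x)" if "j < N" "k < N" for j k
  unfolding of_real_mult
  by (rule test_fn_mult[OF \<psi> smcl.mult[OF smcl.of_real[OF phi_smooth[OF that(1)]] smcl.of_real[OF phi_smooth[OF that(2)]]]])
 have main: "cmod (remainder \<psi> u w)
   <= (C * (t - s) powr (1 - 2 * \<alpha>) + (B * Q) ^ 3 * M * A) * (w - u) powr (3 * \<alpha>)"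
  if uw: "s <= u" "u < w" "w <= t" for u w
 proof -
  have mem: "u \<in> {s..t}" "w \<in> {s..t}" using uw by auto
  let ?P = "\<lambda>q x. exp (- phase N \<phi> (\<lambda>k. Ip k q) x) * \<psi> x"
  let ?d = "\<lambda>k. Ip k w - Ip k u"
  let ?th = "phase N \<phi> ?d"
  let ?c = "\<lambda>x. cnj (\<psi> x)"
  note we = weak_evolution[OF \<psi> mem(2) mem uw(2)]
  have NLi: "set_integrable lborel {u..w} (NL \<psi>)"
   by (rule set_integrable_subset[OF NL_integrable[OF \<psi>]]) (use uw in auto)
  have E1: "cmod (pair (v w) (?P w) - pair (v u) (?P w) - sint u w (NL \<psi>)) <= (C * (w - u) powr \<alpha>) * (w - u)"
  proof -
   have "pair (v w) (?P w) - pair (v u) (?P w) - sint u w (NL \<psi>) =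
     sint u w (\<lambda>r. NL (gt \<psi> w r) r - NL \<psi> r)"
    unfolding we(2) by (rule set_integral_diff(2)[OF we(1) NLi, symmetric])
   also have "cmod ... <= (C * (w - u) powr \<alpha>) * (w - u)"
   proof (rule set_integral_norm_le_const)
    show "set_integrable lborel {u..w} (\<lambda>r. NL (gt \<psi> w r) r - NL \<psi> r)"
     by (rule set_integral_diff(1)[OF we(1) NLi])
    fix r assume r: "r \<in> {u..w}"
    have "cmod (NL (gt \<psi> w r) r - NL \<psi> r) <= C * \<bar>r - w\<bar> powr \<alpha>"
     by (rule C(2)) (use r uw in auto)
    also have "... <= C * (w - u) powr \<alpha>"
     by (intro mult_left_mono powr_mono2) (use C r al in auto)
    finally show "cmod (NL (gt \<psi> w r) r - NL \<psi> r) <= C * (w - u) powr \<alpha>" .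
   qed (use uw in simp)
   finally show ?thesis .
  qed
  \<comment> \<open>1 + \<alpha> = (1 - 2\<alpha>) + 3\<alpha> with 1 - 2\<alpha> > 0, so the
    surplus power is absorbed by the length of the window.\<close>
  have P1: "(w - u) powr \<alpha> * (w - u) <= (t - s) powr (1 - 2 * \<alpha>) * (w - u) powr (3 * \<alpha>)"
  proof -
   have "(w - u) powr \<alpha> * (w - u) = (w - u) powr (1 - 2 * \<alpha>) * (w - u) powr (3 * \<alpha>)"
   proof -
    have "(w - u) powr \<alpha> * (w - u) = (w - u) powr (\<alpha> + 1)" using uw by (simp add: powr_add)
    moreover have "\<alpha> + 1 = (1 - 2 * \<alpha>) + 3 * \<alpha>" by simp
    ultimately show ?thesis by (simp only: powr_add)
   qed
   also have "... <= (t - s) powr (1 - 2 * \<alpha>) * (w - u) powr (3 * \<alpha>)"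
    by (intro mult_right_mono powr_mono2) (use uw al in auto)
   finally show ?thesis .
  qed
  have m1: "exp (?th x) = 1 + ?th x + (?th x)\<^sup>2 / 2 + (exp (?th x) - 1 - ?th x - (?th x)\<^sup>2 / 2)" for x by simp
  let ?R = "\<lambda>x. (exp (?th x) - 1 - ?th x - (?th x)\<^sup>2 / 2) * ?c x"
  have Rb: "cmod (?R x) <= (B * (\<Sum>k<N. \<bar>?d k\<bar>)) ^ 3 * M" for x
  proof -
   have "cmod (exp (?th x) - 1 - ?th x - (?th x)\<^sup>2 / 2) <= cmod (?th x) ^ 3" by (rule exp_phase_bound(2))
   also have "... <= (B * (\<Sum>k<N. \<bar>?d k\<bar>)) ^ 3" by (rule power_mono[OF ph]) simp
   finally show ?thesis unfolding norm_mult complex_mod_cnj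
    by (rule mult_mono[OF _ M]) (use B(1) in \<open>auto intro!: zero_le_power mult_nonneg_nonneg sum_nonneg\<close>)
  qed
  have Rm: "?R \<in> borel_measurable borel"
  proof -
   have [measurable]: "?th \<in> borel_measurable borel" "?c \<in> borel_measurable borel"
    using borel_measurable_continuous_onI[OF smooth_continuous[OF smcl_smooth[OF smcl_phase]]] test_fn_borel[OF test_fn_cnj[OF \<psi>]] by auto
   show ?thesis by measurable
  qed
  have Rz: "?R x = 0" if "x \<notin> ?K" for x
  proof -
   have "\<psi> x = 0" using dpart_outside_support[OF that, of "[]"] by simp
   then show ?thesis by simp
  qed
  have RR: "integrable lborel (\<lambda>x. X u x * ?R x) \<and> cmod (LBINT x. X u x * ?R x) <= ((B * (\<Sum>k<N. \<bar>?d k\<bar>)) ^ 3 * M) * A"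
   by (rule pairing_boundD(1)[OF PA mem(1) Rm Rb Rz])
  have i0: "integrable lborel (\<lambda>x. X u x * ?c x)" by (rule FF_integrable[OF \<psi> mem(1)])
  let ?T1 = "\<lambda>k x. X u x * cnj (cplx (\<phi> k x) * \<psi> x)"
  let ?T2 = "\<lambda>j k x. X u x * cnj (cplx (\<phi> j x * \<phi> k x) * \<psi> x)"
  have t1: "X u x * (?th x * ?c x) = \<i> * (\<Sum>k<N. cplx (?d k) * ?T1 k x)" for x
   by (simp add: phase_def sum_distrib_left sum_distrib_right mult_ac)
  have t2: "X u x * ((?th x)\<^sup>2 / 2 * ?c x) = - (\<Sum>j<N. \<Sum>k<N. cplx (?d j * ?d k) * ?T2 j k x) / 2" for x
  proof -
   have "(?th x)\<^sup>2 = - (\<Sum>j<N. \<Sum>k<N. cplx ((\<phi> j x * ?d j) * (\<phi> k x * ?d k)))"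
   proof -
    define T where "T = (\<Sum>k<N. \<phi> k x * ?d k)"
    have "(?th x)\<^sup>2 = - cplx (T * T)"
     unfolding phase_alt T_def[symmetric] by (simp add: power_mult_distrib) (simp add: power2_eq_square)
    also have "T * T = (\<Sum>j<N. \<Sum>k<N. (\<phi> j x * ?d j) * (\<phi> k x * ?d k))"
     unfolding T_def by (rule sum_product)
    finally show ?thesis by simp
   qed
   then show ?thesis by (simp add: sum_distrib_left sum_distrib_right mult_ac)
  qed
  have it1: "integrable lborel (\<lambda>x. \<i> * (\<Sum>k<N. cplx (?d k) * ?T1 k x))"
   by (intro integrable_mult_right Bochner_Integration.integrable_sum FF_integrable tphi mem) simp
  have it2: "integrable lborel (\<lambda>x. - (\<Sum>j<N. \<Sum>k<N. cplx (?d j * ?d k) * ?T2 j k x) / 2)"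
   by (intro integrable_divide_zero integrable_minus integrable_mult_right Bochner_Integration.integrable_sum FF_integrable tphi2 mem) auto
  have I1: "(LBINT x. \<i> * (\<Sum>k<N. cplx (?d k) * ?T1 k x)) =
    \<i> * (\<Sum>k<N. cplx (?d k) * F1 \<psi> k u)"
   unfolding integral_mult_right_zero FF_def pair_def
   by (subst Bochner_Integration.integral_sum)
    (auto simp only: integral_mult_right_zero lessThan_iff intro!: integrable_mult_right FF_integrable tphi mem)
  have I2: "(LBINT x. - (\<Sum>j<N. \<Sum>k<N. cplx (?d j * ?d k) * ?T2 j k x) / 2) =
    - (\<Sum>j<N. \<Sum>k<N. cplx (?d j * ?d k) * F2 \<psi> j k u) / 2"
  proof -
   have "(LBINT x. (\<Sum>j<N. \<Sum>k<N. cplx (?d j * ?d k) * ?T2 j k x)) =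
    (\<Sum>j<N. (LBINT x. (\<Sum>k<N. cplx (?d j * ?d k) * ?T2 j k x)))"
    by (intro Bochner_Integration.integral_sum Bochner_Integration.integrable_sum integrable_mult_right FF_integrable tphi2 mem) auto
   also have "... = (\<Sum>j<N. \<Sum>k<N. (LBINT x. cplx (?d j * ?d k) * ?T2 j k x))"
    by (intro sum.cong refl Bochner_Integration.integral_sum integrable_mult_right FF_integrable tphi2 mem) auto
   finally show ?thesis unfolding FF_def pair_def by (simp only: integral_divide_zero integral_minus integral_mult_right_zero)
  qed
  have E2: "pair (v u) (?P w) - FF \<psi> u - \<i> * (\<Sum>k<N. cplx (?d k) * F1 \<psi> k u)
    + (\<Sum>j<N. \<Sum>k<N. cplx (?d j * ?d k) * F2 \<psi> j k u) / 2 = (LBINT x. X u x * ?R x)"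
  proof -
   have "pair (v u) (?P w) = (LBINT x. exp (?th x) * X u x * ?c x)" by (rule pair_gauge)
   also have "... = (LBINT x. ((X u x * ?c x + \<i> * (\<Sum>k<N. cplx (?d k) * ?T1 k x)) +
      (- (\<Sum>j<N. \<Sum>k<N. cplx (?d j * ?d k) * ?T2 j k x) / 2)) + X u x * ?R x)"
   proof (rule Bochner_Integration.integral_cong[OF refl])
    fix x
    have "e * y * c = y * c + y * (h * c) + y * (h\<^sup>2 / 2 * c) + y * ((e - 1 - h - h\<^sup>2 / 2) * c)" for e y c h :: complex
     by (simp add: algebra_simps)
    from this[of "exp (?th x)" "X u x" "?c x" "?th x"]
    show "exp (?th x) * X u x * ?c x = ((X u x * ?c x + \<i> * (\<Sum>k<N. cplx (?d k) * ?T1 k x)) +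
      (- (\<Sum>j<N. \<Sum>k<N. cplx (?d j * ?d k) * ?T2 j k x) / 2)) + X u x * ?R x"
     unfolding t1 t2 .
   qed
   also have "... = (((LBINT x. X u x * ?c x) + (LBINT x. \<i> * (\<Sum>k<N. cplx (?d k) * ?T1 k x)))
     + (LBINT x. - (\<Sum>j<N. \<Sum>k<N. cplx (?d j * ?d k) * ?T2 j k x) / 2)) + (LBINT x. X u x * ?R x)"
    by (simp only: Bochner_Integration.integral_add[OF Bochner_Integration.integrable_add[OF Bochner_Integration.integrable_add[OF i0 it1] it2] conjunct1[OF RR]]
      Bochner_Integration.integral_add[OF Bochner_Integration.integrable_add[OF i0 it1] it2] Bochner_Integration.integral_add[OF i0 it1])
   finally have e: "pair (v u) (?P w) = ((FF \<psi> u + \<i> * (\<Sum>k<N. cplx (?d k) * F1 \<psi> k u))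
     + - (\<Sum>j<N. \<Sum>k<N. cplx (?d j * ?d k) * F2 \<psi> j k u) / 2) + (LBINT x. X u x * ?R x)"
    unfolding I1 I2 FF_def[of \<psi>] pair_def[of _ \<psi>] .
   have "P = ((a + b) + - S / 2) + R ==> P - a - b + S / 2 = R" for P a b S R :: complex by simp
   from this[OF e] show ?thesis .
  qed
  have Sd: "(\<Sum>k<N. \<bar>?d k\<bar>) <= Q * (w - u) powr \<alpha>"
   using Ip_increment[OF mem] uw by (simp add: Q_def)
  have R3: "((B * (\<Sum>k<N. \<bar>?d k\<bar>)) ^ 3 * M) * A <= ((B * Q) ^ 3 * M * A) * (w - u) powr (3 * \<alpha>)"
  proof -
   have "(B * (\<Sum>k<N. \<bar>?d k\<bar>)) ^ 3 <= (B * (Q * (w - u) powr \<alpha>)) ^ 3"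
    by (intro power_mono mult_left_mono Sd) (use B in \<open>auto intro!: mult_nonneg_nonneg sum_nonneg\<close>)
   also have "... = (B * Q) ^ 3 * (w - u) powr (3 * \<alpha>)"
   proof -
    have "((w - u) powr \<alpha>) ^ 3 = (w - u) powr (3 * \<alpha>)" using uw by (simp add: powr_power mult.commute)
    then show ?thesis by (simp only: power_mult_distrib mult.assoc)
   qed
   finally have "(B * (\<Sum>k<N. \<bar>?d k\<bar>)) ^ 3 * (M * A) <= (B * Q) ^ 3 * (w - u) powr (3 * \<alpha>) * (M * A)"
    by (rule mult_right_mono) (use M0 A0 in simp)
   then show ?thesis by (simp only: mult_ac)
  qed
  have "remainder \<psi> u w
   = (pair (v w) (?P w) - pair (v u) (?P w) - sint u w (NL \<psi>)) + (LBINT x. X u x * ?R x)"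
   unfolding E2[symmetric] FF_gauge[of \<psi> w] by (simp only: algebra_simps)
  then have "cmod (remainder \<psi> u w)
    <= (C * (w - u) powr \<alpha>) * (w - u) + ((B * (\<Sum>k<N. \<bar>?d k\<bar>)) ^ 3 * M) * A"
   using norm_triangle_mono[OF E1 conjunct2[OF RR]] by (simp only:)
  also have "... <= (C * (t - s) powr (1 - 2 * \<alpha>)) * (w - u) powr (3 * \<alpha>) + ((B * Q) ^ 3 * M * A) * (w - u) powr (3 * \<alpha>)"
   using mult_left_mono[OF P1 C(1)] R3 by (simp only: mult.assoc add_mono)
  finally show ?thesis by (simp only: distrib_right)
 qed
 show ?thesis
 proof (intro exI[of _ "C * (t - s) powr (1 - 2 * \<alpha>) + (B * Q) ^ 3 * M * A"] conjI allI impI)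
  show "0 <= C * (t - s) powr (1 - 2 * \<alpha>) + (B * Q) ^ 3 * M * A" using B C Q M0 A0 by simp
  fix u w assume h: "s <= u \<and> u <= w \<and> w <= t"
  show "cmod (remainder \<psi> u w)
   <= (C * (t - s) powr (1 - 2 * \<alpha>) + (B * Q) ^ 3 * M * A) * (w - u) powr (3 * \<alpha>)"
  proof (cases "u = w")
   case True
   have "sint w w (NL \<psi>) = 0"
    unfolding set_lebesgue_integral_def
    by (rule integral_eq_zero_AE, rule eventually_mono[OF AE_lborel_singleton[of w]]) (auto simp: indicator_def)
   then show ?thesis using True by simp
  qed (use main h in auto)
 qed
qed

end

section \<open>Brownian increments\<close>

abbreviation gauss :: "real => real measure" where
 "gauss d \<equiv> density lborel (\<lambda>x. ennreal (normal_density 0 (sqrt d) x))"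

text \<open>Completing the square turns the tilted density into a multiple of the normal density
  with mean b d, whose mass is 1.\<close>

lemma nn_integral_gauss_exp:
 assumes d: "d > 0"
 shows "(\<integral>\<^sup>+x. ennreal (exp (a + b * x)) \<partial>gauss d) = ennreal (exp (a + b\<^sup>2 * d / 2))"
proof -
 have eq: "normal_density 0 (sqrt d) x * exp (a + b * x) = exp (a + b\<^sup>2 * d / 2) * normal_density (b * d) (sqrt d) x" for x
 proof -
  have "- x\<^sup>2 / (2 * d) + (a + b * x) = (a + b\<^sup>2 * d / 2) + - (x - b * d)\<^sup>2 / (2 * d)"
   using d by (simp add: field_simps power2_eq_square)
  then have e: "exp (- x\<^sup>2 / (2 * d)) * exp (a + b * x) = exp (a + b\<^sup>2 * d / 2) * exp (- (x - b * d)\<^sup>2 / (2 * d))"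
   by (simp only: exp_add[symmetric])
  have n: "normal_density m (sqrt d) x = 1 / sqrt (2 * pi * d) * exp (- (x - m)\<^sup>2 / (2 * d))" for m
   using d by (simp add: normal_density_def)
  have "K * E1 * E2 = E3 * (K * E4)" if "E1 * E2 = E3 * E4" for K E1 E2 E3 E4 :: real
   using that by (simp add: mult.assoc mult.left_commute)
  from this[OF e] show ?thesis unfolding n diff_zero .
 qed
 interpret prob_space "density lborel (\<lambda>x. ennreal (normal_density (b * d) (sqrt d) x))"
  by (rule prob_space_normal_density) (use d in simp)
 have one: "(\<integral>\<^sup>+x. ennreal (normal_density (b * d) (sqrt d) x) \<partial>lborel) = 1"
  using emeasure_space_1 by (simp add: emeasure_density)
 have "(\<integral>\<^sup>+x. ennreal (exp (a + b * x)) \<partial>gauss d) = (\<integral>\<^sup>+x. ennreal (normal_density 0 (sqrt d) x) * ennreal (exp (a + b * x)) \<partial>lborel)"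
  by (rule nn_integral_density) auto
 also have "... = (\<integral>\<^sup>+x. ennreal (exp (a + b\<^sup>2 * d / 2)) * ennreal (normal_density (b * d) (sqrt d) x) \<partial>lborel)"
  by (simp add: eq flip: ennreal_mult)
 also have "... = ennreal (exp (a + b\<^sup>2 * d / 2))" by (simp add: nn_integral_cmult one)
 finally show ?thesis .
qed

lemma gauss_moments:
 assumes d: "d > 0"
 shows "has_bochner_integral lborel (\<lambda>x. normal_density 0 (sqrt d) x) 1"
  "has_bochner_integral lborel (\<lambda>x. normal_density 0 (sqrt d) x * x) 0"
  "has_bochner_integral lborel (\<lambda>x. normal_density 0 (sqrt d) x * x\<^sup>2) d"
  "has_bochner_integral lborel (\<lambda>x. normal_density 0 (sqrt d) x * x ^ 4) (3 * d\<^sup>2)"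
proof -
 have s: "sqrt d > 0" using d by simp
 show "has_bochner_integral lborel (\<lambda>x. normal_density 0 (sqrt d) x) 1"
  using normal_moment_even[OF s, of 0 0] by simp
 show "has_bochner_integral lborel (\<lambda>x. normal_density 0 (sqrt d) x * x) 0"
  using normal_moment_nz_1[OF s, of 0] by simp
 show "has_bochner_integral lborel (\<lambda>x. normal_density 0 (sqrt d) x * x\<^sup>2) d"
  using normal_moment_even[OF s, of 0 1] d by (simp add: fact_numeral)
 have "fact (2 * 2) / ((2 / (sqrt d)\<^sup>2) ^ 2 * fact 2) = 3 * d\<^sup>2"
  using d by (simp add: fact_numeral power_divide field_simps)
 then show "has_bochner_integral lborel (\<lambda>x. normal_density 0 (sqrt d) x * x ^ 4) (3 * d\<^sup>2)"
  using normal_moment_even[OF s, of 0 2] by simp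
qed

lemma nn_integral_gauss_poly:
 assumes d: "d > 0" and I: "has_bochner_integral lborel (\<lambda>x. normal_density 0 (sqrt d) x * f x) c"
  and f: "!!x. f x >= 0" "f \<in> borel_measurable borel"
 shows "(\<integral>\<^sup>+x. ennreal (f x) \<partial>gauss d) = ennreal c"
proof -
 have "(\<integral>\<^sup>+x. ennreal (f x) \<partial>gauss d) = (\<integral>\<^sup>+x. ennreal (normal_density 0 (sqrt d) x * f x) \<partial>lborel)"
  using f by (subst nn_integral_density) (auto simp: ennreal_mult)
 also have "... = ennreal c"
  using I f by (intro nn_integral_eq_integral[THEN trans])
   (auto simp: has_bochner_integral_iff)
 finally show ?thesis .
qed

lemma nn_integral_gauss_affine_sq:
 assumes d: "d > 0"
 shows "(\<integral>\<^sup>+x. ennreal ((a + b * x)\<^sup>2) \<partial>gauss d) = ennreal (a\<^sup>2 + b\<^sup>2 * d)"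
proof (rule nn_integral_gauss_poly[OF d])
 note m = gauss_moments[OF d]
 have "has_bochner_integral lborel (\<lambda>x. a\<^sup>2 * normal_density 0 (sqrt d) x + (2 * a * b) * (normal_density 0 (sqrt d) x * x) + b\<^sup>2 * (normal_density 0 (sqrt d) x * x\<^sup>2)) (a\<^sup>2 * 1 + (2 * a * b) * 0 + b\<^sup>2 * d)"
  by (intro has_bochner_integral_add has_bochner_integral_mult_right m)
 then show "has_bochner_integral lborel (\<lambda>x. normal_density 0 (sqrt d) x * (a + b * x)\<^sup>2) (a\<^sup>2 + b\<^sup>2 * d)"
  by (simp add: algebra_simps power2_eq_square)
qed auto

text \<open>x^2 - d is centred with variance 3 d^2 - d^2 = 2 d^2.\<close>

lemma nn_integral_gauss_square_sq:
 assumes d: "d > 0"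
 shows "(\<integral>\<^sup>+x. ennreal ((a + (x\<^sup>2 - d))\<^sup>2) \<partial>gauss d) = ennreal (a\<^sup>2 + 2 * d\<^sup>2)"
proof (rule nn_integral_gauss_poly[OF d])
 note m = gauss_moments[OF d]
 have "has_bochner_integral lborel (\<lambda>x. (a - d)\<^sup>2 * normal_density 0 (sqrt d) x + (2 * (a - d)) * (normal_density 0 (sqrt d) x * x\<^sup>2) + normal_density 0 (sqrt d) x * x ^ 4) ((a - d)\<^sup>2 * 1 + (2 * (a - d)) * d + 3 * d\<^sup>2)"
  by (intro has_bochner_integral_add has_bochner_integral_mult_right m)
 then show "has_bochner_integral lborel (\<lambda>x. normal_density 0 (sqrt d) x * (a + (x\<^sup>2 - d))\<^sup>2) (a\<^sup>2 + 2 * d\<^sup>2)"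
  by (simp add: algebra_simps power2_eq_square eval_nat_numeral)
qed auto

text \<open>Appending a last time is the induction step of all moment bounds: the new increment is
  integrated out given the past.\<close>

lemma psum_snoc:
 assumes "finite A" "A \<noteq> {}" "\<forall>a\<in>A. a < b"
 shows "psum (insert b A) f = psum A f + f (Max A) b"
proof -
 let ?c = "Max A"
 have c: "?c \<in> A" by (rule Max_in[OF assms(1,2)])
 then have cb: "?c < b" using assms by blast
 have le: "x <= ?c" if "x \<in> A" for x using that assms by simp
 have 1: "insert b A \<inter> {..?c} = A" using cb le by auto
 have "x = ?c" if "x \<in> A" "?c <= x" for x using le[OF that(1)] that(2) by (rule order_antisym)
 then have 2: "insert b A \<inter> {?c..} = {?c, b}" using c cb by (blast intro: less_imp_le order_refl)
 show ?thesis using psum_split[of "insert b A" ?c f] assms c unfolding 1 2 by (simp add: psum_pair)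
qed

lemma Max_atLeast: "finite A ==> A \<noteq> {} ==> A \<subseteq> {0::real..} ==> 0 <= Max A"
 by (meson Max_in atLeast_iff subsetD)

section \<open>Laws of Brownian increments and independence of the past\<close>

locale bm_family = prob_space M for M :: "'w measure" +
 fixes F :: "real => 'w set set" and N :: nat and B :: "nat => real => 'w => real"
 assumes filt: "filtration_usual M F" and bm: "std_BM_family M F N B"
begin

definition Fm :: "real => 'w measure" where "Fm s = sigma (space M) (F s)"

lemma sets_Fm: "0 <= s ==> sets (Fm s) = F s"
proof -
 assume "0 <= s"
 then have "sigma_algebra (space M) (F s)" using filt by (auto simp: filtration_usual_def)
 then show ?thesis unfolding Fm_def by (simp add: sigma_algebra.sets_measure_of_eq)
qed

lemma space_Fm: "space (Fm s) = space M"
 unfolding Fm_def by (simp add: space_measure_of_conv)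

lemma sub_Fm: "0 <= s ==> subalgebra M (Fm s)"
proof -
 assume s: "0 <= s"
 then have "F s \<subseteq> sets M" using filt[unfolded filtration_usual_def, THEN conjunct1] by blast
 then show ?thesis using s by (simp add: subalgebra_def sets_Fm space_Fm)
qed

lemma Fm_mono: "0 <= s ==> s <= t ==> f \<in> borel_measurable (Fm s) ==> f \<in> borel_measurable (Fm t)"
proof -
 assume st: "0 <= s" "s <= t" and f: "f \<in> borel_measurable (Fm s)"
 have "subalgebra (Fm t) (Fm s)"
 proof -
  have "F s \<subseteq> F t" using filt[unfolded filtration_usual_def, THEN conjunct2, THEN conjunct1] st by blast
  then show ?thesis using st by (simp add: subalgebra_def sets_Fm space_Fm)
 qed
 then show ?thesis using f by (rule measurable_from_subalg)
qed

lemma Fm_M: "0 <= s ==> f \<in> borel_measurable (Fm s) ==> f \<in> borel_measurable M"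
 using measurable_from_subalg[OF sub_Fm] by blast

lemma adapted_Fm: "adapted M F X ==> 0 <= t ==> X t \<in> borel_measurable (Fm t)"
 by (auto simp: adapted_def Fm_def)

lemma B_Fm: "k < N ==> 0 <= s ==> s <= t ==> B k s \<in> borel_measurable (Fm t)"
 by (rule Fm_mono[OF _ _ adapted_Fm]) (use bm in \<open>auto simp: std_BM_family_def\<close>)

lemma B_M [measurable]: "k < N ==> 0 <= s ==> B k s \<in> borel_measurable M"
 using Fm_M[OF _ B_Fm] by blast

definition incr :: "nat => real => real => 'w => real" where "incr k s t om = B k t om - B k s om"

lemma incr_meas: "k < N ==> 0 <= s ==> 0 <= t ==> incr k s t \<in> borel_measurable M"
 unfolding incr_def by measurable

lemma incr_Fm: "k < N ==> 0 <= u ==> u <= v ==> incr k u v \<in> borel_measurable (Fm v)"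
 unfolding incr_def by (intro borel_measurable_diff B_Fm) auto

lemma gauss_measure:
 assumes "d > 0" "C \<in> sets borel"
 shows "(LBINT x. indicator C x * normal_density 0 (sqrt d) x) = measure (gauss d) C"
proof -
 have "emeasure (gauss d) C = (\<integral>\<^sup>+x. ennreal (indicator C x * normal_density 0 (sqrt d) x) \<partial>lborel)"
  using assms by (simp add: emeasure_density ennreal_mult' mult.commute ennreal_indicator)
 also have "... = ennreal (LBINT x. indicator C x * normal_density 0 (sqrt d) x)"
 proof (rule nn_integral_eq_integral)
  have "integrable lborel (normal_density 0 (sqrt d))"
   using gauss_moments(1)[OF assms(1)] by (simp add: has_bochner_integral_iff)
  from integrable_real_mult_indicator[OF _ this, of C] assms
  show "integrable lborel (\<lambda>x. indicator C x * normal_density 0 (sqrt d) x)" by (simp add: mult.commute)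
 qed auto
 finally show ?thesis by (simp add: measure_def)
qed

lemma joint_law:
 assumes "0 <= s" "s < t" "A \<in> F s" "!!k. k < N ==> C k \<in> sets borel"
 shows "measure M (A \<inter> {om \<in> space M. \<forall>k<N. incr k s t om \<in> C k}) = measure M A * (\<Prod>k<N. measure (gauss (t - s)) (C k))"
proof -
 have "measure M (A \<inter> {om \<in> space M. \<forall>k<N. B k t om - B k s om \<in> C k}) =
   measure M A * (\<Prod>k<N. (LBINT x. indicator (C k) x * normal_density 0 (sqrt (t - s)) x))"
  using bm assms unfolding std_BM_family_def by blast
 then show ?thesis using assms by (simp add: incr_def gauss_measure)
qed

lemma gauss_prob: "d > 0 ==> prob_space (gauss d)"
 by (rule prob_space_normal_density) simp

lemma gauss_UNIV: "d > 0 ==> measure (gauss d) UNIV = 1"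
 using prob_space.prob_space[OF gauss_prob] by simp

lemma law1:
 assumes "0 <= s" "s < t" "k < N" "A \<in> F s" "C \<in> sets borel"
 shows "emeasure M (A \<inter> {om \<in> space M. incr k s t om \<in> C}) = emeasure M A * emeasure (gauss (t - s)) C"
proof -
 interpret G: prob_space "gauss (t - s)" by (rule gauss_prob) (use assms in simp)
 have "measure M (A \<inter> {om \<in> space M. \<forall>j<N. incr j s t om \<in> (if j = k then C else UNIV)})
  = measure M A * (\<Prod>j<N. measure (gauss (t - s)) (if j = k then C else UNIV))"
  by (rule joint_law) (use assms in auto)
 also have "{om \<in> space M. \<forall>j<N. incr j s t om \<in> (if j = k then C else UNIV)} = {om \<in> space M. incr k s t om \<in> C}"
  using assms by auto
 also have "(\<Prod>j<N. measure (gauss (t - s)) (if j = k then C else UNIV)) = (\<Prod>j<N. if j = k then measure (gauss (t - s)) C else 1)"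
  using gauss_UNIV[of "t - s"] assms by (intro prod.cong) auto
 also have "... = measure (gauss (t - s)) C" using assms by simp
 finally show ?thesis
  by (simp add: emeasure_eq_measure G.emeasure_eq_measure ennreal_mult')
qed

lemma law2:
 assumes "0 <= s" "s < t" "j < N" "k < N" "j \<noteq> k" "A \<in> F s" "C \<in> sets borel" "D \<in> sets borel"
 shows "emeasure M (A \<inter> {om \<in> space M. incr j s t om \<in> C \<and> incr k s t om \<in> D}) =
   emeasure M A * (emeasure (gauss (t - s)) C * emeasure (gauss (t - s)) D)"
proof -
 interpret G: prob_space "gauss (t - s)" by (rule gauss_prob) (use assms in simp)
 let ?C = "\<lambda>i. if i = j then C else if i = k then D else UNIV"
 have "measure M (A \<inter> {om \<in> space M. \<forall>i<N. incr i s t om \<in> ?C i})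
  = measure M A * (\<Prod>i<N. measure (gauss (t - s)) (?C i))"
  by (rule joint_law) (use assms in auto)
 also have "{om \<in> space M. \<forall>i<N. incr i s t om \<in> ?C i} = {om \<in> space M. incr j s t om \<in> C \<and> incr k s t om \<in> D}"
  using assms by (auto split: if_splits)
 also have "(\<Prod>i<N. measure (gauss (t - s)) (?C i)) = (\<Prod>i<N. (if i = j then measure (gauss (t - s)) C else 1) * (if i = k then measure (gauss (t - s)) D else 1))"
  using gauss_UNIV[of "t - s"] assms by (intro prod.cong) auto
 also have "... = measure (gauss (t - s)) C * measure (gauss (t - s)) D" using assms by (simp add: prod.distrib)
 finally show ?thesis
  by (simp add: emeasure_eq_measure G.emeasure_eq_measure ennreal_mult')
qed

text \<open>The product formula on rectangles identifies the joint law of \<omega>, seen through the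
  past sigma-algebra, and \<open>xi\<close> as a product measure. Integrating out \<open>xi\<close>
  first by Fubini plays the role of conditioning on the past.\<close>

lemma indep_of_law:
 assumes s: "0 <= s" and G: "prob_space G" and xi: "xi \<in> measurable M G" and f: "f \<in> borel_measurable (Fm s \<Otimes>\<^sub>M G)"
  and law: "!!A C. A \<in> F s ==> A \<in> sets M ==> C \<in> sets G ==>
   emeasure M (A \<inter> {om \<in> space M. xi om \<in> C}) = emeasure M A * emeasure G C"
 shows "(\<integral>\<^sup>+om. f (om, xi om) \<partial>M) = (\<integral>\<^sup>+om. (\<integral>\<^sup>+x. f (om, x) \<partial>G) \<partial>M)"
proof -
 let ?R = "restr_to_subalg M (Fm s)" and ?D = "distr M (Fm s \<Otimes>\<^sub>M G) (\<lambda>om. (om, xi om))"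
 have sub: "subalgebra M (Fm s)" by (rule sub_Fm[OF s])
 interpret G: prob_space G by (rule G)
 have Rf: "finite_measure ?R" by (rule finite_measure_restr_to_subalg[OF sub finite_measure_axioms])
 interpret R: finite_measure ?R by (rule Rf)
 have sR: "sets ?R = sets (Fm s)" by (rule sets_restr_to_subalg[OF sub])
 have spR: "space ?R = space M" by (rule space_restr_to_subalg)
 have idm: "(\<lambda>om. om) \<in> measurable M (Fm s)"
  by (rule measurableI) (use sub in \<open>auto simp: subalgebra_def space_Fm\<close>)
 have pm: "(\<lambda>om. (om, xi om)) \<in> measurable M (Fm s \<Otimes>\<^sub>M G)" by (rule measurable_Pair[OF idm xi])
 have sRG: "sets (?R \<Otimes>\<^sub>M G) = sets (Fm s \<Otimes>\<^sub>M G)" by (rule sets_pair_measure_cong[OF sR refl])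
 have eq: "?R \<Otimes>\<^sub>M G = ?D"
 proof (rule pair_measure_eqI)
  show "sets (?R \<Otimes>\<^sub>M G) = sets ?D" unfolding sets_distr by (rule sRG)
  fix A C assume A: "A \<in> sets ?R" and C: "C \<in> sets G"
  have A': "A \<in> sets (Fm s)" "A \<in> F s" using A sR sets_Fm[OF s] by auto
  have AM: "A \<subseteq> space M" using sets.sets_into_space[OF A] spR by simp
  have AsM: "A \<in> sets M" using A'(1) sub by (auto simp: subalgebra_def)
  have "emeasure ?D (A \<times> C) = emeasure M ((\<lambda>om. (om, xi om)) -` (A \<times> C) \<inter> space M)"
   by (rule emeasure_distr[OF pm]) (use A' C in auto)
  also have "(\<lambda>om. (om, xi om)) -` (A \<times> C) \<inter> space M = A \<inter> {om \<in> space M. xi om \<in> C}"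
   using AM by auto
  also have "emeasure M ... = emeasure M A * emeasure G C" by (rule law[OF A'(2) AsM C])
  also have "emeasure M A = emeasure ?R A" by (rule emeasure_restr_to_subalg[OF sub A'(1), symmetric])
  finally show "emeasure ?R A * emeasure G C = emeasure ?D (A \<times> C)" ..
 qed unfold_locales
 have f': "f \<in> borel_measurable (?R \<Otimes>\<^sub>M G)"
  using f measurable_cong_sets[OF sRG refl[of "sets (borel :: ennreal measure)"]] by blast
 have g: "(\<lambda>om. \<integral>\<^sup>+x. f (om, x) \<partial>G) \<in> borel_measurable (Fm s)"
  using G.borel_measurable_nn_integral_fst[OF f'] measurable_cong_sets[OF sR refl[of "sets (borel :: ennreal measure)"]] by blast
 have "(\<integral>\<^sup>+om. f (om, xi om) \<partial>M) = integral\<^sup>N ?D f"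
  by (subst nn_integral_distr[OF pm]) (use f in simp_all)
 also have "... = integral\<^sup>N (?R \<Otimes>\<^sub>M G) f" by (simp only: eq)
 also have "... = (\<integral>\<^sup>+om. (\<integral>\<^sup>+x. f (om, x) \<partial>G) \<partial>?R)" by (rule G.nn_integral_fst[OF f', symmetric])
 also have "... = (\<integral>\<^sup>+om. (\<integral>\<^sup>+x. f (om, x) \<partial>G) \<partial>M)" by (rule nn_integral_subalgebra2[OF sub g])
 finally show ?thesis .
qed

lemma indep1:
 assumes st: "0 <= s" "s < t" and k: "k < N" and f: "f \<in> borel_measurable (Fm s \<Otimes>\<^sub>M borel)"
 shows "(\<integral>\<^sup>+om. f (om, incr k s t om) \<partial>M) = (\<integral>\<^sup>+om. (\<integral>\<^sup>+x. f (om, x) \<partial>gauss (t - s)) \<partial>M)"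
proof (rule indep_of_law[OF st(1)])
 let ?G = "gauss (t - s)"
 show "prob_space ?G" by (rule gauss_prob) (use st in simp)
 show "incr k s t \<in> measurable M ?G" using incr_meas[OF k, of s t] st by simp
 have "sets (Fm s \<Otimes>\<^sub>M ?G) = sets (Fm s \<Otimes>\<^sub>M borel)" by (rule sets_pair_measure_cong) auto
 from measurable_cong_sets[OF this refl] show "f \<in> borel_measurable (Fm s \<Otimes>\<^sub>M ?G)" using f by blast
 show "emeasure M (A \<inter> {om \<in> space M. incr k s t om \<in> C}) = emeasure M A * emeasure ?G C"
  if "A \<in> F s" "C \<in> sets ?G" for A C
  by (rule law1[OF st k that(1)]) (use that in simp)
qed

lemma indep2:
 assumes st: "0 <= s" "s < t" and jk: "j < N" "k < N" "j \<noteq> k" and f: "f \<in> borel_measurable (Fm s \<Otimes>\<^sub>M (borel \<Otimes>\<^sub>M borel))"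
 shows "(\<integral>\<^sup>+om. f (om, (incr j s t om, incr k s t om)) \<partial>M) = (\<integral>\<^sup>+om. (\<integral>\<^sup>+z. f (om, z) \<partial>(gauss (t - s) \<Otimes>\<^sub>M gauss (t - s))) \<partial>M)"
proof -
 let ?G = "gauss (t - s)"
 let ?xi = "\<lambda>om. (incr j s t om, incr k s t om)"
 interpret G: prob_space ?G by (rule gauss_prob) (use st in simp)
 interpret GG: pair_prob_space ?G ?G ..
 have sG: "sets (?G \<Otimes>\<^sub>M ?G) = sets (borel \<Otimes>\<^sub>M borel)" by (rule sets_pair_measure_cong) auto
 have im: "?xi \<in> measurable M (borel \<Otimes>\<^sub>M borel)"
  using incr_meas[OF jk(1)] incr_meas[OF jk(2)] st by (intro measurable_Pair) auto
 have law: "emeasure M (A \<inter> {om \<in> space M. ?xi om \<in> C}) = emeasure M A * emeasure (?G \<Otimes>\<^sub>M ?G) C"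
  if A: "A \<in> F s" "A \<in> sets M" and C: "C \<in> sets (borel \<Otimes>\<^sub>M borel)" for A C
 proof -
  \<comment> \<open>For fixed A two finite measures on the plane are compared: the law of the pair
    of increments on A and the product of Gaussians scaled by the mass of A. They agree on
    rectangles by \<open>law2\<close>, hence on all Borel sets.\<close>
  let ?D = "distr (density M (indicator A)) (borel \<Otimes>\<^sub>M borel) ?xi"
  let ?S = "scale_measure (emeasure M A) ?G"
  have Dem: "emeasure ?D E = emeasure M (A \<inter> {om \<in> space M. ?xi om \<in> E})" if "E \<in> sets (borel \<Otimes>\<^sub>M borel)" for E
  proof -
   have "emeasure ?D E = emeasure (density M (indicator A)) (?xi -` E \<inter> space M)"
    using im that by (subst emeasure_distr) auto
   also have "... = (\<integral>\<^sup>+om. indicator A om * indicator (?xi -` E \<inter> space M) om \<partial>M)"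
    using A(2) measurable_sets[OF im that] by (intro emeasure_density) auto
   also have "... = (\<integral>\<^sup>+om. indicator (A \<inter> {om \<in> space M. ?xi om \<in> E}) om \<partial>M)"
    by (intro nn_integral_cong) (auto simp: indicator_def)
   also have "... = emeasure M (A \<inter> {om \<in> space M. ?xi om \<in> E})"
   proof (rule nn_integral_indicator)
    have "?xi -` E \<inter> space M = {om \<in> space M. ?xi om \<in> E}" by auto
    then show "A \<inter> {om \<in> space M. ?xi om \<in> E} \<in> sets M" using A(2) measurable_sets[OF im that] by auto
   qed
   finally show ?thesis .
  qed
  have Sf: "finite_measure ?S"
   by (rule finite_measureI) (simp add: emeasure_eq_measure ennreal_mult_eq_top_iff)
  interpret S: finite_measure ?S by (rule Sf)
  have eqD: "?S \<Otimes>\<^sub>M ?G = ?D"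
  proof (rule pair_measure_eqI)
   show "sets (?S \<Otimes>\<^sub>M ?G) = sets ?D" unfolding sets_distr by (rule sets_pair_measure_cong) auto
   fix C1 C2 assume C12: "C1 \<in> sets ?S" "C2 \<in> sets ?G"
   then have "C1 \<times> C2 \<in> sets (borel \<Otimes>\<^sub>M borel)" by auto
   from Dem[OF this] show "emeasure ?S C1 * emeasure ?G C2 = emeasure ?D (C1 \<times> C2)"
    using law2[OF st jk A(1), of C1 C2] C12 by (simp add: mult.assoc)
  qed unfold_locales
  have "emeasure M (A \<inter> {om \<in> space M. ?xi om \<in> C}) = emeasure (?S \<Otimes>\<^sub>M ?G) C" unfolding eqD Dem[OF C] ..
  also have "... = (\<integral>\<^sup>+x. emeasure ?G (Pair x -` C) \<partial>?S)"
  proof (rule G.emeasure_pair_measure_alt)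
   have "sets (?S \<Otimes>\<^sub>M ?G) = sets (borel \<Otimes>\<^sub>M borel)" by (rule sets_pair_measure_cong) auto
   then show "C \<in> sets (?S \<Otimes>\<^sub>M ?G)" using C by simp
  qed
  also have "... = emeasure M A * (\<integral>\<^sup>+x. emeasure ?G (Pair x -` C) \<partial>?G)"
  proof (rule nn_integral_scale_measure)
   show "(\<lambda>x. emeasure ?G (Pair x -` C)) \<in> borel_measurable ?G"
    by (rule G.measurable_emeasure_Pair) (use C sG in simp)
  qed
  also have "(\<integral>\<^sup>+x. emeasure ?G (Pair x -` C) \<partial>?G) = emeasure (?G \<Otimes>\<^sub>M ?G) C"
   by (rule G.emeasure_pair_measure_alt[symmetric]) (use C sG in simp)
  finally show ?thesis .
 qed
 have fG: "f \<in> borel_measurable (Fm s \<Otimes>\<^sub>M (?G \<Otimes>\<^sub>M ?G))"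
  using f measurable_cong_sets[OF sets_pair_measure_cong[OF refl sG] refl[of "sets (borel :: ennreal measure)"]] by blast
 have iG: "?xi \<in> measurable M (?G \<Otimes>\<^sub>M ?G)" using im measurable_cong_sets[OF refl sG] by blast
 show ?thesis
  by (rule indep_of_law[OF st(1) GG.prob_space_axioms iG fG law]) (use sG in auto)
qed

section \<open>Moment and tail bounds for sums with adapted integrands\<close>

lemma psum_Fm:
 assumes P: "finite P" "P \<noteq> {}" "P \<subseteq> {0..}"
  and f: "!!u v. u \<in> P ==> v \<in> P ==> u < v ==> (\<lambda>om. f u v om) \<in> borel_measurable (Fm v)"
 shows "(\<lambda>om. psum P (\<lambda>u v. f u v om :: real)) \<in> borel_measurable (Fm (Max P))"
proof -
 have "(\<lambda>om. \<Sum>(u, v)\<in>gaps P. f u v om) \<in> borel_measurable (Fm (Max P))"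
 proof (rule borel_measurable_sum)
  fix z assume "z \<in> gaps P"
  then have "fst z \<in> P" "snd z \<in> P" "fst z < snd z" by (auto simp: gaps_def)
  then show "(\<lambda>om. case z of (u, v) => f u v om) \<in> borel_measurable (Fm (Max P))"
   using f[of "fst z" "snd z"] P by (auto simp: case_prod_unfold intro!: Fm_mono[of "snd z" "Max P"])
 qed
 then show ?thesis by (simp add: psum_gaps[OF P(1)])
qed

lemma simple_sum_Fm:
 assumes P: "finite P" "P \<noteq> {}" "P \<subseteq> {0..}" and k: "k < N" and H: "!!u. u \<in> P ==> H u \<in> borel_measurable (Fm u)"
 shows "(\<lambda>om. psum P (\<lambda>u v. H u om * incr k u v om)) \<in> borel_measurable (Fm (Max P))"
proof (rule psum_Fm[OF P])
 fix u v assume uv: "u \<in> P" "v \<in> P" "u < v"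
 then have "0 <= u" using P by auto
 then have [measurable]: "H u \<in> borel_measurable (Fm v)" "incr k u v \<in> borel_measurable (Fm v)"
  using uv Fm_mono[OF _ _ H[OF uv(1)], of v] incr_Fm[OF k, of u v] by auto
 show "(\<lambda>om. H u om * incr k u v om) \<in> borel_measurable (Fm v)" by measurable
qed

text \<open>Given the past, the last summand is Gaussian with a coefficient bounded by \<kappa>;
  integrating it out costs exp(\<theta>^2 \<kappa>^2 / 2 times the length of the last gap). The
  exponents add up to the total length.\<close>

lemma simple_sum_exp_bound:
 assumes P: "finite P" "P \<noteq> {}" "P \<subseteq> {0..}" and k: "k < N"
  and H: "!!u. u \<in> P ==> H u \<in> borel_measurable (Fm u)" "!!u om. u \<in> P ==> \<bar>H u om\<bar> <= \<kappa>"
 shows "(\<integral>\<^sup>+om. ennreal (exp (\<theta> * psum P (\<lambda>u v. H u om * incr k u v om))) \<partial>M) <= ennreal (exp (\<theta>\<^sup>2 * \<kappa>\<^sup>2 * (Max P - Min P) / 2))"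
 using P H
proof (induction P rule: finite_linorder_max_induct)
 case (insert b A)
 show ?case
 proof (cases "A = {}")
  case True
  then show ?thesis by (simp add: emeasure_space_1)
 next
  case False
  let ?c = "Max A"
  have c: "?c \<in> A" "?c < b" "0 <= ?c" using insert False Max_in[of A] Max_atLeast[of A] by auto
  let ?S = "\<lambda>om. psum A (\<lambda>u v. H u om * incr k u v om)"
  have Sm [measurable]: "?S \<in> borel_measurable (Fm ?c)"
   by (rule simple_sum_Fm) (use insert False k in auto)
  have Hm [measurable]: "H ?c \<in> borel_measurable (Fm ?c)" using insert c by auto
  let ?f = "\<lambda>(om, x). ennreal (exp (\<theta> * ?S om + \<theta> * H ?c om * x))"
  have "(\<integral>\<^sup>+om. ennreal (exp (\<theta> * psum (insert b A) (\<lambda>u v. H u om * incr k u v om))) \<partial>M) = (\<integral>\<^sup>+om. ?f (om, incr k ?c b om) \<partial>M)"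
   using insert False by (simp add: psum_snoc distrib_left mult.assoc)
  also have "... = (\<integral>\<^sup>+om. (\<integral>\<^sup>+x. ?f (om, x) \<partial>gauss (b - ?c)) \<partial>M)"
   by (rule indep1[OF c(3) c(2) k]) measurable
  also have "... = (\<integral>\<^sup>+om. ennreal (exp (\<theta> * ?S om + (\<theta> * H ?c om)\<^sup>2 * (b - ?c) / 2)) \<partial>M)"
   using c by (simp add: nn_integral_gauss_exp)
  also have "... <= (\<integral>\<^sup>+om. ennreal (exp (\<theta>\<^sup>2 * \<kappa>\<^sup>2 * (b - ?c) / 2)) * ennreal (exp (\<theta> * ?S om)) \<partial>M)"
  proof (rule nn_integral_mono)
   fix om
   have "\<bar>H ?c om\<bar> <= \<bar>\<kappa>\<bar>" using insert.prems(4)[of ?c om] c by simp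
   then have "(H ?c om)\<^sup>2 <= \<kappa>\<^sup>2" by (simp add: abs_le_square_iff)
   then have "(\<theta> * H ?c om)\<^sup>2 * (b - ?c) <= \<theta>\<^sup>2 * \<kappa>\<^sup>2 * (b - ?c)"
    using c by (auto simp: power_mult_distrib intro!: mult_right_mono mult_left_mono)
   then have "\<theta> * ?S om + (\<theta> * H ?c om)\<^sup>2 * (b - ?c) / 2 <= \<theta>\<^sup>2 * \<kappa>\<^sup>2 * (b - ?c) / 2 + \<theta> * ?S om" by simp
   then have "exp (\<theta> * ?S om + (\<theta> * H ?c om)\<^sup>2 * (b - ?c) / 2) <= exp (\<theta>\<^sup>2 * \<kappa>\<^sup>2 * (b - ?c) / 2) * exp (\<theta> * ?S om)"
    by (simp flip: exp_add)
   then show "ennreal (exp (\<theta> * ?S om + (\<theta> * H ?c om)\<^sup>2 * (b - ?c) / 2)) <= ennreal (exp (\<theta>\<^sup>2 * \<kappa>\<^sup>2 * (b - ?c) / 2)) * ennreal (exp (\<theta> * ?S om))"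
    by (simp add: ennreal_leI flip: ennreal_mult)
  qed
  also have "... = ennreal (exp (\<theta>\<^sup>2 * \<kappa>\<^sup>2 * (b - ?c) / 2)) * (\<integral>\<^sup>+om. ennreal (exp (\<theta> * ?S om)) \<partial>M)"
   by (rule nn_integral_cmult, rule measurable_compose[OF Fm_M[OF c(3) Sm], of "\<lambda>x. ennreal (exp (\<theta> * x))" borel]) measurable
  also have "... <= ennreal (exp (\<theta>\<^sup>2 * \<kappa>\<^sup>2 * (b - ?c) / 2)) * ennreal (exp (\<theta>\<^sup>2 * \<kappa>\<^sup>2 * (?c - Min A) / 2))"
   by (rule mult_left_mono[OF insert.IH]) (use insert False in auto)
  also have "... = ennreal (exp (\<theta>\<^sup>2 * \<kappa>\<^sup>2 * (b - Min A) / 2))"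
   by (simp add: ennreal_mult[symmetric] exp_add[symmetric] del: ennreal_mult) (simp add: field_simps)
  also have "b - Min A = Max (insert b A) - Min (insert b A)"
  proof -
   have "Max (insert b A) = b" using insert False by (simp add: max_absorb1)
   moreover have "Min A < b" using insert False by simp
   then have "Min (insert b A) = Min A" using insert False by simp
   ultimately show ?thesis by simp
  qed
  finally show ?thesis .
 qed
qed simp

text \<open>Orthogonality of martingale differences as an inequality: \<open>step\<close> says that
  a summand over [u,v] adds at most c u v to the second moment of anything known at u. With
  nonnegative integrals no integrability has to be tracked through the induction.\<close>

lemma sum_sq_bound:
 assumes P: "finite P" "P \<noteq> {}" "P \<subseteq> {0..}"
  and f: "!!u v. u \<in> P ==> v \<in> P ==> u < v ==> (\<lambda>om. f u v om) \<in> borel_measurable (Fm v)"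
  and step: "!!u v S. u \<in> P ==> v \<in> P ==> u < v ==> S \<in> borel_measurable (Fm u) ==>
    (\<integral>\<^sup>+om. ennreal ((S om + f u v om)\<^sup>2) \<partial>M) <= (\<integral>\<^sup>+om. ennreal ((S om)\<^sup>2) \<partial>M) + ennreal (c u v)"
  and c: "!!u v. u \<in> P ==> v \<in> P ==> u < v ==> c u v >= 0"
 shows "(\<integral>\<^sup>+om. ennreal ((psum P (\<lambda>u v. f u v om))\<^sup>2) \<partial>M) <= ennreal (psum P c)"
 using P f step c
proof (induction P rule: finite_linorder_max_induct)
 case (insert b A)
 show ?case
 proof (cases "A = {}")
  case True
  then show ?thesis by simp
 next
  case False
  let ?m = "Max A"
  have m: "?m \<in> A" "?m < b" "0 <= ?m" using insert False Max_in[of A] Max_atLeast[of A] by auto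
  let ?S = "\<lambda>om. psum A (\<lambda>u v. f u v om)"
  have Sm: "?S \<in> borel_measurable (Fm ?m)"
   by (rule psum_Fm) (use insert False in auto)
  have cA: "psum A c >= 0" unfolding psum_gaps[OF insert.hyps(1)]
   by (rule sum_nonneg) (use insert.prems(5) in \<open>auto simp: gaps_def\<close>)
  have "(\<integral>\<^sup>+om. ennreal ((psum (insert b A) (\<lambda>u v. f u v om))\<^sup>2) \<partial>M) = (\<integral>\<^sup>+om. ennreal ((?S om + f ?m b om)\<^sup>2) \<partial>M)"
   using insert False by (simp add: psum_snoc)
  also have "... <= (\<integral>\<^sup>+om. ennreal ((?S om)\<^sup>2) \<partial>M) + ennreal (c ?m b)"
   by (rule insert.prems(4)) (use m Sm in auto)
  also have "... <= ennreal (psum A c) + ennreal (c ?m b)"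
   by (rule add_right_mono[OF insert.IH]) (use insert False in auto)
  also have "... = ennreal (psum (insert b A) c)"
   using insert False m cA by (simp add: psum_snoc flip: ennreal_plus)
  finally show ?thesis .
 qed
qed simp

text \<open>The upper half of the Ito isometry for possibly unbounded integrands; the cross term
  disappears because the increment is centred and independent of the past.\<close>

lemma simple_sum_sq_bound:
 assumes P: "finite P" "P \<noteq> {}" "P \<subseteq> {0..}" and k: "k < N"
  and H: "!!u. u \<in> P ==> H u \<in> borel_measurable (Fm u)" "!!u. u \<in> P ==> (\<integral>\<^sup>+om. ennreal ((H u om)\<^sup>2) \<partial>M) <= ennreal q"
  and q: "q >= 0"
 shows "(\<integral>\<^sup>+om. ennreal ((psum P (\<lambda>u v. H u om * incr k u v om))\<^sup>2) \<partial>M) <= ennreal (psum P (\<lambda>u v. q * (v - u)))"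
proof (rule sum_sq_bound[OF P])
 have incrm: "incr k u v \<in> borel_measurable (Fm v)" if "0 <= u" "u < v" for u v
  by (rule incr_Fm[OF k]) (use that in auto)
 fix u v assume uv: "u \<in> P" "v \<in> P" "u < v"
 then have u0: "0 <= u" using P by auto
 show "(\<lambda>om. H u om * incr k u v om) \<in> borel_measurable (Fm v)"
 proof -
  have [measurable]: "H u \<in> borel_measurable (Fm v)" "incr k u v \<in> borel_measurable (Fm v)"
   using uv u0 H by (auto intro!: Fm_mono[of u v] incrm)
  show ?thesis by measurable
 qed
 show "q * (v - u) >= 0" using q uv by simp
 fix S :: "'w => real" assume S [measurable]: "S \<in> borel_measurable (Fm u)"
 have [measurable]: "H u \<in> borel_measurable (Fm u)" using H uv by auto
 have SM: "S \<in> borel_measurable M" "H u \<in> borel_measurable M" using Fm_M[OF u0 S] Fm_M[OF u0 H(1)[OF uv(1)]] .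
 let ?f = "\<lambda>(om, x). ennreal ((S om + H u om * x)\<^sup>2)"
 have "(\<integral>\<^sup>+om. ennreal ((S om + H u om * incr k u v om)\<^sup>2) \<partial>M) = (\<integral>\<^sup>+om. ?f (om, incr k u v om) \<partial>M)" by simp
 also have "... = (\<integral>\<^sup>+om. (\<integral>\<^sup>+x. ?f (om, x) \<partial>gauss (v - u)) \<partial>M)"
  by (rule indep1[OF u0 uv(3) k]) measurable
 also have "... = (\<integral>\<^sup>+om. ennreal ((S om)\<^sup>2) + ennreal ((H u om)\<^sup>2) * ennreal (v - u) \<partial>M)"
  using uv by (simp add: nn_integral_gauss_affine_sq ennreal_mult')
 also have "... = (\<integral>\<^sup>+om. ennreal ((S om)\<^sup>2) \<partial>M) + (\<integral>\<^sup>+om. ennreal ((H u om)\<^sup>2) \<partial>M) * ennreal (v - u)"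
  using SM by (subst nn_integral_add) (auto simp: nn_integral_multc)
 also have "... <= (\<integral>\<^sup>+om. ennreal ((S om)\<^sup>2) \<partial>M) + ennreal q * ennreal (v - u)"
  by (intro add_left_mono mult_right_mono H uv) simp
 finally show "(\<integral>\<^sup>+om. ennreal ((S om + H u om * incr k u v om)\<^sup>2) \<partial>M) <= (\<integral>\<^sup>+om. ennreal ((S om)\<^sup>2) \<partial>M) + ennreal (q * (v - u))"
  using q by (simp add: ennreal_mult')
qed

text \<open>For j = k the centred square has variance 2 (v-u)^2; for j \<noteq> k the product of two
  independent increments has variance (v-u)^2. The larger value bounds both.\<close>

lemma quad_var_sq_bound:
 assumes P: "finite P" "P \<noteq> {}" "P \<subseteq> {0..}" and jk: "j < N" "k < N"
 shows "(\<integral>\<^sup>+om. ennreal ((psum P (\<lambda>u v. incr j u v om * incr k u v om - (if j = k then v - u else 0)))\<^sup>2) \<partial>M)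
   <= ennreal (psum P (\<lambda>u v. 2 * (v - u)\<^sup>2))"
proof (rule sum_sq_bound[OF P])
 have incrm: "incr i u v \<in> borel_measurable (Fm v)" if "0 <= u" "u < v" "i < N" for u v i
  by (rule incr_Fm) (use that in auto)
 fix u v assume uv: "u \<in> P" "v \<in> P" "u < v"
 then have u0: "0 <= u" using P by auto
 have [measurable]: "incr j u v \<in> borel_measurable (Fm v)" "incr k u v \<in> borel_measurable (Fm v)"
  using incrm u0 uv jk by auto
 show "(\<lambda>om. incr j u v om * incr k u v om - (if j = k then v - u else 0)) \<in> borel_measurable (Fm v)" by measurable
 show "0 <= 2 * (v - u)\<^sup>2" by simp
 fix S :: "'w => real" assume S [measurable]: "S \<in> borel_measurable (Fm u)"
 have SM: "S \<in> borel_measurable M" using Fm_M[OF u0 S] .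
 have d: "v - u > 0" using uv by simp
 show "(\<integral>\<^sup>+om. ennreal ((S om + (incr j u v om * incr k u v om - (if j = k then v - u else 0)))\<^sup>2) \<partial>M)
   <= (\<integral>\<^sup>+om. ennreal ((S om)\<^sup>2) \<partial>M) + ennreal (2 * (v - u)\<^sup>2)"
 proof (cases "j = k")
  case True
  let ?f = "\<lambda>(om, x). ennreal ((S om + (x\<^sup>2 - (v - u)))\<^sup>2)"
  have "(\<integral>\<^sup>+om. ennreal ((S om + (incr j u v om * incr k u v om - (if j = k then v - u else 0)))\<^sup>2) \<partial>M) = (\<integral>\<^sup>+om. ?f (om, incr k u v om) \<partial>M)"
   using True by (simp add: power2_eq_square)
  also have "... = (\<integral>\<^sup>+om. (\<integral>\<^sup>+x. ?f (om, x) \<partial>gauss (v - u)) \<partial>M)"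
   by (rule indep1[OF u0 uv(3) jk(2)]) measurable
  also have "... = (\<integral>\<^sup>+om. ennreal ((S om)\<^sup>2) + ennreal (2 * (v - u)\<^sup>2) \<partial>M)"
   using d by (simp add: nn_integral_gauss_square_sq)
  also have "... = (\<integral>\<^sup>+om. ennreal ((S om)\<^sup>2) \<partial>M) + ennreal (2 * (v - u)\<^sup>2)"
   using SM by (subst nn_integral_add) (auto simp: emeasure_space_1)
  finally show ?thesis by simp
 next
  case False
  interpret G: prob_space "gauss (v - u)" by (rule gauss_prob[OF d])
  let ?f = "\<lambda>(om, z). ennreal ((S om + fst z * snd z)\<^sup>2)"
  have fm: "?f \<in> borel_measurable (Fm u \<Otimes>\<^sub>M (borel \<Otimes>\<^sub>M borel))" by measurable
  have inner: "(\<integral>\<^sup>+z. ennreal ((a + fst z * snd z)\<^sup>2) \<partial>(gauss (v - u) \<Otimes>\<^sub>M gauss (v - u))) = ennreal (a\<^sup>2 + (v - u)\<^sup>2)" for a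
  proof -
   have "(\<integral>\<^sup>+z. ennreal ((a + fst z * snd z)\<^sup>2) \<partial>(gauss (v - u) \<Otimes>\<^sub>M gauss (v - u))) =
    (\<integral>\<^sup>+x. (\<integral>\<^sup>+y. ennreal ((a + fst (x, y) * snd (x, y))\<^sup>2) \<partial>gauss (v - u)) \<partial>gauss (v - u))"
    by (rule G.nn_integral_fst[symmetric]) measurable
   also have "... = (\<integral>\<^sup>+x. ennreal (a\<^sup>2) + ennreal (v - u) * ennreal ((0 + 1 * x)\<^sup>2) \<partial>gauss (v - u))"
    using d by (simp add: nn_integral_gauss_affine_sq ennreal_mult' mult.commute)
   also have "... = ennreal (a\<^sup>2) + ennreal (v - u) * ennreal (0\<^sup>2 + 1\<^sup>2 * (v - u))"
    using G.emeasure_space_1 by (subst nn_integral_add) (auto simp: nn_integral_cmult nn_integral_gauss_affine_sq[OF d, of 0 1, simplified])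
   also have "... = ennreal (a\<^sup>2 + (v - u)\<^sup>2)"
    using d by (simp add: power2_eq_square flip: ennreal_mult)
   finally show ?thesis .
  qed
  have "(\<integral>\<^sup>+om. ennreal ((S om + (incr j u v om * incr k u v om - (if j = k then v - u else 0)))\<^sup>2) \<partial>M) = (\<integral>\<^sup>+om. ?f (om, (incr j u v om, incr k u v om)) \<partial>M)"
   using False by simp
  also have "... = (\<integral>\<^sup>+om. (\<integral>\<^sup>+z. ?f (om, z) \<partial>(gauss (v - u) \<Otimes>\<^sub>M gauss (v - u))) \<partial>M)"
   by (rule indep2[OF u0 uv(3) jk False fm])
  also have "... = (\<integral>\<^sup>+om. ennreal ((S om)\<^sup>2) + ennreal ((v - u)\<^sup>2) \<partial>M)"
   by (simp add: inner)
  also have "... = (\<integral>\<^sup>+om. ennreal ((S om)\<^sup>2) \<partial>M) + ennreal ((v - u)\<^sup>2)"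
   using SM by (subst nn_integral_add) (auto simp: emeasure_space_1)
  also have "... <= (\<integral>\<^sup>+om. ennreal ((S om)\<^sup>2) \<partial>M) + ennreal (2 * (v - u)\<^sup>2)"
   by (intro add_left_mono ennreal_leI) simp
  finally show ?thesis .
 qed
qed

lemma incr_sq:
 assumes "0 <= s" "s <= t" "k < N"
 shows "(\<integral>\<^sup>+om. ennreal ((incr k s t om)\<^sup>2) \<partial>M) = ennreal (t - s)"
proof (cases "s = t")
 case True
 then show ?thesis by (simp add: incr_def)
next
 case False
 then have st: "s < t" using assms by simp
 let ?f = "\<lambda>(om, x). ennreal ((0 + 1 * x)\<^sup>2)"
 have "(\<integral>\<^sup>+om. ennreal ((incr k s t om)\<^sup>2) \<partial>M) = (\<integral>\<^sup>+om. ?f (om, incr k s t om) \<partial>M)" by simp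
 also have "... = (\<integral>\<^sup>+om. (\<integral>\<^sup>+x. ?f (om, x) \<partial>gauss (t - s)) \<partial>M)"
  by (rule indep1[OF assms(1) st assms(3)]) measurable
 also have "... = ennreal (t - s)"
  using st nn_integral_gauss_affine_sq[of "t - s" 0 1] by (simp add: emeasure_space_1)
 finally show ?thesis .
qed

text \<open>The exponential Markov inequality for the sum and for its negative, whence the factor
  2.\<close>

lemma simple_sum_tail:
 assumes P: "finite P" "P \<noteq> {}" "P \<subseteq> {0..}" and k: "k < N"
  and H: "!!u. u \<in> P ==> H u \<in> borel_measurable (Fm u)" "!!u om. u \<in> P ==> \<bar>H u om\<bar> <= \<kappa>"
  and L: "Max P - Min P <= L" "L > 0" and kp: "\<kappa> > 0" and a: "a > 0"
 shows "measure M {om \<in> space M. a <= \<bar>psum P (\<lambda>u v. H u om * incr k u v om)\<bar>} <= 2 * exp (- (a\<^sup>2 / (2 * \<kappa>\<^sup>2 * L)))"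
proof -
 let ?Q = "\<lambda>om. psum P (\<lambda>u v. H u om * incr k u v om)"
 have one: "measure M {om \<in> space M. a <= psum P (\<lambda>u v. G u om * incr k u v om)} <= exp (- (a\<^sup>2 / (2 * \<kappa>\<^sup>2 * L)))"
  if G: "!!u. u \<in> P ==> G u \<in> borel_measurable (Fm u)" "!!u om. u \<in> P ==> \<bar>G u om\<bar> <= \<kappa>" for G
 proof -
  define S where "S om = psum P (\<lambda>u v. G u om * incr k u v om)" for om
  have Max0: "0 <= Max P" by (rule Max_atLeast[OF P])
  have "S \<in> borel_measurable (Fm (Max P))" unfolding S_def by (rule simple_sum_Fm[OF P k G(1)])
  then have Sm [measurable]: "S \<in> borel_measurable M" by (rule Fm_M[OF Max0])
  \<comment> \<open>The minimiser of \<theta>^2 \<kappa>^2 L / 2 - \<theta> a.\<close>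
  define \<theta> where "\<theta> = a / (\<kappa>\<^sup>2 * L)"
  have th: "\<theta> > 0" using a kp L by (simp add: \<theta>_def)
  let ?E = "{om \<in> space M. a <= S om}"
  have "ennreal (exp (\<theta> * a)) * emeasure M ?E = (\<integral>\<^sup>+om. ennreal (exp (\<theta> * a)) * indicator ?E om \<partial>M)"
   by (simp add: nn_integral_cmult_indicator)
  also have "... <= (\<integral>\<^sup>+om. ennreal (exp (\<theta> * S om)) \<partial>M)"
   using th by (intro nn_integral_mono) (auto simp: indicator_def intro!: ennreal_leI)
  also have "... <= ennreal (exp (\<theta>\<^sup>2 * \<kappa>\<^sup>2 * (Max P - Min P) / 2))"
   unfolding S_def by (rule simple_sum_exp_bound[OF P k G])
  also have "... <= ennreal (exp (\<theta>\<^sup>2 * \<kappa>\<^sup>2 * L / 2))"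
   using L by (intro ennreal_leI) (auto intro!: mult_left_mono divide_right_mono)
  finally have "exp (\<theta> * a) * measure M ?E <= exp (\<theta>\<^sup>2 * \<kappa>\<^sup>2 * L / 2)"
   by (simp add: emeasure_eq_measure flip: ennreal_mult)
  then have "measure M ?E <= exp (\<theta>\<^sup>2 * \<kappa>\<^sup>2 * L / 2) / exp (\<theta> * a)" by (simp add: field_simps)
  also have "... = exp (\<theta>\<^sup>2 * \<kappa>\<^sup>2 * L / 2 - \<theta> * a)" by (simp add: exp_diff)
  also have "\<theta>\<^sup>2 * \<kappa>\<^sup>2 * L / 2 - \<theta> * a = - (a\<^sup>2 / (2 * \<kappa>\<^sup>2 * L))"
   using kp L by (simp add: \<theta>_def field_simps power2_eq_square)
  finally show ?thesis by (simp add: S_def)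
 qed
 have S_neg: "psum P (\<lambda>u v. - H u om * incr k u v om) = - ?Q om" for om
  by (simp add: psum_def Let_def sum_negf)
 note [measurable] = Fm_M[OF Max_atLeast[OF P] simple_sum_Fm[OF P k H(1)]]
 have "measure M {om \<in> space M. a <= \<bar>?Q om\<bar>} \<le>
  measure M ({om \<in> space M. a <= ?Q om} \<union> {om \<in> space M. a <= - ?Q om})"
  by (rule finite_measure_mono) (auto simp: abs_if)
 also have "... <= measure M {om \<in> space M. a <= ?Q om} + measure M {om \<in> space M. a <= - ?Q om}"
  by (rule measure_Un_le) auto
 also have "... <= exp (- (a\<^sup>2 / (2 * \<kappa>\<^sup>2 * L))) + exp (- (a\<^sup>2 / (2 * \<kappa>\<^sup>2 * L)))"
  using one[OF H] one[of "\<lambda>u om. - H u om"] H unfolding S_neg by (intro add_mono) auto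
 finally show ?thesis by simp
qed

end

section \<open>Dyadic grids and chaining\<close>

text \<open>The dyadic grid of level n with both end points added. Levels are nested, and cutting at
  a grid point gives the grids of the two parts, so one family serves all intervals and
  refinements.\<close>

definition dg :: "nat => real => real => real set" where
 "dg n s t = insert s (insert t ({s..t} \<inter> range (\<lambda>i::nat. real i / 2 ^ n)))"

definition dyadic :: "real set" where
 "dyadic = {real i / 2 ^ n | i n :: nat. True}"

lemma half_pow_powr: "1 / 2 ^ n = (2::real) powr (- real n)"
 by (simp add: powr_minus powr_realpow inverse_eq_divide)

lemma dyadicI [intro]: "real i / 2 ^ n \<in> dyadic"
 by (auto simp: dyadic_def)

lemma countable_dyadic: "countable dyadic"
proof -
 have "dyadic = (\<lambda>(i, n). real i / 2 ^ n) ` (UNIV :: (nat \<times> nat) set)" by (auto simp: dyadic_def)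
 then show ?thesis by (metis countableI_type countable_image)
qed

lemma dyadic_nonneg: "x \<in> dyadic ==> 0 <= x"
 by (auto simp: dyadic_def)

lemma finite_dg: "finite (dg n s t)"
proof -
 have "{s..t} \<inter> range (\<lambda>i::nat. real i / 2 ^ n) \<subseteq> (\<lambda>i. real i / 2 ^ n) ` {..nat \<lceil>t * 2 ^ n\<rceil>}"
 proof
  fix x assume "x \<in> {s..t} \<inter> range (\<lambda>i::nat. real i / 2 ^ n)"
  then obtain i :: nat where i: "x = real i / 2 ^ n" "x <= t" by auto
  then have "real i / 2 ^ n <= t" by simp
  then have "real i <= t * 2 ^ n" by (simp add: pos_divide_le_eq)
  then have "i <= nat \<lceil>t * 2 ^ n\<rceil>" by linarith
  then show "x \<in> (\<lambda>i. real i / 2 ^ n) ` {..nat \<lceil>t * 2 ^ n\<rceil>}" using i by auto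
 qed
 then show ?thesis unfolding dg_def by (metis finite.insertI finite_atMost finite_imageI finite_subset)
qed

lemma dg_partition: "s <= t ==> partition_of (dg n s t) s t"
 unfolding partition_of_def using finite_dg[of n s t] by (auto simp: dg_def)

lemma dg_sub: "s <= t ==> dg n s t \<subseteq> {s..t}" "s \<in> dg n s t" "t \<in> dg n s t"
 by (auto simp: dg_def)

lemma dg_gap:
 assumes "0 <= s" "(x, y) \<in> gaps (dg n s t)" "s <= t"
 shows "y - x <= 1 / 2 ^ n"
proof (rule ccontr)
 assume n: "\<not> y - x <= 1 / 2 ^ n"
 have xy: "x \<in> dg n s t" "y \<in> dg n s t" "dg n s t \<inter> {x<..<y} = {}" "s <= x" "y <= t" "0 <= x"
  using assms dg_sub(1)[OF assms(3), of n] by (auto simp: gaps_def)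
 define i where "i = nat (\<lfloor>x * 2 ^ n\<rfloor> + 1)"
 have fl: "real i = real_of_int \<lfloor>x * 2 ^ n\<rfloor> + 1" using xy by (simp add: i_def)
 have p: "(2::real) ^ n > 0" by simp
 have "x * 2 ^ n < real i" "real i <= x * 2 ^ n + 1" using fl by linarith+
 then have z: "x < real i / 2 ^ n" "real i / 2 ^ n <= x + 1 / 2 ^ n"
  by (simp_all add: pos_less_divide_eq pos_divide_le_eq distrib_right)
 then have "real i / 2 ^ n < y" using n by simp
 then have in1: "real i / 2 ^ n \<in> {x<..<y}" and "real i / 2 ^ n \<in> {s..t}" using z xy by auto
 then have "real i / 2 ^ n \<in> dg n s t" unfolding dg_def by blast
 then show False using xy(3) in1 by blast
qed

lemma dg_mesh:
 assumes "0 <= s" "s <= t" "1 / 2 ^ n < \<delta>"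
 shows "mesh (dg n s t) < \<delta>"
proof -
 have "0 < 1 / (2::real) ^ n" by simp
 then have "\<delta> > 0" using assms(3) by (rule less_trans)
 moreover have "y - x < \<delta>" if "(x, y) \<in> gaps (dg n s t)" for x y
  using dg_gap[OF assms(1) that assms(2)] assms(3) by linarith
 ultimately show ?thesis using mesh_less_iff[OF finite_dg] by auto
qed

lemma dg_restrict:
 assumes "m \<in> dg n s t" "s <= t"
 shows "dg n s t \<inter> {..m} = dg n s m" "dg n s t \<inter> {m..} = dg n m t"
 using assms unfolding dg_def by auto

lemma dg_mono: "n <= n' ==> dg n s t \<subseteq> dg n' s t"
proof -
 assume n: "n <= n'"
 have "real i / 2 ^ n \<in> range (\<lambda>i::nat. real i / 2 ^ n')" for i :: nat
 proof -
  have "(2::real) ^ n' = 2 ^ n * 2 ^ (n' - n)" using n by (simp flip: power_add)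
  then have "real i / 2 ^ n = real (i * 2 ^ (n' - n)) / 2 ^ n'" by simp
  then show ?thesis by blast
 qed
 then show ?thesis unfolding dg_def by auto
qed

lemma dg_dyadic: "s \<in> dyadic ==> t \<in> dyadic ==> dg n s t \<subseteq> dyadic"
 unfolding dg_def by auto

lemma half_pow_eventually: "\<delta> > 0 ==> \<forall>\<^sub>F n in sequentially. 1 / 2 ^ n < (\<delta>::real)"
proof -
 assume d: "\<delta> > 0"
 have "(\<lambda>n. (1/2::real) ^ n) \<longlonglongrightarrow> 0" by (rule LIMSEQ_power_zero) simp
 from order_tendstoD(2)[OF this d] show ?thesis by (simp add: power_one_over)
qed

section \<open>Summable tails and chaining\<close>

lemma exp_tail_summable:
 assumes "c > 0" "\<beta> > 0"
 shows "summable (\<lambda>n::nat. 2 ^ n * exp (- c * 2 powr (real n * \<beta>)))"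
proof -
 \<comment> \<open>With m \<beta> \<ge> 2 the m-th power of 2^(n\<beta>) dominates 4^n. The
   exponential beats that power, which leaves 2^(-n) after the multiplication by 2^n.\<close>
 obtain m :: nat where m: "real m * \<beta> >= 2"
  using reals_Archimedean3[OF assms(2)] by (metis less_imp_le mult.commute)
 have lim: "((\<lambda>x. x ^ m / exp x) \<longlongrightarrow> (0::real)) at_top" by (rule tendsto_power_div_exp_0)
 then have "\<forall>\<^sub>F x in at_top. x ^ m / exp x < (1::real)" by (rule order_tendstoD(2)) simp
 then obtain x0 where x0: "!!x. x >= x0 ==> x ^ m / exp x < (1::real)" by (auto simp: eventually_at_top_linorder)
 have gt: "filterlim (\<lambda>n::nat. c * 2 powr (real n * \<beta>)) at_top sequentially"
 proof (rule filterlim_tendsto_pos_mult_at_top[OF tendsto_const assms(1)])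
  have eq: "2 powr (real n * \<beta>) = (2 powr \<beta>) ^ n" for n by (simp add: powr_powr[symmetric] powr_realpow mult.commute)
  have "1 < (2::real) powr \<beta>" using assms by (simp add: gr_one_powr)
  then show "filterlim (\<lambda>n::nat. (2::real) powr (real n * \<beta>)) at_top sequentially"
   unfolding eq
   by (intro filterlim_at_infinity_imp_filterlim_at_top filterlim_realpow_sequentially_gt1 always_eventually allI zero_less_power) auto
 qed
 have ev: "\<forall>\<^sub>F n in sequentially. norm (2 ^ n * exp (- c * 2 powr (real n * \<beta>))) <= (1 / c ^ m) * (1 / 2) ^ n"
  using filterlim_at_top[THEN iffD1, OF gt, rule_format, of x0]
 proof eventually_elim
  case (elim n)
  let ?y = "2 powr (real n * \<beta>)"
  have y: "(c * ?y) ^ m < exp (c * ?y)" using x0[OF elim] by (simp add: divide_less_eq)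
  have "(4::real) ^ n = (2 powr 2) powr real n" by (simp add: powr_realpow)
  also have "... = 2 powr (2 * real n)" by (rule powr_powr)
  also have "... <= 2 powr (real n * \<beta> * real m)"
  proof (rule powr_mono)
   have "2 * real n <= (real m * \<beta>) * real n" using m by (intro mult_right_mono) auto
   then show "2 * real n <= real n * \<beta> * real m" by (simp add: mult_ac)
  qed simp
  also have "... = ?y ^ m" by (simp add: powr_powr[symmetric] powr_realpow)
  finally have "c ^ m * 4 ^ n <= (c * ?y) ^ m" using assms by (simp add: power_mult_distrib)
  then have "c ^ m * 4 ^ n <= exp (c * ?y)" using y by linarith
  then have "c ^ m * 4 ^ n * exp (- c * ?y) <= 1" by (simp add: exp_minus field_simps)
  moreover have "(4::real) ^ n = 2 ^ n * 2 ^ n" by (simp flip: power_mult_distrib)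
  ultimately have "c ^ m * 2 ^ n * (2 ^ n * exp (- c * ?y)) <= 1" by (simp add: mult_ac)
  then have "2 ^ n * exp (- c * ?y) <= 1 / (c ^ m * 2 ^ n)" using assms by (subst pos_le_divide_eq) (auto simp: mult_ac)
  then show ?case by (simp add: power_one_over)
 qed
 have "summable (\<lambda>n. (1 / c ^ m) * (1 / 2 :: real) ^ n)" by (intro summable_mult summable_geometric) simp
 then show ?thesis by (rule summable_comparison_test_ev[OF ev])
qed

text \<open>Level n has T 2^n cells, so the union bound costs a factor 2^n, which
  \<open>exp_tail_summable\<close> tolerates.\<close>

lemma (in prob_space) borel_cantelli_dyadic:
 fixes T :: nat and c \<beta> :: real
 assumes meas: "!!n i. bad n i \<in> sets M" and c: "c > 0" "\<beta> > 0"
  and b: "!!n i. i < T * 2 ^ n ==> measure M (bad n i) <= 2 * exp (- c * 2 powr (real n * \<beta>))"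
 shows "AE om in M. \<exists>n0. \<forall>n\<ge>n0. \<forall>i<T * 2 ^ n. om \<notin> bad n i"
proof -
 define U where "U n = (\<Union>i<T * 2 ^ n. bad n i)" for n
 have Um: "U n \<in> sets M" for n unfolding U_def using meas by auto
 have Ub: "measure M (U n) <= (2 * real T) * (2 ^ n * exp (- c * 2 powr (real n * \<beta>)))" for n
 proof -
  have "measure M (U n) <= (\<Sum>i<T * 2 ^ n. measure M (bad n i))"
   unfolding U_def by (rule measure_UNION_le) (use meas in auto)
  also have "... <= (\<Sum>i<T * 2 ^ n. 2 * exp (- c * 2 powr (real n * \<beta>)))" by (rule sum_mono) (use b in auto)
  finally show ?thesis by (simp add: mult_ac)
 qed
 have "summable (\<lambda>n. measure M (U n))"
  by (rule summable_comparison_test'[OF summable_mult[OF exp_tail_summable[OF c]], of _ _ "2 * real T"]) (use Ub in auto)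
 then have "AE om in M. \<forall>\<^sub>F n in sequentially. om \<in> space M - U n"
  by (intro borel_cantelli_AE1 Um) (auto simp: emeasure_eq_measure)
 then show ?thesis
  by eventually_elim (auto simp: eventually_sequentially U_def)
qed

text \<open>Below n0 there are finitely many cells; their normalised sizes are simply added to the
  constant.\<close>

lemma dyadic_uniformize:
 fixes x :: "nat => nat => real"
 assumes "\<exists>n0. \<forall>n\<ge>n0. \<forall>i<T * 2 ^ n. \<bar>x n i\<bar> <= D * 2 powr (- (real n * \<gamma>))"
 obtains C where "C >= 0" "!!n i. i < T * 2 ^ n ==> \<bar>x n i\<bar> <= C * 2 powr (- (real n * \<gamma>))"
proof -
 obtain n0 where n0: "!!n i. n >= n0 ==> i < T * 2 ^ n ==> \<bar>x n i\<bar> <= D * 2 powr (- (real n * \<gamma>))" using assms by auto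
 define y where "y n i = \<bar>x n i\<bar> * 2 powr (real n * \<gamma>)" for n i
 have y0: "y n i >= 0" for n i by (simp add: y_def)
 define C where "C = \<bar>D\<bar> + (\<Sum>n<n0. \<Sum>i<T * 2 ^ n. y n i)"
 have s0: "(\<Sum>n<n0. \<Sum>i<T * 2 ^ n. y n i) >= 0" by (intro sum_nonneg y0)
 show thesis
 proof (rule that[of C])
  show "C >= 0" using s0 by (simp add: C_def)
  fix n i :: nat assume i: "i < T * 2 ^ n"
  have "y n i <= C"
  proof (cases "n >= n0")
   case True
   have "y n i <= (D * 2 powr (- (real n * \<gamma>))) * 2 powr (real n * \<gamma>)"
    unfolding y_def by (rule mult_right_mono[OF n0[OF True i]]) simp
   also have "... = D" by (simp add: powr_minus)
   finally show ?thesis using s0 unfolding C_def by linarith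
  next
   case False
   have "y n i <= (\<Sum>i<T * 2 ^ n. y n i)" using i y0 by (intro member_le_sum) auto
   also have "... <= (\<Sum>n<n0. \<Sum>i<T * 2 ^ n. y n i)"
    using False y0 by (intro member_le_sum[of n "{..<n0}" "\<lambda>n. \<Sum>i<T * 2 ^ n. y n i"]) (auto intro!: sum_nonneg)
   finally show ?thesis unfolding C_def by simp
  qed
  then have "y n i * 2 powr (- (real n * \<gamma>)) <= C * 2 powr (- (real n * \<gamma>))" by (rule mult_right_mono) simp
  moreover have "y n i * 2 powr (- (real n * \<gamma>)) = \<bar>x n i\<bar>" by (simp add: y_def powr_minus)
  ultimately show "\<bar>x n i\<bar> <= C * 2 powr (- (real n * \<gamma>))" by (simp only:)
 qed
qed

text \<open>The defect is allowed to be a product of two Hoelder bounds, which covers path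
  increments (no defect) and the area (defect from Chen's relation) alike. Each refinement costs two
  end cells and two defects, all at most C 2^(-m\<gamma>) r^(n+1-m) with r = 2^(-\<gamma>/2): one
  factor of the defect sees the fine scale 2^(-n-1), the other only the total length 2^(-m).\<close>

lemma dyadic_chain:
 fixes A :: "real => real => real" and T :: nat
 assumes g: "\<gamma> > 0" and C: "C >= 0" and d0: "!!s. A s s = 0"
  and d1: "!!n i. i < T * 2 ^ n ==> \<bar>A (real i / 2 ^ n) (real (Suc i) / 2 ^ n)\<bar> <= C * 2 powr (- (real n * \<gamma>))"
  and d2: "!!s u t. 0 <= s ==> s <= u ==> u <= t ==> t <= real T ==>
    \<bar>A s t - A s u - A u t\<bar> <= C * ((u - s) powr (\<gamma> / 2) * (t - u) powr (\<gamma> / 2))"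
  and ij: "i <= j" "j <= T * 2 ^ n" "m <= n" "real (j - i) / 2 ^ n <= 1 / 2 ^ m"
 shows "\<bar>A (real i / 2 ^ n) (real j / 2 ^ n)\<bar> <= 4 * C * 2 powr (- (real m * \<gamma>)) * (\<Sum>l\<le>n - m. (2 powr (- (\<gamma> / 2))) ^ l)"
 using ij(3) ij(1,2,4)
proof (induction n arbitrary: i j rule: dec_induct)
 case base
 have "real (j - i) <= 1" using base(3) by (simp add: divide_le_cancel)
 then consider "j = i" | "j = Suc i" using base(1) by linarith
 then show ?case
 proof cases
  case 1
  then show ?thesis using C by (simp add: d0)
 next
  case 2
  then have "\<bar>A (real i / 2 ^ m) (real j / 2 ^ m)\<bar> <= C * 2 powr (- (real m * \<gamma>))" using d1[of i m] base by simp
  also have "... <= 4 * C * 2 powr (- (real m * \<gamma>))" using C by (intro mult_right_mono) auto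
  finally show ?thesis by simp
 qed
next
 case (step n)
 let ?r = "2 powr (- (\<gamma> / 2)) :: real"
 let ?N = "2 ^ Suc n :: real"
 have r: "0 <= ?r" by simp
 \<comment> \<open>The end points are rounded inward to the coarser grid, i/2 upwards and j/2
   downwards.\<close>
 define i' where "i' = (i + 1) div 2"
 define j' where "j' = j div 2"
 let ?s = "real i / ?N" and ?t = "real j / ?N" and ?s' = "real i' / 2 ^ n" and ?t' = "real j' / 2 ^ n"
 have S: "!!x. real x / 2 ^ n = real (2 * x) / ?N" by simp
 have nb: "\<bar>A (real a / ?N) (real b / ?N)\<bar> <= C * 2 powr (- (real (Suc n) * \<gamma>))" if "a <= b" "b <= a + 1" "b <= T * 2 ^ Suc n" for a b
 proof (cases "a = b")
  case True
  then show ?thesis using C by (simp add: d0)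
 next
  case False
  then have "b = Suc a" using that by simp
  then show ?thesis using d1[of a "Suc n"] that by simp
 qed
 show ?case
 proof (cases "i' <= j'")
  case False
  \<comment> \<open>The rounded points cross only if i = j is odd.\<close>
  then have "i = j" using step.prems(1) unfolding i'_def j'_def by linarith
  then show ?thesis using C r by (simp add: d0 sum_nonneg)
 next
  case True
  have o: "i <= 2 * i'" "2 * i' <= i + 1" "2 * j' <= j" "j <= 2 * j' + 1" unfolding i'_def j'_def by linarith+
  have le: "?s <= ?s'" "?s' <= ?t'" "?t' <= ?t"
   unfolding S by (rule divide_right_mono[OF of_nat_mono]; use o True in simp)+
  have tT: "?t <= real T"
  proof -
   have "real j <= real (T * 2 ^ Suc n)" using step.prems(2) by (rule of_nat_mono)
   then show ?thesis by (subst pos_divide_le_eq) auto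
  qed
  have IH: "\<bar>A ?s' ?t'\<bar> <= 4 * C * 2 powr (- (real m * \<gamma>)) * (\<Sum>l\<le>n - m. ?r ^ l)"
  proof (rule step.IH[OF True])
   show "j' <= T * 2 ^ n" using step.prems(2) o by simp
   have "2 * (j' - i') <= j - i" using o by linarith
   then have "real (2 * (j' - i')) / ?N <= real (j - i) / ?N" by (intro divide_right_mono of_nat_mono) auto
   then show "real (j' - i') / 2 ^ n <= 1 / 2 ^ m" using step.prems(3) unfolding S by linarith
  qed
  have ts: "?t - ?s <= 1 / 2 ^ m" using step.prems by (simp add: of_nat_diff diff_divide_distrib)
  have ss: "?s' - ?s <= 1 / ?N" "?t - ?t' <= 1 / ?N"
   unfolding S using o by (simp_all only: diff_divide_distrib[symmetric]) (auto intro!: divide_right_mono)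
  have h: "(1 / ?N) powr (\<gamma> / 2) * (1 / 2 ^ m) powr (\<gamma> / 2) = 2 powr (- (real m * \<gamma>)) * ?r ^ (Suc n - m)"
  proof -
   note a = half_pow_powr
   have "(1 / ?N) powr (\<gamma> / 2) * (1 / 2 ^ m) powr (\<gamma> / 2) = 2 powr (- real (Suc n) * (\<gamma> / 2) + - real m * (\<gamma> / 2))"
    unfolding a by (simp add: powr_powr powr_add[symmetric])
   also have "- real (Suc n) * (\<gamma> / 2) + - real m * (\<gamma> / 2) = - (real m * \<gamma>) + (- (\<gamma> / 2)) * real (Suc n - m)"
    using step.hyps by (simp add: of_nat_diff field_simps)
   also have "2 powr (- (real m * \<gamma>) + (- (\<gamma> / 2)) * real (Suc n - m)) = 2 powr (- (real m * \<gamma>)) * ?r ^ (Suc n - m)"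
    by (simp only: powr_add powr_powr[symmetric]) (simp add: powr_realpow)
   finally show ?thesis .
  qed
  have e2: "C * ((x) powr (\<gamma> / 2) * (y) powr (\<gamma> / 2)) <= C * (2 powr (- (real m * \<gamma>)) * ?r ^ (Suc n - m))"
   if "0 <= x" "x <= 1 / ?N" "0 <= y" "y <= 1 / 2 ^ m" for x y
   unfolding h[symmetric] by (intro mult_left_mono[OF _ C] mult_mono powr_mono2) (use that g in auto)
  have D1: "\<bar>A ?s ?t - A ?s ?s' - A ?s' ?t\<bar> <= C * (2 powr (- (real m * \<gamma>)) * ?r ^ (Suc n - m))"
   by (rule order_trans[OF d2 e2]) (use le tT ss ts in auto)
  have D2: "\<bar>A ?s' ?t - A ?s' ?t' - A ?t' ?t\<bar> <= C * (2 powr (- (real m * \<gamma>)) * ?r ^ (Suc n - m))"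
  proof (rule order_trans[OF d2])
   have "C * ((?t - ?t') powr (\<gamma> / 2) * (?t' - ?s') powr (\<gamma> / 2)) <= C * (2 powr (- (real m * \<gamma>)) * ?r ^ (Suc n - m))"
    by (rule e2) (use le ss ts in auto)
   then show "C * ((?t' - ?s') powr (\<gamma> / 2) * (?t - ?t') powr (\<gamma> / 2)) <= C * (2 powr (- (real m * \<gamma>)) * ?r ^ (Suc n - m))"
    by (simp only: mult.commute)
  qed (use le tT in auto)
  \<comment> \<open>The bound for a cell of level n+1 is the defect bound with both lengths equal to
    2^(-n-1).\<close>
  have e1: "C * 2 powr (- (real (Suc n) * \<gamma>)) <= C * (2 powr (- (real m * \<gamma>)) * ?r ^ (Suc n - m))"
  proof -
   have "2 powr (- (real (Suc n) * \<gamma>)) = (1 / ?N) powr (\<gamma> / 2) * (1 / ?N) powr (\<gamma> / 2)"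
   proof -
    note a = half_pow_powr[of "Suc n"]
    show ?thesis unfolding a by (simp add: powr_powr powr_add[symmetric] algebra_simps)
   qed
   moreover have "(1 / ?N) <= 1 / 2 ^ m" using step.hyps by (intro divide_left_mono power_increasing) auto
   ultimately show ?thesis using e2[of "1 / ?N" "1 / ?N"] by simp
  qed
  have N1: "\<bar>A ?s ?s'\<bar> <= C * 2 powr (- (real (Suc n) * \<gamma>))" unfolding S
   by (rule nb) (use o True step.prems in auto)
  have N2: "\<bar>A ?t' ?t\<bar> <= C * 2 powr (- (real (Suc n) * \<gamma>))" unfolding S
   by (rule nb) (use o True step.prems in auto)
  have "\<bar>A ?s ?t\<bar> <= \<bar>A ?s' ?t'\<bar> + 4 * (C * (2 powr (- (real m * \<gamma>)) * ?r ^ (Suc n - m)))"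
   using D1 D2 e1 N1 N2 by linarith
  also have "... <= 4 * C * 2 powr (- (real m * \<gamma>)) * (\<Sum>l\<le>n - m. ?r ^ l) + 4 * (C * (2 powr (- (real m * \<gamma>)) * ?r ^ (Suc n - m)))"
   using IH by simp
  also have "... = 4 * C * 2 powr (- (real m * \<gamma>)) * (\<Sum>l\<le>Suc n - m. ?r ^ l)"
  proof -
   have "Suc n - m = Suc (n - m)" using step.hyps by simp
   then show ?thesis by (simp add: distrib_left mult_ac)
  qed
  finally show ?thesis .
 qed
qed

text \<open>Adapting the coarse scale m to the distance makes the bound of
  \<open>dyadic_chain\<close> independent of the level for nearby dyadic points. Continuity carries
  it to real points, and distances above 1 are covered by a bound of |A| on the compact
  square.\<close>

lemma chain_holder:
 fixes A :: "real => real => real" and T :: nat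
 assumes g: "\<gamma> > 0" and C: "C >= 0" and d0: "!!s. A s s = 0"
  and d1: "!!n i. i < T * 2 ^ n ==> \<bar>A (real i / 2 ^ n) (real (Suc i) / 2 ^ n)\<bar> <= C * 2 powr (- (real n * \<gamma>))"
  and d2: "!!s u t. 0 <= s ==> s <= u ==> u <= t ==> t <= real T ==>
    \<bar>A s t - A s u - A u t\<bar> <= C * ((u - s) powr (\<gamma> / 2) * (t - u) powr (\<gamma> / 2))"
  and cont: "continuous_on ({0..real T} \<times> {0..real T}) (\<lambda>z. A (fst z) (snd z))"
 shows "\<exists>C'. \<forall>s t. 0 <= s \<and> s <= t \<and> t <= real T --> \<bar>A s t\<bar> <= C' * (t - s) powr \<gamma>"
proof -
 let ?r = "2 powr (- (\<gamma> / 2)) :: real"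
 have r: "0 <= ?r" "?r < 1" using g powr_less_mono[of "- (\<gamma> / 2)" 0 2] by auto
 define K where "K = 4 * C * (1 / (1 - ?r)) * 2 powr \<gamma>"
 have K0: "K >= 0" using C r by (simp add: K_def)
 have dy: "\<bar>A (real i / 2 ^ n) (real j / 2 ^ n)\<bar> <= K * (real j / 2 ^ n - real i / 2 ^ n) powr \<gamma>"
  if ij: "i < j" "j <= T * 2 ^ n" "real j / 2 ^ n - real i / 2 ^ n <= 1" for i j n
 proof -
  define h where "h = real j / 2 ^ n - real i / 2 ^ n"
  have hh: "h = real (j - i) / 2 ^ n" using ij by (simp add: h_def of_nat_diff diff_divide_distrib)
  have h0: "h >= 1 / 2 ^ n" unfolding hh using ij by (intro divide_right_mono) auto
  \<comment> \<open>The scale with 2^(-m-1) < h \<le> 2^(-m); the factor 2^\<gamma> in K pays for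
    replacing 2^(-m) by h.\<close>
  define m where "m = (GREATEST m. h <= 1 / 2 ^ m)"
  have bd: "k <= n" if "h <= 1 / 2 ^ k" for k
  proof -
   have "1 / (2::real) ^ n <= 1 / 2 ^ k" using h0 that by linarith
   then have "(2::real) ^ k <= 2 ^ n" by (simp add: field_simps)
   then show ?thesis by simp
  qed
  have h1: "h <= 1 / 2 ^ 0" using ij by (simp add: h_def)
  have m1: "h <= 1 / 2 ^ m" unfolding m_def by (rule GreatestI_nat[where P = "\<lambda>m. h <= 1 / 2 ^ m", OF h1 bd])
  have m2: "\<not> h <= 1 / 2 ^ Suc m"
  proof
   assume "h <= 1 / 2 ^ Suc m"
   then have "Suc m <= m" unfolding m_def using Greatest_le_nat[where P = "\<lambda>m. h <= 1 / 2 ^ m", OF _ bd] by blast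
   then show False by simp
  qed
  have "\<bar>A (real i / 2 ^ n) (real j / 2 ^ n)\<bar> <= 4 * C * 2 powr (- (real m * \<gamma>)) * (\<Sum>l\<le>n - m. ?r ^ l)"
   by (rule dyadic_chain[OF g C d0 d1 d2]) (use ij bd[OF m1] m1 hh in auto)
  also have "... <= 4 * C * 2 powr (- (real m * \<gamma>)) * (1 / (1 - ?r))"
  proof (rule mult_left_mono)
   have "(\<Sum>l\<le>n - m. ?r ^ l) <= (\<Sum>l. ?r ^ l)" using r by (intro sum_le_suminf summable_geometric) auto
   also have "... = 1 / (1 - ?r)" using r by (intro suminf_geometric) auto
   finally show "(\<Sum>l\<le>n - m. ?r ^ l) <= 1 / (1 - ?r)" .
  qed (use C in simp)
  also have "... = 4 * C * (1 / (1 - ?r)) * 2 powr (- (real m * \<gamma>))" by simp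
  also have "... <= 4 * C * (1 / (1 - ?r)) * (2 powr \<gamma> * h powr \<gamma>)"
  proof (rule mult_left_mono)
   have "2 powr (- (real m * \<gamma>)) = 2 powr \<gamma> * (1 / 2 ^ Suc m) powr \<gamma>"
   proof -
    note a = half_pow_powr[of "Suc m"]
    show ?thesis unfolding a by (simp add: powr_powr powr_add[symmetric] algebra_simps)
   qed
   also have "... <= 2 powr \<gamma> * h powr \<gamma>" using m2 g by (intro mult_left_mono powr_mono2) auto
   finally show "2 powr (- (real m * \<gamma>)) <= 2 powr \<gamma> * h powr \<gamma>" .
  qed (use C r in simp)
  also have "... = K * h powr \<gamma>" by (simp add: K_def)
  finally show ?thesis unfolding h_def .
 qed
 have cl: "\<bar>A s t\<bar> <= K * (t - s) powr \<gamma>" if st: "0 <= s" "s < t" "t <= real T" "t - s <= 1" for s t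
 proof -
  \<comment> \<open>s is rounded up and t down, so the approximating pairs keep a distance of at
    most t - s \<le> 1.\<close>
  define i where "i n = nat \<lceil>s * 2 ^ n\<rceil>" for n
  define j where "j n = nat \<lfloor>t * 2 ^ n\<rfloor>" for n
  have p: "(2::real) ^ n > 0" for n by simp
  have bi: "s * 2 ^ n <= real (i n)" "real (i n) <= s * 2 ^ n + 1" for n
  proof -
   have "0 <= s * 2 ^ n" using st by simp
   then have "real (i n) = real_of_int \<lceil>s * 2 ^ n\<rceil>" by (simp add: i_def)
   then show "s * 2 ^ n <= real (i n)" "real (i n) <= s * 2 ^ n + 1" by linarith+
  qed
  have bj: "real (j n) <= t * 2 ^ n" "t * 2 ^ n - 1 <= real (j n)" for n
  proof -
   have "0 <= t * 2 ^ n" using st by simp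
   then have "real (j n) = real_of_int \<lfloor>t * 2 ^ n\<rfloor>" by (simp add: j_def)
   then show "real (j n) <= t * 2 ^ n" "t * 2 ^ n - 1 <= real (j n)" by linarith+
  qed
  define x where "x n = real (i n) / 2 ^ n" for n
  define y where "y n = real (j n) / 2 ^ n" for n
  have bx: "s <= x n" "x n <= s + 1 / 2 ^ n" for n
   unfolding x_def using bi[of n] p[of n] by (simp_all add: pos_le_divide_eq pos_divide_le_eq distrib_right)
  have by': "y n <= t" "t - 1 / 2 ^ n <= y n" for n
   unfolding y_def using bj[of n] p[of n] by (simp_all add: pos_le_divide_eq pos_divide_le_eq left_diff_distrib)
  have hp: "(\<lambda>n. 1 / 2 ^ n :: real) \<longlonglongrightarrow> 0"
   using LIMSEQ_power_zero[of "1/2::real"] by (simp add: power_one_over)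
  have lx: "x \<longlonglongrightarrow> s"
   by (rule tendsto_sandwich[of "\<lambda>n. s" _ _ "\<lambda>n. s + 1 / 2 ^ n"]) (use bx tendsto_add[OF tendsto_const hp, of s] in auto)
  have ly: "y \<longlonglongrightarrow> t"
   by (rule tendsto_sandwich[of "\<lambda>n. t - 1 / 2 ^ n" _ _ "\<lambda>n. t"]) (use by' tendsto_diff[OF tendsto_const hp, of t] in auto)
  have ev: "\<forall>\<^sub>F n in sequentially. x n < y n"
   by (rule order_tendstoD(1)[OF tendsto_diff[OF ly lx], of 0, THEN eventually_mono]) (use st in auto)
  have evb: "\<forall>\<^sub>F n in sequentially. \<bar>A (x n) (y n)\<bar> <= K * (y n - x n) powr \<gamma>"
   using ev
  proof eventually_elim
   case (elim n)
   have "t * 2 ^ n <= real T * 2 ^ n" by (rule mult_right_mono[OF st(3)]) simp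
   then have "real (j n) <= real T * 2 ^ n" using bj(1)[of n] by linarith
   then have "real (j n) <= real (T * 2 ^ n)" by simp
   then have "j n <= T * 2 ^ n" by (rule of_nat_le_iff[THEN iffD1])
   moreover have "i n < j n" using elim p[of n] by (simp add: x_def y_def divide_less_cancel)
   moreover have "y n - x n <= 1" using bx(1)[of n] by'(1)[of n] st by linarith
   ultimately show ?case unfolding x_def y_def by (intro dy) auto
  qed
  have lA: "(\<lambda>n. A (x n) (y n)) \<longlonglongrightarrow> A s t"
  proof -
   have "((\<lambda>n. A (fst (x n, y n)) (snd (x n, y n))) \<longlongrightarrow> A (fst (s, t)) (snd (s, t))) sequentially"
   proof (rule continuous_on_tendsto_compose[OF cont tendsto_Pair[OF lx ly]])
    show "\<forall>\<^sub>F n in sequentially. (x n, y n) \<in> {0..real T} \<times> {0..real T}"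
     using ev
    proof eventually_elim
     case (elim n)
     then show ?case using bx(1)[of n] by'(1)[of n] st by auto
    qed
   qed (use st in auto)
   then show ?thesis by simp
  qed
  have lp: "(\<lambda>n. K * (y n - x n) powr \<gamma>) \<longlonglongrightarrow> K * (t - s) powr \<gamma>"
   by (intro tendsto_intros lx ly) (use st in auto)
  show ?thesis
   by (rule tendsto_le[OF _ lp tendsto_rabs[OF lA] evb]) simp
 qed
 have "compact ((\<lambda>z. A (fst z) (snd z)) ` ({0..real T} \<times> {0..real T}))"
  by (intro compact_continuous_image cont compact_Times) auto
 then obtain Mx where Mx: "!!s t. s \<in> {0..real T} ==> t \<in> {0..real T} ==> \<bar>A s t\<bar> <= Mx"
 proof -
  from \<open>compact _\<close> obtain B where B: "\<forall>z\<in>(\<lambda>z. A (fst z) (snd z)) ` ({0..real T} \<times> {0..real T}). norm z <= B"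
   using compact_imp_bounded bounded_iff by blast
  have "\<bar>A s t\<bar> <= B" if "s \<in> {0..real T}" "t \<in> {0..real T}" for s t
  proof -
   have "A s t \<in> (\<lambda>z. A (fst z) (snd z)) ` ({0..real T} \<times> {0..real T})"
    using that by (intro image_eqI[of _ _ "(s, t)"]) auto
   then show ?thesis using B by fastforce
  qed
  then show thesis by (rule that)
 qed
 have "\<bar>A s t\<bar> <= (K + \<bar>Mx\<bar>) * (t - s) powr \<gamma>" if st: "0 <= s" "s <= t" "t <= real T" for s t
 proof (cases "t - s <= 1")
  case True
  show ?thesis
  proof (cases "s = t")
   case False
   then have "\<bar>A s t\<bar> <= K * (t - s) powr \<gamma>" using cl True st by auto
   then show ?thesis by (simp add: distrib_right add_increasing2)
  qed (simp add: d0)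
 next
  case False
  then have "1 <= (t - s) powr \<gamma>" using g by (simp add: ge_one_powr_ge_zero)
  then have "\<bar>Mx\<bar> * 1 <= \<bar>Mx\<bar> * (t - s) powr \<gamma>" by (intro mult_left_mono) auto
  moreover have "\<bar>A s t\<bar> <= \<bar>Mx\<bar>" using Mx[of s t] st by auto
  moreover have "K * (t - s) powr \<gamma> >= 0" using K0 by simp
  ultimately show ?thesis by (simp add: distrib_right)
 qed
 then show ?thesis by blast
qed

section \<open>Ito sums in probability\<close>

context prob_space
begin

definition convP :: "(nat => 'a => real) => bool" where
 "convP X \<longleftrightarrow> (\<forall>\<epsilon>>0. (\<lambda>n. measure M {om \<in> space M. \<epsilon> < \<bar>X n om\<bar>}) \<longlonglongrightarrow> 0)"

lemma convP_AE_cong: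
 assumes c: "convP X" and ae: "!!n. AE om in M. X n om = Y n om"
  and m: "!!n. X n \<in> borel_measurable M" "!!n. Y n \<in> borel_measurable M"
 shows "convP Y"
 unfolding convP_def
proof (intro allI impI)
 fix \<epsilon> :: real assume e: "\<epsilon> > 0"
 have "measure M {om \<in> space M. \<epsilon> < \<bar>Y n om\<bar>} = measure M {om \<in> space M. \<epsilon> < \<bar>X n om\<bar>}" for n
 proof (rule finite_measure_eq_AE)
  note [measurable] = m
  show "AE x in M. (x \<in> {om \<in> space M. \<epsilon> < \<bar>Y n om\<bar>}) = (x \<in> {om \<in> space M. \<epsilon> < \<bar>X n om\<bar>})"
   using ae[of n] by eventually_elim auto
  show "{om \<in> space M. \<epsilon> < \<bar>Y n om\<bar>} \<in> sets M" "{om \<in> space M. \<epsilon> < \<bar>X n om\<bar>} \<in> sets M" by measurable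
 qed
 then show "(\<lambda>n. measure M {om \<in> space M. \<epsilon> < \<bar>Y n om\<bar>}) \<longlonglongrightarrow> 0"
  using c e by (simp add: convP_def)
qed

lemma convP_diff:
 assumes X: "convP X" and Y: "convP Y" and m: "!!n. X n \<in> borel_measurable M" "!!n. Y n \<in> borel_measurable M"
 shows "convP (\<lambda>n om. X n om - Y n om)"
 unfolding convP_def
proof (intro allI impI)
 fix \<epsilon> :: real assume e: "\<epsilon> > 0"
 then have e2: "\<epsilon> / 2 > 0" by simp
 have "(\<lambda>n. measure M {om \<in> space M. \<epsilon> / 2 < \<bar>X n om\<bar>} + measure M {om \<in> space M. \<epsilon> / 2 < \<bar>Y n om\<bar>}) \<longlonglongrightarrow> 0 + 0"
  by (intro tendsto_add X[unfolded convP_def, rule_format, OF e2] Y[unfolded convP_def, rule_format, OF e2])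
 then have lim: "(\<lambda>n. measure M {om \<in> space M. \<epsilon> / 2 < \<bar>X n om\<bar>} + measure M {om \<in> space M. \<epsilon> / 2 < \<bar>Y n om\<bar>}) \<longlonglongrightarrow> 0" by simp
 note [measurable] = m
 have le: "norm (measure M {om \<in> space M. \<epsilon> < \<bar>X n om - Y n om\<bar>}) \<le>
    measure M {om \<in> space M. \<epsilon> / 2 < \<bar>X n om\<bar>} + measure M {om \<in> space M. \<epsilon> / 2 < \<bar>Y n om\<bar>}" for n
 proof -
  have "measure M {om \<in> space M. \<epsilon> < \<bar>X n om - Y n om\<bar>} \<le>
   measure M ({om \<in> space M. \<epsilon> / 2 < \<bar>X n om\<bar>} \<union> {om \<in> space M. \<epsilon> / 2 < \<bar>Y n om\<bar>})"
   by (rule finite_measure_mono) auto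
  also have "... <= measure M {om \<in> space M. \<epsilon> / 2 < \<bar>X n om\<bar>} + measure M {om \<in> space M. \<epsilon> / 2 < \<bar>Y n om\<bar>}"
   by (rule measure_Un_le) auto
  finally show ?thesis by simp
 qed
 show "(\<lambda>n. measure M {om \<in> space M. \<epsilon> < \<bar>X n om - Y n om\<bar>}) \<longlonglongrightarrow> 0"
  by (rule Lim_null_comparison[OF always_eventually[OF allI[OF le]] lim])
qed

text \<open>Diagonal extraction: stage l controls only the first l+1 sequences at threshold 1/(l+1),
  failing with probability below 2^(-l). By Borel-Cantelli a single subsequence serves countably
  many sequences.\<close>

lemma convP_subseq:
 fixes X :: "'i::countable => nat => 'a => real"
 assumes c: "!!i. convP (X i)" and m: "!!i n. X i n \<in> borel_measurable M"
 obtains r where "strict_mono r" "AE om in M. \<forall>i. (\<lambda>n. X i (r n) om) \<longlonglongrightarrow> 0"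
proof -
 define Z where "Z l n = (\<Union>i\<le>l. {om \<in> space M. 1 / real (Suc l) < \<bar>X (from_nat i) n om\<bar>})" for l n :: nat
 note [measurable] = m
 have Zm: "Z l n \<in> sets M" for l n unfolding Z_def by measurable
 have lim: "(\<lambda>n. measure M (Z l n)) \<longlonglongrightarrow> 0" for l
 proof -
  have "(\<lambda>n. \<Sum>i\<le>l. measure M {om \<in> space M. 1 / real (Suc l) < \<bar>X (from_nat i) n om\<bar>}) \<longlonglongrightarrow> (\<Sum>i\<le>l. 0)"
   using c unfolding convP_def by (intro tendsto_sum) simp
  then have 1: "(\<lambda>n. \<Sum>i\<le>l. measure M {om \<in> space M. 1 / real (Suc l) < \<bar>X (from_nat i) n om\<bar>}) \<longlonglongrightarrow> 0" by simp
  have 2: "norm (measure M (Z l n)) <= (\<Sum>i\<le>l. measure M {om \<in> space M. 1 / real (Suc l) < \<bar>X (from_nat i) n om\<bar>})" for n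
   unfolding Z_def real_norm_def abs_of_nonneg[OF measure_nonneg] by (rule measure_UNION_le) auto
  show ?thesis by (rule Lim_null_comparison[OF always_eventually[OF allI[OF 2]] 1])
 qed
 have "\<exists>r. \<forall>l. measure M (Z l (r l)) < (1 / 2) ^ l \<and> r l < r (Suc l)"
 proof (rule dependent_nat_choice)
  have "\<forall>\<^sub>F n in sequentially. measure M (Z 0 n) < (1 / 2) ^ 0" by (rule order_tendstoD(2)[OF lim]) simp
  then show "\<exists>x. measure M (Z 0 x) < (1 / 2) ^ 0" by (auto simp: eventually_sequentially)
  fix x l :: nat
  have "\<forall>\<^sub>F n in sequentially. measure M (Z (Suc l) n) < (1 / 2) ^ Suc l" by (rule order_tendstoD(2)[OF lim]) simp
  then have "\<forall>\<^sub>F n in sequentially. measure M (Z (Suc l) n) < (1 / 2) ^ Suc l \<and> x < n"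
   using eventually_gt_at_top[of x] by eventually_elim blast
  then show "\<exists>y. measure M (Z (Suc l) y) < (1 / 2) ^ Suc l \<and> x < y" by (rule eventually_happens'[OF sequentially_bot])
 qed
 then obtain r where r: "!!l. measure M (Z l (r l)) < (1 / 2) ^ l" "!!l. r l < r (Suc l)" by blast
 have sm: "strict_mono r" using r(2) by (simp add: strict_mono_Suc_iff)
 have "summable (\<lambda>l. measure M (Z l (r l)))"
 proof (rule summable_comparison_test'[OF summable_geometric[of "1/2 :: real"], of 0])
  show "norm (measure M (Z n (r n))) <= (1 / 2) ^ n" for n using less_imp_le[OF r(1)[of n]] by (simp only: real_norm_def abs_of_nonneg[OF measure_nonneg])
 qed simp
 then have "AE om in M. \<forall>\<^sub>F l in sequentially. om \<in> space M - Z l (r l)"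
  by (intro borel_cantelli_AE1 Zm) (auto simp: emeasure_eq_measure)
 then have "AE om in M. \<forall>i. (\<lambda>n. X i (r n) om) \<longlonglongrightarrow> 0"
 proof eventually_elim
  case (elim om)
  show ?case
  proof
   fix i
   show "(\<lambda>n. X i (r n) om) \<longlonglongrightarrow> 0"
   proof (rule Lim_null_comparison)
    show "\<forall>\<^sub>F n in sequentially. norm (X i (r n) om) <= 1 / real (Suc n)"
     using elim eventually_ge_at_top[of "to_nat i"]
    proof eventually_elim
     case (elim n)
     then have "\<not> 1 / real (Suc n) < \<bar>X (from_nat (to_nat i)) (r n) om\<bar>" unfolding Z_def by blast
     then show ?case by simp
    qed
    show "(\<lambda>n. 1 / real (Suc n)) \<longlonglongrightarrow> 0" using LIMSEQ_Suc[OF lim_1_over_n] by simp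
   qed
  qed
 qed
 with sm show thesis by (rule that)
qed

lemma convP_of_L2:
 assumes m: "!!n. X n \<in> borel_measurable M" and b: "!!n. (\<integral>\<^sup>+om. ennreal ((X n om)\<^sup>2) \<partial>M) <= ennreal (c n)"
  and c: "c \<longlonglongrightarrow> 0" "!!n. c n >= 0"
 shows "convP X"
 unfolding convP_def
proof (intro allI impI)
 fix \<epsilon> :: real assume e: "\<epsilon> > 0"
 note [measurable] = m
 have le: "measure M {om \<in> space M. \<epsilon> < \<bar>X n om\<bar>} <= c n / \<epsilon>\<^sup>2" for n
 proof -
  let ?E = "{om \<in> space M. \<epsilon> < \<bar>X n om\<bar>}"
  have "ennreal (\<epsilon>\<^sup>2) * emeasure M ?E = (\<integral>\<^sup>+om. ennreal (\<epsilon>\<^sup>2) * indicator ?E om \<partial>M)"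
   by (simp add: nn_integral_cmult_indicator)
  also have "... <= (\<integral>\<^sup>+om. ennreal ((X n om)\<^sup>2) \<partial>M)"
  proof (rule nn_integral_mono)
   fix om
   have "\<epsilon>\<^sup>2 <= (X n om)\<^sup>2" if "\<epsilon> < \<bar>X n om\<bar>" using power_mono[of \<epsilon> "\<bar>X n om\<bar>" 2] that e by simp
   then show "ennreal (\<epsilon>\<^sup>2) * indicator ?E om <= ennreal ((X n om)\<^sup>2)" by (auto simp: indicator_def intro: ennreal_leI)
  qed
  also have "... <= ennreal (c n)" by (rule b)
  finally have "ennreal (\<epsilon>\<^sup>2 * measure M ?E) <= ennreal (c n)"
   by (simp only: emeasure_eq_measure ennreal_mult[OF zero_le_power2 measure_nonneg])
  then have "\<epsilon>\<^sup>2 * measure M ?E <= c n" by (rule ennreal_le_iff[OF c(2), THEN iffD1])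
  then show ?thesis using e by (simp add: pos_le_divide_eq mult.commute)
 qed
 have lim: "(\<lambda>n. c n / \<epsilon>\<^sup>2) \<longlonglongrightarrow> 0" using tendsto_divide[OF c(1) tendsto_const, of "\<epsilon>\<^sup>2"] e by simp
 show "(\<lambda>n. measure M {om \<in> space M. \<epsilon> < \<bar>X n om\<bar>}) \<longlonglongrightarrow> 0"
  by (rule tendsto_sandwich[OF always_eventually always_eventually tendsto_const lim]) (use le in simp_all)
qed

text \<open>Fatou's lemma along an almost surely convergent subsequence.\<close>

lemma convP_L2_limit:
 assumes c: "convP (\<lambda>n om. X n om - Y om)" and m: "!!n. X n \<in> borel_measurable M" "Y \<in> borel_measurable M"
  and b: "!!n. (\<integral>\<^sup>+om. ennreal ((X n om)\<^sup>2) \<partial>M) <= C"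
 shows "(\<integral>\<^sup>+om. ennreal ((Y om)\<^sup>2) \<partial>M) <= C"
proof -
 note [measurable] = m
 have "\<exists>r. strict_mono r \<and> (AE om in M. \<forall>i::unit. (\<lambda>n. X (r n) om - Y om) \<longlonglongrightarrow> 0)"
  by (rule convP_subseq[of "\<lambda>_::unit. \<lambda>n om. X n om - Y om"]) (use c in auto)
 then obtain r where r: "AE om in M. (\<lambda>n. X (r n) om - Y om) \<longlonglongrightarrow> 0" by auto
 have "(\<integral>\<^sup>+om. ennreal ((Y om)\<^sup>2) \<partial>M) <= (\<integral>\<^sup>+om. liminf (\<lambda>n. ennreal ((X (r n) om)\<^sup>2)) \<partial>M)"
 proof (rule nn_integral_mono_AE)
  show "AE om in M. ennreal ((Y om)\<^sup>2) <= liminf (\<lambda>n. ennreal ((X (r n) om)\<^sup>2))"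
   using r
  proof eventually_elim
   case (elim om)
   then have "(\<lambda>n. X (r n) om) \<longlonglongrightarrow> Y om" by (simp add: LIM_zero_iff)
   then have "(\<lambda>n. ennreal ((X (r n) om)\<^sup>2)) \<longlonglongrightarrow> ennreal ((Y om)\<^sup>2)" by (intro tendsto_intros)
   then have "liminf (\<lambda>n. ennreal ((X (r n) om)\<^sup>2)) = ennreal ((Y om)\<^sup>2)" by (intro lim_imp_Liminf) auto
   then show ?case by simp
  qed
 qed
 also have "... <= liminf (\<lambda>n. \<integral>\<^sup>+om. ennreal ((X (r n) om)\<^sup>2) \<partial>M)" by (rule nn_integral_liminf) measurable
 also have "... <= liminf (\<lambda>n. C)" by (rule Liminf_mono) (use b in auto)
 finally show ?thesis by (simp add: Liminf_const)
qed

end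

section \<open>Riemann sums of Ito integrals along dyadic grids\<close>

context bm_family
begin

lemma rsum_meas:
 assumes "finite P" "P \<subseteq> {0..}" "k < N" "!!u. u \<in> P ==> h u \<in> borel_measurable M"
 shows "(\<lambda>om. psum P (\<lambda>u v. h u om * incr k u v om)) \<in> borel_measurable M"
proof -
 have "(\<lambda>om. \<Sum>(u, v)\<in>gaps P. h u om * incr k u v om) \<in> borel_measurable M"
 proof (rule borel_measurable_sum)
  fix z assume "z \<in> gaps P"
  then have z: "fst z \<in> P" "snd z \<in> P" by (auto simp: gaps_def)
  have [measurable]: "h (fst z) \<in> borel_measurable M" "incr k (fst z) (snd z) \<in> borel_measurable M"
   using z assms by (auto intro!: incr_meas)
  show "(\<lambda>om. case z of (u, v) => h u om * incr k u v om) \<in> borel_measurable M"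
   unfolding case_prod_unfold by measurable
 qed
 then show ?thesis by (simp add: psum_gaps[OF assms(1)])
qed

lemma adapted_M: "adapted M F h ==> 0 <= u ==> h u \<in> borel_measurable M"
 by (rule Fm_M[OF _ adapted_Fm])

lemma dg_nonneg: "0 <= s ==> s <= t ==> dg n s t \<subseteq> {0..}"
 using dg_sub(1)[of s t n] by fastforce

lemma ito_conv_partition:
 assumes J: "ito_proc M h (B k) J" and t: "t > 0" and P: "!!n. partition_of (P n) 0 t" "!!\<delta>. \<delta> > 0 ==> \<forall>\<^sub>F n in sequentially. mesh (P n) < \<delta>"
 shows "convP (\<lambda>n om. psum (P n) (\<lambda>u v. h u om * incr k u v om) - J t om)"
 unfolding convP_def
proof (intro allI impI)
 fix \<epsilon> :: real assume e: "\<epsilon> > 0"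
 show "(\<lambda>n. measure M {om \<in> space M. \<epsilon> < \<bar>psum (P n) (\<lambda>u v. h u om * incr k u v om) - J t om\<bar>}) \<longlonglongrightarrow> 0"
 proof (rule tendstoI)
  fix \<eta> :: real assume "\<eta> > 0"
  then obtain \<delta> where d: "\<delta> > 0" "!!P. partition_of P 0 t \<and> mesh P < \<delta> ==>
    measure M {om \<in> space M. \<epsilon> < \<bar>psum P (\<lambda>u v. h u om * (B k v om - B k u om)) - J t om\<bar>} < \<eta>"
   using J[unfolded ito_proc_def, THEN conjunct2, THEN conjunct2, rule_format, OF t e] by blast
  show "\<forall>\<^sub>F n in sequentially. dist (measure M {om \<in> space M. \<epsilon> < \<bar>psum (P n) (\<lambda>u v. h u om * incr k u v om) - J t om\<bar>}) 0 < \<eta>"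
   using P(2)[OF d(1)]
  proof eventually_elim
   case (elim n)
   then show ?case using d(2)[of "P n"] P(1)[of n] by (simp add: incr_def)
  qed
 qed
qed

lemma dg_mesh_eventually:
 "0 <= s ==> s <= t ==> \<delta> > 0 ==> \<forall>\<^sub>F n in sequentially. mesh (dg n s t) < \<delta>"
 using half_pow_eventually[of \<delta>] by (auto elim: eventually_mono intro: dg_mesh)

lemma ito_conv0:
 assumes J: "ito_proc M h (B k) J" and h: "adapted M F h" and k: "k < N" and t: "0 <= t"
 shows "convP (\<lambda>n om. psum (dg n 0 t) (\<lambda>u v. h u om * incr k u v om) - J t om)"
proof (cases "t = 0")
 case False
 then show ?thesis
  using t by (intro ito_conv_partition[OF J]) (auto intro!: dg_partition dg_mesh_eventually)
next
 \<comment> \<open>The convergence in \<open>ito_proc\<close> concerns t > 0 only; at t = 0 the sums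
   are empty and J 0 = 0 almost surely.\<close>
 case True
 have Jm: "J 0 \<in> borel_measurable M" and J0: "AE om in M. J 0 om = 0"
  using J unfolding ito_proc_def by (auto elim: AE_mp)
 have d0: "dg n 0 0 = {0}" for n by (auto simp: dg_def)
 have "convP (\<lambda>n om. 0)" by (auto simp: convP_def)
 then show ?thesis unfolding True d0 psum_single
  by (rule convP_AE_cong) (use Jm J0 in \<open>auto elim: eventually_mono\<close>)
qed

text \<open>\<open>ito_proc\<close> speaks of partitions of [0,t] only. The grids of [0,s] and [s,t]
  together form one, and the limit over [0,s] is subtracted.\<close>

lemma ito_conv:
 assumes J: "ito_proc M h (B k) J" and h: "adapted M F h" and k: "k < N" and st: "0 <= s" "s < t"
 shows "convP (\<lambda>n om. psum (dg n s t) (\<lambda>u v. h u om * incr k u v om) - (J t om - J s om))"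
proof -
 define P where "P n = dg n 0 s \<union> dg n s t" for n
 have p1: "partition_of (dg n 0 s) 0 s" and p2: "partition_of (dg n s t) s t" for n
  using st by (auto intro: dg_partition)
 have P: "partition_of (P n) 0 t" for n unfolding P_def by (rule partition_union(1)[OF p1 p2])
 have Pm: "\<forall>\<^sub>F n in sequentially. mesh (P n) < \<delta>" if d: "\<delta> > 0" for \<delta>
  using dg_mesh_eventually[OF order_refl st(1) d] dg_mesh_eventually[OF st(1) less_imp_le[OF st(2)] d]
  by eventually_elim (use mesh_union[OF p1 p2] d in \<open>auto simp: P_def\<close>)
 have c1: "convP (\<lambda>n om. psum (P n) (\<lambda>u v. h u om * incr k u v om) - J t om)"
  using st by (intro ito_conv_partition[OF J _ P Pm]) auto
 have c2: "convP (\<lambda>n om. psum (dg n 0 s) (\<lambda>u v. h u om * incr k u v om) - J s om)"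
  by (rule ito_conv0[OF J h k st(1)])
 have Jm: "J t \<in> borel_measurable M" "J s \<in> borel_measurable M"
  using J st unfolding ito_proc_def by auto
 have m1: "(\<lambda>om. psum (P n) (\<lambda>u v. h u om * incr k u v om)) \<in> borel_measurable M" for n
  using P[of n] by (intro rsum_meas k adapted_M[OF h]) (auto simp: partition_of_def)
 have m2: "(\<lambda>om. psum (dg n 0 s) (\<lambda>u v. h u om * incr k u v om)) \<in> borel_measurable M" for n
  using p1[of n] by (intro rsum_meas k adapted_M[OF h]) (auto simp: partition_of_def)
 have "convP (\<lambda>n om. (psum (P n) (\<lambda>u v. h u om * incr k u v om) - J t om) - (psum (dg n 0 s) (\<lambda>u v. h u om * incr k u v om) - J s om))"
  by (rule convP_diff[OF c1 c2]) (use m1 m2 Jm in auto)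
 then show ?thesis unfolding P_def psum_union[OF p1 p2] by (simp add: algebra_simps)
qed

text \<open>The event E may look into the future, so an adapted sum cannot be restricted to it.
  Truncating the integrand to [-\<kappa>, \<kappa>] keeps adaptedness and changes nothing on E. The
  threshold 2 a is shared between the exponential tail of the truncated sums and the distance of the
  Riemann sums from the integral, which vanishes in probability.\<close>

lemma ito_tail:
 assumes J: "ito_proc M h (B k) J" and h: "adapted M F h" and k: "k < N" and st: "0 <= s" "s < t"
  and dy: "s \<in> dyadic" "t \<in> dyadic" and E: "E \<in> sets M"
  and Eh: "!!om u. om \<in> E ==> u \<in> dyadic ==> s <= u ==> u <= t ==> \<bar>h u om - h s om\<bar> <= \<kappa>"
  and kp: "\<kappa> > 0" and a: "a > 0"
 shows "measure M (E \<inter> {om \<in> space M. 2 * a < \<bar>J t om - J s om - h s om * incr k s t om\<bar>}) <= 2 * exp (- (a\<^sup>2 / (2 * \<kappa>\<^sup>2 * (t - s))))"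
proof -
 let ?D = "\<lambda>om. J t om - J s om - h s om * incr k s t om"
 let ?S = "\<lambda>n om. psum (dg n s t) (\<lambda>u v. h u om * incr k u v om)"
 define H where "H u om = max (- \<kappa>) (min \<kappa> (h u om - h s om))" for u om
 have dgp: "partition_of (dg n s t) s t" for n using st by (intro dg_partition) simp
 have dgs: "finite (dg n s t)" "dg n s t \<noteq> {}" "dg n s t \<subseteq> {0..}" "dg n s t \<subseteq> {s..t}" for n
  using dgp[of n] st by (auto simp: partition_of_def)
 have Jm [measurable]: "J t \<in> borel_measurable M" "J s \<in> borel_measurable M"
  using J st unfolding ito_proc_def by auto
 have hm [measurable]: "h s \<in> borel_measurable M" using adapted_M[OF h st(1)] .
 have im [measurable]: "incr k s t \<in> borel_measurable M" using incr_meas[OF k] st by simp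
 have Sm [measurable]: "?S n \<in> borel_measurable M" for n
  using dgs[of n] by (intro rsum_meas k adapted_M[OF h]) auto
 have Hm: "H u \<in> borel_measurable (Fm u)" if "u \<in> dg n s t" for u n
 proof -
  have u: "s <= u" "0 <= u" using that dgs(3,4)[of n] by auto
  have [measurable]: "h u \<in> borel_measurable (Fm u)" "h s \<in> borel_measurable (Fm u)"
   using adapted_Fm[OF h u(2)] Fm_mono[OF st(1) u(1) adapted_Fm[OF h st(1)]] by auto
  show ?thesis unfolding H_def by measurable
 qed
 let ?T = "\<lambda>n om. psum (dg n s t) (\<lambda>u v. H u om * incr k u v om)"
 have Tm [measurable]: "?T n \<in> borel_measurable M" for n
 proof (rule rsum_meas[OF dgs(1) dgs(3) k])
  fix u assume u: "u \<in> dg n s t"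
  then have "0 <= u" using dgs(3) by auto
  then show "H u \<in> borel_measurable M" by (rule Fm_M[OF _ Hm[OF u]])
 qed
 have tail: "measure M {om \<in> space M. a <= \<bar>?T n om\<bar>} <= 2 * exp (- (a\<^sup>2 / (2 * \<kappa>\<^sup>2 * (t - s))))" for n
 proof (rule simple_sum_tail[OF dgs(1,2,3) k Hm])
  show "\<bar>H u om\<bar> <= \<kappa>" for u om using kp by (auto simp: H_def)
  have "Max (dg n s t) <= t" "s <= Min (dg n s t)" using dgs[of n] by auto
  then show "Max (dg n s t) - Min (dg n s t) <= t - s" by simp
 qed (use st kp a in auto)
 have onE: "?S n om - h s om * incr k s t om = ?T n om" if "om \<in> E" for n om
 proof -
  have "h s om * incr k s t om = psum (dg n s t) (\<lambda>u v. h s om * incr k u v om)"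
   unfolding psum_mult incr_def using psum_additive[OF dgp, of n "\<lambda>u. B k u om"] by simp
  then have "?S n om - h s om * incr k s t om = psum (dg n s t) (\<lambda>u v. h u om * incr k u v om - h s om * incr k u v om)"
   by (simp add: psum_diff)
  also have "... = ?T n om"
  proof (rule psum_cong[OF dgs(1)])
   fix u v assume "(u, v) \<in> gaps (dg n s t)"
   then have "u \<in> dg n s t" by (auto simp: gaps_def)
   then have "u \<in> dyadic" "s <= u" "u <= t" using dg_dyadic[OF dy] dgs(4)[of n] by auto
   then have "H u om = h u om - h s om" using Eh[OF that, of u] by (auto simp: H_def abs_le_iff)
   then show "h u om * incr k u v om - h s om * incr k u v om = H u om * incr k u v om" by (simp add: left_diff_distrib)
  qed
  finally show ?thesis .
 qed
 have le: "measure M (E \<inter> {om \<in> space M. 2 * a < \<bar>?D om\<bar>}) <= measure M {om \<in> space M. a < \<bar>?S n om - (J t om - J s om)\<bar>} + 2 * exp (- (a\<^sup>2 / (2 * \<kappa>\<^sup>2 * (t - s))))" for n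
 proof -
  have "measure M (E \<inter> {om \<in> space M. 2 * a < \<bar>?D om\<bar>}) <= measure M ({om \<in> space M. a < \<bar>?S n om - (J t om - J s om)\<bar>} \<union> {om \<in> space M. a <= \<bar>?T n om\<bar>})"
  proof (rule finite_measure_mono)
   show "E \<inter> {om \<in> space M. 2 * a < \<bar>?D om\<bar>} \<subseteq> {om \<in> space M. a < \<bar>?S n om - (J t om - J s om)\<bar>} \<union> {om \<in> space M. a <= \<bar>?T n om\<bar>}"
   proof
    fix om assume w: "om \<in> E \<inter> {om \<in> space M. 2 * a < \<bar>?D om\<bar>}"
    then have "?D om = ?T n om - (?S n om - (J t om - J s om))" using onE[of om n] by simp
    then have "a < \<bar>?S n om - (J t om - J s om)\<bar> \<or> a <= \<bar>?T n om\<bar>" using w by auto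
    then show "om \<in> {om \<in> space M. a < \<bar>?S n om - (J t om - J s om)\<bar>} \<union> {om \<in> space M. a <= \<bar>?T n om\<bar>}" using w by blast
   qed
  qed measurable
  also have "... <= measure M {om \<in> space M. a < \<bar>?S n om - (J t om - J s om)\<bar>} + measure M {om \<in> space M. a <= \<bar>?T n om\<bar>}"
   by (rule measure_Un_le) measurable
  finally show ?thesis using tail[of n] by linarith
 qed
 have "(\<lambda>n. measure M {om \<in> space M. a < \<bar>?S n om - (J t om - J s om)\<bar>} + 2 * exp (- (a\<^sup>2 / (2 * \<kappa>\<^sup>2 * (t - s))))) \<longlonglongrightarrow> 0 + 2 * exp (- (a\<^sup>2 / (2 * \<kappa>\<^sup>2 * (t - s))))"
  using ito_conv[OF J h k st] a unfolding convP_def by (intro tendsto_add tendsto_const) blast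
 from LIMSEQ_le_const[OF this] le show ?thesis by auto
qed

lemma AE_dyadic_small:
 assumes bad: "!!n i. bad n i = {om \<in> space M. D * 2 powr (- (real n * \<gamma>)) < \<bar>x n i om\<bar>}"
  and ae: "\<exists>n0. \<forall>n\<ge>n0. \<forall>i<T * 2 ^ n. om \<notin> bad n i" and w: "om \<in> space M"
 shows "\<exists>n0. \<forall>n\<ge>n0. \<forall>i<T * 2 ^ n. \<bar>x n i om\<bar> <= D * 2 powr (- (real n * \<gamma>))"
 using ae w unfolding bad by (auto simp: not_less)

definition holder_upto :: "nat => real => (real => real) => bool" where
 "holder_upto T \<gamma> f \<longleftrightarrow> (\<exists>C. \<forall>s t. 0 <= s \<and> s <= t \<and> t <= real T --> \<bar>f t - f s\<bar> <= C * (t - s) powr \<gamma>)"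

lemma B_cont: "AE om in M. \<forall>k<N. continuous_on {0..} (\<lambda>t. B k t om)"
 using bm unfolding std_BM_family_def by (auto elim: AE_mp)

lemma diff_prod_cont:
 fixes f :: "real => real"
 assumes "continuous_on {0..} f"
 shows "continuous_on ({0..real T} \<times> {0..real T}) (\<lambda>z. f (fst z))" "continuous_on ({0..real T} \<times> {0..real T}) (\<lambda>z. f (snd z))"
 by (rule continuous_on_compose2[OF assms]; auto intro: continuous_intros)+

end

context bm_family
begin

lemma incr_tail:
 assumes st: "0 <= s" "s < t" and k: "k < N" and a: "a > 0"
 shows "measure M {om \<in> space M. a <= \<bar>incr k s t om\<bar>} <= 2 * exp (- (a\<^sup>2 / (2 * (t - s))))"
proof -
 have "measure M {om \<in> space M. a <= \<bar>psum {s, t} (\<lambda>u v. (\<lambda>_ _. 1) u om * incr k u v om)\<bar>} <= 2 * exp (- (a\<^sup>2 / (2 * 1\<^sup>2 * (t - s))))"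
  by (rule simple_sum_tail[of "{s, t}" k "\<lambda>_ _. 1"]) (use st k a in auto)
 then show ?thesis unfolding psum_pair[OF st(2)] by simp
qed

lemma dyadic_uniformize_ex:
 fixes x :: "nat => nat => real"
 assumes "\<exists>n0. \<forall>n\<ge>n0. \<forall>i<T * 2 ^ n. \<bar>x n i\<bar> <= D * 2 powr (- (real n * \<gamma>))"
 shows "\<exists>C\<ge>0. \<forall>n i. i < T * 2 ^ n --> \<bar>x n i\<bar> <= C * 2 powr (- (real n * \<gamma>))"
 by (rule dyadic_uniformize[OF assms]) blast

text \<open>Over a cell of level n the threshold 2^(-n\<alpha>) amounts to 2^(n(1-2\<alpha>)/2)
  standard deviations, so the tails are summable for \<alpha> < 1/2; chaining applies with zero
  defect.\<close>

lemma B_holder: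
 assumes al: "0 < \<alpha>" "\<alpha> < 1 / 2" and k: "k < N"
 shows "AE om in M. holder_upto T \<alpha> (\<lambda>t. B k t om)"
proof -
 define x where "x n i om = incr k (real i / 2 ^ n) (real (Suc i) / 2 ^ n) om" for n i :: nat and om
 define bad where "bad n i = {om \<in> space M. 1 * 2 powr (- (real n * \<alpha>)) < \<bar>x n i om\<bar>}" for n i
 have xm [measurable]: "x n i \<in> borel_measurable M" for n i unfolding x_def by (rule incr_meas[OF k]) auto
 have "AE om in M. \<exists>n0. \<forall>n\<ge>n0. \<forall>i<T * 2 ^ n. om \<notin> bad n i"
 proof (rule borel_cantelli_dyadic[where c = "1 / 2" and \<beta> = "1 - 2 * \<alpha>"])
  show "bad n i \<in> sets M" for n i unfolding bad_def by measurable
  fix n i :: nat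
  have lt: "real i / 2 ^ n < real (Suc i) / 2 ^ n" by (simp add: divide_strict_right_mono)
  have df: "real (Suc i) / 2 ^ n - real i / 2 ^ n = 1 / 2 ^ n" by (simp add: diff_divide_distrib[symmetric])
  let ?a = "2 powr (- (real n * \<alpha>)) :: real"
  have "measure M (bad n i) <= measure M {om \<in> space M. ?a <= \<bar>x n i om\<bar>}"
   unfolding bad_def by (rule finite_measure_mono) auto
  also have "... <= 2 * exp (- (?a\<^sup>2 / (2 * (1 / 2 ^ n))))"
   unfolding x_def using incr_tail[OF _ lt k, of ?a] unfolding df by simp
  also have "?a\<^sup>2 / (2 * (1 / 2 ^ n)) = 1 / 2 * 2 powr (real n * (1 - 2 * \<alpha>))"
  proof -
   have 1: "?a\<^sup>2 = 2 powr (- (2 * (real n * \<alpha>)))" by (simp only: power2_eq_square powr_add[symmetric]) (simp add: mult.commute)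
   have 2: "(2::real) ^ n = 2 powr real n" by (simp add: powr_realpow)
   have "?a\<^sup>2 / (2 * (1 / 2 ^ n)) = 1 / 2 * (?a\<^sup>2 * 2 ^ n)" by simp
   also have "?a\<^sup>2 * 2 ^ n = 2 powr (- (2 * (real n * \<alpha>)) + real n)" by (simp only: 1 2 powr_add)
   also have "- (2 * (real n * \<alpha>)) + real n = real n * (1 - 2 * \<alpha>)" by (simp add: algebra_simps)
   finally show ?thesis .
  qed
  finally show "measure M (bad n i) <= 2 * exp (- (1 / 2) * 2 powr (real n * (1 - 2 * \<alpha>)))" by simp
 qed (use al in auto)
 then show ?thesis
  using B_cont AE_space
 proof eventually_elim
  case (elim om)
  have "\<exists>n0. \<forall>n\<ge>n0. \<forall>i<T * 2 ^ n. \<bar>x n i om\<bar> <= 1 * 2 powr (- (real n * \<alpha>))"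
   by (rule AE_dyadic_small[OF bad_def elim(1,3)])
  then obtain C where C: "C >= 0" "!!n i. i < T * 2 ^ n ==> \<bar>x n i om\<bar> <= C * 2 powr (- (real n * \<alpha>))"
   using dyadic_uniformize_ex[of T "\<lambda>n i. x n i om" 1 \<alpha>] by blast
  have c: "continuous_on {0..} (\<lambda>t. B k t om)" using elim k by blast
  show ?case unfolding holder_upto_def
  proof (rule chain_holder[where A = "\<lambda>s t. B k t om - B k s om", OF al(1) C(1)])
   show "\<bar>B k (real (Suc i) / 2 ^ n) om - B k (real i / 2 ^ n) om\<bar> <= C * 2 powr (- (real n * \<alpha>))" if "i < T * 2 ^ n" for n i
    using C(2)[OF that] by (simp add: x_def incr_def)
   show "continuous_on ({0..real T} \<times> {0..real T}) (\<lambda>z. B k (snd z) om - B k (fst z) om)"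
    by (intro continuous_on_diff diff_prod_cont c)
  qed (use C in auto)
 qed
qed

end

section \<open>Controlled paths\<close>

text \<open>Dyadic rounding upwards. Natural numbers are fixed, so rounding never leaves [0,T] for
  natural T.\<close>

definition dup :: "nat => real => real" where
 "dup n t = real (nat \<lceil>t * 2 ^ n\<rceil>) / 2 ^ n"

lemma dup_dyadic: "dup n t \<in> dyadic"
 unfolding dup_def by (rule dyadicI)

lemma dup_bounds:
 assumes "0 <= t"
 shows "t <= dup n t" "dup n t <= t + 1 / 2 ^ n"
proof -
 have p: "(2::real) ^ n > 0" by simp
 have "0 <= t * 2 ^ n" using assms by simp
 then have "real (nat \<lceil>t * 2 ^ n\<rceil>) = real_of_int \<lceil>t * 2 ^ n\<rceil>" by simp
 then have "t * 2 ^ n <= real (nat \<lceil>t * 2 ^ n\<rceil>)" "real (nat \<lceil>t * 2 ^ n\<rceil>) <= t * 2 ^ n + 1" by linarith+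
 then show "t <= dup n t" "dup n t <= t + 1 / 2 ^ n"
  unfolding dup_def using p by (simp_all add: pos_le_divide_eq pos_divide_le_eq distrib_right)
qed

lemma dup_mono: "s <= t ==> dup n s <= dup n t"
 unfolding dup_def by (intro divide_right_mono of_nat_mono nat_mono ceiling_mono mult_right_mono) auto

lemma dup_nat: "dup n (real T) = real T"
proof -
 have "real T * 2 ^ n = real_of_int (int (T * 2 ^ n))" by simp
 then have "\<lceil>real T * 2 ^ n\<rceil> = int (T * 2 ^ n)" by (simp only: ceiling_of_int)
 then have "nat \<lceil>real T * 2 ^ n\<rceil> = T * 2 ^ n" by (simp only: nat_int)
 then show ?thesis by (simp add: dup_def)
qed

lemma dup_le: "t <= real T ==> dup n t <= real T"
 using dup_mono[of t "real T" n] by (simp add: dup_nat)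

lemma dup_lim:
 assumes "0 <= t"
 shows "(\<lambda>n. dup n t) \<longlonglongrightarrow> t"
proof -
 have hp: "(\<lambda>n. 1 / 2 ^ n :: real) \<longlonglongrightarrow> 0"
  using LIMSEQ_power_zero[of "1/2::real"] by (simp add: power_one_over)
 have "(\<lambda>n. t + 1 / 2 ^ n) \<longlonglongrightarrow> t" using tendsto_add[OF tendsto_const hp, of t] by simp
 then show ?thesis
  by (rule tendsto_sandwich[OF _ _ tendsto_const, rotated 2]) (use dup_bounds[OF assms] in auto)
qed

lemma dup_compose:
 assumes f: "continuous_on {0..} f" and t: "0 <= t"
 shows "(\<lambda>n. f (dup n t)) \<longlonglongrightarrow> f t"
proof (rule continuous_on_tendsto_compose[OF f dup_lim[OF t]])
 have "0 <= dup n t" for n using dup_bounds(1)[OF t, of n] t by linarith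
 then show "\<forall>\<^sub>F n in sequentially. dup n t \<in> {0..}" by simp
qed (use t in simp)

lemma dyadic_zero_extend:
 fixes f :: "real => real"
 assumes f: "continuous_on {0..} f" and z: "!!t. t \<in> dyadic ==> f t = 0" and t: "0 <= t"
 shows "f t = 0"
proof -
 have "(\<lambda>n. f (dup n t)) \<longlonglongrightarrow> f t" by (rule dup_compose[OF f t])
 moreover have "(\<lambda>n. f (dup n t)) = (\<lambda>n. 0)" using z[OF dup_dyadic] by simp
 ultimately show ?thesis by (metis LIMSEQ_unique tendsto_const)
qed

lemma holder_on_abs:
 assumes "holder_on S \<alpha> f"
 shows "\<exists>C\<ge>0. \<forall>s\<in>S. \<forall>t\<in>S. norm (f t - f s) <= C * \<bar>t - s\<bar> powr \<alpha>"
proof -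
 obtain C where C: "!!s t. s \<in> S ==> t \<in> S ==> norm (f t - f s) <= C * \<bar>t - s\<bar> powr \<alpha>"
  using assms by (auto simp: holder_on_def)
 have "norm (f t - f s) <= \<bar>C\<bar> * \<bar>t - s\<bar> powr \<alpha>" if "s \<in> S" "t \<in> S" for s t
  by (rule order_trans[OF C[OF that]]) (intro mult_right_mono, auto)
 then show ?thesis by (intro exI[of _ "\<bar>C\<bar>"]) auto
qed

lemma holder_on_uniform:
 fixes N :: nat
 assumes "\<forall>j<N. holder_on S \<alpha> (f j)"
 shows "\<exists>C\<ge>0. \<forall>j<N. \<forall>s\<in>S. \<forall>t\<in>S. norm (f j t - f j s) <= C * \<bar>t - s\<bar> powr \<alpha>"
proof -
 have "\<forall>j. \<exists>C. j < N --> C >= 0 \<and> (\<forall>s\<in>S. \<forall>t\<in>S. norm (f j t - f j s) <= C * \<bar>t - s\<bar> powr \<alpha>)"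
  using assms holder_on_abs by blast
 then obtain C where C: "!!j. j < N ==> C j >= 0"
  "!!j s t. j < N ==> s \<in> S ==> t \<in> S ==> norm (f j t - f j s) <= C j * \<bar>t - s\<bar> powr \<alpha>" by metis
 have le: "C j <= (\<Sum>j<N. C j)" if "j < N" for j using C(1) that by (intro member_le_sum) auto
 have "norm (f j t - f j s) <= (\<Sum>j<N. C j) * \<bar>t - s\<bar> powr \<alpha>" if "j < N" "s \<in> S" "t \<in> S" for j s t
  by (rule order_trans[OF C(2)[OF that]]) (intro mult_right_mono le that, auto)
 moreover have "(\<Sum>j<N. C j) >= 0" using C(1) by (intro sum_nonneg) auto
 ultimately show ?thesis by blast
qed

text \<open>The compensated summand of a rough integral against a single component b, where A j is
  the second level of component j against b.\<close>

definition germ :: "nat => (real => real) => (nat => real => real => real) => (real => 'b::real_normed_vector)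
  => (nat => real => 'b) => real => real => 'b" where
 "germ N b A Y Y' u w = (b w - b u) *\<^sub>R Y u + (\<Sum>j<N. A j u w *\<^sub>R Y' j u)"

text \<open>By Chen's relation the defect of the germ is minus the increment of B_k times the
  remainder of Y, minus the second level times the increments of Y'. The orders \<alpha> + 2\<alpha>
  and 2\<alpha> + \<alpha> both exceed 1.\<close>

lemma controlled_sewing:
 fixes Y :: "real => 'b::banach"
 assumes al: "1 / 3 < \<alpha>" and c: "controlled_on {a..b} \<alpha> N Bp Y Y'" and k: "k < N" and H: "H >= 0"
  and ho: "!!u w. a <= u ==> u <= w ==> w <= b ==> \<bar>Bp k w - Bp k u\<bar> <= H * (w - u) powr \<alpha>"
  and area: "!!j u w. j < N ==> a <= u ==> u <= w ==> w <= b ==> \<bar>A j u w\<bar> <= H * (w - u) powr (2 * \<alpha>)"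
  and chen: "!!j u m w. j < N ==> A j u w = A j u m + A j m w + (Bp j m - Bp j u) * (Bp k w - Bp k m)"
 shows "\<exists>L K. \<forall>u w. a <= u \<and> u <= w \<and> w <= b -->
  norm (L w - L u - germ N (Bp k) A Y Y' u w) <= K * (w - u) powr (3 * \<alpha>)"
proof -
 obtain C1 where C1: "C1 >= 0" "\<forall>j<N. \<forall>s\<in>{a..b}. \<forall>t\<in>{a..b}. norm (Y' j t - Y' j s) <= C1 * \<bar>t - s\<bar> powr \<alpha>"
  using holder_on_uniform[of N "{a..b}" \<alpha> Y'] c unfolding controlled_on_def by blast
 obtain C2 where C2: "\<forall>u\<in>{a..b}. \<forall>v\<in>{a..b}.
    norm (Y v - Y u - (\<Sum>j<N. (Bp j v - Bp j u) *\<^sub>R Y' j u)) <= C2 * \<bar>v - u\<bar> powr (2 * \<alpha>)"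
  using c unfolding controlled_on_def by blast
 let ?X = "germ N (Bp k) A Y Y'"
 define C where "C = \<bar>C2\<bar> * H + real N * (C1 * H)"
 have C0: "C >= 0" unfolding C_def using C1(1) H by simp
 have d: "norm (?X u w - ?X u m - ?X m w) <= C * (w - u) powr (3 * \<alpha>)" if o: "a <= u" "u <= m" "m <= w" "w <= b" for u m w
 proof -
  have tri: "norm (- x - y) <= norm x + norm y" for x y :: 'b
   using norm_triangle_ineq4[of "- x" y] by simp
  let ?R = "Y m - Y u - (\<Sum>j<N. (Bp j m - Bp j u) *\<^sub>R Y' j u)"
  have e1: "(\<Sum>j<N. A j u w *\<^sub>R Y' j u) = (\<Sum>j<N. A j u m *\<^sub>R Y' j u) + (\<Sum>j<N. A j m w *\<^sub>R Y' j u)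
    + (Bp k w - Bp k m) *\<^sub>R (\<Sum>j<N. (Bp j m - Bp j u) *\<^sub>R Y' j u)"
   unfolding scaleR_sum_right sum.distrib[symmetric]
   by (rule sum.cong[OF refl]) (simp add: chen[of _ u w m] scaleR_add_left mult.commute)
  have eq: "?X u w - ?X u m - ?X m w = - ((Bp k w - Bp k m) *\<^sub>R ?R) - (\<Sum>j<N. A j m w *\<^sub>R (Y' j m - Y' j u))"
   unfolding germ_def e1 by (simp add: scaleR_diff_right sum_subtractf algebra_simps)
  have pw: "x powr p * y powr q <= (w - u) powr (3 * \<alpha>)" if "0 <= x" "x <= w - u" "0 <= y" "y <= w - u" "0 <= p" "0 <= q" "p + q = 3 * \<alpha>" for x y p q
  proof -
   have "x powr p * y powr q <= (w - u) powr p * (w - u) powr q"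
    using that by (intro mult_mono powr_mono2) auto
   also have "... = (w - u) powr (3 * \<alpha>)" using that by (simp only: powr_add[symmetric])
   finally show ?thesis .
  qed
  have n1: "norm ((Bp k w - Bp k m) *\<^sub>R ?R) <= (\<bar>C2\<bar> * H) * (w - u) powr (3 * \<alpha>)"
  proof -
   have "norm ?R <= C2 * \<bar>m - u\<bar> powr (2 * \<alpha>)" using C2[rule_format, of u m] o by auto
   also have "... <= \<bar>C2\<bar> * (m - u) powr (2 * \<alpha>)" using o by (simp add: mult_right_mono)
   finally have "norm ((Bp k w - Bp k m) *\<^sub>R ?R) <= (H * (w - m) powr \<alpha>) * (\<bar>C2\<bar> * (m - u) powr (2 * \<alpha>))"
    unfolding norm_scaleR using ho[of m w] o H by (intro mult_mono) auto
   also have "... = (\<bar>C2\<bar> * H) * ((w - m) powr \<alpha> * (m - u) powr (2 * \<alpha>))" by simp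
   also have "... <= (\<bar>C2\<bar> * H) * (w - u) powr (3 * \<alpha>)"
    by (intro mult_left_mono pw) (use o al H in auto)
   finally show ?thesis .
  qed
  have n2: "norm (A j m w *\<^sub>R (Y' j m - Y' j u)) <= (C1 * H) * (w - u) powr (3 * \<alpha>)" if j: "j < N" for j
  proof -
   have "norm (Y' j m - Y' j u) <= C1 * \<bar>m - u\<bar> powr \<alpha>" using C1(2)[rule_format, OF j, of u m] o by auto
   then have "norm (A j m w *\<^sub>R (Y' j m - Y' j u)) <= (H * (w - m) powr (2 * \<alpha>)) * (C1 * (m - u) powr \<alpha>)"
    unfolding norm_scaleR using area[OF j, of m w] o H by (intro mult_mono) auto
   also have "... = (C1 * H) * ((w - m) powr (2 * \<alpha>) * (m - u) powr \<alpha>)" by simp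
   also have "... <= (C1 * H) * (w - u) powr (3 * \<alpha>)"
    by (intro mult_left_mono pw) (use o al H C1(1) in auto)
   finally show ?thesis .
  qed
  have "norm (\<Sum>j<N. A j m w *\<^sub>R (Y' j m - Y' j u)) <= (\<Sum>j<N. (C1 * H) * (w - u) powr (3 * \<alpha>))"
   by (rule sum_norm_le) (use n2 in simp)
  then have "norm (\<Sum>j<N. A j m w *\<^sub>R (Y' j m - Y' j u)) <= real N * (C1 * H) * (w - u) powr (3 * \<alpha>)" by simp
  moreover have "norm (?X u w - ?X u m - ?X m w) <= norm ((Bp k w - Bp k m) *\<^sub>R ?R) + norm (\<Sum>j<N. A j m w *\<^sub>R (Y' j m - Y' j u))"
   unfolding eq by (rule tri)
  ultimately show ?thesis using n1 unfolding C_def distrib_right by linarith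
 qed
 have th: "3 * \<alpha> > 1" using al by simp
 show ?thesis
 proof (cases "a <= b")
  case True
  show ?thesis
   by (rule sewing[OF C0 th d]) blast+
 next
  case False
  then have "\<not> (a <= u \<and> u <= w \<and> w <= b)" for u w by linarith
  then show ?thesis by blast
 qed
qed

lemma dg_block:
 assumes "m <= n" "s <= t" "(x, y) \<in> gaps (dg m s t)"
 shows "dg n s t \<inter> {x..y} = dg n x y"
proof -
 have g: "x \<in> dg m s t" "y \<in> dg m s t" "x < y" using assms(3) by (auto simp: gaps_def)
 then have "x \<in> dg n s t" "y \<in> dg n s t" using dg_mono[OF assms(1)] by blast+
 moreover have "y \<in> dg n x t"
  unfolding dg_restrict(2)[OF \<open>x \<in> dg n s t\<close> assms(2), symmetric] using \<open>y \<in> dg n s t\<close> g(3) by simp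
 moreover have "x <= t" using dg_sub(1)[OF assms(2)] \<open>x \<in> dg n s t\<close> by fastforce
 ultimately have "dg n s t \<inter> {x..} = dg n x t" "dg n x t \<inter> {..y} = dg n x y"
  using dg_restrict[of _ n] assms(2) by blast+
 moreover have "dg n s t \<inter> {x..y} = (dg n s t \<inter> {x..}) \<inter> {..y}" by auto
 ultimately show ?thesis by simp
qed

text \<open>The Gubinelli derivative need not be adapted, so its sums against the second level escape all L2 estimates;
freezing it on a coarse grid leaves only the vanishing block sums and an oscillation term.\<close>

lemma two_scale:
 fixes f :: "nat => real => real" and A :: "nat => real => real => real" and r :: "nat => nat"
 assumes t: "0 <= t" and f: "!!j. j < N ==> continuous_on {0..t} (f j)" and r: "strict_mono r"
  and blk: "!!m j x y. j < N ==> (x, y) \<in> gaps (dg m 0 t) ==> (\<lambda>n. psum (dg (r n) x y) (A j)) \<longlonglongrightarrow> 0"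
  and K: "\<exists>\<^sub>F n in sequentially. psum (dg (r n) 0 t) (\<lambda>u v. \<Sum>j<N. \<bar>A j u v\<bar>) <= K"
  and L: "(\<lambda>n. psum (dg (r n) 0 t) (\<lambda>u v. \<Sum>j<N. f j u * A j u v)) \<longlonglongrightarrow> L"
 shows "L = 0"
proof -
 let ?Sf = "(\<lambda>u v. \<Sum>j<N. f j u * A j u v)"
 let ?SA = "(\<lambda>u v. \<Sum>j<N. \<bar>A j u v\<bar>)"
 have main: "\<bar>L\<bar> <= \<epsilon> * \<bar>K\<bar>" if e: "\<epsilon> > 0" for \<epsilon> :: real
 proof -
  have uc: "\<forall>j. \<exists>\<delta>. j < N --> \<delta> > 0 \<and> (\<forall>x\<in>{0..t}. \<forall>y\<in>{0..t}. \<bar>y - x\<bar> < \<delta> --> \<bar>f j y - f j x\<bar> <= \<epsilon>)"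
  proof
   fix j
   show "\<exists>\<delta>. j < N --> \<delta> > 0 \<and> (\<forall>x\<in>{0..t}. \<forall>y\<in>{0..t}. \<bar>y - x\<bar> < \<delta> --> \<bar>f j y - f j x\<bar> <= \<epsilon>)"
   proof (cases "j < N")
    case True
    have "uniformly_continuous_on {0..t} (f j)" by (rule compact_uniformly_continuous[OF f[OF True] compact_Icc])
    then obtain d where "d > 0" "\<forall>x\<in>{0..t}. \<forall>x'\<in>{0..t}. dist x' x < d --> dist (f j x') (f j x) < \<epsilon>"
     using e unfolding uniformly_continuous_on_def by blast
    then show ?thesis by (intro exI[of _ d]) (auto simp: dist_real_def intro: less_imp_le)
   qed auto
  qed
  then obtain \<delta> where de: "!!j. j < N ==> \<delta> j > 0"
   "!!j x y. j < N ==> x \<in> {0..t} ==> y \<in> {0..t} ==> \<bar>y - x\<bar> < \<delta> j ==> \<bar>f j y - f j x\<bar> <= \<epsilon>" by metis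
  define D where "D = Min (insert 1 (\<delta> ` {..<N}))"
  have D: "D > 0" "!!j. j < N ==> D <= \<delta> j" unfolding D_def using de(1) by auto
  obtain m where m: "1 / 2 ^ m < D" using half_pow_eventually[OF D(1)] by (auto simp: eventually_sequentially)
  let ?P = "dg m 0 t"
  let ?Q = "\<lambda>n. dg (r n) 0 t"
  have Pp: "partition_of ?P 0 t" and Qp: "partition_of (?Q n) 0 t" for n using t by (auto intro: dg_partition)
  have fP: "finite ?P" by (rule finite_dg)
  \<comment> \<open>The contribution of the values of f at the coarse points; m is fixed, so it
    tends to 0 by \<open>blk\<close> as the fine level grows.\<close>
  define E where "E n = psum ?P (\<lambda>x y. \<Sum>j<N. \<bar>f j x\<bar> * \<bar>psum (dg (r n) x y) (A j)\<bar>)" for n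
  have E: "E \<longlonglongrightarrow> 0"
  proof -
   have "(\<lambda>n. \<Sum>(x, y)\<in>gaps ?P. \<Sum>j<N. \<bar>f j x\<bar> * \<bar>psum (dg (r n) x y) (A j)\<bar>) \<longlonglongrightarrow> (\<Sum>z\<in>gaps ?P. \<Sum>j<N. \<bar>f j (fst z)\<bar> * \<bar>0\<bar>)"
    unfolding case_prod_unfold
    by (intro tendsto_sum tendsto_mult tendsto_const tendsto_rabs blk) auto
   then show ?thesis unfolding E_def psum_gaps[OF fP] by simp
  qed
  have bnd: "\<bar>psum (?Q n) ?Sf\<bar> <= \<epsilon> * psum (?Q n) ?SA + E n" if n: "m <= r n" for n
  proof -
   have PQ: "?P \<subseteq> ?Q n" by (rule dg_mono[OF n])
   have one: "\<bar>psum (dg (r n) x y) ?Sf\<bar> <= \<epsilon> * psum (dg (r n) x y) ?SA + (\<Sum>j<N. \<bar>f j x\<bar> * \<bar>psum (dg (r n) x y) (A j)\<bar>)"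
    if xy: "(x, y) \<in> gaps ?P" for x y
   proof -
    have xt: "0 <= x" "x < y" "y <= t" using partition_gapsD[OF Pp xy] by auto
    have len: "y - x < D" using dg_gap[OF order_refl xy t] m by linarith
    have pxy: "partition_of (dg (r n) x y) x y" using xt by (intro dg_partition) simp
    have "psum (dg (r n) x y) ?Sf =
      psum (dg (r n) x y) (\<lambda>u v. \<Sum>j<N. (f j u - f j x) * A j u v) + (\<Sum>j<N. f j x * psum (dg (r n) x y) (A j))"
     unfolding psum_mult[symmetric] psum_sum[symmetric] psum_add[symmetric] sum.distrib[symmetric]
     by (simp only: left_diff_distrib diff_add_cancel)
    moreover have "\<bar>psum (dg (r n) x y) (\<lambda>u v. \<Sum>j<N. (f j u - f j x) * A j u v)\<bar> <= \<epsilon> * psum (dg (r n) x y) ?SA"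
    proof -
     have "\<bar>psum (dg (r n) x y) (\<lambda>u v. \<Sum>j<N. (f j u - f j x) * A j u v)\<bar> <= psum (dg (r n) x y) (\<lambda>u v. \<bar>\<Sum>j<N. (f j u - f j x) * A j u v\<bar>)"
      using norm_psum[OF finite_dg, of "r n" x y "\<lambda>u v. \<Sum>j<N. (f j u - f j x) * A j u v"] by simp
     also have "... <= psum (dg (r n) x y) (\<lambda>u v. \<epsilon> * (\<Sum>j<N. \<bar>A j u v\<bar>))"
     proof (rule psum_mono[OF finite_dg])
      fix u v assume uv: "(u, v) \<in> gaps (dg (r n) x y)"
      have u: "x <= u" "u < v" "v <= y" using partition_gapsD[OF pxy uv] by auto
      have "\<bar>(f j u - f j x) * A j u v\<bar> <= \<epsilon> * \<bar>A j u v\<bar>" if j: "j < N" for j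
      proof -
       have "\<bar>f j u - f j x\<bar> <= \<epsilon>" using u xt len D(2)[OF j] by (intro de(2)[OF j]) auto
       then show ?thesis unfolding abs_mult by (intro mult_right_mono) auto
      qed
      then have "\<bar>\<Sum>j<N. (f j u - f j x) * A j u v\<bar> <= (\<Sum>j<N. \<epsilon> * \<bar>A j u v\<bar>)"
       by (intro order_trans[OF sum_abs] sum_mono) auto
      then show "\<bar>\<Sum>j<N. (f j u - f j x) * A j u v\<bar> <= \<epsilon> * (\<Sum>j<N. \<bar>A j u v\<bar>)" by (simp only: sum_distrib_left)
     qed
     also have "... = \<epsilon> * psum (dg (r n) x y) ?SA" by (rule psum_mult)
     finally show ?thesis .
    qed
    moreover have "\<bar>\<Sum>j<N. f j x * psum (dg (r n) x y) (A j)\<bar> <= (\<Sum>j<N. \<bar>f j x\<bar> * \<bar>psum (dg (r n) x y) (A j)\<bar>)"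
     using sum_abs[of "\<lambda>j. f j x * psum (dg (r n) x y) (A j)" "{..<N}"] by (simp only: abs_mult)
    ultimately show ?thesis by linarith
   qed
   have ref: "psum (?Q n) F = psum ?P (\<lambda>x y. psum (dg (r n) x y) F)" for F :: "real => real => real"
    unfolding psum_refine[OF Pp Qp PQ, of F]
    by (rule psum_cong[OF fP]) (use dg_block[OF n t] in simp)
   have "\<bar>psum (?Q n) ?Sf\<bar> <= psum ?P (\<lambda>x y. \<bar>psum (dg (r n) x y) ?Sf\<bar>)"
    unfolding ref using norm_psum[OF fP, of "\<lambda>x y. psum (dg (r n) x y) ?Sf"] by simp
   also have "... <= psum ?P (\<lambda>x y. \<epsilon> * psum (dg (r n) x y) ?SA + (\<Sum>j<N. \<bar>f j x\<bar> * \<bar>psum (dg (r n) x y) (A j)\<bar>))"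
    by (rule psum_mono[OF fP one])
   also have "... = \<epsilon> * psum (?Q n) ?SA + E n"
    unfolding psum_add psum_mult E_def ref[of "\<lambda>u v. \<Sum>j<N. \<bar>A j u v\<bar>"] by simp
   finally show ?thesis .
  qed
  show ?thesis
  \<comment> \<open>K bounds the sums for infinitely many n only. The contradiction confronts this
    with an inequality valid for all large n.\<close>
  proof (rule ccontr)
   assume "\<not> \<bar>L\<bar> <= \<epsilon> * \<bar>K\<bar>"
   moreover have "(\<lambda>n. \<bar>psum (?Q n) ?Sf\<bar> - E n) \<longlonglongrightarrow> \<bar>L\<bar> - 0"
    by (intro tendsto_diff tendsto_rabs L E)
   ultimately have ev: "\<forall>\<^sub>F n in sequentially. \<epsilon> * \<bar>K\<bar> < \<bar>psum (?Q n) ?Sf\<bar> - E n"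
    by (intro order_tendstoD(1)) auto
   have "\<forall>\<^sub>F n in sequentially. m <= r n"
    using eventually_ge_at_top[of m] by eventually_elim (use seq_suble[OF r] order_trans in blast)
   with ev have "\<forall>\<^sub>F n in sequentially. \<not> psum (?Q n) ?SA <= K"
   proof eventually_elim
    case (elim n)
    show ?case
    proof
     assume "psum (?Q n) ?SA <= K"
     then have "\<epsilon> * psum (?Q n) ?SA <= \<epsilon> * \<bar>K\<bar>" using e by (intro mult_left_mono) auto
     then show False using elim bnd[of n] by linarith
    qed
   qed
   then show False using K by (simp add: frequently_def)
  qed
 qed
 show ?thesis
 proof (rule ccontr)
  assume "L \<noteq> 0"
  \<comment> \<open>This \<epsilon> makes the right side at most |L| / 2.\<close>
  then have "\<bar>L\<bar> <= (\<bar>L\<bar> / (2 * (\<bar>K\<bar> + 1))) * \<bar>K\<bar>" by (intro main) auto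
  also have "... = \<bar>L\<bar> / 2 * (\<bar>K\<bar> / (\<bar>K\<bar> + 1))" by simp
  also have "... <= \<bar>L\<bar> / 2 * 1" by (intro mult_left_mono) auto
  finally show False using \<open>L \<noteq> 0\<close> by simp
 qed
qed

section \<open>The Ito rough path\<close>

context bm_family
begin

definition area :: "nat => nat => (real => 'w => real) => real => real => 'w => real" where
 "area j k Jp s t om = Jp t om - Jp s om - B j s om * incr k s t om"

lemma area_chen: "area j k Jp s t om = area j k Jp s u om + area j k Jp u t om + (B j u om - B j s om) * (B k t om - B k u om)"
 by (simp add: area_def incr_def algebra_simps)

lemma adapted_B: "k < N ==> adapted M F (B k)"
 using bm by (auto simp: std_BM_family_def)

lemma ito_meas: "ito_proc M h b Jp ==> 0 <= t ==> Jp t \<in> borel_measurable M"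
 by (auto simp: ito_proc_def)

lemma ito_cont: "ito_proc M h b Jp ==> AE om in M. Jp 0 om = 0 \<and> continuous_on {0..} (\<lambda>t. Jp t om)"
 by (auto simp: ito_proc_def)

text \<open>On the event that B_j is \<alpha>-Hoelder with constant R at dyadic times, it oscillates
  by at most R 2^(-n\<alpha>) over a cell of level n, and \<open>ito_tail\<close> with a =
  2^(-2n\<alpha>) yields the exponent 2^(n(1-2\<alpha>)) / (2 R^2). Almost every path lies in such
  an event for some natural R, and Chen's relation supplies the defect for chaining.\<close>

lemma area_holder:
 assumes al: "0 < \<alpha>" "\<alpha> < 1 / 2" and jk: "j < N" "k < N" and J: "ito_proc M (B j) (B k) Jp"
 shows "AE om in M. \<exists>C. \<forall>s t. 0 <= s \<and> s <= t \<and> t <= real T --> \<bar>area j k Jp s t om\<bar> <= C * (t - s) powr (2 * \<alpha>)"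
proof -
 define x where "x n i om = area j k Jp (real i / 2 ^ n) (real (Suc i) / 2 ^ n) om" for n i :: nat and om
 define DT where "DT = dyadic \<inter> {0..real T}"
 \<comment> \<open>Restricting to dyadic times makes this a countable intersection of measurable
   events.\<close>
 define E where "E R = {om \<in> space M. \<forall>u\<in>DT. \<forall>v\<in>DT. \<bar>B j v om - B j u om\<bar> <= real R * \<bar>v - u\<bar> powr \<alpha>}" for R :: nat
 define bad where "bad R n i = E R \<inter> {om \<in> space M. 2 * 2 powr (- (real n * (2 * \<alpha>))) < \<bar>x n i om\<bar>}" for R n i :: nat
 have cDT: "countable DT" unfolding DT_def using countable_dyadic by auto
 have DT0: "0 <= u" if "u \<in> DT" for u using that unfolding DT_def by auto
 have xm [measurable]: "x n i \<in> borel_measurable M" for n i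
 proof -
  have [measurable]: "B j (real i / 2 ^ n) \<in> borel_measurable M" "incr k (real i / 2 ^ n) (real (Suc i) / 2 ^ n) \<in> borel_measurable M"
   "Jp (real i / 2 ^ n) \<in> borel_measurable M" "Jp (real (Suc i) / 2 ^ n) \<in> borel_measurable M"
   using jk by (auto intro!: B_M incr_meas ito_meas[OF J])
  show ?thesis unfolding x_def area_def by measurable
 qed
 have Em [measurable]: "E R \<in> sets M" for R
  unfolding E_def
 proof (rule sets.sets_Collect_countable_All'[OF _ cDT], rule sets.sets_Collect_countable_All'[OF _ cDT])
  fix u v assume uv: "u \<in> DT" "v \<in> DT"
  have [measurable]: "B j u \<in> borel_measurable M" "B j v \<in> borel_measurable M" using uv DT0 jk by (auto intro!: B_M)
  show "{om \<in> space M. \<bar>B j v om - B j u om\<bar> <= real R * \<bar>v - u\<bar> powr \<alpha>} \<in> sets M" by measurable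
 qed
 have "AE om in M. \<exists>n0. \<forall>n\<ge>n0. \<forall>i<T * 2 ^ n. om \<notin> bad (Suc R) n i" for R
 \<comment> \<open>\<open>Suc R\<close> keeps the oscillation bound strictly positive and the rate
   finite.\<close>
 proof (rule borel_cantelli_dyadic[where c = "1 / (2 * (real (Suc R))\<^sup>2)" and \<beta> = "1 - 2 * \<alpha>"])
  show "bad (Suc R) n i \<in> sets M" for n i unfolding bad_def by measurable
  fix n i :: nat assume i: "i < T * 2 ^ n"
  let ?s = "real i / 2 ^ n" and ?t = "real (Suc i) / 2 ^ n"
  let ?R = "real (Suc R)"
  have lt: "?s < ?t" by (simp add: divide_strict_right_mono)
  have df: "?t - ?s = 1 / 2 ^ n" by (simp add: diff_divide_distrib[symmetric])
  have tT: "?t <= real T"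
  proof -
   have "real (Suc i) <= real (T * 2 ^ n)" using i by (intro of_nat_mono) simp
   then show ?thesis by (subst pos_divide_le_eq) auto
  qed
  let ?a = "2 powr (- (real n * (2 * \<alpha>))) :: real" and ?\<kappa> = "?R * (1 / 2 ^ n) powr \<alpha>"
  have "measure M (bad (Suc R) n i) <= 2 * exp (- (?a\<^sup>2 / (2 * ?\<kappa>\<^sup>2 * (?t - ?s))))"
   unfolding bad_def x_def area_def
  proof (rule ito_tail[OF J adapted_B[OF jk(1)] jk(2) _ lt])
   fix om u assume w: "om \<in> E (Suc R)" "u \<in> dyadic" "?s <= u" "u <= ?t"
   have s0: "0 <= ?s" by simp
   have "0 <= u" "u <= real T" "?s <= real T" using s0 w(3,4) lt tT by linarith+
   then have "u \<in> DT" "?s \<in> DT" unfolding DT_def using w(2) s0 by auto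
   then have "\<bar>B j u om - B j ?s om\<bar> <= ?R * \<bar>u - ?s\<bar> powr \<alpha>" using w(1) unfolding E_def by blast
   also have "... <= ?R * (1 / 2 ^ n) powr \<alpha>"
    by (intro mult_left_mono powr_mono2) (use al w df in auto)
   finally show "\<bar>B j u om - B j ?s om\<bar> <= ?R * (1 / 2 ^ n) powr \<alpha>" .
  qed (rule dyadicI Em | simp)+
  also have "?a\<^sup>2 / (2 * ?\<kappa>\<^sup>2 * (?t - ?s)) = 1 / (2 * ?R\<^sup>2) * 2 powr (real n * (1 - 2 * \<alpha>))"
  proof -
   have 1: "?a\<^sup>2 = 2 powr (- (4 * (real n * \<alpha>)))" by (simp only: power2_eq_square powr_add[symmetric]) (simp add: mult_ac)
   note hp = half_pow_powr[of n]
   have 2: "?\<kappa>\<^sup>2 = ?R\<^sup>2 * 2 powr (- (2 * (real n * \<alpha>)))"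
    unfolding hp power_mult_distrib powr_powr by (simp only: power2_eq_square powr_add[symmetric]) (simp add: mult_ac)
   have "?a\<^sup>2 / (2 * ?\<kappa>\<^sup>2 * (?t - ?s)) = 1 / (2 * ?R\<^sup>2) * (2 powr (- (4 * (real n * \<alpha>))) / (2 powr (- (2 * (real n * \<alpha>))) * 2 powr (- real n)))"
    unfolding 1 2 df unfolding hp by simp
   also have "2 powr (- (4 * (real n * \<alpha>))) / (2 powr (- (2 * (real n * \<alpha>))) * 2 powr (- real n)) = 2 powr (- (4 * (real n * \<alpha>)) - (- (2 * (real n * \<alpha>)) + - real n))"
    by (simp only: powr_add[symmetric] powr_diff[symmetric])
   also have "- (4 * (real n * \<alpha>)) - (- (2 * (real n * \<alpha>)) + - real n) = real n * (1 - 2 * \<alpha>)" by (simp add: algebra_simps)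
   finally show ?thesis .
  qed
  finally show "measure M (bad (Suc R) n i) <= 2 * exp (- (1 / (2 * ?R\<^sup>2)) * 2 powr (real n * (1 - 2 * \<alpha>)))" by simp
 qed (use al in auto)
 then have "AE om in M. \<forall>R. \<exists>n0. \<forall>n\<ge>n0. \<forall>i<T * 2 ^ n. om \<notin> bad (Suc R) n i" by (simp add: AE_all_countable)
 then show ?thesis
  using B_cont ito_cont[OF J] B_holder[OF al jk(1), of T] B_holder[OF al jk(2), of T] AE_space
 proof eventually_elim
  case (elim om)
  obtain Cj where Cj: "!!s t. 0 <= s ==> s <= t ==> t <= real T ==> \<bar>B j t om - B j s om\<bar> <= Cj * (t - s) powr \<alpha>"
   using elim(4) unfolding holder_upto_def by blast
  obtain Ck where Ck: "!!s t. 0 <= s ==> s <= t ==> t <= real T ==> \<bar>B k t om - B k s om\<bar> <= Ck * (t - s) powr \<alpha>"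
   using elim(5) unfolding holder_upto_def by blast
  define R where "R = nat \<lceil>\<bar>Cj\<bar>\<rceil>"
  have CR: "Cj <= real (Suc R)" unfolding R_def by linarith
  have "\<bar>B j v om - B j u om\<bar> <= real (Suc R) * \<bar>v - u\<bar> powr \<alpha>" if uv: "u \<in> DT" "v \<in> DT" for u v
  proof -
   have 1: "\<bar>B j y om - B j x om\<bar> <= real (Suc R) * (y - x) powr \<alpha>" if "x \<in> DT" "y \<in> DT" "x <= y" for x y
    by (rule order_trans[OF Cj mult_right_mono[OF CR]]) (use that in \<open>auto simp: DT_def\<close>)
   show ?thesis
   proof (cases "u <= v")
    case True
    then show ?thesis using 1[OF uv] by simp
   next
    case False
    then show ?thesis using 1[OF uv(2,1)] by (simp add: abs_minus_commute)
   qed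
  qed
  then have wE: "om \<in> E (Suc R)" unfolding E_def using elim(6) by blast
  have "\<exists>n0. \<forall>n\<ge>n0. \<forall>i<T * 2 ^ n. om \<notin> bad (Suc R) n i" using elim(1) by blast
  then have "\<exists>n0. \<forall>n\<ge>n0. \<forall>i<T * 2 ^ n. \<bar>x n i om\<bar> <= 2 * 2 powr (- (real n * (2 * \<alpha>)))"
   unfolding bad_def using wE elim(6) by (auto simp: not_less)
  from dyadic_uniformize_ex[OF this]
  obtain C1 where C1: "C1 >= 0" "!!n i. i < T * 2 ^ n ==> \<bar>x n i om\<bar> <= C1 * 2 powr (- (real n * (2 * \<alpha>)))" by blast
  define C where "C = C1 + \<bar>Cj\<bar> * \<bar>Ck\<bar>"
  have C0: "C >= 0" using C1 by (simp add: C_def)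
  have ga: "2 * \<alpha> > 0" using al by simp
  have c1: "continuous_on {0..} (\<lambda>t. B j t om)" "continuous_on {0..} (\<lambda>t. B k t om)" "continuous_on {0..} (\<lambda>t. Jp t om)"
   using elim jk by blast+
  show ?case
  proof (rule chain_holder[where A = "\<lambda>s t. area j k Jp s t om", OF ga C0])
   show "area j k Jp s s om = 0" for s by (simp add: area_def incr_def)
   show "\<bar>area j k Jp (real i / 2 ^ n) (real (Suc i) / 2 ^ n) om\<bar> <= C * 2 powr (- (real n * (2 * \<alpha>)))" if "i < T * 2 ^ n" for n i
   proof -
    have "\<bar>x n i om\<bar> <= C1 * 2 powr (- (real n * (2 * \<alpha>)))" by (rule C1(2)[OF that])
    also have "... <= C * 2 powr (- (real n * (2 * \<alpha>)))" by (rule mult_right_mono) (auto simp: C_def)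
    finally show ?thesis by (simp only: x_def)
   qed
   show "continuous_on ({0..real T} \<times> {0..real T}) (\<lambda>z. area j k Jp (fst z) (snd z) om)"
    unfolding area_def incr_def by (intro continuous_on_diff continuous_on_mult diff_prod_cont c1)
   show "\<bar>area j k Jp s t om - area j k Jp s u om - area j k Jp u t om\<bar> <= C * ((u - s) powr (2 * \<alpha> / 2) * (t - u) powr (2 * \<alpha> / 2))"
    if o: "0 <= s" "s <= u" "u <= t" "t <= real T" for s u t
   proof -
    have "area j k Jp s t om - area j k Jp s u om - area j k Jp u t om = (B j u om - B j s om) * (B k t om - B k u om)"
     using area_chen[of j k Jp s t om u] by simp
    moreover have "\<bar>(B j u om - B j s om) * (B k t om - B k u om)\<bar> <= (\<bar>Cj\<bar> * (u - s) powr \<alpha>) * (\<bar>Ck\<bar> * (t - u) powr \<alpha>)"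
     unfolding abs_mult
    proof (rule mult_mono)
     show "\<bar>B j u om - B j s om\<bar> <= \<bar>Cj\<bar> * (u - s) powr \<alpha>"
      by (rule order_trans[OF Cj mult_right_mono]) (use o in auto)
     show "\<bar>B k t om - B k u om\<bar> <= \<bar>Ck\<bar> * (t - u) powr \<alpha>"
      by (rule order_trans[OF Ck mult_right_mono]) (use o in auto)
    qed auto
    moreover have "(\<bar>Cj\<bar> * (u - s) powr \<alpha>) * (\<bar>Ck\<bar> * (t - u) powr \<alpha>) = (\<bar>Cj\<bar> * \<bar>Ck\<bar>) * ((u - s) powr \<alpha> * (t - u) powr \<alpha>)" by simp
    moreover have "... <= C * ((u - s) powr \<alpha> * (t - u) powr \<alpha>)"
     by (rule mult_right_mono) (use C1 in \<open>auto simp: C_def\<close>)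
    ultimately show ?thesis by simp
   qed
  qed
 qed
qed

text \<open>Summation by parts on a grid: the products of increments and the two Riemann sums
  telescope to the increment of B_j B_k, and the centred products vanish in L^2 with the mesh. The
  identity holds first at one time, then at all dyadic times by countability, and at all times by
  continuity.\<close>

lemma ito_sym:
 assumes jk: "j < N" "k < N" and J1: "ito_proc M (B j) (B k) J1" and J2: "ito_proc M (B k) (B j) J2"
 shows "AE om in M. \<forall>t\<ge>0. J1 t om + J2 t om = B j t om * B k t om - B j 0 om * B k 0 om - (if j = k then t else 0)"
proof -
 let ?\<delta> = "\<lambda>t::real. if j = k then t else 0"
 let ?V = "\<lambda>t om. B j t om * B k t om - B j 0 om * B k 0 om - ?\<delta> t"
 have fixed: "AE om in M. J1 t om + J2 t om - ?V t om = 0" if t: "0 <= t" for t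
 proof -
  define Q where "Q n om = psum (dg n 0 t) (\<lambda>u v. incr j u v om * incr k u v om - ?\<delta> (v - u))" for n om
  define S1 where "S1 n om = psum (dg n 0 t) (\<lambda>u v. B j u om * incr k u v om)" for n om
  define S2 where "S2 n om = psum (dg n 0 t) (\<lambda>u v. B k u om * incr j u v om)" for n om
  have dgp: "partition_of (dg n 0 t) 0 t" for n using t by (rule dg_partition)
  have dgs: "finite (dg n 0 t)" "dg n 0 t \<noteq> {}" "dg n 0 t \<subseteq> {0..}" for n
   using dgp[of n] by (auto simp: partition_of_def)
  have id: "Q n om + S1 n om + S2 n om = B j t om * B k t om - B j 0 om * B k 0 om - ?\<delta> t" for n om
  proof -
   have "Q n om + S1 n om + S2 n om = psum (dg n 0 t) (\<lambda>u v. (B j v om * B k v om - ?\<delta> v) - (B j u om * B k u om - ?\<delta> u))"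
    unfolding Q_def S1_def S2_def psum_add[symmetric]
    by (rule psum_cong[OF dgs(1)]) (simp add: incr_def algebra_simps)
   also have "... = (B j t om * B k t om - ?\<delta> t) - (B j 0 om * B k 0 om - ?\<delta> 0)"
    by (rule psum_additive[OF dgp])
   finally show ?thesis by simp
  qed
  have Bm [measurable]: "B i u \<in> borel_measurable M" if "u \<in> {0..}" "i \<in> {j, k}" for i u
   using that jk by (auto intro!: B_M)
  have S1m: "S1 n \<in> borel_measurable M" for n
   unfolding S1_def by (rule rsum_meas[OF dgs(1,3) jk(2)]) (use dgs(3)[of n] jk in \<open>auto intro!: B_M\<close>)
  have S2m: "S2 n \<in> borel_measurable M" for n
   unfolding S2_def by (rule rsum_meas[OF dgs(1,3) jk(1)]) (use dgs(3)[of n] jk in \<open>auto intro!: B_M\<close>)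
  have [measurable]: "B j t \<in> borel_measurable M" "B k t \<in> borel_measurable M" "B j 0 \<in> borel_measurable M" "B k 0 \<in> borel_measurable M"
   using t jk by (auto intro!: B_M)
  have Qm: "Q n \<in> borel_measurable M" for n
  proof -
   note [measurable] = S1m S2m
   have "Q n = (\<lambda>om. B j t om * B k t om - B j 0 om * B k 0 om - ?\<delta> t - S1 n om - S2 n om)"
   proof
    fix om show "Q n om = B j t om * B k t om - B j 0 om * B k 0 om - ?\<delta> t - S1 n om - S2 n om" using id[of n om] by linarith
   qed
   then show ?thesis by simp
  qed
  have cQ: "convP Q"
  proof (rule convP_of_L2[OF Qm])
   show "(\<integral>\<^sup>+om. ennreal ((Q n om)\<^sup>2) \<partial>M) <= ennreal (2 * t * (1 / 2 ^ n))" for n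
   proof -
    have "(\<integral>\<^sup>+om. ennreal ((Q n om)\<^sup>2) \<partial>M) <= ennreal (psum (dg n 0 t) (\<lambda>u v. 2 * (v - u)\<^sup>2))"
     unfolding Q_def by (rule quad_var_sq_bound[OF dgs jk])
    also have "... <= ennreal (2 * t * (1 / 2 ^ n))"
    proof (rule ennreal_leI)
     have "psum (dg n 0 t) (\<lambda>u v. 2 * (v - u)\<^sup>2) <= psum (dg n 0 t) (\<lambda>u v. (2 * (1 / 2 ^ n)) * (v - u))"
     proof (rule psum_mono[OF dgs(1)])
      fix u v assume g: "(u, v) \<in> gaps (dg n 0 t)"
      have "v - u <= 1 / 2 ^ n" "0 <= v - u" using dg_gap[OF order_refl g t] partition_gapsD[OF dgp g] by auto
      then have "(v - u) * (v - u) <= 1 / 2 ^ n * (v - u)" by (intro mult_right_mono)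
      then show "2 * (v - u)\<^sup>2 <= 2 * (1 / 2 ^ n) * (v - u)" unfolding power2_eq_square mult.assoc by (rule mult_left_mono) simp
     qed
     also have "... = 2 * t * (1 / 2 ^ n)" unfolding psum_mult using psum_additive[OF dgp, of n "\<lambda>u. u"] by simp
     finally show "psum (dg n 0 t) (\<lambda>u v. 2 * (v - u)\<^sup>2) <= 2 * t * (1 / 2 ^ n)" .
    qed
    finally show ?thesis .
   qed
   have "(\<lambda>n. 1 / 2 ^ n :: real) \<longlonglongrightarrow> 0"
    using LIMSEQ_power_zero[of "1/2::real"] by (simp add: power_one_over)
   from tendsto_mult[OF tendsto_const this, of "2 * t"]
   show "(\<lambda>n. 2 * t * (1 / 2 ^ n)) \<longlonglongrightarrow> 0" by simp
  qed (use t in auto)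
  have c1: "convP (\<lambda>n om. S1 n om - J1 t om)" unfolding S1_def by (rule ito_conv0[OF J1 adapted_B[OF jk(1)] jk(2) t])
  have c2: "convP (\<lambda>n om. S2 n om - J2 t om)" unfolding S2_def by (rule ito_conv0[OF J2 adapted_B[OF jk(2)] jk(1) t])
  have Jm: "J1 t \<in> borel_measurable M" "J2 t \<in> borel_measurable M" using ito_meas[OF J1 t] ito_meas[OF J2 t] by auto
  \<comment> \<open>Packing the three sequences into one family lets a single subsequence serve them
    all.\<close>
  define X where "X i = (if i = (0::nat) then Q else if i = 1 then (\<lambda>n om. S1 n om - J1 t om) else (\<lambda>n om. S2 n om - J2 t om))" for i
  have cX: "convP (X i)" for i using cQ c1 c2 by (simp add: X_def)
  have mX: "X i n \<in> borel_measurable M" for i n using Qm S1m S2m Jm by (simp add: X_def)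
  obtain r :: "nat => nat" where "strict_mono r" and ae: "AE om in M. \<forall>i. (\<lambda>n. X i (r n) om) \<longlonglongrightarrow> 0"
   by (rule convP_subseq[of X, OF cX mX]) (rule that)
  from ae show ?thesis
  proof eventually_elim
   case (elim om)
   have "(\<lambda>n. Q (r n) om) \<longlonglongrightarrow> 0" "(\<lambda>n. S1 (r n) om - J1 t om) \<longlonglongrightarrow> 0" "(\<lambda>n. S2 (r n) om - J2 t om) \<longlonglongrightarrow> 0"
    using elim[rule_format, of 0] elim[rule_format, of 1] elim[rule_format, of 2] by (simp_all add: X_def)
   then have "(\<lambda>n. Q (r n) om + (S1 (r n) om - J1 t om) + (S2 (r n) om - J2 t om)) \<longlonglongrightarrow> 0 + 0 + 0"
    by (intro tendsto_add)
   moreover have "Q (r n) om + (S1 (r n) om - J1 t om) + (S2 (r n) om - J2 t om) = ?V t om - J1 t om - J2 t om" for n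
    unfolding id[of "r n" om, symmetric] by linarith
   ultimately have "(\<lambda>n::nat. ?V t om - J1 t om - J2 t om) \<longlonglongrightarrow> 0" by simp
   then have "?V t om - J1 t om - J2 t om = 0" by (rule LIMSEQ_unique[OF tendsto_const])
   then show ?case by linarith
  qed
 qed
 have "AE om in M. \<forall>t\<in>dyadic. J1 t om + J2 t om - ?V t om = 0"
  by (rule AE_ball_countable'[OF _ countable_dyadic]) (rule fixed[OF dyadic_nonneg])
 then show ?thesis using B_cont ito_cont[OF J1] ito_cont[OF J2]
 proof eventually_elim
  case (elim om)
  have "J1 t om + J2 t om - ?V t om = 0" if "0 <= t" for t
  proof (rule dyadic_zero_extend[where f = "\<lambda>t. J1 t om + J2 t om - ?V t om"])
   have c: "continuous_on {0..} (\<lambda>t. B j t om)" "continuous_on {0..} (\<lambda>t. B k t om)" using elim jk by blast+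
   have d: "continuous_on {0..} ?\<delta>" by (cases "j = k") auto
   show "continuous_on {0..} (\<lambda>t. J1 t om + J2 t om - ?V t om)"
    using elim by (intro continuous_on_diff continuous_on_add continuous_on_mult c d continuous_on_const) auto
  qed (use elim that in auto)
  then show ?case by simp
 qed
qed

end

section \<open>Comparison of Ito and rough integrals\<close>

lemma holder_on_continuous:
 assumes h: "holder_on S \<alpha> f" and al: "\<alpha> > 0"
 shows "continuous_on S f"
proof -
 obtain C where C: "C >= 0" "\<forall>s\<in>S. \<forall>t\<in>S. norm (f t - f s) <= C * \<bar>t - s\<bar> powr \<alpha>"
  using holder_on_abs[OF h] by blast
 show ?thesis
  unfolding continuous_on_def
 proof
  fix s assume s: "s \<in> S"
  have "((\<lambda>t. C * \<bar>t - s\<bar> powr \<alpha>) \<longlongrightarrow> C * \<bar>s - s\<bar> powr \<alpha>) (at s within S)"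
   using al by (intro tendsto_mult tendsto_const tendsto_powr' tendsto_rabs tendsto_diff tendsto_ident_at) auto
  then have lim: "((\<lambda>t. C * \<bar>t - s\<bar> powr \<alpha>) \<longlongrightarrow> 0) (at s within S)" by simp
  have "\<forall>\<^sub>F t in at s within S. norm (f t - f s) <= C * \<bar>t - s\<bar> powr \<alpha>"
   unfolding eventually_at_filter using C(2) s by auto
  from Lim_null_comparison[OF this lim] show "(f \<longlongrightarrow> f s) (at s within S)" by (rule LIM_zero_cancel)
 qed
qed

lemma mesh_lim_dg:
 fixes L :: "'b::real_normed_vector"
 assumes l: "mesh_lim s t X L" and st: "0 <= s" "s <= t" and r: "strict_mono r"
 shows "(\<lambda>n. psum (dg (r n) s t) X) \<longlonglongrightarrow> L"
proof -
 have "(\<lambda>n. psum (dg n s t) X) \<longlonglongrightarrow> L"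
 proof (rule tendstoI)
  fix \<epsilon> :: real assume "\<epsilon> > 0"
  then obtain \<delta> where d: "\<delta> > 0" "!!P. partition_of P s t ==> mesh P < \<delta> ==> norm (psum P X - L) < \<epsilon>"
   using l unfolding mesh_lim_def by blast
  have "\<forall>\<^sub>F n in sequentially. mesh (dg n s t) < \<delta>"
   using half_pow_eventually[OF d(1)] by eventually_elim (rule dg_mesh[OF st])
  then show "\<forall>\<^sub>F n in sequentially. dist (psum (dg n s t) X) L < \<epsilon>"
   by eventually_elim (use d(2) dg_partition[OF st(2)] in \<open>simp add: dist_norm\<close>)
 qed
 from LIMSEQ_subseq_LIMSEQ[OF this r] show ?thesis by (simp add: o_def)
qed

text \<open>A finite liminf bounds infinitely many terms, not all large ones; this is why
  \<open>two_scale\<close> is stated with a frequent bound.\<close>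

lemma frequently_of_liminf:
 fixes V :: "nat => real"
 assumes "liminf (\<lambda>n. ennreal (V n)) \<noteq> \<infinity>"
 shows "\<exists>K. \<exists>\<^sub>F n in sequentially. V n <= K"
proof (rule ccontr)
 assume "\<not> (\<exists>K. \<exists>\<^sub>F n in sequentially. V n <= K)"
 then have ev: "\<forall>\<^sub>F n in sequentially. \<not> V n <= K" for K by (simp add: not_frequently)
 have le: "ennreal K <= liminf (\<lambda>n. ennreal (V n))" for K
  by (rule Liminf_bounded, use ev[of K] in eventually_elim) (auto intro: ennreal_leI)
 obtain l where l: "liminf (\<lambda>n. ennreal (V n)) = ennreal l" "l >= 0"
  using assms by (cases "liminf (\<lambda>n. ennreal (V n))") auto
 have "ennreal (l + 1) <= ennreal l" using le[of "l + 1"] l(1) by simp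
 then have "l + 1 <= l" by (rule ennreal_le_iff[OF l(2), THEN iffD1])
 then show False by simp
qed

context bm_family
begin

lemma area_meas:
 assumes "0 <= u" "0 <= v" "j < N" "k < N" "ito_proc M (B j) (B k) Jp"
 shows "area j k Jp u v \<in> borel_measurable M"
proof -
 have [measurable]: "B j u \<in> borel_measurable M" "incr k u v \<in> borel_measurable M"
  "Jp u \<in> borel_measurable M" "Jp v \<in> borel_measurable M"
  using B_M[OF assms(3,1)] incr_meas[OF assms(4,1,2)] ito_meas[OF assms(5,1)] ito_meas[OF assms(5,2)] by auto
 show ?thesis unfolding area_def by measurable
qed

text \<open>The area is the limit in probability of sums with integrand B_j(x) - B_j(u), whose
  second moment is at most v - u. The isometry bound is then (v-u)^2, and it survives the
  limit.\<close>

lemma area_sq: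
 assumes uv: "0 <= u" "u < v" and jk: "j < N" "k < N" and J: "ito_proc M (B j) (B k) Jp"
 shows "(\<integral>\<^sup>+om. ennreal ((area j k Jp u v om)\<^sup>2) \<partial>M) <= ennreal ((v - u)\<^sup>2)"
proof -
 have dgp: "partition_of (dg n u v) u v" for n using uv by (intro dg_partition) simp
 have dgs: "finite (dg n u v)" "dg n u v \<noteq> {}" "dg n u v \<subseteq> {0..}" "dg n u v \<subseteq> {u..v}" for n
  using dgp[of n] uv by (auto simp: partition_of_def)
 define S where "S n om = psum (dg n u v) (\<lambda>x y. incr j u x om * incr k x y om)" for n om
 have Sm: "S n \<in> borel_measurable M" for n
  unfolding S_def by (rule rsum_meas[OF dgs(1,3) jk(2)]) (use dgs(3)[of n] jk uv in \<open>auto intro!: incr_meas\<close>)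
 have eq: "psum (dg n u v) (\<lambda>x y. B j x om * incr k x y om) - (Jp v om - Jp u om) = S n om - area j k Jp u v om" for n om
 proof -
  have "B j u om * incr k u v om = psum (dg n u v) (\<lambda>x y. B j u om * incr k x y om)"
   unfolding psum_mult incr_def using psum_additive[OF dgp, of n "\<lambda>x. B k x om"] by simp
  then have "S n om + B j u om * incr k u v om = psum (dg n u v) (\<lambda>x y. B j x om * incr k x y om)"
   unfolding S_def by (simp add: psum_add[symmetric] incr_def algebra_simps)
  then show ?thesis unfolding area_def by simp
 qed
 have "convP (\<lambda>n om. S n om - area j k Jp u v om)"
  using ito_conv[OF J adapted_B[OF jk(1)] jk(2) uv] unfolding eq .
 then show ?thesis
 proof (rule convP_L2_limit[OF _ Sm area_meas[OF _ _ jk J]])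
  fix n
  have "(\<integral>\<^sup>+om. ennreal ((S n om)\<^sup>2) \<partial>M) <= ennreal (psum (dg n u v) (\<lambda>x y. (v - u) * (y - x)))"
   unfolding S_def
  proof (rule simple_sum_sq_bound[OF dgs(1,2,3) jk(2)])
   fix x assume x: "x \<in> dg n u v"
   then have x': "u <= x" "x <= v" using dgs(4)[of n] by auto
   show "incr j u x \<in> borel_measurable (Fm x)" by (rule incr_Fm) (use x' uv jk in auto)
   show "(\<integral>\<^sup>+om. ennreal ((incr j u x om)\<^sup>2) \<partial>M) <= ennreal (v - u)"
    using incr_sq[OF uv(1) x'(1) jk(1)] x' by (simp add: ennreal_leI)
  qed (use uv in simp)
  also have "psum (dg n u v) (\<lambda>x y. (v - u) * (y - x)) = (v - u)\<^sup>2"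
   unfolding psum_mult using psum_additive[OF dgp, of n "\<lambda>x. x"] by (simp add: power2_eq_square)
  finally show "(\<integral>\<^sup>+om. ennreal ((S n om)\<^sup>2) \<partial>M) <= ennreal ((v - u)\<^sup>2)" .
 qed (use uv in auto)
qed

text \<open>Young's inequality with weight v - u bounds the first moment by two halves of v -
  u.\<close>

lemma area_abs:
 assumes uv: "0 <= u" "u < v" and jk: "j < N" "k < N" and J: "ito_proc M (B j) (B k) Jp"
 shows "(\<integral>\<^sup>+om. ennreal \<bar>area j k Jp u v om\<bar> \<partial>M) <= ennreal (v - u)"
proof -
 let ?A = "area j k Jp u v" and ?d = "v - u"
 have [measurable]: "?A \<in> borel_measurable M" by (rule area_meas[OF _ _ jk J]) (use uv in auto)
 have d: "?d > 0" using uv by simp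
 have pt: "\<bar>x\<bar> <= x\<^sup>2 * (1 / (2 * d)) + d / 2" if "d > 0" for x d :: real
 proof -
  have "0 <= (\<bar>x\<bar> - d)\<^sup>2" by simp
  then have "2 * d * \<bar>x\<bar> <= x\<^sup>2 + d\<^sup>2" unfolding power2_diff by (simp add: mult.commute mult.left_commute)
  then show ?thesis using that by (simp add: field_simps power2_eq_square)
 qed
 have "(\<integral>\<^sup>+om. ennreal \<bar>?A om\<bar> \<partial>M) <= (\<integral>\<^sup>+om. ennreal ((?A om)\<^sup>2) * ennreal (1 / (2 * ?d)) + ennreal (?d / 2) \<partial>M)"
 proof (rule nn_integral_mono)
  fix om
  have "ennreal \<bar>?A om\<bar> <= ennreal ((?A om)\<^sup>2 * (1 / (2 * ?d)) + ?d / 2)" by (rule ennreal_leI[OF pt[OF d]])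
  also have "... = ennreal ((?A om)\<^sup>2) * ennreal (1 / (2 * ?d)) + ennreal (?d / 2)"
   using d by (subst ennreal_plus) (auto simp: ennreal_mult[symmetric])
  finally show "ennreal \<bar>?A om\<bar> <= ennreal ((?A om)\<^sup>2) * ennreal (1 / (2 * ?d)) + ennreal (?d / 2)" .
 qed
 also have "... = (\<integral>\<^sup>+om. ennreal ((?A om)\<^sup>2) \<partial>M) * ennreal (1 / (2 * ?d)) + ennreal (?d / 2)"
  by (subst nn_integral_add) (auto simp: nn_integral_multc emeasure_space_1)
 also have "... <= ennreal (?d\<^sup>2) * ennreal (1 / (2 * ?d)) + ennreal (?d / 2)"
  by (intro add_right_mono mult_right_mono area_sq[OF uv jk J]) simp
 also have "... = ennreal (?d\<^sup>2 * (1 / (2 * ?d)) + ?d / 2)"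
  using d by (subst ennreal_plus) (auto simp: ennreal_mult[symmetric])
 also have "?d\<^sup>2 * (1 / (2 * ?d)) + ?d / 2 = ?d" using d by (simp add: field_simps power2_eq_square)
 finally show ?thesis .
qed

text \<open>Each gap contributes at most N times its length, so the expected sum of |area| is at
  most N t on every grid. Fatou's lemma then gives a finite liminf on almost every path.\<close>

lemma area_psum_frequently:
 assumes t: "0 <= t" and k: "k < N" and J: "!!j. j < N ==> ito_proc M (B j) (B k) (Jp j)"
 shows "AE om in M. \<exists>K. \<exists>\<^sub>F n in sequentially. psum (dg (r n) 0 t) (\<lambda>u v. \<Sum>j<N. \<bar>area j k (Jp j) u v om\<bar>) <= K"
proof -
 let ?V = "\<lambda>n om. psum (dg (r n) 0 t) (\<lambda>u v. \<Sum>j<N. \<bar>area j k (Jp j) u v om\<bar>)"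
 have dgp: "partition_of (dg n 0 t) 0 t" for n using t by (rule dg_partition)
 have fd: "finite (dg n 0 t)" for n by (rule finite_dg)
 have gp: "0 <= fst z" "fst z < snd z" if "z \<in> gaps (dg n 0 t)" for z n
  using partition_gapsD[OF dgp, of "fst z" "snd z" n] that by auto
 have Am: "(\<lambda>om. ennreal \<bar>area j k (Jp j) (fst z) (snd z) om\<bar>) \<in> borel_measurable M" if "z \<in> gaps (dg n 0 t)" "j < N" for z n j
 proof -
  have [measurable]: "area j k (Jp j) (fst z) (snd z) \<in> borel_measurable M"
   by (rule area_meas[OF _ _ that(2) k J[OF that(2)]]) (use gp[OF that(1)] in auto)
  show ?thesis by measurable
 qed
 have V: "ennreal (?V n om) = (\<Sum>z\<in>gaps (dg (r n) 0 t). \<Sum>j<N. ennreal \<bar>area j k (Jp j) (fst z) (snd z) om\<bar>)" for n om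
  unfolding psum_gaps[OF fd] case_prod_unfold by (simp add: sum_nonneg)
 have Vm: "(\<lambda>om. ennreal (?V n om)) \<in> borel_measurable M" for n
  unfolding V by (intro borel_measurable_sum Am) auto
 have Vb: "(\<integral>\<^sup>+om. ennreal (?V n om) \<partial>M) <= ennreal (real N * t)" for n
 proof -
  have "(\<integral>\<^sup>+om. ennreal (?V n om) \<partial>M) = (\<Sum>z\<in>gaps (dg (r n) 0 t). \<Sum>j<N. \<integral>\<^sup>+om. ennreal \<bar>area j k (Jp j) (fst z) (snd z) om\<bar> \<partial>M)"
   unfolding V
   by (subst nn_integral_sum, (intro borel_measurable_sum Am; simp), intro sum.cong refl nn_integral_sum Am; simp)
  also have "... <= (\<Sum>z\<in>gaps (dg (r n) 0 t). \<Sum>j<N. ennreal (snd z - fst z))"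
   by (intro sum_mono area_abs k J gp) auto
  also have "... = (\<Sum>z\<in>gaps (dg (r n) 0 t). ennreal (real N * (snd z - fst z)))"
  proof (rule sum.cong[OF refl])
   fix z assume "z \<in> gaps (dg (r n) 0 t)"
   then have "0 <= snd z - fst z" using gp(2)[of z "r n"] by simp
   then show "(\<Sum>j<N. ennreal (snd z - fst z)) = ennreal (real N * (snd z - fst z))"
    by (subst sum_ennreal) simp_all
  qed
  also have "... = ennreal (\<Sum>z\<in>gaps (dg (r n) 0 t). real N * (snd z - fst z))"
  proof (rule sum_ennreal)
   fix z assume "z \<in> gaps (dg (r n) 0 t)"
   then show "0 <= real N * (snd z - fst z)" using gp(2)[of z "r n"] by simp
  qed
  also have "(\<Sum>z\<in>gaps (dg (r n) 0 t). real N * (snd z - fst z)) = psum (dg (r n) 0 t) (\<lambda>u v. real N * (v - u))"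
   unfolding psum_gaps[OF fd] case_prod_unfold ..
  also have "... = real N * t" unfolding psum_mult using psum_additive[OF dgp, of "r n" "\<lambda>x. x"] by simp
  finally show ?thesis .
 qed
 have "(\<integral>\<^sup>+om. liminf (\<lambda>n. ennreal (?V n om)) \<partial>M) <= liminf (\<lambda>n. \<integral>\<^sup>+om. ennreal (?V n om) \<partial>M)"
  by (rule nn_integral_liminf[OF Vm])
 also have "... <= liminf (\<lambda>n::nat. ennreal (real N * t))" by (rule Liminf_mono) (use Vb in auto)
 also have "... = ennreal (real N * t)" by (simp add: Liminf_const)
 finally have fin: "(\<integral>\<^sup>+om. liminf (\<lambda>n. ennreal (?V n om)) \<partial>M) \<noteq> \<infinity>"
  using neq_top_trans[of "ennreal (real N * t)"] by simp
 have "(\<lambda>om. liminf (\<lambda>n. ennreal (?V n om))) \<in> borel_measurable M" by (rule borel_measurable_liminf[OF Vm])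
 from nn_integral_noteq_infinite[OF this fin] show ?thesis
  by eventually_elim (rule frequently_of_liminf)
qed

lemma ito_germ:
 assumes al: "1 / 3 < \<alpha>" "\<alpha> < 1 / 2" and k: "k < N" and J: "!!j. j < N ==> ito_proc M (B j) (B k) (Jp j)"
  and h: "adapted M F h" and I: "ito_proc M h (B k) Ih"
  and hc: "AE om in M. continuous_on {0..} (\<lambda>t. h t om)"
  and ctl: "AE om in M. \<forall>T\<ge>0. controlled_on {0..T} \<alpha> N (\<lambda>j t. B j t om) (\<lambda>t. h t om) (\<lambda>j t. h' j t om)"
 shows "AE om in M. \<exists>K. \<forall>u w. 0 <= u \<and> u <= w \<and> w <= real T -->
  \<bar>Ih w om - Ih u om - germ N (\<lambda>t. B k t om) (\<lambda>j u w. area j k (Jp j) u w om) (\<lambda>t. h t om) (\<lambda>j t. h' j t om) u w\<bar> <= K * (w - u) powr (3 * \<alpha>)"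
proof -
 \<comment> \<open>Indices below N stand for the components B_j and the others for h, so one family
   covers every integral against B_k.\<close>
 define hh where "hh j = (if j < N then B j else h)" for j
 define JJ where "JJ j = (if j < N then Jp j else Ih)" for j
 have had: "adapted M F (hh j)" for j using h adapted_B by (simp add: hh_def)
 have hJ: "ito_proc M (hh j) (B k) (JJ j)" for j using J I by (simp add: hh_def JJ_def)
 \<comment> \<open>The index consists of a component and two dyadic numbers given by numerator and
   exponent, a countable type. Pairs in the wrong order receive the zero sequence.\<close>
 define X :: "nat \<times> (nat \<times> nat) \<times> (nat \<times> nat) => nat => 'w => real"
  where "X = (\<lambda>(j, (i, m), (i', m')) n om. let x = real i / 2 ^ m; y = real i' / 2 ^ m' in
   if x < y then psum (dg n x y) (\<lambda>u v. hh j u om * incr k u v om) - (JJ j y om - JJ j x om) else 0)"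
 have Xeq: "X (j, (i, m), (i', m')) = (if real i / 2 ^ m < real i' / 2 ^ m' then
   (\<lambda>n om. psum (dg n (real i / 2 ^ m) (real i' / 2 ^ m')) (\<lambda>u v. hh j u om * incr k u v om) - (JJ j (real i' / 2 ^ m') om - JJ j (real i / 2 ^ m) om))
   else (\<lambda>n om. 0))" for j i m i' m' unfolding X_def by (auto simp: Let_def)
 have c0: "convP (\<lambda>n om. 0)" by (simp add: convP_def)
 have cX: "convP (X z)" for z
 proof -
  obtain j i m i' m' where z: "z = (j, (i, m), (i', m'))" by (cases z) auto
  have "convP (\<lambda>n om. psum (dg n (real i / 2 ^ m) (real i' / 2 ^ m')) (\<lambda>u v. hh j u om * incr k u v om) - (JJ j (real i' / 2 ^ m') om - JJ j (real i / 2 ^ m) om))"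
   if "real i / 2 ^ m < real i' / 2 ^ m'"
   by (rule ito_conv[OF hJ had k _ that]) simp
  then show ?thesis unfolding z Xeq using c0 by simp
 qed
 have mX: "X z n \<in> borel_measurable M" for z n
 proof -
  obtain j i m i' m' where z: "z = (j, (i, m), (i', m'))" by (cases z) auto
  have "(\<lambda>om. psum (dg n (real i / 2 ^ m) (real i' / 2 ^ m')) (\<lambda>u v. hh j u om * incr k u v om) - (JJ j (real i' / 2 ^ m') om - JJ j (real i / 2 ^ m) om)) \<in> borel_measurable M"
   if lt: "real i / 2 ^ m < real i' / 2 ^ m'"
  proof (intro borel_measurable_diff rsum_meas[OF finite_dg _ k] ito_meas[OF hJ])
   show "dg n (real i / 2 ^ m) (real i' / 2 ^ m') \<subseteq> {0..}" by (rule dg_nonneg) (use lt in auto)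
   then show "hh j u \<in> borel_measurable M" if "u \<in> dg n (real i / 2 ^ m) (real i' / 2 ^ m')" for u
    using that by (intro adapted_M[OF had]) auto
  qed auto
  then show ?thesis unfolding z Xeq by simp
 qed
 obtain r :: "nat => nat" where r: "strict_mono r" and ae: "AE om in M. \<forall>z. (\<lambda>n. X z (r n) om) \<longlonglongrightarrow> 0"
  by (rule convP_subseq[of X, OF cX mX]) (rule that)
 have fr: "AE om in M. \<forall>t\<in>dyadic. \<exists>K. \<exists>\<^sub>F n in sequentially. psum (dg (r n) 0 t) (\<lambda>u v. \<Sum>j<N. \<bar>area j k (Jp j) u v om\<bar>) <= K"
  by (rule AE_ball_countable'[OF _ countable_dyadic]) (rule area_psum_frequently[OF dyadic_nonneg k J])
 have al0: "0 < \<alpha>" using al by simp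
 have ah: "AE om in M. \<forall>j\<in>{..<N}. \<exists>C. \<forall>s t. 0 <= s \<and> s <= t \<and> t <= real T --> \<bar>area j k (Jp j) s t om\<bar> <= C * (t - s) powr (2 * \<alpha>)"
  by (rule AE_ball_countable') (use area_holder[OF al0 al(2) _ k J] in auto)
 have Jc: "AE om in M. \<forall>j\<in>{..<N}. continuous_on {0..} (\<lambda>t. Jp j t om)"
  by (rule AE_ball_countable') (use ito_cont[OF J] in \<open>auto elim: eventually_mono\<close>)
 show ?thesis
  using ae fr ah Jc B_cont hc ctl ito_cont[OF I] B_holder[OF al0 al(2) k, of T]
 proof eventually_elim
  case (elim om)
  define A where "A j u w = area j k (Jp j) u w om" for j u w
  define f where "f t = h t om" for t
  define f' where "f' j t = h' j t om" for j t
  define b where "b j t = B j t om" for j t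
  define G where "G = germ N (b k) A f f'"
  have A_eq: "A j u w = Jp j w om - Jp j u om - b j u * (b k w - b k u)" for j u w
   by (simp add: A_def area_def incr_def b_def)
  have G_eq: "G u w = f u * (b k w - b k u) + (\<Sum>j<N. f' j u * A j u w)" for u w
   unfolding G_def germ_def by (simp add: mult.commute)
  have ct: "controlled_on {0..real T} \<alpha> N b f f'"
   using elim(7)[rule_format, of "real T"] unfolding b_def f_def f'_def by simp
  obtain CB where CB: "!!s t. 0 <= s ==> s <= t ==> t <= real T ==> \<bar>b k t - b k s\<bar> <= CB * (t - s) powr \<alpha>"
   using elim(9) unfolding holder_upto_def b_def by blast
  have "\<forall>j. \<exists>C. j < N --> (\<forall>s t. 0 <= s \<and> s <= t \<and> t <= real T --> \<bar>A j s t\<bar> <= C * (t - s) powr (2 * \<alpha>))"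
   using elim(3) unfolding A_def by blast
  then obtain CA where CA: "!!j s t. j < N ==> 0 <= s ==> s <= t ==> t <= real T ==> \<bar>A j s t\<bar> <= CA j * (t - s) powr (2 * \<alpha>)"
   by metis
  define H where "H = \<bar>CB\<bar> + (\<Sum>j<N. \<bar>CA j\<bar>)"
  have H: "H >= 0" "CB <= H" unfolding H_def by (simp_all add: sum_nonneg add_increasing2)
  have HA: "CA j <= H" if "j < N" for j
  proof -
   have "\<bar>CA j\<bar> <= (\<Sum>j<N. \<bar>CA j\<bar>)" by (rule member_le_sum) (use that in auto)
   then show ?thesis unfolding H_def by linarith
  qed
  have "\<exists>L K. \<forall>u w. 0 <= u \<and> u <= w \<and> w <= real T --> norm (L w - L u - germ N (b k) A f f' u w) <= K * (w - u) powr (3 * \<alpha>)"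
  proof (rule controlled_sewing[OF al(1) ct k H(1)])
   show "\<bar>b k w - b k u\<bar> <= H * (w - u) powr \<alpha>" if "0 <= u" "u <= w" "w <= real T" for u w
    by (rule order_trans[OF CB[OF that] mult_right_mono[OF H(2)]]) simp
   show "\<bar>A j u w\<bar> <= H * (w - u) powr (2 * \<alpha>)" if "j < N" "0 <= u" "u <= w" "w <= real T" for j u w
    by (rule order_trans[OF CA[OF that] mult_right_mono[OF HA[OF that(1)]]]) simp
   show "A j u w = A j u m + A j m w + (b j m - b j u) * (b k w - b k m)" for j u m w
    unfolding A_def b_def by (rule area_chen)
  qed
  then obtain L K where LK: "!!u w. 0 <= u ==> u <= w ==> w <= real T ==> \<bar>L w - L u - G u w\<bar> <= K * (w - u) powr (3 * \<alpha>)"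
   unfolding G_def real_norm_def by blast
  have lim: "(\<lambda>n. psum (dg (r n) x y) (\<lambda>u v. hh j u om * incr k u v om)) \<longlonglongrightarrow> JJ j y om - JJ j x om"
   if xy: "x \<in> dyadic" "y \<in> dyadic" "x < y" for j x y
  proof -
   obtain i m i' m' where e: "x = real i / 2 ^ m" "y = real i' / 2 ^ m'" using xy unfolding dyadic_def by blast
   have "(\<lambda>n. X (j, (i, m), (i', m')) (r n) om) \<longlonglongrightarrow> 0" using elim(1) by blast
   then show ?thesis unfolding Xeq using xy(3) unfolding e by (simp add: LIM_zero_iff)
  qed
  have fc: "continuous_on {0..real T} (f' j)" if "j < N" for j
   using ct that al0 unfolding controlled_on_def by (blast intro: holder_on_continuous)
  have id: "Ih t om - Ih 0 om = L t - L 0" if t: "t \<in> dyadic" "t <= real T" for t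
  proof (cases "t = 0")
   case False
   have t0: "0 <= t" "0 < t" using dyadic_nonneg[OF t(1)] False by auto
   have d0: "0 \<in> dyadic" using dyadicI[of 0 0] by simp
   have dgd: "dg n 0 t \<subseteq> dyadic" for n by (rule dg_dyadic[OF d0 t(1)])
   have dgp: "partition_of (dg n 0 t) 0 t" for n using t0 by (intro dg_partition) simp
   have th: "3 * \<alpha> > 1" using al by simp
   have "mesh_lim 0 t G (L t - L 0)"
    by (rule mesh_lim_of_germ[OF th, where K = K]) (use LK t(2) in auto)
   then have l1: "(\<lambda>n. psum (dg (r n) 0 t) G) \<longlonglongrightarrow> L t - L 0" by (rule mesh_lim_dg[OF _ order_refl t0(1) r])
   have l2: "(\<lambda>n. psum (dg (r n) 0 t) (\<lambda>u v. f u * (b k v - b k u))) \<longlonglongrightarrow> Ih t om - Ih 0 om"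
    using lim[OF d0 t(1) t0(2), of N] by (simp add: hh_def JJ_def incr_def f_def b_def)
   have "psum (dg (r n) 0 t) G - psum (dg (r n) 0 t) (\<lambda>u v. f u * (b k v - b k u)) = psum (dg (r n) 0 t) (\<lambda>u v. \<Sum>j<N. f' j u * A j u v)" for n
    unfolding psum_diff[symmetric] G_eq by (simp only: add_diff_cancel_left')
   then have l3: "(\<lambda>n. psum (dg (r n) 0 t) (\<lambda>u v. \<Sum>j<N. f' j u * A j u v)) \<longlonglongrightarrow> (L t - L 0) - (Ih t om - Ih 0 om)"
    using tendsto_diff[OF l1 l2] by simp
   obtain K' where K': "\<exists>\<^sub>F n in sequentially. psum (dg (r n) 0 t) (\<lambda>u v. \<Sum>j<N. \<bar>A j u v\<bar>) <= K'"
    using elim(2) t(1) unfolding A_def by blast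
   \<comment> \<open>Over a fixed block the areas sum to the increment of the Ito integral of B_j
     minus its own Riemann sum, a difference that tends to 0.\<close>
   have blk: "(\<lambda>n. psum (dg (r n) x y) (A j)) \<longlonglongrightarrow> 0" if j: "j < N" and xy: "(x, y) \<in> gaps (dg m 0 t)" for m j x y
   proof -
    have g: "x \<in> dg m 0 t" "y \<in> dg m 0 t" "x < y" "0 <= x" using partition_gapsD[OF dgp xy] by auto
    then have xyd: "x \<in> dyadic" "y \<in> dyadic" using dgd by auto
    have pxy: "partition_of (dg n x y) x y" for n using g by (intro dg_partition) simp
    have "psum (dg (r n) x y) (A j) = (Jp j y om - Jp j x om) - psum (dg (r n) x y) (\<lambda>u v. hh j u om * incr k u v om)" for n
    proof -
     have "(Jp j y om - Jp j x om) = psum (dg (r n) x y) (\<lambda>u v. Jp j v om - Jp j u om)" by (rule psum_additive[OF pxy, symmetric])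
     then show ?thesis using j by (simp add: psum_diff[symmetric] hh_def A_eq[abs_def] b_def incr_def)
    qed
    moreover have "(\<lambda>n. (Jp j y om - Jp j x om) - psum (dg (r n) x y) (\<lambda>u v. hh j u om * incr k u v om)) \<longlonglongrightarrow> (Jp j y om - Jp j x om) - (JJ j y om - JJ j x om)"
     by (intro tendsto_diff tendsto_const lim[OF xyd g(3)])
    ultimately show ?thesis using j by (simp add: JJ_def)
   qed
   have "(L t - L 0) - (Ih t om - Ih 0 om) = 0"
    by (rule two_scale[where f = f' and A = A and r = r, OF t0(1) _ r blk K' l3])
     (use continuous_on_subset[OF fc] t(2) in auto)
   then show ?thesis by simp
  qed simp
  have dy: "\<bar>Ih w om - Ih u om - G u w\<bar> <= K * (w - u) powr (3 * \<alpha>)"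
   if "u \<in> dyadic" "w \<in> dyadic" "u <= w" "w <= real T" for u w
  proof -
   have "Ih w om - Ih u om = L w - L u" using id[OF that(1)] id[OF that(2)] that by linarith
   then show ?thesis using LK[OF dyadic_nonneg[OF that(1)] that(3,4)] by simp
  qed
  have "\<bar>Ih w om - Ih u om - G u w\<bar> <= K * (w - u) powr (3 * \<alpha>)" if uw: "0 <= u" "u <= w" "w <= real T" for u w
  \<comment> \<open>On the diagonal both sides vanish; off it the limit of the \<open>powr\<close>
    term is taken at a positive base.\<close>
  proof (cases "u = w")
   case True
   have "A j w w = 0" for j by (simp add: A_def area_def incr_def)
   then show ?thesis unfolding True G_eq by simp
  next
   case False
   have w0: "0 <= w" using uw by simp
   have c: "(\<lambda>n. F (dup n x)) \<longlonglongrightarrow> F x" if "continuous_on {0..real T} F" "0 <= x" "x <= real T" for F :: "real => real" and x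
   proof (rule continuous_on_tendsto_compose[OF that(1) dup_lim[OF that(2)]])
    have "0 <= dup n x" "dup n x <= real T" for n using dup_bounds(1)[OF that(2), of n] dup_le[OF that(3), of n] that by linarith+
    then show "\<forall>\<^sub>F n in sequentially. dup n x \<in> {0..real T}" by simp
   qed (use that in simp)
   have sub: "continuous_on {0..real T} F" if "continuous_on {0..} F" for F :: "real => real"
    by (rule continuous_on_subset[OF that]) auto
   have cb: "continuous_on {0..real T} (b j)" if "j < N" for j using elim(5) that unfolding b_def by (blast intro: sub)
   have cJ: "continuous_on {0..real T} (\<lambda>t. Jp j t om)" if "j < N" for j using elim(4) that by (blast intro: sub)
   have cf: "continuous_on {0..real T} f" using elim(6) unfolding f_def by (rule sub)
   have cI: "continuous_on {0..real T} (\<lambda>t. Ih t om)" using elim(8) by (blast intro: sub)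
   have uT: "u <= real T" using uw by simp
   have "(\<lambda>n. \<bar>Ih (dup n w) om - Ih (dup n u) om - G (dup n u) (dup n w)\<bar>) \<longlonglongrightarrow> \<bar>Ih w om - Ih u om - G u w\<bar>"
    unfolding G_eq A_eq
    by (intro tendsto_rabs tendsto_diff tendsto_add tendsto_sum tendsto_mult c[OF cI] c[OF cf] c[OF cb] c[OF cJ] c[OF fc])
     (use uw uT w0 k in auto)
   moreover have "(\<lambda>n. K * (dup n w - dup n u) powr (3 * \<alpha>)) \<longlonglongrightarrow> K * (w - u) powr (3 * \<alpha>)"
    by (intro tendsto_intros dup_lim uw(1) w0) (use False uw in auto)
   moreover have "\<bar>Ih (dup n w) om - Ih (dup n u) om - G (dup n u) (dup n w)\<bar> <= K * (dup n w - dup n u) powr (3 * \<alpha>)" for n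
    by (rule dy[OF dup_dyadic dup_dyadic dup_mono[OF uw(2)] dup_le[OF uw(3)]])
   ultimately show ?thesis by (intro LIMSEQ_le) auto
  qed
  then show ?case unfolding G_def A_def f_def[abs_def] f'_def[abs_def] b_def[abs_def] by blast
 qed
qed

end

section \<open>The rough equation\<close>

text \<open>Two-parameter orders of magnitude with one constant for the window. Only u \<le> w is
  recorded; \<open>controlled_onI\<close> recovers the reversed order. C \<ge> 0 is built in so that
  estimates can be multiplied.\<close>

definition dbigo :: "real => real => real => (real => real => complex) => bool" where
 "dbigo s t \<theta> E \<longleftrightarrow> (\<exists>C\<ge>0. \<forall>u w. s <= u \<and> u <= w \<and> w <= t --> cmod (E u w) <= C * (w - u) powr \<theta>)"

lemma dbigoI:
 assumes "!!u w. s <= u ==> u <= w ==> w <= t ==> cmod (E u w) <= C * (w - u) powr \<theta>"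
 shows "dbigo s t \<theta> E"
 unfolding dbigo_def
proof (intro exI[of _ "\<bar>C\<bar>"] conjI allI impI)
 fix u w assume o: "s <= u \<and> u <= w \<and> w <= t"
 have "cmod (E u w) <= C * (w - u) powr \<theta>" using assms o by blast
 also have "... <= \<bar>C\<bar> * (w - u) powr \<theta>" by (rule mult_right_mono) auto
 finally show "cmod (E u w) <= \<bar>C\<bar> * (w - u) powr \<theta>" .
qed simp

lemma dbigo_cong:
 assumes "dbigo s t \<theta> E" "!!u w. s <= u ==> u <= w ==> w <= t ==> E' u w = E u w"
 shows "dbigo s t \<theta> E'"
 using assms unfolding dbigo_def by auto

lemma dbigo_zero: "dbigo s t \<theta> (\<lambda>u w. 0)"
 by (rule dbigoI[of _ _ _ 0]) simp

lemma dbigo_add: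
 assumes "dbigo s t \<theta> E" "dbigo s t \<theta> E'"
 shows "dbigo s t \<theta> (\<lambda>u w. E u w + E' u w)"
proof -
 obtain C where C: "!!u w. s <= u ==> u <= w ==> w <= t ==> cmod (E u w) <= C * (w - u) powr \<theta>"
  using assms(1) unfolding dbigo_def by blast
 obtain C' where C': "!!u w. s <= u ==> u <= w ==> w <= t ==> cmod (E' u w) <= C' * (w - u) powr \<theta>"
  using assms(2) unfolding dbigo_def by blast
 show ?thesis
 proof (rule dbigoI)
  fix u w assume o: "s <= u" "u <= w" "w <= t"
  show "cmod (E u w + E' u w) <= (C + C') * (w - u) powr \<theta>"
   using norm_triangle_ineq[of "E u w" "E' u w"] C[OF o] C'[OF o] unfolding distrib_right by linarith
 qed
qed

lemma dbigo_sum: "(!!i. i \<in> S ==> dbigo s t \<theta> (E i)) ==> dbigo s t \<theta> (\<lambda>u w. \<Sum>i\<in>S. E i u w)"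
 by (induction S rule: infinite_finite_induct) (auto intro!: dbigo_zero dbigo_add)

lemma dbigo_mult:
 assumes "dbigo s t \<theta> E" "dbigo s t \<theta>' E'"
 shows "dbigo s t (\<theta> + \<theta>') (\<lambda>u w. E u w * E' u w)"
proof -
 obtain C where C: "C >= 0" "!!u w. s <= u ==> u <= w ==> w <= t ==> cmod (E u w) <= C * (w - u) powr \<theta>"
  using assms(1) unfolding dbigo_def by blast
 obtain C' where C': "!!u w. s <= u ==> u <= w ==> w <= t ==> cmod (E' u w) <= C' * (w - u) powr \<theta>'"
  using assms(2) unfolding dbigo_def by blast
 show ?thesis
 proof (rule dbigoI)
  fix u w assume o: "s <= u" "u <= w" "w <= t"
  have "cmod (E u w * E' u w) <= (C * (w - u) powr \<theta>) * (C' * (w - u) powr \<theta>')"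
   unfolding norm_mult using C(1) by (intro mult_mono C C' o) auto
  also have "... = (C * C') * (w - u) powr (\<theta> + \<theta>')" by (simp add: powr_add)
  finally show "cmod (E u w * E' u w) <= (C * C') * (w - u) powr (\<theta> + \<theta>')" .
 qed
qed

lemma dbigo_bounded_mult:
 assumes "\<exists>M. \<forall>r\<in>{s..t}. cmod (f r) <= M" "dbigo s t \<theta> E"
 shows "dbigo s t \<theta> (\<lambda>u w. f u * E u w)"
proof -
 obtain C where C: "!!u w. s <= u ==> u <= w ==> w <= t ==> cmod (E u w) <= C * (w - u) powr \<theta>"
  using assms(2) unfolding dbigo_def by blast
 obtain M where M: "!!r. r \<in> {s..t} ==> cmod (f r) <= M" using assms(1) by blast
 show ?thesis
 proof (rule dbigoI)
  fix u w assume o: "s <= u" "u <= w" "w <= t"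
  have "cmod (f u) <= \<bar>M\<bar>" using M[of u] o by force
  then have "cmod (f u * E u w) <= \<bar>M\<bar> * (C * (w - u) powr \<theta>)"
   unfolding norm_mult by (intro mult_mono C o) auto
  then show "cmod (f u * E u w) <= (\<bar>M\<bar> * C) * (w - u) powr \<theta>" by (simp only: mult.assoc)
 qed
qed

lemma dbigo_cmult: "dbigo s t \<theta> E ==> dbigo s t \<theta> (\<lambda>u w. c * E u w)"
 by (rule dbigo_bounded_mult[of s t "\<lambda>_. c"]) auto

lemma dbigo_minus: "dbigo s t \<theta> E ==> dbigo s t \<theta> (\<lambda>u w. - E u w)"
 by (simp add: dbigo_def)

lemma dbigo_diff: "dbigo s t \<theta> E ==> dbigo s t \<theta> E' ==> dbigo s t \<theta> (\<lambda>u w. E u w - E' u w)"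
 using dbigo_add[OF _ dbigo_minus, of s t \<theta> E E'] by simp

lemma dbigo_weaken:
 assumes "dbigo s t \<theta>' E" "\<theta> <= \<theta>'"
 shows "dbigo s t \<theta> E"
proof -
 obtain C where C: "C >= 0" "!!u w. s <= u ==> u <= w ==> w <= t ==> cmod (E u w) <= C * (w - u) powr \<theta>'"
  using assms(1) unfolding dbigo_def by blast
 show ?thesis
 proof (rule dbigoI)
  fix u w assume o: "s <= u" "u <= w" "w <= t"
  have "(w - u) powr \<theta>' = (w - u) powr (\<theta>' - \<theta>) * (w - u) powr \<theta>" by (simp add: powr_add[symmetric])
  also have "... <= (t - s) powr (\<theta>' - \<theta>) * (w - u) powr \<theta>"
   by (intro mult_right_mono powr_mono2) (use o assms in auto)
  finally have "C * (w - u) powr \<theta>' <= C * ((t - s) powr (\<theta>' - \<theta>) * (w - u) powr \<theta>)"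
   by (rule mult_left_mono[OF _ C(1)])
  then show "cmod (E u w) <= (C * (t - s) powr (\<theta>' - \<theta>)) * (w - u) powr \<theta>"
   using C(2)[OF o] by (simp only: mult.assoc)
 qed
qed

text \<open>A bound is carried along with the Hoelder estimate so that the class is closed under
  products.\<close>

definition hbd :: "real => real => real => (real => complex) => bool" where
 "hbd s t \<alpha> f \<longleftrightarrow> (\<exists>M. \<forall>r\<in>{s..t}. cmod (f r) <= M) \<and> dbigo s t \<alpha> (\<lambda>u w. f w - f u)"

lemma hbd_bounded: "hbd s t \<alpha> f ==> \<exists>M. \<forall>r\<in>{s..t}. cmod (f r) <= M"
 by (simp add: hbd_def)

lemma hbd_dbigo: "hbd s t \<alpha> f ==> dbigo s t \<alpha> (\<lambda>u w. f w - f u)"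
 by (simp add: hbd_def)

lemma dbigo_holder:
 assumes "dbigo s t \<alpha> (\<lambda>u w. f w - f u)"
 shows "holder_on {s..t} \<alpha> f"
proof -
 obtain C where C: "!!u w. s <= u ==> u <= w ==> w <= t ==> cmod (f w - f u) <= C * (w - u) powr \<alpha>"
  using assms unfolding dbigo_def by blast
 have "cmod (f w - f u) <= C * \<bar>w - u\<bar> powr \<alpha>" if "u \<in> {s..t}" "w \<in> {s..t}" for u w
 proof (cases "u <= w")
  case True then show ?thesis using C[of u w] that by simp
 next
  case False then show ?thesis using C[of w u] that by (simp add: norm_minus_commute)
 qed
 then show ?thesis unfolding holder_on_def by blast
qed

lemma hbd_holder: "hbd s t \<alpha> f ==> holder_on {s..t} \<alpha> f"
 by (rule dbigo_holder[OF hbd_dbigo])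

lemma holder_hbd:
 fixes f :: "real => real"
 assumes h: "holder_on {s..t} \<alpha> f" and al: "\<alpha> > 0"
 shows "hbd s t \<alpha> (\<lambda>r. cplx (f r))"
 unfolding hbd_def
proof
 have "bounded (f ` {s..t})" by (intro compact_imp_bounded compact_continuous_image holder_on_continuous[OF h al] compact_Icc)
 then show "\<exists>M. \<forall>r\<in>{s..t}. cmod (cplx (f r)) <= M" unfolding bounded_iff by auto
 obtain C where C: "\<forall>u\<in>{s..t}. \<forall>w\<in>{s..t}. norm (f w - f u) <= C * \<bar>w - u\<bar> powr \<alpha>" using h unfolding holder_on_def by blast
 show "dbigo s t \<alpha> (\<lambda>u w. cplx (f w) - cplx (f u))"
 proof (rule dbigoI)
  fix u w assume "s <= u" "u <= w" "w <= t"
  then have "\<bar>f w - f u\<bar> <= C * (w - u) powr \<alpha>" using C[rule_format, of u w] by auto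
  then show "cmod (cplx (f w) - cplx (f u)) <= C * (w - u) powr \<alpha>"
   unfolding of_real_diff[symmetric] norm_of_real .
 qed
qed

lemma hbd_const: "hbd s t \<alpha> (\<lambda>r. c)"
 unfolding hbd_def using dbigo_zero by auto

lemma hbd_add:
 assumes "hbd s t \<alpha> f" "hbd s t \<alpha> h"
 shows "hbd s t \<alpha> (\<lambda>r. f r + h r)"
 unfolding hbd_def
proof
 obtain M where "\<forall>r\<in>{s..t}. cmod (f r) <= M" using hbd_bounded[OF assms(1)] by blast
 moreover obtain M' where "\<forall>r\<in>{s..t}. cmod (h r) <= M'" using hbd_bounded[OF assms(2)] by blast
 ultimately have "cmod (f r + h r) <= M + M'" if "r \<in> {s..t}" for r
  using norm_triangle_ineq[of "f r" "h r"] that by fastforce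
 then show "\<exists>M. \<forall>r\<in>{s..t}. cmod (f r + h r) <= M" by blast
 show "dbigo s t \<alpha> (\<lambda>u w. f w + h w - (f u + h u))"
  by (rule dbigo_cong[OF dbigo_add[OF hbd_dbigo[OF assms(1)] hbd_dbigo[OF assms(2)]]]) simp
qed

lemma hbd_mult:
 assumes "hbd s t \<alpha> f" "hbd s t \<alpha> h" "\<alpha> > 0"
 shows "hbd s t \<alpha> (\<lambda>r. f r * h r)"
 unfolding hbd_def
proof
 obtain M where M: "\<forall>r\<in>{s..t}. cmod (f r) <= M" using hbd_bounded[OF assms(1)] by blast
 obtain M' where M': "\<forall>r\<in>{s..t}. cmod (h r) <= M'" using hbd_bounded[OF assms(2)] by blast
 have "cmod (f r * h r) <= \<bar>M\<bar> * \<bar>M'\<bar>" if "r \<in> {s..t}" for r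
  unfolding norm_mult using M M' that by (intro mult_mono) force+
 then show "\<exists>M. \<forall>r\<in>{s..t}. cmod (f r * h r) <= M" by blast
 have "dbigo s t \<alpha> (\<lambda>u w. f u * (h w - h u) + (h u * (f w - f u) + (f w - f u) * (h w - h u)))"
  using assms by (intro dbigo_add dbigo_bounded_mult[OF hbd_bounded] hbd_dbigo dbigo_weaken[OF dbigo_mult, of _ _ \<alpha> _ \<alpha>]) auto
 then show "dbigo s t \<alpha> (\<lambda>u w. f w * h w - f u * h u)"
  by (rule dbigo_cong) (simp add: algebra_simps)
qed

lemma hbd_sum: "(!!i. i \<in> S ==> hbd s t \<alpha> (f i)) ==> hbd s t \<alpha> (\<lambda>r. \<Sum>i\<in>S. f i r)"
 by (induction S rule: infinite_finite_induct) (auto intro!: hbd_const hbd_add)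

text \<open>For w < u the remainder is minus the one in natural order plus the increments of b times
  those of Y', a term of order 2\<alpha>.\<close>

lemma controlled_onI:
 assumes Y: "hbd s t \<alpha> Y" and Y': "!!j. j < N ==> hbd s t \<alpha> (Y' j)"
  and b: "!!j. j < N ==> dbigo s t \<alpha> (\<lambda>u w. cplx (b j w - b j u))"
  and R: "dbigo s t (2 * \<alpha>) (\<lambda>u w. Y w - Y u - (\<Sum>j<N. cplx (b j w - b j u) * Y' j u))"
 shows "controlled_on {s..t} \<alpha> N b Y Y'"
proof -
 let ?R = "\<lambda>u w. Y w - Y u - (\<Sum>j<N. (b j w - b j u) *\<^sub>R Y' j u)"
 obtain C1 where C1: "C1 >= 0" "!!u w. s <= u ==> u <= w ==> w <= t ==> cmod (?R u w) <= C1 * (w - u) powr (2 * \<alpha>)"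
  using R unfolding dbigo_def scaleR_conv_of_real by blast
 have "dbigo s t (\<alpha> + \<alpha>) (\<lambda>u w. \<Sum>j<N. cplx (b j w - b j u) * (Y' j w - Y' j u))"
  by (intro dbigo_sum dbigo_mult b hbd_dbigo Y') auto
 then obtain C2 where C2: "C2 >= 0" "!!u w. s <= u ==> u <= w ==> w <= t ==>
   cmod (\<Sum>j<N. (b j w - b j u) *\<^sub>R (Y' j w - Y' j u)) <= C2 * (w - u) powr (\<alpha> + \<alpha>)"
  unfolding dbigo_def scaleR_conv_of_real by blast
 have "cmod (?R u w) <= (C1 + C2) * \<bar>w - u\<bar> powr (2 * \<alpha>)" if uw: "u \<in> {s..t}" "w \<in> {s..t}" for u w
 proof (cases "u <= w")
  case True
  then have "cmod (?R u w) <= C1 * (w - u) powr (2 * \<alpha>)" using uw by (intro C1(2)) auto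
  also have "... <= (C1 + C2) * (w - u) powr (2 * \<alpha>)" using C2(1) by (intro mult_right_mono) auto
  finally show ?thesis using True by simp
 next
  case False
  then have o: "s <= w" "w <= u" "u <= t" using uw by auto
  have eq: "?R u w = - ?R w u + (\<Sum>j<N. (b j u - b j w) *\<^sub>R (Y' j u - Y' j w))"
   by (simp add: sum_subtractf sum_negf sum.distrib algebra_simps)
  have "cmod (?R u w) <= cmod (?R w u) + cmod (\<Sum>j<N. (b j u - b j w) *\<^sub>R (Y' j u - Y' j w))"
   unfolding eq using norm_triangle_ineq[of "- ?R w u" "\<Sum>j<N. (b j u - b j w) *\<^sub>R (Y' j u - Y' j w)"] by (simp only: norm_minus_cancel)
  also have "... <= C1 * (u - w) powr (2 * \<alpha>) + C2 * (u - w) powr (\<alpha> + \<alpha>)" by (intro add_mono C1(2) C2(2) o)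
  also have "... = (C1 + C2) * \<bar>w - u\<bar> powr (2 * \<alpha>)" using False by (simp add: distrib_right abs_if)
  finally show ?thesis .
 qed
 then show ?thesis unfolding controlled_on_def using hbd_holder[OF Y] hbd_holder[OF Y'] by blast
qed

text \<open>Every term of the expansion has order at least \<alpha>. This supplies the Hoelder bound
  on \<open>Ip\<close> that \<open>nls_window\<close> demands.\<close>

lemma germ_path_holder:
 fixes f :: "real => real"
 assumes al: "0 < \<alpha>"
  and bh: "!!u w. s <= u ==> u <= w ==> w <= t ==> \<bar>b w - b u\<bar> <= K * (w - u) powr \<alpha>"
  and ah: "!!j u w. j < N ==> s <= u ==> u <= w ==> w <= t ==> \<bar>A j u w\<bar> <= K * (w - u) powr (2 * \<alpha>)"
  and ctl: "controlled_on {s..t} \<alpha> N bb g g'"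
  and ig: "!!u w. s <= u ==> u <= w ==> w <= t ==> \<bar>f w - f u - germ N b A g g' u w\<bar> <= K * (w - u) powr (3 * \<alpha>)"
 shows "holder_on {s..t} \<alpha> f"
proof -
 have g: "hbd s t \<alpha> (\<lambda>r. cplx (g r))" "j < N ==> hbd s t \<alpha> (\<lambda>r. cplx (g' j r))" for j
  using ctl al by (auto intro!: holder_hbd simp: controlled_on_def)
 have 1: "dbigo s t (3 * \<alpha>) (\<lambda>u w. cplx (f w - f u - germ N b A g g' u w))"
  by (rule dbigoI) (unfold norm_of_real, rule ig)
 have 2: "dbigo s t \<alpha> (\<lambda>u w. cplx (b w - b u))"
  by (rule dbigoI) (unfold norm_of_real, rule bh)
 have 3: "dbigo s t (2 * \<alpha>) (\<lambda>u w. cplx (A j u w))" if "j < N" for j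
  by (rule dbigoI) (unfold norm_of_real, rule ah[OF that])
 have "dbigo s t \<alpha> (\<lambda>u w. cplx (f w - f u - germ N b A g g' u w) + (cplx (g u) * cplx (b w - b u)
   + (\<Sum>j<N. cplx (g' j u) * cplx (A j u w))))"
  using al by (intro dbigo_add dbigo_weaken[OF 1] dbigo_bounded_mult[OF hbd_bounded[OF g(1)]] 2 dbigo_sum
   dbigo_bounded_mult[OF hbd_bounded[OF g(2)]] dbigo_weaken[OF 3]) auto
 then have "dbigo s t \<alpha> (\<lambda>u w. cplx (f w) - cplx (f u))"
  by (rule dbigo_cong) (simp add: germ_def mult.commute)
 then have "holder_on {s..t} \<alpha> (\<lambda>r. cplx (f r))" by (rule dbigo_holder)
 then show ?thesis unfolding holder_on_def of_real_diff[symmetric] norm_of_real by simp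
qed

text \<open>The almost sure facts as deterministic estimates with one constant K: A is the second
  level, \<open>sym\<close> contains its Ito correction, and \<open>igerm\<close> says that
  \<open>Ip k\<close> is locally the compensated sum of g_k up to order 3\<alpha>.\<close>

locale rough_window = nls_window N p \<alpha> H s t \<phi> Ip I v
 for N p \<alpha> H s t and \<phi> :: "nat => 'a::euclidean_space => real" and Ip I v +
 fixes b :: "nat => real => real" and A :: "nat => nat => real => real => real"
  and g :: "nat => real => real" and g' :: "nat => nat => real => real" and K :: real
 assumes al3: "1 / 3 < \<alpha>" and K0: "K >= 0"
  and bh: "!!k u w. k < N ==> s <= u ==> u <= w ==> w <= t ==> \<bar>b k w - b k u\<bar> <= K * (w - u) powr \<alpha>"
  and ah: "!!j k u w. j < N ==> k < N ==> s <= u ==> u <= w ==> w <= t ==> \<bar>A j k u w\<bar> <= K * (w - u) powr (2 * \<alpha>)"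
  and chen: "!!j k u m w. j < N ==> k < N ==> A j k u w = A j k u m + A j k m w + (b j m - b j u) * (b k w - b k m)"
  and sym: "!!j k u w. j < N ==> k < N ==> s <= u ==> u <= w ==> w <= t ==>
    A j k u w + A k j u w = (b j w - b j u) * (b k w - b k u) - (if j = k then w - u else 0)"
  and ctl: "!!k. k < N ==> controlled_on {s..t} \<alpha> N b (g k) (g' k)"
  and igerm: "!!k u w. k < N ==> s <= u ==> u <= w ==> w <= t ==>
    \<bar>Ip k w - Ip k u - germ N (b k) (\<lambda>j. A j k) (g k) (g' k) u w\<bar> <= K * (w - u) powr (3 * \<alpha>)"
begin

abbreviation "Ob \<equiv> dbigo s t"
abbreviation "Hb \<equiv> hbd s t \<alpha>"
abbreviation "dB k u w \<equiv> cplx (b k w - b k u)"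
abbreviation "AA j k u w \<equiv> cplx (A j k u w)"
abbreviation "gc k u \<equiv> cplx (g k u)"
abbreviation "gd k j u \<equiv> cplx (g' k j u)"

lemma test_fn1: "test_fn \<psi> ==> k < N ==> test_fn (\<lambda>x. cplx (\<phi> k x) * \<psi> x)"
 by (rule test_fn_mult) (auto intro: smcl.of_real phi_smooth)

lemma F1_F1: "F1 (\<lambda>x. cplx (\<phi> k x) * \<psi> x) j = F2 \<psi> j k"
 by (simp add: mult.assoc)

lemma test_fn2: "test_fn \<psi> ==> j < N ==> k < N ==> test_fn (\<lambda>x. cplx (\<phi> j x * \<phi> k x) * \<psi> x)"
 using test_fn1[OF test_fn1, of \<psi> k j] by (simp add: mult.assoc)

lemma F2_sym: "F2 \<psi> j k = F2 \<psi> k j"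
 by (simp add: mult.commute)

lemma O_dI: "k < N ==> Ob \<alpha> (dI k)"
proof (rule dbigoI)
 fix u w assume "k < N" "s <= u" "u <= w" "w <= t"
 then show "cmod (dI k u w) <= H * (w - u) powr \<alpha>" unfolding norm_of_real using hol[of k u w] by simp
qed

lemma O_dB: "k < N ==> Ob \<alpha> (dB k)"
 by (rule dbigoI) (unfold norm_of_real, rule bh)

lemma O_AA: "j < N ==> k < N ==> Ob (2 * \<alpha>) (AA j k)"
 by (rule dbigoI) (unfold norm_of_real, rule ah)

lemma Hb_g: "k < N ==> Hb (gc k)"
 using ctl[of k] al by (intro holder_hbd) (auto simp: controlled_on_def)

lemma Hb_gd: "k < N ==> j < N ==> Hb (gd k j)"
 using ctl[of k] al by (intro holder_hbd) (auto simp: controlled_on_def)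

lemma O_I3: "k < N ==> Ob (3 * \<alpha>) (\<lambda>u w. dI k u w - gc k u * dB k u w - (\<Sum>j<N. gd k j u * AA j k u w))"
proof (rule dbigoI)
 fix u w assume o: "k < N" "s <= u" "u <= w" "w <= t"
 have "dI k u w - gc k u * dB k u w - (\<Sum>j<N. gd k j u * AA j k u w) =
   cplx (Ip k w - Ip k u - germ N (b k) (\<lambda>j. A j k) (g k) (g' k) u w)"
  unfolding germ_def by (simp add: mult.commute)
 then show "cmod (dI k u w - gc k u * dB k u w - (\<Sum>j<N. gd k j u * AA j k u w)) <= K * (w - u) powr (3 * \<alpha>)"
  using igerm[OF o] by (simp only: norm_of_real)
qed

lemma O_I2:
 assumes k: "k < N"
 shows "Ob (2 * \<alpha>) (\<lambda>u w. dI k u w - gc k u * dB k u w)"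
proof -
 have "Ob (2 * \<alpha>) (\<lambda>u w. (dI k u w - gc k u * dB k u w - (\<Sum>j<N. gd k j u * AA j k u w)) + (\<Sum>j<N. gd k j u * AA j k u w))"
  using al k by (intro dbigo_add dbigo_weaken[OF O_I3[OF k]] dbigo_sum dbigo_bounded_mult[OF hbd_bounded[OF Hb_gd]] O_AA) auto
 then show ?thesis by simp
qed

lemma FF_bd: "test_fn \<psi> ==> \<exists>M. \<forall>r\<in>{s..t}. cmod (FF \<psi> r) <= M"
 using FF_bound by metis

lemma O_NL:
 assumes "test_fn \<psi>"
 shows "Ob 1 (\<lambda>u w. sint u w (NL \<psi>))"
proof -
 obtain C where C: "!!r. r \<in> {s..t} ==> cmod (NL \<psi> r) <= C" using NL_lipschitz[OF assms] by metis
 show ?thesis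
 proof (rule dbigoI)
  fix u w assume o: "s <= u" "u <= w" "w <= t"
  have "set_integrable lborel {u..w} (NL \<psi>)"
   by (rule set_integrable_subset[OF NL_integrable[OF assms]]) (use o in auto)
  then have "cmod (sint u w (NL \<psi>)) <= C * (w - u)"
   by (rule set_integral_norm_le_const) (use C o in auto)
  then show "cmod (sint u w (NL \<psi>)) <= C * (w - u) powr 1" using o by simp
 qed
qed

lemma O_FF3:
 assumes "test_fn \<psi>"
 shows "Ob (3 * \<alpha>) (remainder \<psi>)"
 unfolding dbigo_def by (rule FF_expansion[OF assms])

text \<open>First order truncation of the expansion: F is controlled by B with derivative \<i> g_k
  <\<phi>_k X, \<psi>>. The drift has order 1 > 2\<alpha>, and products of two increments of
  \<open>Ip\<close> already have order 2\<alpha>.\<close>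

lemma O_FF2:
 assumes \<psi>: "test_fn \<psi>"
 shows "Ob (2 * \<alpha>) (\<lambda>u w. FF \<psi> w - FF \<psi> u - \<i> * (\<Sum>k<N. gc k u * dB k u w * F1 \<psi> k u))"
proof -
 have q: "Ob (2 * \<alpha>) (\<lambda>u w. (\<Sum>j<N. \<Sum>k<N. F2 \<psi> j k u * (dI j u w * dI k u w)))"
 proof (intro dbigo_sum dbigo_bounded_mult FF_bd test_fn2[OF \<psi>])
  fix j k assume "j \<in> {..<N}" "k \<in> {..<N}"
  then show "Ob (2 * \<alpha>) (\<lambda>u w. dI j u w * dI k u w)"
   using dbigo_mult[OF O_dI[of j] O_dI[of k]] by (simp only: lessThan_iff mult_2)
 qed auto
 have "Ob (2 * \<alpha>) (\<lambda>u w. remainder \<psi> u w + (sint u w (NL \<psi>)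
   + \<i> * (\<Sum>k<N. F1 \<psi> k u * (dI k u w - gc k u * dB k u w)) - (1 / 2) * (\<Sum>j<N. \<Sum>k<N. F2 \<psi> j k u * (dI j u w * dI k u w))))"
  using al by (intro dbigo_add dbigo_diff dbigo_cmult q dbigo_weaken[OF O_FF3[OF \<psi>]] dbigo_weaken[OF O_NL[OF \<psi>]]
    dbigo_sum dbigo_bounded_mult FF_bd test_fn1[OF \<psi>] O_I2) auto
 then show ?thesis
 proof (rule dbigo_cong)
  fix u w
  have "(\<Sum>j<N. \<Sum>k<N. cplx ((Ip j w - Ip j u) * (Ip k w - Ip k u)) * F2 \<psi> j k u) = (\<Sum>j<N. \<Sum>k<N. F2 \<psi> j k u * (dI j u w * dI k u w))"
   by (intro sum.cong refl) (simp only: of_real_mult mult_ac)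
  moreover have "(\<Sum>k<N. F1 \<psi> k u * (dI k u w - gc k u * dB k u w)) = (\<Sum>k<N. dI k u w * F1 \<psi> k u) - (\<Sum>k<N. gc k u * dB k u w * F1 \<psi> k u)"
   unfolding sum_subtractf[symmetric] by (intro sum.cong refl) (simp only: right_diff_distrib mult_ac)
  ultimately show "FF \<psi> w - FF \<psi> u - \<i> * (\<Sum>k<N. gc k u * dB k u w * F1 \<psi> k u) = remainder \<psi> u w + (sint u w (NL \<psi>)
   + \<i> * (\<Sum>k<N. F1 \<psi> k u * (dI k u w - gc k u * dB k u w)) - (1 / 2) * (\<Sum>j<N. \<Sum>k<N. F2 \<psi> j k u * (dI j u w * dI k u w)))"
   by (simp only: right_diff_distrib) simp
 qed
qed

lemma Hb_FF:
 assumes \<psi>: "test_fn \<psi>"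
 shows "Hb (FF \<psi>)"
 unfolding hbd_def
proof
 show "\<exists>M. \<forall>r\<in>{s..t}. cmod (FF \<psi> r) <= M" by (rule FF_bd[OF \<psi>])
 have "Ob \<alpha> (\<lambda>u w. (FF \<psi> w - FF \<psi> u - \<i> * (\<Sum>k<N. gc k u * dB k u w * F1 \<psi> k u)) + \<i> * (\<Sum>k<N. F1 \<psi> k u * (gc k u * dB k u w)))"
  using al by (intro dbigo_add dbigo_weaken[OF O_FF2[OF \<psi>]] dbigo_cmult dbigo_sum dbigo_bounded_mult[OF FF_bd]
   dbigo_bounded_mult[OF hbd_bounded[OF Hb_g]] test_fn1[OF \<psi>] O_dB) auto
 then show "Ob \<alpha> (\<lambda>u w. FF \<psi> w - FF \<psi> u)"
 proof (rule dbigo_cong)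
  fix u w
  have "(\<Sum>k<N. F1 \<psi> k u * (gc k u * dB k u w)) = (\<Sum>k<N. gc k u * dB k u w * F1 \<psi> k u)" by (intro sum.cong refl) (simp only: mult_ac)
  then show "FF \<psi> w - FF \<psi> u = (FF \<psi> w - FF \<psi> u - \<i> * (\<Sum>k<N. gc k u * dB k u w * F1 \<psi> k u)) + \<i> * (\<Sum>k<N. F1 \<psi> k u * (gc k u * dB k u w))"
   by simp
 qed
qed

text \<open>The rough integrand with g_k pulled out as a scalar and \<phi>_k moved into the test
  function, so that everything is expressed by F for modified test functions.\<close>

definition Yf :: "('a => complex) => nat => real => complex" where
 "Yf \<psi> k r = \<i> * (gc k r * F1 \<psi> k r)"

text \<open>The Gubinelli derivative of \<open>Yf \<psi> k\<close> in direction j. The factor -1 is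
  \<i>^2, one \<i> from the integrand and one from the equation for X.\<close>

definition Yd :: "('a => complex) => nat => nat => real => complex" where
 "Yd \<psi> k j r = (- 1) * (gc j r * (gc k r * F2 \<psi> j k r)) + \<i> * (gd k j r * F1 \<psi> k r)"

lemma Hb_Yf: "test_fn \<psi> ==> k < N ==> Hb (Yf \<psi> k)"
 unfolding Yf_def[abs_def] using al(1) by (intro hbd_mult hbd_const Hb_g Hb_FF test_fn1) auto

lemma Hb_Yd: "test_fn \<psi> ==> k < N ==> j < N ==> Hb (Yd \<psi> k j)"
 unfolding Yd_def[abs_def] using al(1) by (intro hbd_add hbd_mult hbd_const Hb_g Hb_gd Hb_FF test_fn1 test_fn2) auto

lemma O_g:
 assumes "k < N"
 shows "Ob (2 * \<alpha>) (\<lambda>u w. gc k w - gc k u - (\<Sum>j<N. dB j u w * gd k j u))"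
proof -
 obtain C where C: "\<forall>u\<in>{s..t}. \<forall>w\<in>{s..t}. norm (g k w - g k u - (\<Sum>j<N. (b j w - b j u) *\<^sub>R g' k j u)) <= C * \<bar>w - u\<bar> powr (2 * \<alpha>)"
  using ctl[OF assms] unfolding controlled_on_def by blast
 show ?thesis
 proof (rule dbigoI)
  fix u w assume o: "s <= u" "u <= w" "w <= t"
  have "gc k w - gc k u - (\<Sum>j<N. dB j u w * gd k j u) = cplx (g k w - g k u - (\<Sum>j<N. (b j w - b j u) *\<^sub>R g' k j u))"
   by simp
  moreover have "\<bar>g k w - g k u - (\<Sum>j<N. (b j w - b j u) *\<^sub>R g' k j u)\<bar> <= C * (w - u) powr (2 * \<alpha>)"
   using C[rule_format, of u w] o by auto
  ultimately show "cmod (gc k w - gc k u - (\<Sum>j<N. dB j u w * gd k j u)) <= C * (w - u) powr (2 * \<alpha>)"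
   by (simp only: norm_of_real)
 qed
qed

text \<open>Leibniz rule for controlled paths: the remainder consists of that of g_k, that of F for
  the test function \<phi>_k \<psi>, and the product of the two increments, each of order
  2\<alpha>.\<close>

lemma controlled_Y:
 assumes \<psi>: "test_fn \<psi>" and k: "k < N"
 shows "controlled_on {s..t} \<alpha> N b (Yf \<psi> k) (Yd \<psi> k)"
proof (rule controlled_onI[OF Hb_Yf[OF \<psi> k] Hb_Yd[OF \<psi> k] O_dB])
 note t1 = test_fn1[OF \<psi> k]
 have "Ob (2 * \<alpha>) (\<lambda>u w. \<i> * (F1 \<psi> k u * (gc k w - gc k u - (\<Sum>j<N. dB j u w * gd k j u)))
   + (\<i> * (gc k u * (F1 \<psi> k w - F1 \<psi> k u - \<i> * (\<Sum>j<N. gc j u * dB j u w * F2 \<psi> j k u)))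
   + \<i> * ((gc k w - gc k u) * (F1 \<psi> k w - F1 \<psi> k u))))"
  using al(1) k O_FF2[OF t1, unfolded F1_F1] dbigo_mult[OF hbd_dbigo[OF Hb_g[OF k]] hbd_dbigo[OF Hb_FF[OF t1]]]
  by (intro dbigo_add dbigo_cmult dbigo_bounded_mult[OF FF_bd[OF t1]] dbigo_bounded_mult[OF hbd_bounded[OF Hb_g[OF k]]] O_g)
   (simp_all only: mult_2)
 then show "Ob (2 * \<alpha>) (\<lambda>u w. Yf \<psi> k w - Yf \<psi> k u - (\<Sum>j<N. dB j u w * Yd \<psi> k j u))"
 proof (rule dbigo_cong)
  fix u w
  let ?S1 = "\<Sum>j<N. dB j u w * gd k j u" and ?S2 = "\<Sum>j<N. gc j u * dB j u w * F2 \<psi> j k u"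
  have "(\<Sum>j<N. dB j u w * Yd \<psi> k j u) = - (gc k u * ?S2) + \<i> * (F1 \<psi> k u * ?S1)"
   unfolding Yd_def sum_distrib_left sum_negf[symmetric] sum.distrib[symmetric]
   by (intro sum.cong refl) (simp add: algebra_simps)
  then show "Yf \<psi> k w - Yf \<psi> k u - (\<Sum>j<N. dB j u w * Yd \<psi> k j u) = \<i> * (F1 \<psi> k u * (gc k w - gc k u - ?S1))
   + (\<i> * (gc k u * (F1 \<psi> k w - F1 \<psi> k u - \<i> * ?S2)) + \<i> * ((gc k w - gc k u) * (F1 \<psi> k w - F1 \<psi> k u)))"
   unfolding Yf_def by (simp only:) (simp add: algebra_simps)
 qed
qed

text \<open>The pairing of \<mu> X with \<psi>, as \<open>pair_mu\<close> confirms.\<close>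

definition mm :: "('a => complex) => real => complex" where
 "mm \<psi> r = 1 / 2 * (\<Sum>k<N. gc k r * (gc k r * F2 \<psi> k k r))"

lemma Hb_mm: "test_fn \<psi> ==> Hb (mm \<psi>)"
 unfolding mm_def[abs_def] using al(1) by (intro hbd_mult hbd_sum hbd_const Hb_g Hb_FF test_fn2) auto

lemma mm_integrable:
 assumes "test_fn \<psi>"
 shows "set_integrable lborel {s..t} (mm \<psi>)"
 by (rule borel_integrable_atLeastAtMost'[OF holder_on_continuous[OF hbd_holder[OF Hb_mm[OF assms]] al(1)]])

text \<open>Freezing an \<alpha>-Hoelder integrand at u costs O((w-u)^(1+\<alpha>)), and 1 +
  \<alpha> > 3\<alpha>.\<close>

lemma O_mm:
 assumes \<psi>: "test_fn \<psi>"
 shows "Ob (3 * \<alpha>) (\<lambda>u w. sint u w (mm \<psi>) - cplx (w - u) * mm \<psi> u)"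
proof -
 obtain C where C: "C >= 0" "!!u w. s <= u ==> u <= w ==> w <= t ==> cmod (mm \<psi> w - mm \<psi> u) <= C * (w - u) powr \<alpha>"
  using hbd_dbigo[OF Hb_mm[OF \<psi>]] unfolding dbigo_def by blast
 have "Ob (\<alpha> + 1) (\<lambda>u w. sint u w (mm \<psi>) - cplx (w - u) * mm \<psi> u)"
 proof (rule dbigoI)
  fix u w assume o: "s <= u" "u <= w" "w <= t"
  have i: "set_integrable lborel {u..w} (mm \<psi>)"
   by (rule set_integrable_subset[OF mm_integrable[OF \<psi>]]) (use o in auto)
  have ic: "set_integrable lborel {u..w} (\<lambda>r. mm \<psi> u)"
   by (rule borel_integrable_atLeastAtMost') simp
  have "sint u w (\<lambda>r. mm \<psi> u) = cplx (w - u) * mm \<psi> u"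
   unfolding set_lebesgue_integral_def using o by (simp add: scaleR_conv_of_real)
  then have "sint u w (mm \<psi>) - cplx (w - u) * mm \<psi> u = sint u w (\<lambda>r. mm \<psi> r - mm \<psi> u)"
   using set_integral_diff(2)[OF i ic] by simp
  moreover have "cmod (sint u w (\<lambda>r. mm \<psi> r - mm \<psi> u)) <= (C * (w - u) powr \<alpha>) * (w - u)"
  proof (rule set_integral_norm_le_const[OF set_integral_diff(1)[OF i ic]])
   fix r assume r: "r \<in> {u..w}"
   have "cmod (mm \<psi> r - mm \<psi> u) <= C * (r - u) powr \<alpha>" by (rule C(2)) (use r o in auto)
   also have "... <= C * (w - u) powr \<alpha>" using r al C(1) by (intro mult_left_mono powr_mono2) auto
   finally show "cmod (mm \<psi> r - mm \<psi> u) <= C * (w - u) powr \<alpha>" .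
  qed (use o in simp)
  ultimately show "cmod (sint u w (mm \<psi>) - cplx (w - u) * mm \<psi> u) <= C * (w - u) powr (\<alpha> + 1)"
   using o by (simp add: powr_add mult.assoc)
 qed
 then show ?thesis by (rule dbigo_weaken) (use al in simp)
qed

text \<open>Against symmetric coefficients only the symmetric part of the second level counts, and
  \<open>sym\<close> expresses it by products of increments and a diagonal term in w - u.\<close>

lemma sum_double_sym:
 fixes c :: "nat => nat => complex"
 assumes c: "!!j k. c j k = c k j" and o: "s <= u" "u <= w" "w <= t"
 shows "(\<Sum>j<N. \<Sum>k<N. AA j k u w * c j k) =
  1 / 2 * (\<Sum>j<N. \<Sum>k<N. dB j u w * dB k u w * c j k) - cplx (w - u) * (1 / 2 * (\<Sum>k<N. c k k))"
proof -
 have half: "x = y / 2" if "2 * x = y" for x y :: complex using that by auto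
 have swap: "(\<Sum>j<N. \<Sum>k<N. AA j k u w * c j k) = (\<Sum>j<N. \<Sum>k<N. AA k j u w * c j k)"
  by (subst sum.swap) (simp add: c)
 have "(\<Sum>j<N. \<Sum>k<N. AA j k u w * c j k) + (\<Sum>j<N. \<Sum>k<N. AA k j u w * c j k)
   = (\<Sum>j<N. \<Sum>k<N. dB j u w * dB k u w * c j k - (if j = k then cplx (w - u) * c j k else 0))"
  unfolding sum.distrib[symmetric]
 proof (intro sum.cong refl)
  fix j k assume "j \<in> {..<N}" "k \<in> {..<N}"
  then have "AA j k u w + AA k j u w = dB j u w * dB k u w - cplx (if j = k then w - u else 0)"
   using sym[of j k u w] o by (simp only: lessThan_iff of_real_add[symmetric] of_real_mult[symmetric] of_real_diff[symmetric])
  then show "AA j k u w * c j k + AA k j u w * c j k = dB j u w * dB k u w * c j k - (if j = k then cplx (w - u) * c j k else 0)"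
   by (simp only: distrib_right[symmetric]) (simp add: left_diff_distrib)
 qed
 also have "... = (\<Sum>j<N. \<Sum>k<N. dB j u w * dB k u w * c j k) - (\<Sum>j<N. cplx (w - u) * c j j)"
  unfolding sum_subtractf by (simp add: sum.delta')
 also have "(\<Sum>j<N. cplx (w - u) * c j j) = cplx (w - u) * (\<Sum>j<N. c j j)" by (simp only: sum_distrib_left)
 finally have "2 * (\<Sum>j<N. \<Sum>k<N. AA j k u w * c j k) = (\<Sum>j<N. \<Sum>k<N. dB j u w * dB k u w * c j k) - cplx (w - u) * (\<Sum>j<N. c j j)"
  unfolding swap[symmetric] by (simp only: mult_2)
 then have "(\<Sum>j<N. \<Sum>k<N. AA j k u w * c j k) = ((\<Sum>j<N. \<Sum>k<N. dB j u w * dB k u w * c j k) - cplx (w - u) * (\<Sum>j<N. c j j)) / 2"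
  by (rule half)
 then show ?thesis by (simp only: diff_divide_distrib) simp
qed

text \<open>The error collects four terms of order 3\<alpha>: the Taylor remainder of F, the
  expansion of \<open>Ip\<close> in the linear term, its first order replacement in the quadratic
  term, and the freezing of \<open>mm\<close>.\<close>

lemma O_main:
 assumes \<psi>: "test_fn \<psi>"
 shows "Ob (3 * \<alpha>) (\<lambda>u w. FF \<psi> w - FF \<psi> u - (sint u w (NL \<psi>) - sint u w (mm \<psi>))
   - (\<Sum>k<N. germ N (b k) (\<lambda>j. A j k) (Yf \<psi> k) (Yd \<psi> k) u w))"
proof -
 let ?I3 = "\<lambda>k u w. dI k u w - gc k u * dB k u w - (\<Sum>j<N. gd k j u * AA j k u w)"
 \<comment> \<open>dI_j dI_k - g_j g_k dB_j dB_k, telescoped so that each product has one factor of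
   order \<alpha> and one of order 2\<alpha>.\<close>
 let ?Q = "\<lambda>j k u w. dI j u w * (dI k u w - gc k u * dB k u w) + gc k u * (dB k u w * (dI j u w - gc j u * dB j u w))"
 have q: "Ob (3 * \<alpha>) (\<lambda>u w. (\<Sum>j<N. \<Sum>k<N. F2 \<psi> j k u * ?Q j k u w))"
 proof (intro dbigo_sum dbigo_bounded_mult[OF FF_bd] test_fn2[OF \<psi>])
  fix j k assume "j \<in> {..<N}" "k \<in> {..<N}"
  then have jk: "j < N" "k < N" by auto
  have e: "\<alpha> + 2 * \<alpha> = 3 * \<alpha>" by simp
  show "Ob (3 * \<alpha>) (?Q j k)"
   unfolding e[symmetric]
   by (intro dbigo_add dbigo_bounded_mult[OF hbd_bounded[OF Hb_g[OF jk(2)]]] dbigo_mult O_dI O_dB O_I2 jk)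
 qed auto
 have "Ob (3 * \<alpha>) (\<lambda>u w. remainder \<psi> u w + (\<i> * (\<Sum>k<N. F1 \<psi> k u * ?I3 k u w) - (1 / 2) * (\<Sum>j<N. \<Sum>k<N. F2 \<psi> j k u * ?Q j k u w))
   + (sint u w (mm \<psi>) - cplx (w - u) * mm \<psi> u))"
  by (intro dbigo_add[OF dbigo_add[OF O_FF3[OF \<psi>] dbigo_diff] O_mm[OF \<psi>]] dbigo_cmult q dbigo_sum dbigo_bounded_mult[OF FF_bd] test_fn1[OF \<psi>] O_I3) auto
 then show ?thesis
 proof (rule dbigo_cong)
  fix u w assume o: "s <= u" "u <= w" "w <= t"
  let ?S1 = "\<Sum>k<N. gc k u * dB k u w * F1 \<psi> k u" and ?S2 = "\<Sum>k<N. \<Sum>j<N. gd k j u * AA j k u w * F1 \<psi> k u"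
  let ?S3 = "\<Sum>j<N. \<Sum>k<N. AA j k u w * (gc j u * (gc k u * F2 \<psi> j k u))"
  let ?T = "\<Sum>k<N. dI k u w * F1 \<psi> k u"
  let ?S4 = "\<Sum>j<N. \<Sum>k<N. cplx ((Ip j w - Ip j u) * (Ip k w - Ip k u)) * F2 \<psi> j k u"
  let ?S5 = "\<Sum>j<N. \<Sum>k<N. dB j u w * dB k u w * (gc j u * (gc k u * F2 \<psi> j k u))"
  have 1: "(\<Sum>k<N. F1 \<psi> k u * ?I3 k u w) = ?T - ?S1 - ?S2"
   unfolding sum_subtractf[symmetric]
   by (intro sum.cong refl) (simp add: right_diff_distrib sum_distrib_left mult_ac)
  have 2: "(\<Sum>j<N. \<Sum>k<N. F2 \<psi> j k u * ?Q j k u w) = ?S4 - ?S5"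
   unfolding sum_subtractf[symmetric]
   by (intro sum.cong refl) (simp add: algebra_simps)
  have 3: "(\<Sum>k<N. germ N (b k) (\<lambda>j. A j k) (Yf \<psi> k) (Yd \<psi> k) u w) = \<i> * ?S1 + (\<i> * ?S2 - ?S3)"
  proof -
   have "germ N (b k) (\<lambda>j. A j k) (Yf \<psi> k) (Yd \<psi> k) u w = \<i> * (gc k u * dB k u w * F1 \<psi> k u)
     + (\<i> * (\<Sum>j<N. gd k j u * AA j k u w * F1 \<psi> k u) - (\<Sum>j<N. AA j k u w * (gc j u * (gc k u * F2 \<psi> j k u))))" for k
   proof -
    have "(\<Sum>j<N. AA j k u w * Yd \<psi> k j u) = \<i> * (\<Sum>j<N. gd k j u * AA j k u w * F1 \<psi> k u) - (\<Sum>j<N. AA j k u w * (gc j u * (gc k u * F2 \<psi> j k u)))"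
     unfolding sum_distrib_left sum_subtractf[symmetric]
     by (intro sum.cong refl) (simp add: Yd_def algebra_simps)
    then show ?thesis unfolding germ_def scaleR_conv_of_real by (simp only: Yf_def mult_ac)
   qed
   then have "(\<Sum>k<N. germ N (b k) (\<lambda>j. A j k) (Yf \<psi> k) (Yd \<psi> k) u w) = \<i> * ?S1 + (\<i> * ?S2 - (\<Sum>k<N. \<Sum>j<N. AA j k u w * (gc j u * (gc k u * F2 \<psi> j k u))))"
    by (simp only: sum.distrib sum_subtractf sum_distrib_left)
   also have "(\<Sum>k<N. \<Sum>j<N. AA j k u w * (gc j u * (gc k u * F2 \<psi> j k u))) = ?S3" by (rule sum.swap)
   finally show ?thesis .
  qed
  have 4: "?S3 = 1 / 2 * ?S5 - cplx (w - u) * mm \<psi> u"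
   unfolding mm_def by (rule sum_double_sym[OF _ o]) (simp only: F2_sym mult.left_commute)
  show "FF \<psi> w - FF \<psi> u - (sint u w (NL \<psi>) - sint u w (mm \<psi>))
   - (\<Sum>k<N. germ N (b k) (\<lambda>j. A j k) (Yf \<psi> k) (Yd \<psi> k) u w) =
   remainder \<psi> u w + (\<i> * (\<Sum>k<N. F1 \<psi> k u * ?I3 k u w) - (1 / 2) * (\<Sum>j<N. \<Sum>k<N. F2 \<psi> j k u * ?Q j k u w))
   + (sint u w (mm \<psi>) - cplx (w - u) * mm \<psi> u)"
  proof -
   have alg: "Fw - Fu - (Ln - Lm) - (ii * S1 + (ii * S2 - (1 / 2 * S5 - M))) =
    (Fw - Fu - Ln - ii * T + S4 / 2) + (ii * (T - S1 - S2) - 1 / 2 * (S4 - S5)) + (Lm - M)"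
    for Fw Fu Ln Lm ii S1 S2 S5 M T S4 :: complex by (simp add: field_simps)
   show ?thesis unfolding 1 2 3 4 by (rule alg)
  qed
 qed
qed

lemma rough_identity:
 assumes \<psi>: "test_fn \<psi>"
 shows "\<exists>L. (\<forall>k<N. mesh_lim s t (germ N (b k) (\<lambda>j. A j k) (Yf \<psi> k) (Yd \<psi> k)) (L k)) \<and>
  FF \<psi> t - FF \<psi> s - sint s t (\<lambda>r. NL \<psi> r - mm \<psi> r) = (\<Sum>k<N. L k)"
proof -
 let ?G = "\<lambda>k. germ N (b k) (\<lambda>j. A j k) (Yf \<psi> k) (Yd \<psi> k)"
 have th: "3 * \<alpha> > 1" using al3 by simp
 have "\<exists>L C. \<forall>u w. s <= u \<and> u <= w \<and> w <= t --> cmod (L w - L u - ?G k u w) <= C * (w - u) powr (3 * \<alpha>)" if k: "k < N" for k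
  by (rule controlled_sewing[OF al3 controlled_Y[OF \<psi> k] k K0]) (use bh ah chen k in auto)
 then have "\<forall>k. \<exists>L C. k < N --> (\<forall>u w. s <= u \<and> u <= w \<and> w <= t --> cmod (L w - L u - ?G k u w) <= C * (w - u) powr (3 * \<alpha>))"
  by blast
 then obtain L C where L: "!!k u w. k < N ==> s <= u ==> u <= w ==> w <= t ==> cmod (L k w - L k u - ?G k u w) <= C k * (w - u) powr (3 * \<alpha>)"
  by metis
 have O_L: "Ob (3 * \<alpha>) (\<lambda>u w. L k w - L k u - ?G k u w)" if "k < N" for k
  by (rule dbigoI) (rule L[OF that])
 let ?D = "\<lambda>r. NL \<psi> r - mm \<psi> r"
 have Di: "set_integrable lborel {s..t} ?D" by (rule set_integral_diff(1)[OF NL_integrable[OF \<psi>] mm_integrable[OF \<psi>]])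
 define J where "J w = sint s w ?D" for w
 have sub: "set_integrable lborel {u..w} f" if "set_integrable lborel {s..t} f" "s <= u" "w <= t" for u w and f :: "real => complex"
  by (rule set_integrable_subset[OF that(1)]) (use that in auto)
 have J: "J w - J u = sint u w ?D" if o: "s <= u" "u <= w" "w <= t" for u w
 proof -
  have hk: "sint x y ?D = integral {x..y} ?D" "?D integrable_on {x..y}" if "s <= x" "y <= t" for x y
   using set_borel_integral_eq_integral[OF sub[OF Di that]] by auto
  have "integral {s..u} ?D + integral {u..w} ?D = integral {s..w} ?D"
   by (rule Henstock_Kurzweil_Integration.integral_combine) (use o hk(2) in auto)
  then show ?thesis unfolding J_def using hk(1) o by (simp add: algebra_simps)
 qed
 define R where "R w = FF \<psi> w - J w - (\<Sum>k<N. L k w)" for w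
 have "Ob (3 * \<alpha>) (\<lambda>u w. (FF \<psi> w - FF \<psi> u - (sint u w (NL \<psi>) - sint u w (mm \<psi>))
   - (\<Sum>k<N. ?G k u w)) - (\<Sum>k<N. L k w - L k u - ?G k u w))"
  by (intro dbigo_diff O_main[OF \<psi>] dbigo_sum O_L) auto
 then have "Ob (3 * \<alpha>) (\<lambda>u w. R w - R u)"
 proof (rule dbigo_cong)
  fix u w assume o: "s <= u" "u <= w" "w <= t"
  have "J w - J u = sint u w (NL \<psi>) - sint u w (mm \<psi>)"
   unfolding J[OF o] by (rule set_integral_diff(2)[OF sub[OF NL_integrable[OF \<psi>] o(1,3)] sub[OF mm_integrable[OF \<psi>] o(1,3)]])
  then show "R w - R u = (FF \<psi> w - FF \<psi> u - (sint u w (NL \<psi>) - sint u w (mm \<psi>))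
   - (\<Sum>k<N. ?G k u w)) - (\<Sum>k<N. L k w - L k u - ?G k u w)"
   unfolding R_def sum_subtractf by (simp add: algebra_simps)
 qed
 then obtain C' where C': "!!u w. s <= u ==> u <= w ==> w <= t ==> cmod (R w - R u) <= C' * (w - u) powr (3 * \<alpha>)"
  unfolding dbigo_def by blast
 \<comment> \<open>Both \<open>R t - R s\<close> and 0 are limits of the zero germ, the former
   because the increments of R have order above 1; uniqueness of limits identifies them.\<close>
 have "mesh_lim s t (\<lambda>_ _. 0) (R t - R s)"
  by (rule mesh_lim_of_germ[OF th, where K = C']) (use C' in auto)
 moreover have "mesh_lim s t (\<lambda>_ _. 0) (0 :: complex)"
  unfolding mesh_lim_def psum_def by (auto intro: exI[of _ 1])
 ultimately have "R t - R s = 0" using mesh_lim_unique st(1) by blast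
 moreover have "J s = 0" using J[of s s] st(1) unfolding J_def by simp
 ultimately have "FF \<psi> t - FF \<psi> s - J t = (\<Sum>k<N. L k t - L k s)"
  unfolding R_def sum_subtractf by (simp add: algebra_simps)
 moreover have "mesh_lim s t (?G k) (L k t - L k s)" if "k < N" for k
  by (rule mesh_lim_of_germ[OF th, where K = "C k"]) (use L[OF that] in auto)
 ultimately show ?thesis unfolding J_def by (intro exI[of _ "\<lambda>k. L k t - L k s"]) auto
qed

end

section \<open>From windows to the random interval\<close>

lemma controlled_on_cong:
 assumes "controlled_on S \<alpha> N b Y Y'" "!!r. r \<in> S ==> Z r = Y r" "!!j r. j < N ==> r \<in> S ==> Z' j r = Y' j r"
 shows "controlled_on S \<alpha> N b Z Z'"
proof -
 have "(\<Sum>j<N. (b j v - b j u) *\<^sub>R Z' j u) = (\<Sum>j<N. (b j v - b j u) *\<^sub>R Y' j u)" if "u \<in> S" for u v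
  using assms(3) that by (intro sum.cong) auto
 then show ?thesis
  using assms unfolding controlled_on_def holder_on_def by simp
qed

lemma mesh_lim_cong:
 assumes "mesh_lim s t X L" "!!u w. s <= u ==> u < w ==> w <= t ==> Z u w = X u w"
 shows "mesh_lim s t Z L"
proof -
 have "psum P Z = psum P X" if P: "partition_of P s t" for P
 proof (rule psum_cong)
  show "finite P" using P by (simp add: partition_of_def)
  show "Z u w = X u w" if "(u, w) \<in> gaps P" for u w
   using partition_gapsD[OF P that] by (intro assms(2))
 qed
 then show ?thesis using assms(1) unfolding mesh_lim_def by auto
qed

context rough_window
begin

lemma pair_cmult: "pair (\<lambda>x. c * f x) \<psi> = c * pair f \<psi>"
 by (simp add: pair_def mult.assoc)

lemma pair_phi: "pair (\<lambda>x. cplx (\<phi> k x) * X r x) \<psi> = F1 \<psi> k r"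
 by (simp add: pair_def FF_def mult_ac)

lemma pair_phi2: "pair (\<lambda>x. cplx (\<phi> j x * \<phi> k x) * X r x) \<psi> = F2 \<psi> j k r"
 by (simp add: pair_def FF_def mult_ac)

lemma pair_Y: "pair (\<lambda>x. \<i> * cplx (\<phi> k x * g k r) * X r x) \<psi> = Yf \<psi> k r"
proof -
 have "(\<lambda>x. \<i> * cplx (\<phi> k x * g k r) * X r x) = (\<lambda>x. (\<i> * gc k r) * (cplx (\<phi> k x) * X r x))"
  by (simp add: mult_ac)
 then show ?thesis unfolding Yf_def by (simp only: pair_cmult pair_phi mult.assoc)
qed

lemma int_phi:
 assumes "test_fn \<psi>" "r \<in> {s..t}" "k < N"
 shows "integrable lborel (\<lambda>x. cplx (\<phi> k x) * X r x * cnj (\<psi> x))"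
 using FF_integrable[OF test_fn1[OF assms(1,3)] assms(2)] by (simp add: mult_ac)

lemma int_phi2:
 assumes "test_fn \<psi>" "r \<in> {s..t}" "j < N" "k < N"
 shows "integrable lborel (\<lambda>x. cplx (\<phi> j x * \<phi> k x) * X r x * cnj (\<psi> x))"
 using FF_integrable[OF test_fn2[OF assms(1,3,4)] assms(2)] by (simp add: mult_ac)

lemma pair_Yd:
 assumes "test_fn \<psi>" "r \<in> {s..t}" "j < N" "k < N"
 shows "pair (\<lambda>x. cplx (- (\<phi> j x * \<phi> k x * g j r * g k r)) * X r x
  + \<i> * cplx (\<phi> k x * g' k j r) * X r x) \<psi> = Yd \<psi> k j r"
proof -
 have "pair (\<lambda>x. cplx (- (\<phi> j x * \<phi> k x * g j r * g k r)) * X r x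
  + \<i> * cplx (\<phi> k x * g' k j r) * X r x) \<psi>
  = (LBINT x. (- (gc j r * gc k r)) * (cplx (\<phi> j x * \<phi> k x) * X r x * cnj (\<psi> x))
    + (\<i> * gd k j r) * (cplx (\<phi> k x) * X r x * cnj (\<psi> x)))"
  unfolding pair_def by (rule Bochner_Integration.integral_cong[OF refl]) (simp add: algebra_simps)
 also have "... = (- (gc j r * gc k r)) * pair (\<lambda>x. cplx (\<phi> j x * \<phi> k x) * X r x) \<psi>
    + (\<i> * gd k j r) * pair (\<lambda>x. cplx (\<phi> k x) * X r x) \<psi>"
  unfolding pair_def
  by (subst Bochner_Integration.integral_add) (use int_phi[OF assms(1,2,4)] int_phi2[OF assms] in auto)
 also have "... = Yd \<psi> k j r" unfolding pair_phi pair_phi2 Yd_def by simp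
 finally show ?thesis .
qed

lemma pair_mu:
 assumes "test_fn \<psi>" "r \<in> {s..t}"
 shows "pair (\<lambda>x. cplx (1 / 2 * (\<Sum>k<N. (\<phi> k x)\<^sup>2 * (g k r)\<^sup>2)) * X r x) \<psi> = mm \<psi> r"
proof -
 have "pair (\<lambda>x. cplx (1 / 2 * (\<Sum>k<N. (\<phi> k x)\<^sup>2 * (g k r)\<^sup>2)) * X r x) \<psi>
  = (LBINT x. 1 / 2 * (\<Sum>k<N. (gc k r * gc k r) * (cplx (\<phi> k x * \<phi> k x) * X r x * cnj (\<psi> x))))"
  unfolding pair_def
 proof (rule Bochner_Integration.integral_cong[OF refl])
  fix x
  have "cplx (\<Sum>k<N. (\<phi> k x)\<^sup>2 * (g k r)\<^sup>2) * (X r x * cnj (\<psi> x))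
   = (\<Sum>k<N. (gc k r * gc k r) * (cplx (\<phi> k x * \<phi> k x) * X r x * cnj (\<psi> x)))"
   unfolding of_real_sum sum_distrib_right
   by (intro sum.cong refl) (simp add: power2_eq_square mult_ac)
  then show "cplx (1 / 2 * (\<Sum>k<N. (\<phi> k x)\<^sup>2 * (g k r)\<^sup>2)) * X r x * cnj (\<psi> x)
   = 1 / 2 * (\<Sum>k<N. (gc k r * gc k r) * (cplx (\<phi> k x * \<phi> k x) * X r x * cnj (\<psi> x)))"
   by (simp only: of_real_mult[of "1 / 2"] mult.assoc) simp
 qed
 also have "... = 1 / 2 * (\<Sum>k<N. (gc k r * gc k r) * pair (\<lambda>x. cplx (\<phi> k x * \<phi> k x) * X r x) \<psi>)"
  unfolding pair_def integral_mult_right_zero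
  by (subst Bochner_Integration.integral_sum) (use int_phi2[OF assms] in auto)
 also have "... = mm \<psi> r" unfolding pair_phi2 mm_def by (simp only: mult.assoc)
 finally show ?thesis .
qed

text \<open>The body of \<open>rough_sol\<close> for one test function and one window, with the
  abstract A in the place of \<open>BBp\<close>; this shape reduces the final step to
  rewriting.\<close>

lemma rough_window_identity:
 assumes \<psi>: "test_fn \<psi>"
 shows "let Y = (\<lambda>k r. pair (\<lambda>x. \<i> * cplx (\<phi> k x * g k r) * X r x) \<psi>);
       Y' = (\<lambda>k j r. pair (\<lambda>x. cplx (- (\<phi> j x * \<phi> k x * g j r * g k r)) * X r x
                 + \<i> * cplx (\<phi> k x * g' k j r) * X r x) \<psi>);
       \<mu> = (\<lambda>r x. cplx (1/2 * (\<Sum>k<N. (\<phi> k x)\<^sup>2 * (g k r)\<^sup>2)));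
       D = (\<lambda>r. pair (\<lambda>x. \<i> * X r x) (lap \<psi>)
           + pair (\<lambda>x. \<i> * cplx ((cmod (X r x)) powr (p - 1)) * X r x) \<psi>
           - pair (\<lambda>x. \<mu> r x * X r x) \<psi>)
     in (\<forall>k<N. controlled_on {s..t} \<alpha> N b (Y k) (Y' k)) \<and>
      set_integrable lborel {s..t} D \<and>
      (\<exists>L. (\<forall>k<N. mesh_lim s t
           (\<lambda>u w. (b k w - b k u) *\<^sub>R Y k u + (\<Sum>j<N. A j k u w *\<^sub>R Y' k j u)) (L k)) \<and>
         pair (X t) \<psi> - pair (X s) \<psi> - sint s t D = (\<Sum>k<N. L k))"
proof -
 define Y' where "Y' = (\<lambda>k j r. pair (\<lambda>x. cplx (- (\<phi> j x * \<phi> k x * g j r * g k r)) * X r x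
                 + \<i> * cplx (\<phi> k x * g' k j r) * X r x) \<psi>)"
 define D where "D = (\<lambda>r. pair (\<lambda>x. \<i> * X r x) (lap \<psi>)
           + pair (\<lambda>x. \<i> * cplx ((cmod (X r x)) powr (p - 1)) * X r x) \<psi>
           - pair (\<lambda>x. cplx (1/2 * (\<Sum>k<N. (\<phi> k x)\<^sup>2 * (g k r)\<^sup>2)) * X r x) \<psi>)"
 have Y': "Y' k j r = Yd \<psi> k j r" if "k < N" "j < N" "r \<in> {s..t}" for k j r
  unfolding Y'_def by (rule pair_Yd[OF \<psi> that(3,2,1)])
 have D: "D r = NL \<psi> r - mm \<psi> r" if "r \<in> {s..t}" for r
  unfolding D_def NL_def pair_mu[OF \<psi> that] ..
 obtain L where L: "\<forall>k<N. mesh_lim s t (germ N (b k) (\<lambda>j. A j k) (Yf \<psi> k) (Yd \<psi> k)) (L k)"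
  "FF \<psi> t - FF \<psi> s - sint s t (\<lambda>r. NL \<psi> r - mm \<psi> r) = (\<Sum>k<N. L k)"
  using rough_identity[OF \<psi>] by blast
 have 1: "controlled_on {s..t} \<alpha> N b (Yf \<psi> k) (Y' k)" if "k < N" for k
  by (rule controlled_on_cong[OF controlled_Y[OF \<psi> that]]) (use Y' that in auto)
 have eqD: "(\<lambda>r. indicator {s..t} r *\<^sub>R D r) = (\<lambda>r. indicator {s..t} r *\<^sub>R (NL \<psi> r - mm \<psi> r))"
  using D by (auto simp: indicator_def fun_eq_iff)
 have 2: "set_integrable lborel {s..t} D"
  using set_integral_diff(1)[OF NL_integrable[OF \<psi>] mm_integrable[OF \<psi>]] unfolding set_integrable_def eqD .
 have 3: "sint s t D = sint s t (\<lambda>r. NL \<psi> r - mm \<psi> r)"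
  unfolding set_lebesgue_integral_def eqD ..
 have 4: "mesh_lim s t (\<lambda>u w. (b k w - b k u) *\<^sub>R Yf \<psi> k u + (\<Sum>j<N. A j k u w *\<^sub>R Y' k j u)) (L k)" if k: "k < N" for k
 proof (rule mesh_lim_cong[OF L(1)[rule_format, OF k]])
  fix u w assume "s <= u" "u < w" "w <= t"
  then show "(b k w - b k u) *\<^sub>R Yf \<psi> k u + (\<Sum>j<N. A j k u w *\<^sub>R Y' k j u) = germ N (b k) (\<lambda>j. A j k) (Yf \<psi> k) (Yd \<psi> k) u w"
   unfolding germ_def using Y'[OF k] by simp
 qed
 have "(\<forall>k<N. controlled_on {s..t} \<alpha> N b (Yf \<psi> k) (Y' k)) \<and> set_integrable lborel {s..t} D \<and>
   (\<exists>L. (\<forall>k<N. mesh_lim s t (\<lambda>u w. (b k w - b k u) *\<^sub>R Yf \<psi> k u + (\<Sum>j<N. A j k u w *\<^sub>R Y' k j u)) (L k)) \<and>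
    pair (X t) \<psi> - pair (X s) \<psi> - sint s t D = (\<Sum>k<N. L k))"
  using 1 2 4 L(2) unfolding 3 FF_def by blast
 then show ?thesis unfolding Let_def pair_Y D_def Y'_def .
qed

lemma pair_continuous: "test_fn \<psi> ==> continuous_on {s..t} (\<lambda>r. pair (X r) \<psi>)"
 using holder_on_continuous[OF hbd_holder[OF Hb_FF] al(1)] by (simp add: FF_def[abs_def])

end

text \<open>The interval may be open on the right, so each point x is put into a compact window
  [a, y] with a its left end and y strictly between x and the upper end; near x the two sets
  coincide. The left end is real because T0 is positive and at most x.\<close>

lemma continuous_on_Iv:
 assumes T0: "0 < T0 om" and c: "!!s t. s \<in> Iv T0 \<tau> om ==> t \<in> Iv T0 \<tau> om ==> s <= t ==> continuous_on {s..t} f"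
 shows "continuous_on (Iv T0 \<tau> om) f"
 unfolding continuous_on_eq_continuous_within
proof
 fix x assume x: "x \<in> Iv T0 \<tau> om"
 then have x': "T0 om <= ereal x" "ereal x < \<tau> om" by (auto simp: Iv_def)
 obtain a where a: "T0 om = ereal a" using x'(1) T0 by (cases "T0 om") auto
 obtain y where y: "ereal x < ereal y" "ereal y < \<tau> om" using ereal_dense2[OF x'(2)] by blast
 have ax: "a <= x" "x < y" using x' y a by auto
 then have "T0 om <= ereal a" "T0 om <= ereal y" "ereal a < \<tau> om" using a y by (auto intro: le_less_trans[OF _ x'(2)])
 then have ay: "a \<in> Iv T0 \<tau> om" "y \<in> Iv T0 \<tau> om" using y by (auto simp: Iv_def)
 have "continuous_on {a..y} f" by (rule c[OF ay]) (use ax in simp)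
 then have cx: "continuous (at x within {a..y}) f" using ax unfolding continuous_on_eq_continuous_within by auto
 have "Iv T0 \<tau> om \<inter> {..<y} - {x} = {a..y} \<inter> {..<y} - {x}"
  using a y unfolding Iv_def by (auto intro: less_trans[OF _ y(2)])
 then have "at x within Iv T0 \<tau> om = at x within {a..y}"
  by (intro at_within_nhd[of x "{..<y}"]) (use ax in auto)
 then show "continuous (at x within Iv T0 \<tau> om) f" using cx by (simp add: continuous_within)
qed

theorem theorem1p5:
  fixes M :: "'w measure" and F :: "real \<Rightarrow> 'w set set" and N :: nat
    and B :: "nat \<Rightarrow> real \<Rightarrow> 'w \<Rightarrow> real"
    and J :: "nat \<Rightarrow> nat \<Rightarrow> real \<Rightarrow> 'w \<Rightarrow> real"
    and \<phi> :: "nat \<Rightarrow> 'a::euclidean_space \<Rightarrow> real"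
    and g Ig :: "nat \<Rightarrow> real \<Rightarrow> 'w \<Rightarrow> real"
    and g' :: "nat \<Rightarrow> nat \<Rightarrow> real \<Rightarrow> 'w \<Rightarrow> real"
    and \<alpha> p :: real and T0 \<tau> :: "'w \<Rightarrow> ereal"
    and v :: "'w \<Rightarrow> real \<Rightarrow> 'a \<Rightarrow> complex"
  assumes "prob_space M"
    and "filtration_usual M F"
    and "std_BM_family M F N B"
    and "\<forall>j<N. \<forall>k<N. ito_proc M (B j) (B k) (J j k)"
    and "\<forall>k<N. cb_inf_decay (\<phi> k)"
    and "1/3 < \<alpha>" and "\<alpha> < 1/2"
    and "\<forall>l<N. adapted M F (g l)"
    and "AE \<omega> in M. \<forall>l<N. continuous_on {0..} (\<lambda>t. g l t \<omega>)"
    and "AE \<omega> in M. \<forall>l<N. \<forall>T\<ge>0.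
           controlled_on {0..T} \<alpha> N (\<lambda>j t. B j t \<omega>) (\<lambda>t. g l t \<omega>) (\<lambda>j t. g' l j t \<omega>)"
    and "\<forall>k<N. ito_proc M (g k) (B k) (Ig k)"
    and "1 \<le> p" and "p \<le> 1 + 4 / real DIM('a)"
    and "T0 \<in> borel_measurable M" and "\<tau> \<in> borel_measurable M"
    and "\<forall>\<omega>\<in>space M. 0 < T0 \<omega> \<and> 0 < \<tau> \<omega>"
    and "AE \<omega> in M. random_nls_sol N p \<phi> (\<lambda>k t. Ig k t \<omega>) (Iv T0 \<tau> \<omega>) (v \<omega>)"
  shows "AE \<omega> in M. rough_sol N \<alpha> p \<phi> (\<lambda>k t. g k t \<omega>) (\<lambda>k j t. g' k j t \<omega>)
            (\<lambda>k t. B k t \<omega>) (\<lambda>j k t. J j k t \<omega>) (Iv T0 \<tau> \<omega>)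
            (\<lambda>t x. exp (Wfun N \<phi> (\<lambda>k t. Ig k t \<omega>) t x) * v \<omega> t x)"
proof -
 interpret bm_family M F N B
  using assms(1-3) by (simp add: bm_family_def bm_family_axioms_def)
 have al0: "0 < \<alpha>" using assms(6) by simp
 have bh: "AE om in M. \<forall>k\<in>{..<N}. \<forall>T. holder_upto T \<alpha> (\<lambda>t. B k t om)"
  by (rule AE_ball_countable') (use B_holder[OF al0 assms(7)] in \<open>auto simp: AE_all_countable\<close>)
 have ah: "AE om in M. \<forall>j\<in>{..<N}. \<forall>k\<in>{..<N}. \<forall>T. \<exists>C. \<forall>s t. 0 <= s \<and> s <= t \<and> t <= real T --> \<bar>area j k (J j k) s t om\<bar> <= C * (t - s) powr (2 * \<alpha>)"
  by (rule AE_ball_countable', rule AE_ball_countable')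
   (use area_holder[OF al0 assms(7)] assms(4) in \<open>auto simp: AE_all_countable\<close>)
 have sy: "AE om in M. \<forall>j\<in>{..<N}. \<forall>k\<in>{..<N}. \<forall>t\<ge>0. J j k t om + J k j t om = B j t om * B k t om - B j 0 om * B k 0 om - (if j = k then t else 0)"
  by (rule AE_ball_countable', rule AE_ball_countable') (use ito_sym assms(4) in auto)
 have ig: "AE om in M. \<forall>k\<in>{..<N}. \<forall>T. \<exists>K. \<forall>u w. 0 <= u \<and> u <= w \<and> w <= real T -->
  \<bar>Ig k w om - Ig k u om - germ N (\<lambda>t. B k t om) (\<lambda>j u w. area j k (J j k) u w om) (\<lambda>t. g k t om) (\<lambda>j t. g' k j t om) u w\<bar> <= K * (w - u) powr (3 * \<alpha>)"
 proof (rule AE_ball_countable')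
  fix k assume "k \<in> {..<N}"
  then have k: "k < N" by simp
  have "AE om in M. \<exists>K. \<forall>u w. 0 <= u \<and> u <= w \<and> w <= real T -->
  \<bar>Ig k w om - Ig k u om - germ N (\<lambda>t. B k t om) (\<lambda>j u w. area j k (J j k) u w om) (\<lambda>t. g k t om) (\<lambda>j t. g' k j t om) u w\<bar> <= K * (w - u) powr (3 * \<alpha>)" for T
  proof (rule ito_germ[OF assms(6,7) k])
   show "AE om in M. continuous_on {0..} (\<lambda>t. g k t om)" using assms(9) by eventually_elim (use k in blast)
   show "AE om in M. \<forall>T\<ge>0. controlled_on {0..T} \<alpha> N (\<lambda>j t. B j t om) (\<lambda>t. g k t om) (\<lambda>j t. g' k j t om)"
    using assms(10) by eventually_elim (use k in blast)
  qed (use assms(4,8,11) k in auto)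
  then show "AE om in M. \<forall>T. \<exists>K. \<forall>u w. 0 <= u \<and> u <= w \<and> w <= real T -->
  \<bar>Ig k w om - Ig k u om - germ N (\<lambda>t. B k t om) (\<lambda>j u w. area j k (J j k) u w om) (\<lambda>t. g k t om) (\<lambda>j t. g' k j t om) u w\<bar> <= K * (w - u) powr (3 * \<alpha>)"
   by (simp add: AE_all_countable)
 qed simp
 \<comment> \<open>Every exceptional null set is fixed at this point, before the window and the test
   function. The estimates hold for all natural T at once, so each window finds a T beyond its right
   end.\<close>
 show ?thesis
  using bh ah sy ig assms(10) assms(17) AE_space
 proof eventually_elim
  case (elim om)
  let ?I = "Iv T0 \<tau> om"
  define Ip where "Ip k t = Ig k t om" for k t
  define b where "b k t = B k t om" for k t
  define A where "A j k u w = BBp (\<lambda>k t. B k t om) (\<lambda>j k t. J j k t om) j k u w" for j k u w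
  define h where "h k t = g k t om" for k t
  define h' where "h' k j t = g' k j t om" for k j t
  define Z where "Z t x = exp (Wfun N \<phi> Ip t x) * v om t x" for t x
  have A_area: "area j k (J j k) u w om = A j k u w" for j k u w
   by (simp add: A_def BBp_def area_def incr_def)
  have T0: "0 < T0 om" using assms(16) elim(7) by blast
  \<comment> \<open>H and K may depend on the path and on the window, since \<open>rough_sol\<close>
    asks for no uniformity in s and t.\<close>
  have win: "\<exists>H K. rough_window N p \<alpha> H s t \<phi> Ip ?I (v om) b A h h' K" if s: "s \<in> ?I" and t: "t \<in> ?I" and st: "s <= t" for s t
  proof -
   have sub: "{s..t} \<subseteq> ?I"
   proof
    fix r assume "r \<in> {s..t}"
    then have "ereal s <= ereal r" "ereal r <= ereal t" by auto
    moreover have "T0 om <= ereal s" "ereal t < \<tau> om" using s t unfolding Iv_def by auto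
    ultimately have "T0 om <= ereal r" "ereal r < \<tau> om" by (blast intro: order_trans le_less_trans)+
    then show "r \<in> ?I" unfolding Iv_def by simp
   qed
   have s0: "0 <= s"
   proof -
    have "0 < ereal s" using T0 s less_le_trans unfolding Iv_def by blast
    then show ?thesis by simp
   qed
   obtain T :: nat where T: "t <= real T" using real_arch_simple by blast
   have "\<forall>k. \<exists>C. k < N --> (\<forall>u w. 0 <= u \<and> u <= w \<and> w <= real T --> \<bar>b k w - b k u\<bar> <= C * (w - u) powr \<alpha>)"
    using elim(1) unfolding holder_upto_def b_def by blast
   then obtain C1 where C1: "!!k u w. k < N ==> 0 <= u ==> u <= w ==> w <= real T ==> \<bar>b k w - b k u\<bar> <= C1 k * (w - u) powr \<alpha>" by metis
   have "\<forall>j k. \<exists>C. j < N \<and> k < N --> (\<forall>u w. 0 <= u \<and> u <= w \<and> w <= real T --> \<bar>A j k u w\<bar> <= C * (w - u) powr (2 * \<alpha>))"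
    using elim(2) unfolding A_area by blast
   then obtain C2 where C2: "!!j k u w. j < N ==> k < N ==> 0 <= u ==> u <= w ==> w <= real T ==> \<bar>A j k u w\<bar> <= C2 j k * (w - u) powr (2 * \<alpha>)" by metis
   have "\<forall>k. \<exists>C. k < N --> (\<forall>u w. 0 <= u \<and> u <= w \<and> w <= real T --> \<bar>Ip k w - Ip k u - germ N (b k) (\<lambda>j. A j k) (h k) (h' k) u w\<bar> <= C * (w - u) powr (3 * \<alpha>))"
    using elim(4) unfolding A_area Ip_def b_def[abs_def] h_def[abs_def] h'_def[abs_def] by blast
   then obtain C3 where C3: "!!k u w. k < N ==> 0 <= u ==> u <= w ==> w <= real T ==>
     \<bar>Ip k w - Ip k u - germ N (b k) (\<lambda>j. A j k) (h k) (h' k) u w\<bar> <= C3 k * (w - u) powr (3 * \<alpha>)" by metis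
   \<comment> \<open>One constant for all indices and for the three kinds of estimates, in the form
     required by \<open>rough_window\<close>.\<close>
   define K where "K = (\<Sum>k<N. \<bar>C1 k\<bar>) + (\<Sum>j<N. \<Sum>k<N. \<bar>C2 j k\<bar>) + (\<Sum>k<N. \<bar>C3 k\<bar>)"
   have nn: "0 <= (\<Sum>k<N. \<bar>C1 k\<bar>)" "0 <= (\<Sum>j<N. \<Sum>k<N. \<bar>C2 j k\<bar>)" "0 <= (\<Sum>k<N. \<bar>C3 k\<bar>)" by (intro sum_nonneg abs_ge_zero)+
   have K0: "K >= 0" unfolding K_def using nn by linarith
   have le1: "\<bar>f k\<bar> <= (\<Sum>k<N. \<bar>f k\<bar>)" if "k < N" for f :: "nat => real" and k by (rule member_le_sum) (use that in auto)
   have K1: "C1 k <= K" if "k < N" for k using le1[OF that, of C1] nn unfolding K_def by linarith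
   have K3: "C3 k <= K" if "k < N" for k using le1[OF that, of C3] nn unfolding K_def by linarith
   have K2: "C2 j k <= K" if "j < N" "k < N" for j k
   proof -
    have "(\<Sum>k<N. \<bar>C2 j k\<bar>) <= (\<Sum>j<N. \<Sum>k<N. \<bar>C2 j k\<bar>)" by (rule member_le_sum) (use that in \<open>auto intro: sum_nonneg\<close>)
    then show ?thesis using le1[OF that(2), of "C2 j"] nn unfolding K_def by linarith
   qed
   have rb: "\<bar>b k w - b k u\<bar> <= K * (w - u) powr \<alpha>" if "k < N" "s <= u" "u <= w" "w <= t" for k u w
    by (rule order_trans[OF C1 mult_right_mono[OF K1]]) (use that s0 T in auto)
   have ra: "\<bar>A j k u w\<bar> <= K * (w - u) powr (2 * \<alpha>)" if "j < N" "k < N" "s <= u" "u <= w" "w <= t" for j k u w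
    by (rule order_trans[OF C2 mult_right_mono[OF K2]]) (use that s0 T in auto)
   have rg: "\<bar>Ip k w - Ip k u - germ N (b k) (\<lambda>j. A j k) (h k) (h' k) u w\<bar> <= K * (w - u) powr (3 * \<alpha>)" if "k < N" "s <= u" "u <= w" "w <= t" for k u w
    by (rule order_trans[OF C3 mult_right_mono[OF K3]]) (use that s0 T in auto)
   have rc: "controlled_on {s..t} \<alpha> N b (h k) (h' k)" if "k < N" for k
   proof -
    have "controlled_on {0..real T} \<alpha> N b (h k) (h' k)"
     using elim(5) that unfolding b_def[abs_def] h_def[abs_def] h'_def[abs_def] by simp
    moreover have "{s..t} \<subseteq> {0..real T}" using s0 T by auto
    ultimately show ?thesis unfolding controlled_on_def holder_on_def by (meson subsetD)
   qed
   have "\<forall>k<N. holder_on {s..t} \<alpha> (Ip k)"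
    using germ_path_holder[OF al0 rb ra rc rg] by blast
   from holder_on_uniform[OF this] obtain H where H: "\<forall>k<N. \<forall>u\<in>{s..t}. \<forall>w\<in>{s..t}. norm (Ip k w - Ip k u) <= H * \<bar>w - u\<bar> powr \<alpha>" by blast
   have "rough_window N p \<alpha> H s t \<phi> Ip ?I (v om) b A h h' K"
   proof
    show "cb_inf_decay (\<phi> k)" if "k < N" for k using assms(5) that by blast
    show "random_nls_sol N p \<phi> Ip ?I (v om)" using elim(6) unfolding Ip_def[abs_def] .
    show "\<bar>Ip k w - Ip k u\<bar> <= H * \<bar>w - u\<bar> powr \<alpha>" if "k < N" "u \<in> {s..t}" "w \<in> {s..t}" for k u w
     using H that by simp
    show "A j k u w = A j k u m + A j k m w + (b j m - b j u) * (b k w - b k m)" if "j < N" "k < N" for j k u m w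
     unfolding A_area[symmetric] b_def by (rule area_chen)
    show "A j k u w + A k j u w = (b j w - b j u) * (b k w - b k u) - (if j = k then w - u else 0)"
     if "j < N" "k < N" "s <= u" "u <= w" "w <= t" for j k u w
    proof -
     have "J j k u om + J k j u om = B j u om * B k u om - B j 0 om * B k 0 om - (if j = k then u else 0)"
      "J j k w om + J k j w om = B j w om * B k w om - B j 0 om * B k 0 om - (if j = k then w else 0)"
      using elim(3) that s0 by auto
     then show ?thesis unfolding A_def BBp_def b_def by (simp add: algebra_simps split: if_splits)
    qed
   qed (use assms(6,7,12,13) al0 st sub K0 rb ra rc rg in auto)
   then show ?thesis by blast
  qed
  have goal: "rough_sol N \<alpha> p \<phi> h h' b (\<lambda>j k t. J j k t om) ?I Z"
   unfolding rough_sol_def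
  proof (intro allI impI conjI ballI)
   fix \<psi> :: "'a => complex" assume \<psi>: "test_fn \<psi>"
   have ZX: "nls_window.X N \<phi> Ip (v om) = Z" if "nls_window N p \<alpha> H s t \<phi> Ip ?I (v om)" for H s t
    unfolding nls_window.X_def[OF that, abs_def] Z_def[abs_def] Wfun_phase ..
   show "continuous_on ?I (\<lambda>t. pair (Z t) \<psi>)"
   proof (rule continuous_on_Iv[of T0 om, OF T0])
    fix s t assume "s \<in> ?I" "t \<in> ?I" "s <= t"
    from win[OF this] obtain H K where rw: "rough_window N p \<alpha> H s t \<phi> Ip ?I (v om) b A h h' K" by blast
    note nw = rough_window.axioms(1)[OF rw]
    show "continuous_on {s..t} (\<lambda>t. pair (Z t) \<psi>)"
     using rough_window.pair_continuous[OF rw \<psi>] unfolding ZX[OF nw] .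
   qed
   fix s t assume st: "s \<in> ?I" "t \<in> ?I" "s < t"
   from win[OF st(1,2) less_imp_le[OF st(3)]] obtain H K where rw: "rough_window N p \<alpha> H s t \<phi> Ip ?I (v om) b A h h' K" by blast
   note nw = rough_window.axioms(1)[OF rw]
   have AB: "A = BBp b (\<lambda>j k t. J j k t om)" by (simp add: fun_eq_iff A_def b_def[abs_def])
   show "let Y = (\<lambda>k r. pair (\<lambda>x. \<i> * cplx (\<phi> k x * h k r) * Z r x) \<psi>);
       Y' = (\<lambda>k j r. pair (\<lambda>x. cplx (- (\<phi> j x * \<phi> k x * h j r * h k r)) * Z r x
                 + \<i> * cplx (\<phi> k x * h' k j r) * Z r x) \<psi>);
       \<mu> = (\<lambda>r x. cplx (1/2 * (\<Sum>k<N. (\<phi> k x)\<^sup>2 * (h k r)\<^sup>2)));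
       D = (\<lambda>r. pair (\<lambda>x. \<i> * Z r x) (lap \<psi>)
           + pair (\<lambda>x. \<i> * cplx ((cmod (Z r x)) powr (p - 1)) * Z r x) \<psi>
           - pair (\<lambda>x. \<mu> r x * Z r x) \<psi>)
     in (\<forall>k<N. controlled_on {s..t} \<alpha> N b (Y k) (Y' k)) \<and>
      set_integrable lborel {s..t} D \<and>
      (\<exists>L. (\<forall>k<N. mesh_lim s t
           (\<lambda>u w. (b k w - b k u) *\<^sub>R Y k u
              + (\<Sum>j<N. BBp b (\<lambda>j k t. J j k t om) j k u w *\<^sub>R Y' k j u)) (L k)) \<and>
         pair (Z t) \<psi> - pair (Z s) \<psi> - sint s t D
          = (\<Sum>k<N. L k))"
    using rough_window.rough_window_identity[OF rw \<psi>] unfolding ZX[OF nw] AB .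
  qed
  then show ?case unfolding h_def[abs_def] h'_def[abs_def] b_def[abs_def] Z_def[abs_def] Ip_def[abs_def] .
 qed
qed

end
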